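(* Let $B=(B,+,\cdot)$ be a non-zero finite skew brace such that the group $(B,\cdot)$ is nilpotent. Then $F(B,+)$, the Fitting subgroup of the additive group $(B,+)$, is a non-zero ideal of $B$.
   Context: A skew brace is a triple $B=(B,+,\cdot)$ such that $(B,+)$ and $(B,\cdot)$ are groups (neither assumed abelian) on the same underlying set and $a\cdot(b+c)=a\cdot b-a+a\cdot c$ for all $a,b,c\in B$. The two identity elements coincide and are denoted by $0$; "non-zero" means $|B|>1$. For $a\in B$, $\lambda_a:B\to B$ is $\lambda_a(b)=-a+a\cdot b$, an automorphism of $(B,+)$. A left ideal of $B$ is a subgroup $I\leq (B,+)$ with $\lambda_b(I)=I$ for every $b\in B$. An ideal of $B$ is a left ideal that is normal in both $(B,+)$ and $(B,\cdot)$. *)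

theory Defs
  imports "HOL-Algebra.Algebra"
begin

section \<open>Nilpotent groups and the Fitting subgroup\<close>

definition commutator_subgroup :: "('a, 'b) monoid_scheme \<Rightarrow> 'a set \<Rightarrow> 'a set \<Rightarrow> 'a set" where
  "commutator_subgroup G H K =
     generate G (\<Union>h \<in> H. \<Union>k \<in> K. {h \<otimes>\<^bsub>G\<^esub> k \<otimes>\<^bsub>G\<^esub> inv\<^bsub>G\<^esub> h \<otimes>\<^bsub>G\<^esub> inv\<^bsub>G\<^esub> k})"

primrec lower_central :: "('a, 'b) monoid_scheme \<Rightarrow> nat \<Rightarrow> 'a set" where
  "lower_central G 0 = carrier G"
| "lower_central G (Suc n) = commutator_subgroup G (lower_central G n) (carrier G)"

definition nilpotent_group :: "('a, 'b) monoid_scheme \<Rightarrow> bool" where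
  "nilpotent_group G \<longleftrightarrow> group G \<and> (\<exists>n. lower_central G n = {\<one>\<^bsub>G\<^esub>})"

definition fitting_subgroup :: "('a, 'b) monoid_scheme \<Rightarrow> 'a set" where
  "fitting_subgroup G = generate G (\<Union> {N. N \<lhd> G \<and> nilpotent_group (G\<lparr>carrier := N\<rparr>)})"


section \<open>Skew braces\<close>

text \<open>
  A skew brace \<open>B\<close> is represented by a record of the type used for rings: the multiplicative
  group is \<open>B\<close> itself and the additive group, which need not be abelian, is \<open>add_monoid B\<close>.
  The library operations \<open>\<ominus> a\<close> and \<open>a \<ominus> b = a \<oplus> (\<ominus> b)\<close> are those of \<open>add_monoid B\<close> and do
  not presuppose commutativity; the order of the summands matters.
\<close>

locale skew_brace = group B + add: group "add_monoid B" for B :: "('a, 'b) ring_scheme" (structure) +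
  assumes brace_distrib:
    "\<lbrakk> a \<in> carrier B; b \<in> carrier B; c \<in> carrier B \<rbrakk> \<Longrightarrow>
       a \<otimes> (b \<oplus> c) = ((a \<otimes> b) \<ominus> a) \<oplus> (a \<otimes> c)"

definition brace_lambda :: "('a, 'b) ring_scheme \<Rightarrow> 'a \<Rightarrow> 'a \<Rightarrow> 'a" where
  "brace_lambda B a b = (\<ominus>\<^bsub>B\<^esub> a) \<oplus>\<^bsub>B\<^esub> (a \<otimes>\<^bsub>B\<^esub> b)"

definition brace_left_ideal :: "'a set \<Rightarrow> ('a, 'b) ring_scheme \<Rightarrow> bool" where
  "brace_left_ideal I B \<longleftrightarrow>
     subgroup I (add_monoid B) \<and> (\<forall>b \<in> carrier B. brace_lambda B b ` I = I)"

definition brace_ideal :: "'a set \<Rightarrow> ('a, 'b) ring_scheme \<Rightarrow> bool" where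
  "brace_ideal I B \<longleftrightarrow> brace_left_ideal I B \<and> I \<lhd> add_monoid B \<and> I \<lhd> B"

lemma (in skew_brace) zero_eq_one: "\<zero> = \<one>"
proof -
  have z: "\<zero> \<in> carrier B" and o: "\<one> \<in> carrier B"
    using add.one_closed by auto
  have n: "\<ominus> \<one> \<in> carrier B"
    using add.inv_closed o by (simp add: a_inv_def)
  have "\<one> \<otimes> (\<zero> \<oplus> \<zero>) = ((\<one> \<otimes> \<zero>) \<ominus> \<one>) \<oplus> (\<one> \<otimes> \<zero>)"
    by (rule brace_distrib[OF o z z])
  then have "\<zero> = \<ominus> \<one>"
    using z n add.l_one add.r_one by (simp add: a_minus_def)
  then show ?thesis
    using add.r_inv[of "\<one>"] add.r_one o by (simp add: a_inv_def)
qed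

end

theory Submission
  imports Defs "Jordan_Normal_Form.Schur_Decomposition"
    "HOL-Computational_Algebra.Polynomial_Factorial" "HOL-Number_Theory.Cong"
begin

text \<open>
  Let \<open>T\<close>, \<open>D\<close> and \<open>L\<close> be the groups of the permutations \<open>x \<mapsto> a + x\<close>, \<open>x \<mapsto> b \<cdot> x\<close> and
  \<open>\<lambda>\<^sub>b\<close> of \<open>B\<close>. Then \<open>G = T L = D L\<close> with \<open>D\<close> and \<open>L\<close> nilpotent, so \<open>G\<close> is solvable by the theorem of
  Kegel and Wielandt. Hence \<open>G\<close> has a nontrivial normal \<open>p\<close>-subgroup inside \<open>T\<close> for some prime \<open>p\<close>.
  Moreover \<open>O\<^sub>p(G) = (D \<inter> O\<^sub>p(G)) (L \<inter> O\<^sub>p(G))\<close> (Pennington), and as \<open>D \<inter> L = 1\<close>, the translation by \<open>a\<close> lies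
  in \<open>O\<^sub>p(G)\<close> iff both multiplication by \<open>a\<close> and \<open>\<lambda>\<^sub>a\<close> do. So the elements with this property form an ideal,
  and the Fitting subgroup is the sum of these ideals over all \<open>p\<close>.

  For the solvability of \<open>G = A B\<close>, Kegel's argument on subgroups that permute with all conjugates of another
  subgroup reduces to simple \<open>G\<close> and \<open>A\<close>, \<open>B\<close> of coprime orders. If one order is a prime power,
  Burnside's theorem on conjugacy classes of prime power size applies; it is proved by means of the
  eigenvalues of the average over such a class in the regular representation. Otherwise the solvable factorised
  subgroups of \<open>G\<close> and a transfer argument lead to a contradiction.
\<close>

text \<open>The two factorisations of G rest on a x = a + lambda_a(x), that is,
  \<open>ell a = tau a * lam a\<close>. Nothing is assumed about the additive group, so solvability
  of G has to come from the factors D and L. Passing to O_p(G) makes the two operations symmetric: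
  membership of the translation by a yields normality in the additive group and invariance under all
  lambda_b, while membership of the other two permutations yields closure under multiplication and
  its conjugations. In the coprime case the contradiction is numerical: if card A exceeded card B,
  then A would meet its conjugates nontrivially, which is refuted; by symmetry the orders are equal,
  although coprime. The recurring tool is that no solvable subgroup contains Sylow subgroups of G
  both for a prime of A and for a prime of B, so every local subgroup shown to be solvable is
  immediately informative. Irreducible characters are avoided in Burnside's theorem: an eigenspace
  of the class average merges those with equal chi(z)/chi(1), and only traces on it are
  needed.\<close>

no_notation var (\<open>X\<index>\<close>)
hide_const (open) Divisibility.prime

section \<open>Calculations in a group\<close>

class grp = monoid_mult +
  fixes gi :: "'a \<Rightarrow> 'a"
  assumes gi_left [simp]: "gi x * x = 1"
begin

lemma gi_left_cancel [simp]: "gi x * (x * y) = y"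
  by (metis gi_left mult.assoc mult_1_left)

lemma gi_right [simp]: "x * gi x = 1"
  by (metis gi_left mult.assoc mult_1_left)

lemma gi_right_cancel [simp]: "x * (gi x * y) = y"
  by (metis gi_right mult.assoc mult_1_left)

lemma gi_unique: "x * y = 1 \<Longrightarrow> gi x = y"
  by (metis gi_left_cancel mult_1_right)

lemma gi_one [simp]: "gi 1 = 1"
  by (rule gi_unique) simp

lemma gi_gi [simp]: "gi (gi x) = x"
  by (rule gi_unique) simp

lemma gi_mult [simp]: "gi (x * y) = gi y * gi x"
  by (rule gi_unique) (simp add: mult.assoc)

lemma grp_left_cancel [simp]: "x * y = x * z \<longleftrightarrow> y = z"
  by (metis gi_left_cancel)

lemma grp_right_cancel [simp]: "y * x = z * x \<longleftrightarrow> y = z"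
  by (metis gi_right mult.assoc mult_1_right)

lemma grp_left_eq_self [simp]: "x * y = x \<longleftrightarrow> y = 1"
  by (metis grp_left_cancel mult_1_right)

lemma grp_right_eq_self [simp]: "y * x = x \<longleftrightarrow> y = 1"
  by (metis grp_right_cancel mult_1_left)

lemma gi_eq_iff [simp]: "gi x = gi y \<longleftrightarrow> x = y"
  by (metis gi_gi)

definition cj :: "'a \<Rightarrow> 'a \<Rightarrow> 'a" where "cj g x = g * x * gi g"

lemma cj_one [simp]: "cj 1 x = x" "cj g 1 = 1"
  by (simp_all add: cj_def)

lemma cj_mult: "cj g (x * y) = cj g x * cj g y"
  by (simp add: cj_def mult.assoc)

lemma cj_gi: "cj g (gi x) = gi (cj g x)"
  by (simp add: cj_def mult.assoc)

lemma cj_cj: "cj g (cj h x) = cj (g * h) x"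
  by (simp add: cj_def mult.assoc)

lemma cj_inv [simp]: "cj (gi g) (cj g x) = x" "cj g (cj (gi g) x) = x"
  by (simp_all add: cj_cj)

lemma cj_eq_iff [simp]: "cj g x = cj g y \<longleftrightarrow> x = y"
  by (simp add: cj_def)

lemma cj_eq_one_iff [simp]: "cj g x = 1 \<longleftrightarrow> x = 1"
  by (metis cj_one(2) cj_eq_iff)

lemma cj_eq_self_iff: "cj g x = x \<longleftrightarrow> g * x = x * g"
  by (metis cj_def gi_right mult.assoc mult_1_right grp_right_cancel gi_left)

lemma cj_power: "cj g (x ^ n) = cj g x ^ n"
  by (induction n) (simp_all add: cj_mult)

lemma inj_cj: "inj_on (cj g) S"
  by (simp add: inj_on_def)

lemma cj_image_cj: "cj g ` cj h ` S = cj (g * h) ` S"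
  by (simp add: image_image cj_cj)

lemma cj_image_one [simp]: "cj 1 ` S = S"
  by simp

lemma cj_image_inv [simp]: "cj (gi g) ` cj g ` S = S" "cj g ` cj (gi g) ` S = S"
  by (simp_all add: image_image)

lemma card_cj_image [simp]: "card (cj g ` S) = card S"
  by (simp add: card_image inj_cj)

lemma cj_image_subset_swap: "cj g ` S \<subseteq> T \<longleftrightarrow> S \<subseteq> cj (gi g) ` T"
  by (metis cj_image_inv image_mono)

section \<open>Finite subgroups, actions and cosets\<close>

text \<open>A finite group is a finite subset of a type of class \<open>grp\<close>, so that subgroups, products and conjugates of sets
  live in one type; quotients are realised as groups of permutations of the natural numbers.\<close>

definition fsub :: "'a set \<Rightarrow> bool" where
  "fsub H \<longleftrightarrow> finite H \<and> 1 \<in> H \<and> (\<forall>x\<in>H. \<forall>y\<in>H. x * y \<in> H) \<and> (\<forall>x\<in>H. gi x \<in> H)"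

definition normal_in :: "'a set \<Rightarrow> 'a set \<Rightarrow> bool" where
  "normal_in N X \<longleftrightarrow> fsub N \<and> N \<subseteq> X \<and> (\<forall>x\<in>X. \<forall>n\<in>N. cj x n \<in> N)"

definition sprod :: "'a set \<Rightarrow> 'a set \<Rightarrow> 'a set" where
  "sprod H K = {h * k |h k. h \<in> H \<and> k \<in> K}"

definition normaliser :: "'a set \<Rightarrow> 'a set \<Rightarrow> 'a set" where
  "normaliser X H = {g \<in> X. cj g ` H = H}"

definition centraliser :: "'a set \<Rightarrow> 'a set \<Rightarrow> 'a set" where
  "centraliser X S = {g \<in> X. \<forall>s\<in>S. g * s = s * g}"

definition acts :: "'a set \<Rightarrow> 'w set \<Rightarrow> ('a \<Rightarrow> 'w \<Rightarrow> 'w) \<Rightarrow> bool" where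
  "acts Q W f \<longleftrightarrow> (\<forall>q\<in>Q. \<forall>w\<in>W. f q w \<in> W) \<and> (\<forall>w\<in>W. f 1 w = w) \<and>
     (\<forall>q\<in>Q. \<forall>r\<in>Q. \<forall>w\<in>W. f (q * r) w = f q (f r w))"

lemma fsub_finite: "fsub H \<Longrightarrow> finite H" by (simp add: fsub_def)
lemma fsub_one [simp]: "fsub H \<Longrightarrow> 1 \<in> H" by (simp add: fsub_def)
lemma fsub_mult: "fsub H \<Longrightarrow> x \<in> H \<Longrightarrow> y \<in> H \<Longrightarrow> x * y \<in> H" by (simp add: fsub_def)
lemma fsub_gi: "fsub H \<Longrightarrow> x \<in> H \<Longrightarrow> gi x \<in> H" by (simp add: fsub_def)

lemma fsubI: "finite H \<Longrightarrow> 1 \<in> H \<Longrightarrow> (\<And>x y. x \<in> H \<Longrightarrow> y \<in> H \<Longrightarrow> x * y \<in> H) \<Longrightarrow>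
  (\<And>x. x \<in> H \<Longrightarrow> gi x \<in> H) \<Longrightarrow> fsub H"
  by (simp add: fsub_def)

lemma fsub_gi_iff [simp]: "fsub H \<Longrightarrow> gi x \<in> H \<longleftrightarrow> x \<in> H"
  by (metis fsub_gi gi_gi)

lemma fsub_mult_left_iff: "fsub H \<Longrightarrow> x \<in> H \<Longrightarrow> x * y \<in> H \<longleftrightarrow> y \<in> H"
  by (metis fsub_mult fsub_gi gi_left_cancel)

lemma fsub_mult_right_iff: "fsub H \<Longrightarrow> y \<in> H \<Longrightarrow> x * y \<in> H \<longleftrightarrow> x \<in> H"
  by (metis fsub_mult fsub_gi mult.assoc gi_right mult_1_right)

lemma fsub_cj: "fsub H \<Longrightarrow> x \<in> H \<Longrightarrow> y \<in> H \<Longrightarrow> cj x y \<in> H"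
  by (simp add: cj_def fsub_mult fsub_gi)

lemma fsub_power: "fsub H \<Longrightarrow> x \<in> H \<Longrightarrow> x ^ n \<in> H"
  by (induction n) (simp_all add: fsub_mult)

lemma fsub_card_pos: "fsub H \<Longrightarrow> card H > 0"
  by (metis card_gt_0_iff empty_iff fsub_finite fsub_one)

lemma fsub_triv [simp]: "fsub {1}" by (simp add: fsub_def del: fsub_gi_iff)

lemma fsub_Int: "fsub H \<Longrightarrow> fsub K \<Longrightarrow> fsub (H \<inter> K)"
  by (simp add: fsub_def del: fsub_gi_iff)

lemma fsub_cj_image: "fsub H \<Longrightarrow> fsub (cj g ` H)"
  unfolding fsub_def
  by (auto simp del: fsub_gi_iff simp flip: cj_mult cj_gi intro: image_eqI[where x=1])

lemma fsub_card1: "fsub H \<Longrightarrow> card H = 1 \<longleftrightarrow> H = {1}"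
  using fsub_one[of H] by (metis One_nat_def card.empty card_1_singleton_iff card_insert_disjoint empty_iff finite.emptyI singletonD)

lemma fsub_nontriv: "fsub H \<Longrightarrow> H \<noteq> {1} \<Longrightarrow> \<exists>x\<in>H. x \<noteq> 1"
  by auto

text \<open>All fibres of the orbit map are left translates of the stabiliser, hence equally
  large.\<close>

lemma acts_orbit_stabiliser:
  assumes Q: "fsub Q" and a: "acts Q W f" and w: "w \<in> W"
  shows "card ((\<lambda>q. f q w) ` Q) * card {q\<in>Q. f q w = w} = card Q"
proof -
  have fib: "card {q\<in>Q. f q w = v} = card {q\<in>Q. f q w = w}" if v: "v \<in> (\<lambda>q. f q w) ` Q" for v
  proof -
    obtain q0 where q0: "q0 \<in> Q" "v = f q0 w" using v by auto
    have e: "{q\<in>Q. f q w = v} = (\<lambda>q. q0 * q) ` {q\<in>Q. f q w = w}" (is "?L = ?R")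
    proof (intro Set.set_eqI iffI)
      fix q assume q: "q \<in> ?L"
      have "f (gi q0 * q) w = f (gi q0) (f q w)"
        using q q0 a w Q by (simp add: acts_def fsub_gi)
      also have "\<dots> = f (gi q0) (f q0 w)" using q q0 by simp
      also have "\<dots> = f (gi q0 * q0) w"
        using q0 a w Q unfolding acts_def by (metis fsub_gi)
      also have "\<dots> = w" using a w by (simp add: acts_def)
      finally have "gi q0 * q \<in> {q\<in>Q. f q w = w}"
        using q q0 Q by (simp add: fsub_mult fsub_gi)
      then show "q \<in> ?R" by (intro image_eqI[where x="gi q0 * q"]) simp_all
    next
      fix q assume "q \<in> ?R"
      then obtain r where r: "r \<in> Q" "f r w = w" "q = q0 * r" by auto
      then show "q \<in> ?L" using q0 a w Q by (simp add: acts_def fsub_mult)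
    qed
    show ?thesis unfolding e by (rule card_image) (simp add: inj_on_def)
  qed
  have "card Q = (\<Sum>q\<in>Q. 1)" by simp
  also have "\<dots> = (\<Sum>v\<in>(\<lambda>q. f q w) ` Q. \<Sum>q\<in>{q\<in>Q. f q w = v}. 1)"
    by (rule sum.image_gen) (rule fsub_finite[OF Q])
  also have "\<dots> = (\<Sum>v\<in>(\<lambda>q. f q w) ` Q. card {q\<in>Q. f q w = w})"
    by (rule sum.cong) (simp_all add: fib)
  finally show ?thesis by simp
qed

lemma acts_lcoset: "(\<And>q w. q \<in> Q \<Longrightarrow> w \<in> W \<Longrightarrow> (*) q ` w \<in> W) \<Longrightarrow> acts Q W (\<lambda>q. (`) ((*) q))"
  unfolding acts_def by (auto simp: image_image mult.assoc)

lemma lcoset_eq_iff: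
  assumes "fsub P"
  shows "(*) x ` P = (*) y ` P \<longleftrightarrow> gi x * y \<in> P"
proof
  assume "(*) x ` P = (*) y ` P"
  then have "y \<in> (*) x ` P" using assms by (metis fsub_one image_eqI mult_1_right)
  then show "gi x * y \<in> P" by auto
next
  assume h: "gi x * y \<in> P"
  have "(*) y ` P \<subseteq> (*) x ` P"
  proof
    fix z assume "z \<in> (*) y ` P"
    then obtain k where "k \<in> P" "z = y * k" by auto
    then have "z = x * (gi x * y * k)" "gi x * y * k \<in> P" using fsub_mult[OF assms h, of k] by (simp_all add: mult.assoc)
    then show "z \<in> (*) x ` P" by blast
  qed
  moreover have "(*) x ` P \<subseteq> (*) y ` P"
  proof
    fix z assume "z \<in> (*) x ` P"
    then obtain k where "k \<in> P" "z = x * k" by auto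
    moreover have "gi y * x \<in> P" using fsub_gi[OF assms h] by simp
    ultimately have "z = y * (gi y * x * k)" "gi y * x * k \<in> P" using fsub_mult[OF assms, of "gi y * x" k] by (simp_all add: mult.assoc)
    then show "z \<in> (*) y ` P" by blast
  qed
  ultimately show "(*) x ` P = (*) y ` P" by blast
qed

text \<open>Orbit counting for left translation of subsets: \<open>P\<close> is its own stabiliser,
  and its orbit is the set of cosets.\<close>

lemma card_lcosets:
  assumes "fsub X" "fsub P" "P \<subseteq> X"
  shows "card ((\<lambda>x. (*) x ` P) ` X) * card P = card X"
proof -
  have "card ((\<lambda>q. (*) q ` P) ` X) * card {q\<in>X. (*) q ` P = P} = card X"
    by (rule acts_orbit_stabiliser[OF assms(1) acts_lcoset[where W=UNIV]]) auto
  moreover have "{q\<in>X. (*) q ` P = P} = P"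
    using lcoset_eq_iff[OF assms(2), where y=1] assms(2,3) by auto
  ultimately show ?thesis by simp
qed

lemma lagrange_dvd: "fsub X \<Longrightarrow> fsub P \<Longrightarrow> P \<subseteq> X \<Longrightarrow> card P dvd card X"
  by (metis card_lcosets dvd_triv_right)

text \<open>The bridge to HOL-Algebra, through which x^|X| = 1 and Sylow's existence theorem are
  imported.\<close>

lemma fsub_group:
  assumes "fsub X"
  shows "group \<lparr>carrier = X, monoid.mult = (*), one = 1\<rparr>"
proof (rule groupI)
  fix x assume "x \<in> carrier \<lparr>carrier = X, monoid.mult = (*), one = 1\<rparr>"
  then show "\<exists>y\<in>carrier \<lparr>carrier = X, monoid.mult = (*), one = 1\<rparr>.
      y \<otimes>\<^bsub>\<lparr>carrier = X, monoid.mult = (*), one = 1\<rparr>\<^esub> x = \<one>\<^bsub>\<lparr>carrier = X, monoid.mult = (*), one = 1\<rparr>\<^esub>"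
    using assms by (intro bexI[of _ "gi x"]) (simp_all add: fsub_gi)
qed (use assms in \<open>simp_all add: fsub_mult mult.assoc\<close>)

lemma fsub_power_card:
  assumes "fsub X" "x \<in> X" shows "x ^ card X = 1"
proof -
  interpret c: group "\<lparr>carrier = X, monoid.mult = (*), one = 1\<rparr>"
    by (rule fsub_group) fact
  have "x [^]\<^bsub>\<lparr>carrier = X, monoid.mult = (*), one = 1\<rparr>\<^esub> (n::nat) = x ^ n" for n
    by (induction n) (simp_all add: power_commutes)
  then show ?thesis using c.pow_order_eq_1[of x] assms by (simp add: Coset.order_def)
qed

lemma exists_subgroup_prime_power:
  assumes "prime p" "fsub X" "p ^ k dvd card X"
  shows "\<exists>P. fsub P \<and> P \<subseteq> X \<and> card P = p ^ k"
proof -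
  let ?G = "\<lparr>carrier = X, monoid.mult = (*), one = 1\<rparr>"
  have g: "group ?G"
    by (rule fsub_group) fact
  then interpret c: group ?G .
  have i: "inv\<^bsub>?G\<^esub> x = gi x" if "x \<in> X" for x
    using that assms by (intro c.inv_equality) (auto simp: fsub_gi)
  obtain m where "card X = p ^ k * m" using assms by auto
  then obtain H where H: "subgroup H ?G" "card H = p ^ k"
    using sylow_thm[OF assms(1) g, of k m] assms by (auto simp: Coset.order_def fsub_finite)
  have "H \<subseteq> X" using subgroup.subset[OF H(1)] by simp
  moreover have "fsub H"
  proof (rule fsubI)
    show "finite H" using finite_subset[OF \<open>H \<subseteq> X\<close>] assms(2) by (simp add: fsub_finite)
    show "1 \<in> H" using subgroup.one_closed[OF H(1)] by simp
    show "x * y \<in> H" if "x \<in> H" "y \<in> H" for x y using subgroup.m_closed[OF H(1) that] by simp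
    show "gi x \<in> H" if "x \<in> H" for x
      using subgroup.m_inv_closed[OF H(1) that] i that \<open>H \<subseteq> X\<close> by auto
  qed
  ultimately show ?thesis using H by auto
qed

lemma cauchy_thm:
  assumes "prime p" "fsub X" "p dvd card X"
  shows "\<exists>x\<in>X. x \<noteq> 1 \<and> x ^ p = 1"
proof -
  obtain P where P: "fsub P" "P \<subseteq> X" "card P = p" using exists_subgroup_prime_power[of p X 1] assms by auto
  then have "P \<noteq> {1}" using assms(1) by auto
  then show ?thesis using P fsub_power_card[of P] fsub_nontriv by (metis subsetD)
qed

text \<open>A point that is not fixed has an orbit whose size divides a power of p and exceeds 1, so
  deleting this orbit changes neither side modulo p.\<close>

lemma acts_fixed_points:
  assumes p: "prime p" and Q: "fsub Q" "card Q = p ^ k" and a: "acts Q W f" and fin: "finite W"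
  shows "card W mod p = card {w\<in>W. \<forall>q\<in>Q. f q w = w} mod p"
  using fin a
proof (induction W rule: finite_psubset_induct)
  case (psubset W)
  let ?F = "\<lambda>W. {w\<in>W. \<forall>q\<in>Q. f q w = w}"
  show ?case
  proof (cases "?F W = W")
    case True then show ?thesis by simp
  next
    case False
    then obtain w where w: "w \<in> W" "w \<notin> ?F W" by auto
    define O' where "O' = (\<lambda>q. f q w) ` Q"
    have act: "\<And>q w. q \<in> Q \<Longrightarrow> w \<in> W \<Longrightarrow> f q w \<in> W" "\<And>w. w \<in> W \<Longrightarrow> f 1 w = w"
       "\<And>q r w. q \<in> Q \<Longrightarrow> r \<in> Q \<Longrightarrow> w \<in> W \<Longrightarrow> f (q * r) w = f q (f r w)"
      using psubset.prems by (auto simp: acts_def)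
    \<comment> \<open>Orbits are disjoint, so \<open>Q\<close> still acts on the complement of this
      one.\<close>
    have inv: "v \<in> O'" if vO: "f q v \<in> O'" "v \<in> W" "q \<in> Q" for q v
    proof -
      obtain r where r: "r \<in> Q" "f q v = f r w" using vO(1) by (auto simp: O'_def)
      have "v = f (gi q * q) v" using that act by simp
      also have "\<dots> = f (gi q) (f r w)" using that act(3)[of "gi q" q v] Q r by (simp add: fsub_gi)
      also have "\<dots> = f (gi q * r) w" using act(3)[of "gi q" r w] w Q r that by (simp add: fsub_gi)
      finally show ?thesis using Q r that by (auto simp: O'_def fsub_gi fsub_mult)
    qed
    have wO: "w \<in> O'" using Q(1) w act(2) by (metis O'_def fsub_one image_eqI)
    have OW: "O' \<subseteq> W" using w act by (auto simp: O'_def)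
    have a': "acts Q (W - O') f" using act inv by (auto simp: acts_def)
    have IH: "card (W - O') mod p = card (?F (W - O')) mod p"
      using psubset.IH[of "W - O'"] wO OW w a' by blast
    have FO: "?F (W - O') = ?F W"
    proof -
      have "v \<notin> O'" if "v \<in> ?F W" for v
      proof
        assume "v \<in> O'"
        then obtain q where q: "q \<in> Q" "v = f q w" by (auto simp: O'_def)
        have "f (gi q) v = w" using q act(3)[of "gi q" q w] act(2)[of w] w Q by (simp add: fsub_gi)
        then have "v = w" using that q Q by (auto simp: fsub_gi)
        then show False using that w by auto
      qed
      then show ?thesis by auto
    qed
    have dO: "card O' * card {q\<in>Q. f q w = w} = p ^ k"
      using acts_orbit_stabiliser[OF Q(1) psubset.prems w(1)] Q(2) by (simp add: O'_def)
    then have "card O' dvd p ^ k" by (metis dvd_triv_left)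
    then obtain j where j: "card O' = p ^ j" using p divides_primepow_nat by blast
    have "card O' \<noteq> 1"
    proof
      assume "card O' = 1"
      then have "O' = {w}" using wO by (metis card_1_singletonE singletonD)
      then show False using w by (auto simp: O'_def)
    qed
    then have "p dvd card O'" using j by (cases j) auto
    moreover have "card W = card O' + card (W - O')"
      using OW psubset.hyps by (metis card_Diff_subset card_mono finite_subset le_add_diff_inverse)
    ultimately have "card W mod p = card (W - O') mod p" by (auto elim!: dvdE simp: mod_simps)
    then show ?thesis using IH FO by simp
  qed
qed

end

section \<open>Products of subgroups\<close>

lemma sprodI: "h \<in> H \<Longrightarrow> k \<in> K \<Longrightarrow> h * k \<in> sprod H K"
  by (auto simp: sprod_def)

lemma sprodE: "x \<in> sprod H K \<Longrightarrow> (\<And>h k. h \<in> H \<Longrightarrow> k \<in> K \<Longrightarrow> x = h * k \<Longrightarrow> R) \<Longrightarrow> R"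
  by (auto simp: sprod_def)

lemma sprod_mono: "H \<subseteq> H' \<Longrightarrow> K \<subseteq> K' \<Longrightarrow> sprod H K \<subseteq> sprod H' K'"
  by (auto simp: sprod_def)

lemma sprod_subset: "fsub X \<Longrightarrow> H \<subseteq> X \<Longrightarrow> K \<subseteq> X \<Longrightarrow> sprod H K \<subseteq> X"
  by (auto simp: sprod_def fsub_mult subset_iff)

lemma subset_sprod1: "fsub K \<Longrightarrow> H \<subseteq> sprod H K"
  by (metis fsub_one mult_1_right sprodI subsetI)

lemma subset_sprod2: "fsub H \<Longrightarrow> K \<subseteq> sprod H K"
  by (metis fsub_one mult_1_left sprodI subsetI)

lemma finite_sprod: "finite H \<Longrightarrow> finite K \<Longrightarrow> finite (sprod H K)"
proof -
  assume "finite H" "finite K"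
  then have "finite ((\<lambda>(h, k). h * k) ` (H \<times> K))" by simp
  moreover have "sprod H K = (\<lambda>(h, k). h * k) ` (H \<times> K)" by (auto simp: sprod_def)
  ultimately show ?thesis by simp
qed

lemma cj_image_sprod: "cj g ` sprod H K = sprod (cj g ` H) (cj g ` K)"
proof (intro Set.set_eqI iffI)
  fix x assume "x \<in> cj g ` sprod H K"
  then show "x \<in> sprod (cj g ` H) (cj g ` K)" by (auto elim!: sprodE simp: cj_mult intro!: sprodI)
next
  fix x assume "x \<in> sprod (cj g ` H) (cj g ` K)"
  then obtain h k where "h \<in> H" "k \<in> K" "x = cj g (h * k)" by (auto elim!: sprodE simp: cj_mult)
  then show "x \<in> cj g ` sprod H K" by (auto intro: sprodI)
qed

text \<open>A product h k arises from exactly the pairs (h d, d^-1 k) with d in the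
  intersection.\<close>

lemma card_sprod:
  assumes H: "fsub H" and K: "fsub K"
  shows "card (sprod H K) * card (H \<inter> K) = card H * card K"
proof -
  let ?f = "\<lambda>(h, k). h * k"
  have im: "sprod H K = ?f ` (H \<times> K)" by (auto simp: sprod_def)
  have fib: "card {p \<in> H \<times> K. ?f p = y} = card (H \<inter> K)" if y: "y \<in> ?f ` (H \<times> K)" for y
  proof -
    obtain h k where hk: "h \<in> H" "k \<in> K" "y = h * k" using y by auto
    have "{p \<in> H \<times> K. ?f p = y} = (\<lambda>d. (h * d, gi d * k)) ` (H \<inter> K)" (is "?L = ?R")
    proof (intro Set.set_eqI iffI)
      fix p assume "p \<in> ?L"
      then obtain a b where ab: "p = (a, b)" "a \<in> H" "b \<in> K" "a * b = h * k" using hk by auto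
      have e: "gi h * a = k * gi b"
      proof -
        have "gi h * (a * b) * gi b = gi h * (h * k) * gi b" by (simp only: ab(4))
        then show ?thesis by (simp add: mult.assoc)
      qed
      have 1: "gi h * a \<in> H \<inter> K" using ab hk e H K by (metis IntI fsub_gi fsub_mult)
      have 2: "h * (gi h * a) = a" "gi (gi h * a) * k = b" unfolding e by (simp_all add: mult.assoc) (simp flip: e)
      show "p \<in> ?R" using 1 2 ab(1) by (intro image_eqI[where x="gi h * a"]) simp_all
    next
      fix p assume "p \<in> ?R"
      then show "p \<in> ?L" using hk H K by (auto simp: fsub_mult fsub_gi mult.assoc)
    qed
    moreover have "inj_on (\<lambda>d. (h * d, gi d * k)) (H \<inter> K)" by (simp add: inj_on_def)
    ultimately show ?thesis by (simp add: card_image)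
  qed
  have "card H * card K = (\<Sum>p\<in>H \<times> K. 1)" by (simp add: card_cartesian_product)
  also have "\<dots> = (\<Sum>y\<in>?f ` (H \<times> K). \<Sum>p\<in>{p \<in> H \<times> K. ?f p = y}. 1)"
    by (rule sum.image_gen) (use H K in \<open>simp add: fsub_finite\<close>)
  also have "\<dots> = (\<Sum>y\<in>?f ` (H \<times> K). card (H \<inter> K))"
    by (rule sum.cong) (simp_all only: fib card_eq_sum[symmetric])
  finally show ?thesis by (simp add: im)
qed

lemma fsub_sprod:
  assumes H: "fsub H" and K: "fsub K" and c: "sprod K H \<subseteq> sprod H K"
  shows "fsub (sprod H K)"
proof (rule fsubI)
  show "finite (sprod H K)" using H K by (simp add: finite_sprod fsub_finite)
  show "1 \<in> sprod H K" using sprodI[of 1 H 1 K] H K by simp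
  fix x assume "x \<in> sprod H K"
  then obtain h k where x: "h \<in> H" "k \<in> K" "x = h * k" by (auto elim: sprodE)
  then have "gi k * gi h \<in> sprod H K" using c H K by (meson fsub_gi sprodI subsetD)
  then show "gi x \<in> sprod H K" using x by simp
  fix y assume "y \<in> sprod H K"
  then obtain h' k' where y: "h' \<in> H" "k' \<in> K" "y = h' * k'" by (auto elim: sprodE)
  have "k * h' \<in> sprod H K" using x y c sprodI by (metis subsetD)
  then obtain a b where "a \<in> H" "b \<in> K" "k * h' = a * b" by (auto elim: sprodE)
  then have "x * y = (h * a) * (b * k')" using x y by (metis mult.assoc)
  then show "x * y \<in> sprod H K" using \<open>a \<in> H\<close> \<open>b \<in> K\<close> x y H K by (metis fsub_mult sprodI)
qed

text \<open>Inversion exchanges the two products and maps a subgroup onto itself.\<close>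

lemma sprod_commute:
  assumes "fsub H" "fsub K" "fsub (sprod H K)"
  shows "sprod H K = sprod K H"
proof (intro Set.set_eqI iffI)
  fix x assume "x \<in> sprod H K"
  then have "gi x \<in> sprod H K" using assms by simp
  then obtain h k where "h \<in> H" "k \<in> K" "gi x = h * k" by (auto elim: sprodE)
  then have "x = gi k * gi h" by (metis gi_gi gi_mult)
  then show "x \<in> sprod K H" using assms \<open>h \<in> H\<close> \<open>k \<in> K\<close> by (simp add: sprodI)
next
  fix x assume "x \<in> sprod K H"
  then obtain h k where "h \<in> H" "k \<in> K" "x = k * h" by (auto elim: sprodE)
  then have "gi x = gi h * gi k" "gi h \<in> H" "gi k \<in> K" using assms by simp_all
  then have "gi x \<in> sprod H K" by (metis sprodI)
  then show "x \<in> sprod H K" using assms by simp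
qed

section \<open>Normal subgroups, normalisers and centralisers\<close>

lemma normal_in_fsub: "normal_in N X \<Longrightarrow> fsub N" by (simp add: normal_in_def)
lemma normal_in_subset: "normal_in N X \<Longrightarrow> N \<subseteq> X" by (simp add: normal_in_def)
lemma normal_in_cj: "normal_in N X \<Longrightarrow> x \<in> X \<Longrightarrow> n \<in> N \<Longrightarrow> cj x n \<in> N" by (simp add: normal_in_def)

lemma normal_inI: "fsub N \<Longrightarrow> N \<subseteq> X \<Longrightarrow> (\<And>x n. x \<in> X \<Longrightarrow> n \<in> N \<Longrightarrow> cj x n \<in> N) \<Longrightarrow> normal_in N X"
  by (simp add: normal_in_def)

lemma normal_in_cj_image:
  assumes "fsub X" "normal_in N X" "x \<in> X" shows "cj x ` N = N"
proof
  show "cj x ` N \<subseteq> N" using assms by (auto simp: normal_in_cj)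
  show "N \<subseteq> cj x ` N"
  proof
    fix n assume "n \<in> N"
    then have "cj (gi x) n \<in> N" using assms by (simp add: normal_in_cj)
    then show "n \<in> cj x ` N" by (metis cj_inv(2) image_eqI)
  qed
qed

lemma normal_in_self: "fsub X \<Longrightarrow> normal_in X X"
  by (auto intro!: normal_inI simp: fsub_cj)

lemma normal_in_triv: "fsub X \<Longrightarrow> normal_in {1} X"
  by (auto intro!: normal_inI)

lemma normal_in_Int_sub: "normal_in N X \<Longrightarrow> fsub Y \<Longrightarrow> Y \<subseteq> X \<Longrightarrow> normal_in (N \<inter> Y) Y"
  by (intro normal_inI) (auto simp: normal_in_fsub fsub_Int normal_in_cj fsub_cj)

lemma normal_in_Int: "normal_in N X \<Longrightarrow> normal_in M X \<Longrightarrow> normal_in (N \<inter> M) X"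
  by (intro normal_inI) (auto simp: normal_in_fsub fsub_Int normal_in_cj dest: normal_in_subset)

lemma normal_in_restrict: "normal_in N X \<Longrightarrow> N \<subseteq> Y \<Longrightarrow> Y \<subseteq> X \<Longrightarrow> normal_in N Y"
  by (auto simp: normal_in_def)

lemma sprod_normal_fsub:
  assumes N: "normal_in N X" and H: "fsub H" "H \<subseteq> X"
  shows "fsub (sprod H N)"
proof (rule fsub_sprod[OF H(1) normal_in_fsub[OF N]])
  show "sprod N H \<subseteq> sprod H N"
  proof
    fix x assume "x \<in> sprod N H"
    then obtain n h where nh: "n \<in> N" "h \<in> H" "x = n * h" by (auto elim: sprodE)
    then have "x = h * cj (gi h) n" by (simp add: cj_def mult.assoc)
    moreover have "cj (gi h) n \<in> N" using nh N H by (auto intro!: normal_in_cj)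
    ultimately show "x \<in> sprod H N" using nh by (simp add: sprodI)
  qed
qed

lemma sprod_normal_commute:
  assumes N: "normal_in N X" and H: "fsub H" "H \<subseteq> X"
  shows "sprod N H = sprod H N"
  using sprod_commute[OF H(1) normal_in_fsub[OF N] sprod_normal_fsub[OF assms]] by simp

lemma sprod_normal_normal:
  assumes "fsub X" "normal_in N X" "normal_in M X"
  shows "normal_in (sprod M N) X"
proof (rule normal_inI)
  show "fsub (sprod M N)" using assms by (meson normal_in_fsub normal_in_subset sprod_normal_fsub)
  show "sprod M N \<subseteq> X" using assms by (meson normal_in_subset sprod_subset)
  fix x n assume x: "x \<in> X" and "n \<in> sprod M N"
  then obtain a b where ab: "a \<in> M" "b \<in> N" "n = a * b" by (auto elim: sprodE)
  then show "cj x n \<in> sprod M N"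
    using normal_in_cj[OF assms(2) x] normal_in_cj[OF assms(3) x] by (simp add: cj_mult sprodI)
qed

lemma fsub_normaliser:
  assumes "fsub X" shows "fsub (normaliser X H)"
proof (rule fsubI)
  show "finite (normaliser X H)" using assms by (simp add: normaliser_def fsub_finite)
  show "1 \<in> normaliser X H" using assms by (simp add: normaliser_def)
  show "x * y \<in> normaliser X H" if "x \<in> normaliser X H" "y \<in> normaliser X H" for x y
    using that assms by (simp add: normaliser_def fsub_mult flip: cj_image_cj)
  show "gi x \<in> normaliser X H" if "x \<in> normaliser X H" for x
    using that assms unfolding normaliser_def by (metis (mono_tags, lifting) cj_image_inv(1) fsub_gi mem_Collect_eq)
qed

lemma normaliser_subset: "normaliser X H \<subseteq> X" by (auto simp: normaliser_def)

lemma cj_image_self: "fsub H \<Longrightarrow> x \<in> H \<Longrightarrow> cj x ` H = H"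
  by (rule normal_in_cj_image[OF _ normal_in_self])

lemma subset_normaliser: "fsub H \<Longrightarrow> H \<subseteq> X \<Longrightarrow> H \<subseteq> normaliser X H"
  using cj_image_self unfolding normaliser_def by blast

lemma normal_in_normaliser: "fsub H \<Longrightarrow> H \<subseteq> X \<Longrightarrow> normal_in H (normaliser X H)"
  by (intro normal_inI subset_normaliser) (auto simp: normaliser_def)

lemma normaliser_eq_iff:
  assumes X: "fsub X" "fsub H" "H \<subseteq> X"
  shows "normaliser X H = X \<longleftrightarrow> normal_in H X"
proof
  show "normal_in H X" if "normaliser X H = X" using normal_in_normaliser[OF X(2,3)] that by simp
  show "normaliser X H = X" if "normal_in H X" using normal_in_cj_image[OF X(1) that] by (auto simp: normaliser_def)
qed

text \<open>Conjugation preserves cardinality, so for a finite \<open>H\<close> one inclusion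
  suffices.\<close>

lemma normaliserI:
  assumes "fsub H" "g \<in> X" "cj g ` H \<subseteq> H" shows "g \<in> normaliser X H"
  using assms by (simp add: normaliser_def card_subset_eq fsub_finite)

lemma fsub_centraliser:
  assumes "fsub X" shows "fsub (centraliser X S)"
proof (rule fsubI)
  show "finite (centraliser X S)" using assms by (simp add: centraliser_def fsub_finite)
  show "1 \<in> centraliser X S" using assms by (simp add: centraliser_def)
  show "x * y \<in> centraliser X S" if "x \<in> centraliser X S" "y \<in> centraliser X S" for x y
    using that assms by (auto simp: centraliser_def fsub_mult) (metis mult.assoc)
  show "gi x \<in> centraliser X S" if "x \<in> centraliser X S" for x
  proof -
    have "gi x * s = s * gi x" if "x * s = s * x" for s
    proof -
      have "gi x * (x * s) * gi x = gi x * (s * x) * gi x" by (simp only: that)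
      then show ?thesis by (simp add: mult.assoc)
    qed
    then show ?thesis using that assms by (auto simp: centraliser_def)
  qed
qed

lemma centraliser_subset: "centraliser X S \<subseteq> X" by (auto simp: centraliser_def)

lemma commute_cj: "a * b = b * a \<Longrightarrow> cj g a * cj g b = cj g b * cj g a"
  by (metis cj_mult)

lemma centraliser_cj:
  assumes "fsub X" "x \<in> X" "c \<in> centraliser X S" shows "cj x c \<in> centraliser X (cj x ` S)"
  using assms by (auto simp: centraliser_def fsub_cj commute_cj)

lemma normal_centraliser:
  assumes "fsub X" "\<And>x. x \<in> X \<Longrightarrow> cj x ` S = S" shows "normal_in (centraliser X S) X"
  by (intro normal_inI) (use assms centraliser_cj[of X _ _ S] in \<open>auto simp: fsub_centraliser centraliser_subset subsetD\<close>)

lemma centraliser_in_normaliser: "centraliser X S \<subseteq> normaliser X S"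
proof
  fix x assume x: "x \<in> centraliser X S"
  then have "cj x s = s" if "s \<in> S" for s using that by (simp add: centraliser_def cj_eq_self_iff)
  then show "x \<in> normaliser X S" using x by (simp add: centraliser_def normaliser_def)
qed

lemma normal_centraliser_normaliser:
  assumes "fsub X" shows "normal_in (centraliser X S) (normaliser X S)"
proof (rule normal_inI)
  show "fsub (centraliser X S)" by (rule fsub_centraliser) fact
  show "centraliser X S \<subseteq> normaliser X S" by (rule centraliser_in_normaliser)
  fix x n assume "x \<in> normaliser X S" "n \<in> centraliser X S"
  then show "cj x n \<in> centraliser X S" using centraliser_cj[OF assms, of x n S] by (simp add: normaliser_def)
qed

section \<open>Sylow theory\<close>

definition p_elt :: "nat \<Rightarrow> 'a::grp \<Rightarrow> bool" where "p_elt p x \<longleftrightarrow> (\<exists>k. x ^ (p ^ k) = 1)"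

definition p_part :: "nat \<Rightarrow> 'a::grp set \<Rightarrow> 'a set" where "p_part p X = {x \<in> X. p_elt p x}"

definition pgroup :: "nat \<Rightarrow> 'a::grp set \<Rightarrow> bool" where "pgroup p Q \<longleftrightarrow> fsub Q \<and> (\<exists>k. card Q = p ^ k)"

definition syl :: "nat \<Rightarrow> 'a::grp set \<Rightarrow> 'a set \<Rightarrow> bool" where
  "syl p X P \<longleftrightarrow> fsub P \<and> P \<subseteq> X \<and> card P = p ^ multiplicity p (card X)"

lemma coprime_powers_one:
  fixes x :: "'a::grp"
  assumes "coprime a b" "x ^ a = 1" "x ^ b = 1" shows "x = 1"
proof (cases "a = 0")
  case True then show ?thesis using assms by simp
next
  case False
  then obtain u v where "a * u = b * v + 1" using assms(1) bezout_nat[of a b] by (metis coprime_iff_gcd_eq_1)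
  then have "(x ^ a) ^ u = (x ^ b) ^ v * x" by (simp flip: power_mult power_Suc2)
  then show ?thesis using assms by simp
qed

lemma p_elt_p_elt: "prime p \<Longrightarrow> prime q \<Longrightarrow> p \<noteq> q \<Longrightarrow> p_elt p x \<Longrightarrow> p_elt q x \<Longrightarrow> x = 1"
  unfolding p_elt_def by (meson coprime_powers_one coprime_power_left_iff coprime_power_right_iff primes_coprime)

lemma p_elt_one [simp]: "p_elt p 1" by (simp add: p_elt_def)

lemma p_elt_power: "p_elt p x \<Longrightarrow> p_elt p (x ^ n)"
  unfolding p_elt_def by (metis power_commutes power_mult mult.commute power_one)

lemma p_elt_cj_iff [simp]: "p_elt p (cj g x) \<longleftrightarrow> p_elt p x"
  by (simp add: p_elt_def flip: cj_power)

lemma gi_power: "gi (x ^ n) = gi x ^ n" for x :: "'a::grp"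
  by (induction n) (simp_all add: power_commutes)

lemma p_elt_gi_iff [simp]: "p_elt p (gi x) \<longleftrightarrow> p_elt p x"
  by (simp add: p_elt_def flip: gi_power) (metis gi_gi gi_one)

lemma prime_power_if_unique_prime:
  fixes n p :: nat
  assumes "n > 0" "prime p" "\<And>q. prime q \<Longrightarrow> q dvd n \<Longrightarrow> q = p" shows "\<exists>k. n = p ^ k"
proof -
  obtain m where m: "n = p ^ multiplicity p n * m" "\<not> p dvd m"
    using multiplicity_decompose'[of n p] assms by (metis not_prime_unit less_numeral_extra(3))
  have "m = 1"
  proof (rule ccontr)
    assume "m \<noteq> 1"
    then obtain q where "prime q" "q dvd m" using prime_factor_nat by blast
    then show False using assms(3)[of q] m by (metis dvd_mult)
  qed
  then show ?thesis using m by auto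
qed

lemma pgroup_fsub: "pgroup p Q \<Longrightarrow> fsub Q" by (simp add: pgroup_def)

lemma pgroup_p_elt: "pgroup p Q \<Longrightarrow> x \<in> Q \<Longrightarrow> p_elt p x"
  unfolding pgroup_def p_elt_def by (metis fsub_power_card)

text \<open>A further prime q dividing the order would give, by Cauchy, a nontrivial element of
  order q, which cannot be a p-element as well.\<close>

lemma pgroupI:
  assumes "prime p" "fsub Q" "\<And>x. x \<in> Q \<Longrightarrow> p_elt p x" shows "pgroup p Q"
proof -
  have "q = p" if q: "prime q" "q dvd card Q" for q
  proof (rule ccontr)
    assume "q \<noteq> p"
    obtain x where "x \<in> Q" "x \<noteq> 1" "x ^ q = 1" using cauchy_thm[OF q(1) assms(2) q(2)] by auto
    then have "p_elt q x" unfolding p_elt_def by (metis power_one_right)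
    then show False using p_elt_p_elt[OF assms(1) q(1)] \<open>q \<noteq> p\<close> assms(3) \<open>x \<in> Q\<close> \<open>x \<noteq> 1\<close> by auto
  qed
  then show ?thesis
    using prime_power_if_unique_prime[of "card Q" p] assms by (auto simp: pgroup_def fsub_card_pos)
qed

lemma pgroup_subset: "prime p \<Longrightarrow> pgroup p Q \<Longrightarrow> fsub R \<Longrightarrow> R \<subseteq> Q \<Longrightarrow> pgroup p R"
  by (meson pgroupI pgroup_p_elt subsetD)

lemma pgroup_cj_image [simp]: "pgroup p Q \<Longrightarrow> pgroup p (cj g ` Q)"
  by (simp add: pgroup_def fsub_cj_image)

lemma pgroup_coprime_Int:
  assumes "prime p" "prime q" "p \<noteq> q" "pgroup p P" "pgroup q Q" shows "P \<inter> Q = {1}"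
proof -
  have "x = 1" if "x \<in> P" "x \<in> Q" for x
    using p_elt_p_elt[OF assms(1-3)] pgroup_p_elt[OF assms(4) that(1)] pgroup_p_elt[OF assms(5) that(2)] by blast
  then show ?thesis using assms(4,5) by (auto dest!: pgroup_fsub)
qed

lemma p_elt_cyclic:
  assumes "prime p" "fsub X" "x \<in> X" "p_elt p x"
  shows "\<exists>Q. pgroup p Q \<and> Q \<subseteq> X \<and> x \<in> Q \<and> (\<forall>y\<in>Q. \<exists>n. y = x ^ n)"
proof -
  obtain k where k: "x ^ (p ^ k) = 1" using assms by (auto simp: p_elt_def)
  define Q where "Q = range (\<lambda>n. x ^ n)"
  have sub: "Q \<subseteq> X" using assms by (auto simp: Q_def fsub_power)
  have "fsub Q"
  proof (rule fsubI)
    show "finite Q" using sub assms by (meson finite_subset fsub_finite)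
    show "1 \<in> Q" unfolding Q_def by (metis power_0 rangeI)
    show "a * b \<in> Q" if "a \<in> Q" "b \<in> Q" for a b using that by (auto simp: Q_def simp flip: power_add)
    fix a assume "a \<in> Q"
    then obtain n where n: "a = x ^ n" by (auto simp: Q_def)
    \<comment> \<open>The exponent n (p^k - 1) expresses the inverse of x^n as a power with a
      natural exponent.\<close>
    have "n + n * (p ^ k - 1) = p ^ k * n" using assms(1) by (cases "p ^ k") (auto simp: algebra_simps prime_gt_0_nat)
    then have "x ^ n * x ^ (n * (p ^ k - 1)) = x ^ (p ^ k * n)" by (simp only: power_add[symmetric])
    also have "\<dots> = 1" using k by (simp add: power_mult)
    finally have "x ^ n * x ^ (n * (p ^ k - 1)) = 1" .
    then have "gi a = x ^ (n * (p ^ k - 1))" unfolding n by (rule gi_unique)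
    then show "gi a \<in> Q" by (simp add: Q_def)
  qed
  then have "pgroup p Q" using assms by (intro pgroupI) (auto simp: Q_def p_elt_power)
  moreover have "x \<in> Q" unfolding Q_def by (metis power_one_right rangeI)
  ultimately show ?thesis using sub by (auto simp: Q_def)
qed

lemma syl_fsub: "syl p X P \<Longrightarrow> fsub P" by (simp add: syl_def)
lemma syl_subset: "syl p X P \<Longrightarrow> P \<subseteq> X" by (simp add: syl_def)
lemma syl_pgroup: "syl p X P \<Longrightarrow> pgroup p P" by (auto simp: syl_def pgroup_def)

lemma syl_exists: "prime p \<Longrightarrow> fsub X \<Longrightarrow> \<exists>P. syl p X P"
  unfolding syl_def using exists_subgroup_prime_power[of p X "multiplicity p (card X)"] multiplicity_dvd by blast

lemma syl_cj: "fsub X \<Longrightarrow> syl p X P \<Longrightarrow> x \<in> X \<Longrightarrow> syl p X (cj x ` P)"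
  by (auto simp: syl_def fsub_cj_image fsub_cj subset_iff)

lemma syl_cj_image: "syl p X P \<Longrightarrow> syl p (cj g ` X) (cj g ` P)"
  by (auto simp: syl_def fsub_cj_image)

text \<open>\<open>Q\<close> acts on the cosets of \<open>P\<close>. Their number is prime to p, so
  some coset x P is fixed, which means that \<open>Q\<close> lies in the conjugate of
  \<open>P\<close> by x.\<close>

lemma syl_dominates:
  assumes p: "prime p" and X: "fsub X" and P: "syl p X P" and Q: "pgroup p Q" "Q \<subseteq> X"
  shows "\<exists>x\<in>X. Q \<subseteq> cj x ` P"
proof -
  define W where "W = (\<lambda>x. (*) x ` P) ` X"
  obtain k where k: "card Q = p ^ k" "fsub Q" using Q by (auto simp: pgroup_def)
  have fP: "fsub P" "P \<subseteq> X" using P by (auto simp: syl_def)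
  have a: "acts Q W (\<lambda>q. (`) ((*) q))"
  proof (rule acts_lcoset)
    fix q w assume "q \<in> Q" "w \<in> W"
    then obtain x where x: "x \<in> X" "w = (*) x ` P" by (auto simp: W_def)
    have "(*) q ` w = (*) (q * x) ` P" by (simp add: x image_image mult.assoc)
    then show "(*) q ` w \<in> W" using x \<open>q \<in> Q\<close> Q X by (auto simp: W_def fsub_mult subset_iff)
  qed
  have fin: "finite W" using X by (simp add: W_def fsub_finite)
  have cW: "card W * p ^ multiplicity p (card X) = card X"
    using card_lcosets[OF X fP] P by (simp add: W_def syl_def)
  have "\<not> p dvd card W"
  proof
    assume "p dvd card W"
    then have "p ^ Suc (multiplicity p (card X)) dvd card X" using cW by (metis mult_dvd_mono dvd_refl power_Suc)
    moreover have "card X \<noteq> 0" "\<not> is_unit p" using fsub_card_pos[OF X] p by auto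
    ultimately show False by (meson multiplicity_geI not_less_eq_eq order_refl)
  qed
  then have "card {w\<in>W. \<forall>q\<in>Q. (*) q ` w = w} \<noteq> 0"
    using acts_fixed_points[OF p k(2,1) a fin] by (metis dvd_eq_mod_eq_0 mod_0)
  then obtain w where w: "w \<in> W" "\<forall>q\<in>Q. (*) q ` w = w" by (metis (mono_tags, lifting) card.empty empty_Collect_eq)
  then obtain x where x: "x \<in> X" "w = (*) x ` P" by (auto simp: W_def)
  have "Q \<subseteq> cj x ` P"
  proof
    fix q assume "q \<in> Q"
    then have "(*) (q * x) ` P = (*) x ` P" using w x by (metis (no_types, lifting) image_cong image_image mult.assoc)
    then have "gi x * (q * x) \<in> P" by (metis lcoset_eq_iff fP(1))
    moreover have "q = cj x (gi x * (q * x))" by (simp add: cj_def mult.assoc)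
    ultimately show "q \<in> cj x ` P" by blast
  qed
  then show ?thesis using x by auto
qed

lemma syl_conjugate:
  assumes "prime p" "fsub X" "syl p X P" "syl p X Q" shows "\<exists>x\<in>X. Q = cj x ` P"
proof -
  obtain x where "x \<in> X" "Q \<subseteq> cj x ` P" using syl_dominates[OF assms(1-3)] assms(4) syl_pgroup syl_subset by blast
  moreover have "card Q = card (cj x ` P)" using assms by (simp add: syl_def)
  moreover have "finite (cj x ` P)" using assms by (simp add: syl_def fsub_finite)
  ultimately show ?thesis using card_subset_eq by blast
qed

lemma pgroup_in_syl:
  assumes "prime p" "fsub X" "pgroup p Q" "Q \<subseteq> X" shows "\<exists>P. syl p X P \<and> Q \<subseteq> P"
  by (meson assms syl_cj syl_dominates syl_exists)

lemma p_elt_in_syl: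
  assumes "prime p" "fsub X" "x \<in> X" "p_elt p x" shows "\<exists>P. syl p X P \<and> x \<in> P"
  using p_elt_cyclic[OF assms] pgroup_in_syl[OF assms(1,2)] by blast

lemma multiplicity_card_mono: "prime p \<Longrightarrow> fsub X \<Longrightarrow> fsub Y \<Longrightarrow> Y \<subseteq> X \<Longrightarrow> multiplicity p (card Y) \<le> multiplicity p (card X)"
  by (metis dvd_imp_multiplicity_le fsub_card_pos lagrange_dvd less_not_refl)

lemma syl_sub:
  assumes "prime p" "fsub X" "syl p X P" "fsub Y" "P \<subseteq> Y" "Y \<subseteq> X" shows "syl p Y P"
proof -
  have "multiplicity p (card P) \<le> multiplicity p (card Y)" using assms by (meson multiplicity_card_mono syl_fsub)
  moreover have "multiplicity p (card P) = multiplicity p (card X)" using assms by (simp add: syl_def)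
  ultimately have "multiplicity p (card Y) = multiplicity p (card X)"
    using multiplicity_card_mono[OF assms(1,2,4,6)] by simp
  then show ?thesis using assms by (simp add: syl_def)
qed

lemma sylI_card:
  assumes "prime p" "fsub X" "pgroup p Q" "Q \<subseteq> X" "multiplicity p (card X) \<le> multiplicity p (card Q)"
  shows "syl p X Q"
proof -
  obtain k where k: "card Q = p ^ k" "fsub Q" using assms by (auto simp: pgroup_def)
  then have "multiplicity p (card Q) = k" using assms(1) by simp
  moreover have "multiplicity p (card Q) \<le> multiplicity p (card X)" using multiplicity_card_mono assms k by blast
  ultimately show ?thesis using assms k by (simp add: syl_def)
qed

lemma multiplicity_sprod:
  assumes "prime p" "fsub H" "fsub K"
  shows "multiplicity p (card (sprod H K)) + multiplicity p (card (H \<inter> K)) = multiplicity p (card H) + multiplicity p (card K)"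
proof -
  have "card (sprod H K) * card (H \<inter> K) = card H * card K" using card_sprod assms by auto
  moreover have "card H \<noteq> 0" "card K \<noteq> 0" "card (H \<inter> K) \<noteq> 0" using assms fsub_Int fsub_card_pos by (metis less_not_refl)+
  moreover have "card (sprod H K) \<noteq> 0" using calculation by (metis mult_is_0)
  ultimately show ?thesis using assms(1) by (metis prime_elem_multiplicity_mult_distrib prime_imp_prime_elem)
qed

text \<open>\<open>P\<close> already has the full p-part of X, so the product
  \<open>sprod P N\<close> has no larger one; the order formula then passes the p-part of
  \<open>N\<close> to the intersection.\<close>

lemma syl_normal_Int:
  assumes p: "prime p" and X: "fsub X" and N: "normal_in N X" and P: "syl p X P"
  shows "syl p N (N \<inter> P)"
proof (rule sylI_card)
  have fN: "fsub N" "N \<subseteq> X" and fP: "fsub P" "P \<subseteq> X" using N P by (auto simp: normal_in_def syl_def)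
  show "pgroup p (N \<inter> P)" using pgroup_subset[OF p syl_pgroup[OF P]] fN fP fsub_Int by blast
  have "fsub (sprod P N)" "sprod P N \<subseteq> X" using sprod_normal_fsub[OF N fP] sprod_subset[OF X fP(2) fN(2)] by auto
  then have "multiplicity p (card (sprod P N)) \<le> multiplicity p (card X)" using multiplicity_card_mono p X by blast
  moreover have "multiplicity p (card P) = multiplicity p (card X)" using P p by (simp add: syl_def)
  ultimately show "multiplicity p (card N) \<le> multiplicity p (card (N \<inter> P))"
    using multiplicity_sprod[OF p fP(1) fN(1)] by (simp add: Int_commute)
qed (use assms in \<open>auto simp: normal_in_def\<close>)

text \<open>Conjugation by x carries \<open>P\<close> to another Sylow subgroup of \<open>N\<close>,
  and an element of \<open>N\<close> carries it back.\<close>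

lemma frattini:
  assumes p: "prime p" and X: "fsub X" and N: "normal_in N X" and P: "syl p N P" and x: "x \<in> X"
  shows "\<exists>n\<in>N. gi n * x \<in> normaliser X P"
proof -
  have "syl p N (cj x ` P)" using syl_cj_image[OF P, of x] normal_in_cj_image[OF X N x] by simp
  then obtain n where n: "n \<in> N" "cj x ` P = cj n ` P" using syl_conjugate[OF p normal_in_fsub[OF N] P] by blast
  then have "cj (gi n * x) ` P = P" by (metis cj_image_cj cj_image_inv(1))
  then show ?thesis using n x X N by (intro bexI[of _ n]) (auto simp: normaliser_def normal_in_def fsub_mult subset_iff)
qed

lemma syl_normal_unique:
  assumes "prime p" "fsub X" "syl p X P" "normal_in P X"
  shows "P = p_part p X"
proof
  show "P \<subseteq> p_part p X" using assms pgroup_p_elt[OF syl_pgroup] by (auto simp: p_part_def syl_def)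
  show "p_part p X \<subseteq> P"
  proof
    fix x assume "x \<in> p_part p X"
    then obtain Q where "syl p X Q" "x \<in> Q" using p_elt_in_syl[OF assms(1,2)] by (auto simp: p_part_def)
    then show "x \<in> P" using syl_conjugate[OF assms(1-3)] normal_in_cj_image[OF assms(2,4)] by blast
  qed
qed

text \<open>Orders are compared one prime at a time. Below, this is the standard way to show that a
  centraliser, normaliser or product is the whole group.\<close>

lemma eq_if_all_syl:
  assumes "fsub X" "fsub Y" "Y \<subseteq> X" "\<And>q. prime q \<Longrightarrow> \<exists>Q. syl q X Q \<and> Q \<subseteq> Y"
  shows "Y = X"
proof -
  have "multiplicity q (card X) \<le> multiplicity q (card Y)" if q: "prime q" for q
  proof -
    obtain Q where Q: "syl q X Q" "Q \<subseteq> Y" using assms(4)[OF q] by auto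
    then have "multiplicity q (card Q) = multiplicity q (card X)" using q by (simp add: syl_def)
    then show ?thesis using multiplicity_card_mono[OF q assms(2) syl_fsub[OF Q(1)] Q(2)] by simp
  qed
  then have "card X dvd card Y" by (intro multiplicity_le_imp_dvd) (use fsub_card_pos[OF assms(1)] in auto)
  then have "card Y = card X" using lagrange_dvd[OF assms(1-3)] dvd_antisym by blast
  then show ?thesis using assms by (simp add: card_subset_eq fsub_finite)
qed

lemma p_part_triv_iff:
  assumes "prime p" "fsub X" shows "p_part p X = {1} \<longleftrightarrow> \<not> p dvd card X"
proof
  assume t: "p_part p X = {1}"
  show "\<not> p dvd card X"
  proof
    assume "p dvd card X"
    then obtain x where "x \<in> X" "x \<noteq> 1" "x ^ p = 1" using cauchy_thm assms by blast
    then have "x \<in> p_part p X" unfolding p_part_def p_elt_def by (metis (mono_tags, lifting) mem_Collect_eq power_one_right)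
    then show False using t \<open>x \<noteq> 1\<close> by auto
  qed
next
  assume n: "\<not> p dvd card X"
  have "x = 1" if x: "x \<in> p_part p X" for x
  proof -
    obtain k where "x ^ (p ^ k) = 1" using x by (auto simp: p_part_def p_elt_def)
    moreover have "x ^ card X = 1" using x assms fsub_power_card by (auto simp: p_part_def)
    moreover have "coprime (p ^ k) (card X)" using n assms(1) by (simp add: prime_imp_coprime)
    ultimately show ?thesis using coprime_powers_one by blast
  qed
  then show "p_part p X = {1}" using assms by (auto simp: p_part_def)
qed

lemma p_part_subset: "p_part p X \<subseteq> X" by (auto simp: p_part_def)

section \<open>Nilpotent subgroups\<close>

text \<open>A finite group is nilpotent iff any two elements whose orders are powers of distinct primes commute.\<close>

definition nilp :: "'a::grp set \<Rightarrow> bool" where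
  "nilp X \<longleftrightarrow> fsub X \<and> (\<forall>p q x y. prime p \<longrightarrow> prime q \<longrightarrow> p \<noteq> q \<longrightarrow> x \<in> X \<longrightarrow> y \<in> X \<longrightarrow>
      p_elt p x \<longrightarrow> p_elt q y \<longrightarrow> x * y = y * x)"

lemma nilp_fsub: "nilp X \<Longrightarrow> fsub X" by (simp add: nilp_def)

lemma nilp_subset: "nilp X \<Longrightarrow> fsub Y \<Longrightarrow> Y \<subseteq> X \<Longrightarrow> nilp Y"
  by (auto simp: nilp_def subset_iff)

lemma nilp_commute: "nilp X \<Longrightarrow> prime p \<Longrightarrow> prime q \<Longrightarrow> p \<noteq> q \<Longrightarrow> x \<in> X \<Longrightarrow> y \<in> X \<Longrightarrow>
      p_elt p x \<Longrightarrow> p_elt q y \<Longrightarrow> x * y = y * x"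
  by (simp add: nilp_def)

lemma nilp_cj_image:
  assumes "nilp X" shows "nilp (cj g ` X)"
  using assms unfolding nilp_def by (auto simp: fsub_cj_image commute_cj)

lemma pgroup_nilp: "prime p \<Longrightarrow> pgroup p X \<Longrightarrow> nilp X"
  unfolding nilp_def by (metis mult_1_left mult_1_right p_elt_p_elt pgroup_fsub pgroup_p_elt)

text \<open>The normaliser of a Sylow p-subgroup contains that subgroup and, for every other prime,
  a Sylow subgroup, which even centralises it.\<close>

lemma nilp_syl:
  assumes X: "nilp X" and p: "prime p"
  shows "syl p X (p_part p X)" "normal_in (p_part p X) X"
proof -
  have fX: "fsub X" using X by (rule nilp_fsub)
  obtain P where P: "syl p X P" using syl_exists p fX by blast
  have "normaliser X P = X"
  proof (rule eq_if_all_syl[OF fX fsub_normaliser[OF fX] normaliser_subset])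
    fix q :: nat assume q: "prime q"
    show "\<exists>Q. syl q X Q \<and> Q \<subseteq> normaliser X P"
    proof (cases "q = p")
      case True then show ?thesis using P subset_normaliser[OF syl_fsub[OF P] syl_subset[OF P]] by auto
    next
      case False
      obtain Q where Q: "syl q X Q" using syl_exists q fX by blast
      have "Q \<subseteq> centraliser X P"
      proof
        fix x assume x: "x \<in> Q"
        have "x * y = y * x" if "y \<in> P" for y
          using nilp_commute[OF X q p False] x that P Q syl_pgroup pgroup_p_elt syl_subset by (meson subsetD)
        then show "x \<in> centraliser X P" using x syl_subset[OF Q] by (auto simp: centraliser_def)
      qed
      then show ?thesis using Q centraliser_in_normaliser by blast
    qed
  qed
  then have n: "normal_in P X" using normaliser_eq_iff[OF fX syl_fsub[OF P] syl_subset[OF P]] by simp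
  then have "P = p_part p X" using syl_normal_unique p fX P by blast
  then show "syl p X (p_part p X)" "normal_in (p_part p X) X" using P n by auto
qed

lemma nilp_p_part_pgroup: "nilp X \<Longrightarrow> prime p \<Longrightarrow> pgroup p (p_part p X)"
  using nilp_syl(1) syl_pgroup by blast

text \<open>The Sylow p-subgroup of \<open>X\<close> acts by conjugation on that of
  \<open>K\<close>. The number of fixed points is divisible by p, so one of them is not 1; elements
  of order a power of another prime commute with it by nilpotency.\<close>

lemma nilp_central:
  assumes X: "nilp X" and p: "prime p" and K: "normal_in K X" "p dvd card K"
  shows "\<exists>z\<in>K. z \<noteq> 1 \<and> p_elt p z \<and> (\<forall>x\<in>X. z * x = x * z)"
proof -
  have fX: "fsub X" using X by (rule nilp_fsub)
  let ?P = "p_part p X"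
  have P: "syl p X ?P" "normal_in ?P X" using nilp_syl X p by auto
  define W where "W = K \<inter> ?P"
  have W: "syl p K W" unfolding W_def using syl_normal_Int p fX K P by blast
  have Wn: "normal_in W X" unfolding W_def using normal_in_Int K P by blast
  have fP: "fsub ?P" "?P \<subseteq> X" using P by (auto simp: syl_def)
  have a: "acts ?P W cj" using Wn fP by (auto simp: acts_def normal_in_cj cj_cj)
  obtain k where k: "card ?P = p ^ k" using P by (auto simp: syl_def)
  have "finite W" using Wn by (simp add: normal_in_fsub fsub_finite)
  from acts_fixed_points[OF p fP(1) k a this]
  have m: "card W mod p = card {w\<in>W. \<forall>q\<in>?P. cj q w = w} mod p" (is "_ = card ?F mod p") .
  have "card K \<noteq> 0" using K fsub_card_pos normal_in_fsub by (metis less_not_refl)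
  then have "multiplicity p (card K) > 0" using K(2) p by (simp add: prime_multiplicity_gt_zero_iff)
  then have "p dvd card W" using W by (simp add: syl_def)
  then have "p dvd card ?F" using m by (simp add: dvd_eq_mod_eq_0)
  moreover have "1 \<in> ?F" using Wn by (simp add: normal_in_fsub)
  moreover have "finite ?F" using \<open>finite W\<close> by simp
  ultimately have "?F \<noteq> {1}" using p by (metis One_nat_def card.empty card_insert_disjoint empty_iff finite.emptyI not_prime_unit nat_dvd_1_iff_1 is_unit_gcd)
  then obtain z where z: "z \<in> W" "z \<noteq> 1" "\<forall>q\<in>?P. cj q z = z" using \<open>1 \<in> ?F\<close> by auto
  have zp: "p_elt p z" "z \<in> X" using z fP by (auto simp: W_def p_part_def)
  have "centraliser X {z} = X"
  proof (rule eq_if_all_syl[OF fX fsub_centraliser[OF fX] centraliser_subset])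
    fix q :: nat assume q: "prime q"
    have "p_part q X \<subseteq> centraliser X {z}"
    proof
      fix x assume x: "x \<in> p_part q X"
      show "x \<in> centraliser X {z}"
      proof (cases "q = p")
        case True then show ?thesis using x z by (auto simp: centraliser_def p_part_def cj_eq_self_iff)
      next
        case False then show ?thesis using x zp nilp_commute[OF X q p False] by (auto simp: centraliser_def p_part_def)
      qed
    qed
    then show "\<exists>Q. syl q X Q \<and> Q \<subseteq> centraliser X {z}" using nilp_syl(1)[OF X q] by blast
  qed
  then have "\<forall>x\<in>X. x * z = z * x" unfolding centraliser_def by blast
  then have "\<forall>x\<in>X. z * x = x * z" by simp
  then show ?thesis using z zp by (auto simp: W_def)
qed

section \<open>Closures and cores\<close>

text \<open>Left multiplication by x is injective on the finite set \<open>H\<close>, hence onto, so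
  1 is attained and x has its inverse in \<open>H\<close>.\<close>

lemma fsub_mult_closed:
  assumes "finite H" "1 \<in> H" "\<And>x y. x \<in> H \<Longrightarrow> y \<in> H \<Longrightarrow> x * y \<in> H" shows "fsub H"
proof (rule fsubI)
  fix x assume x: "x \<in> H"
  have "(*) x ` H = H"
    by (rule card_subset_eq) (use assms x in \<open>auto simp: card_image inj_on_def\<close>)
  then obtain y where "y \<in> H" "x * y = 1" using assms(2) by (metis (mono_tags, lifting) imageE)
  then show "gi x \<in> H" using gi_unique by metis
qed (use assms in auto)

text \<open>Since \<open>fsub\<close> includes finiteness, the closure is formed inside a finite
  subgroup \<open>X\<close>, which itself belongs to the family when \<open>S\<close> lies in
  it.\<close>

definition gen :: "'a::grp set \<Rightarrow> 'a set \<Rightarrow> 'a set" where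
  "gen X S = \<Inter>{H. fsub H \<and> S \<subseteq> H \<and> H \<subseteq> X}"

lemma gen_subset: "fsub X \<Longrightarrow> S \<subseteq> X \<Longrightarrow> gen X S \<subseteq> X" by (auto simp: gen_def)

lemma subset_gen: "S \<subseteq> gen X S" by (auto simp: gen_def)

lemma gen_least: "fsub H \<Longrightarrow> S \<subseteq> H \<Longrightarrow> H \<subseteq> X \<Longrightarrow> gen X S \<subseteq> H" by (auto simp: gen_def)

lemma fsub_gen: "fsub X \<Longrightarrow> S \<subseteq> X \<Longrightarrow> fsub (gen X S)"
  by (rule fsubI)
    (auto simp: gen_def fsub_mult dest: fsub_finite intro: finite_subset[OF gen_subset[of X S, unfolded gen_def]])

lemma gen_cj_invariant:
  assumes X: "fsub X" and S: "S \<subseteq> X" and inv: "\<And>x. x \<in> X \<Longrightarrow> cj x ` S \<subseteq> S"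
  shows "normal_in (gen X S) X"
proof (rule normal_inI[OF fsub_gen[OF X S] gen_subset[OF X S]])
  fix x n assume x: "x \<in> X" and n: "n \<in> gen X S"
  have "gen X S \<subseteq> cj (gi x) ` gen X S"
  proof (rule gen_least)
    show "fsub (cj (gi x) ` gen X S)" using fsub_gen[OF X S] by (rule fsub_cj_image)
    show "S \<subseteq> cj (gi x) ` gen X S" using inv[OF x] subset_gen[of S X] by (metis cj_image_subset_swap gi_gi subset_trans)
    show "cj (gi x) ` gen X S \<subseteq> X" using gen_subset[OF X S] x X by (auto intro!: fsub_cj)
  qed
  then show "cj x n \<in> gen X S" using n by auto
qed

lemma ex_max_card:
  assumes "finite \<A>" "\<A> \<noteq> {}"
  shows "\<exists>M\<in>\<A>. \<forall>N\<in>\<A>. card (f N) \<le> card (f M)"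
proof -
  let ?I = "(\<lambda>N. card (f N)) ` \<A>"
  have "Max ?I \<in> ?I" using assms by (intro Max_in) auto
  then obtain M where "M \<in> \<A>" "Max ?I = card (f M)" by auto
  then show ?thesis using Max_ge[of ?I] assms by (intro bexI[of _ M]) auto
qed

lemma finite_normal_in: "fsub X \<Longrightarrow> finite {N. normal_in N X \<and> P N}"
  by (rule finite_subset[of _ "Pow X"]) (auto simp: fsub_finite dest: normal_in_subset)

lemma pgroup_sprod:
  assumes p: "prime p" and "pgroup p H" "pgroup p K" "fsub (sprod H K)"
  shows "pgroup p (sprod H K)"
proof -
  obtain a b where "card H = p ^ a" "card K = p ^ b" using assms by (auto simp: pgroup_def)
  then have "card (sprod H K) dvd p ^ (a + b)"
    using card_sprod[of H K] assms(2,3) by (metis dvd_triv_left pgroup_fsub power_add)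
  then show ?thesis using assms divides_primepow_nat[OF p] by (auto simp: pgroup_def)
qed

text \<open>Usually written O_p(X).\<close>

definition core :: "nat \<Rightarrow> 'a::grp set \<Rightarrow> 'a set" where
  "core p X = \<Union>{R. normal_in R X \<and> pgroup p R}"

text \<open>A normal p-subgroup \<open>R\<close> of largest order absorbs every other one
  \<open>S\<close>, because R S is again a normal p-subgroup. The union is therefore
  \<open>R\<close> itself.\<close>

lemma core_normal_pgroup:
  assumes p: "prime p" and X: "fsub X" shows "normal_in (core p X) X" "pgroup p (core p X)"
proof -
  have one: "pgroup p {1}" by (auto simp: pgroup_def intro: exI[of _ 0])
  have "{1} \<in> {R. normal_in R X \<and> pgroup p R}" using one normal_in_triv[OF X] by auto
  then obtain R where R: "normal_in R X" "pgroup p R" and mx: "\<And>S. normal_in S X \<Longrightarrow> pgroup p S \<Longrightarrow> card S \<le> card R"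
    using ex_max_card[of "{R. normal_in R X \<and> pgroup p R}" "\<lambda>x. x"] finite_normal_in[OF X] by blast
  have "S \<subseteq> R" if S: "normal_in S X" "pgroup p S" for S
  proof -
    have n: "normal_in (sprod R S) X" using sprod_normal_normal[OF X S(1) R(1)] .
    then have "card (sprod R S) \<le> card R" using mx pgroup_sprod[OF p R(2) S(2)] by (simp add: normal_in_fsub)
    moreover have "R \<subseteq> sprod R S" by (rule subset_sprod1) (use S in \<open>simp add: pgroup_fsub\<close>)
    ultimately have "R = sprod R S" using n by (metis card_seteq fsub_finite normal_in_fsub)
    then show ?thesis using subset_sprod2[of R S] R by (simp add: pgroup_fsub)
  qed
  then have "core p X = R" using R unfolding core_def by blast
  then show "normal_in (core p X) X" "pgroup p (core p X)" using R by auto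
qed

lemma core_greatest: "normal_in R X \<Longrightarrow> pgroup p R \<Longrightarrow> R \<subseteq> core p X" by (auto simp: core_def)

lemma core_in_syl:
  assumes p: "prime p" and X: "fsub X" and P: "syl p X P" shows "core p X \<subseteq> P"
proof -
  obtain x where "x \<in> X" "core p X \<subseteq> cj x ` P"
    using syl_dominates[OF p X P core_normal_pgroup(2)[OF p X]] core_normal_pgroup(1)[OF p X] normal_in_subset by blast
  then have "cj (gi x) ` core p X \<subseteq> P" by (metis cj_image_subset_swap gi_gi)
  then show ?thesis using normal_in_cj_image[OF X core_normal_pgroup(1)[OF p X], of "gi x"] X \<open>x \<in> X\<close> by simp
qed

lemma normal_p_part:
  assumes "nilp N" "normal_in N X" "prime p" shows "normal_in (p_part p N) X"
  by (rule normal_inI) (use assms nilp_p_part_pgroup[of N p] in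
    \<open>auto simp: pgroup_fsub p_part_def normal_in_cj dest: normal_in_subset\<close>)

text \<open>O_p(N) is characteristic in \<open>N\<close>: conjugation by an element of
  \<open>X\<close> permutes the normal p-subgroups of \<open>N\<close>.\<close>

lemma core_core:
  assumes p: "prime p" and X: "fsub X" and N: "normal_in N X" shows "core p N \<subseteq> core p X"
proof (rule core_greatest)
  have fN: "fsub N" using N by (rule normal_in_fsub)
  show pc: "pgroup p (core p N)" using core_normal_pgroup(2)[OF p fN] .
  show "normal_in (core p N) X"
  proof (rule normal_inI)
    show "fsub (core p N)" using pc by (rule pgroup_fsub)
    show "core p N \<subseteq> X" using core_normal_pgroup(1)[OF p fN] N normal_in_subset by blast
    fix x n assume x: "x \<in> X" and n: "n \<in> core p N"
    have "normal_in (cj x ` core p N) N"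
    proof (rule normal_inI)
      show "fsub (cj x ` core p N)" using pc by (simp add: pgroup_fsub fsub_cj_image)
      show "cj x ` core p N \<subseteq> N" using core_normal_pgroup(1)[OF p fN] normal_in_cj[OF N x] normal_in_subset by blast
      fix y m assume y: "y \<in> N" and "m \<in> cj x ` core p N"
      then obtain c where c: "c \<in> core p N" "m = cj x c" by auto
      have gx: "gi x \<in> X" using x X by simp
      have "cj (cj (gi x) y) c \<in> core p N" using normal_in_cj[OF core_normal_pgroup(1)[OF p fN] normal_in_cj[OF N gx y] c(1)] .
      moreover have "cj y m = cj x (cj (cj (gi x) y) c)" by (simp add: c cj_def mult.assoc)
      ultimately show "cj y m \<in> cj x ` core p N" by blast
    qed
    then have "cj x ` core p N \<subseteq> core p N" using core_greatest pgroup_cj_image[OF pc] by blast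
    then show "cj x n \<in> core p N" using n by blast
  qed
qed

section \<open>Solvable subgroups\<close>

text \<open>A finite group is solvable iff each of its proper quotients \<open>X/N\<close> has a nontrivial normal subgroup of prime power order.\<close>

definition slv :: "'a::grp set \<Rightarrow> bool" where
  "slv X \<longleftrightarrow> fsub X \<and> (\<forall>N. normal_in N X \<longrightarrow> N \<noteq> X \<longrightarrow>
     (\<exists>p L k. prime (p::nat) \<and> normal_in L X \<and> N \<subset> L \<and> card L = p ^ k * card N))"

lemma slv_fsub: "slv X \<Longrightarrow> fsub X" by (simp add: slv_def)

text \<open>Let M be a largest normal subgroup of X that meets Y inside N. The next normal subgroup
  above M, of p-power index over it, cuts out the required step in Y. As it is normal in all of X,
  the lemma serves both for inheritance by subgroups and for X-invariant steps below a normal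
  subgroup.\<close>

lemma slv_step:
  assumes X: "slv X" and Y: "fsub Y" "Y \<subseteq> X" and N: "normal_in N Y" "N \<noteq> Y"
  shows "\<exists>p M k. prime (p::nat) \<and> normal_in M X \<and> normal_in (sprod (M \<inter> Y) N) Y \<and>
    N \<subset> sprod (M \<inter> Y) N \<and> card (sprod (M \<inter> Y) N) = p ^ k * card N"
proof -
  have fX: "fsub X" using X by (rule slv_fsub)
  have fN: "fsub N" "N \<subseteq> Y" using N by (auto simp: normal_in_def)
  let ?S = "{M. normal_in M X \<and> M \<inter> Y \<subseteq> N}"
  have "{1} \<in> ?S" using fN by (auto simp: normal_in_triv fX)
  then have "?S \<noteq> {}" by blast
  from ex_max_card[OF finite_normal_in[OF fX] this, of "\<lambda>x. x"]
  obtain M where M: "normal_in M X" "M \<inter> Y \<subseteq> N" and mx: "\<And>M'. M' \<in> ?S \<Longrightarrow> card M' \<le> card M" by blast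
  have fM: "fsub M" using M by (simp add: normal_in_fsub)
  have "M \<noteq> X" using M Y fN N(2) by blast
  then obtain p M' k where M': "prime (p::nat)" "normal_in M' X" "M \<subset> M'" "card M' = p ^ k * card M"
    using X M(1) unfolding slv_def by blast
  have fM': "fsub M'" using M' by (simp add: normal_in_fsub)
  have "card M < card M'" using M'(3) fM' by (simp add: psubset_card_mono fsub_finite)
  then have nS: "\<not> M' \<inter> Y \<subseteq> N" using mx[of M'] M'(2) by auto
  define D where "D = M' \<inter> Y"
  have fD: "fsub D" using fM' Y by (simp add: D_def fsub_Int)
  have nD: "normal_in D Y" unfolding D_def using normal_in_Int_sub M' Y by blast
  define L where "L = sprod D N"
  have nL: "normal_in L Y" unfolding L_def using sprod_normal_normal[OF Y(1) N(1) nD] .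
  have NL: "N \<subset> L"
    using subset_sprod2[OF fD, of N] subset_sprod1[OF fN(1), of D] nS unfolding L_def D_def by blast
  define c where "c = card (D \<inter> N)"
  have cpos: "0 < c" "card M > 0" "card N > 0" "card (M \<inter> Y) > 0"
    using fD fN fM Y by (auto simp: c_def fsub_Int fsub_card_pos)
  have c1: "card L * c = card D * card N" unfolding L_def c_def using card_sprod fD fN by blast
  \<comment> \<open>\<open>D\<close> modulo \<open>M \<inter> Y\<close> embeds in M'/M and so has
    p-power order. As \<open>M \<inter> Y\<close> lies in \<open>D \<inter> N\<close>, the order of
    \<open>D\<close> modulo \<open>D \<inter> N\<close> is a power of p too.\<close>
  have c2: "card (sprod D M) * card (M \<inter> Y) = card D * card M"
  proof -
    have "D \<inter> M = M \<inter> Y" using M'(3) by (auto simp: D_def)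
    then show ?thesis using card_sprod[OF fD fM] by simp
  qed
  have "sprod D M \<subseteq> M'" using M'(3) by (intro sprod_subset[OF fM']) (auto simp: D_def)
  moreover have "fsub (sprod D M)"
    using sprod_normal_fsub[OF M(1) fD] Y by (auto simp: D_def)
  ultimately have "card (sprod D M) dvd p ^ k * card M" using lagrange_dvd[OF fM'] M'(4) by simp
  then have "card D * card M dvd p ^ k * card M * card (M \<inter> Y)" using c2 by (metis dvd_refl mult_dvd_mono)
  then have "card D dvd p ^ k * card (M \<inter> Y)" using cpos by (simp add: mult.commute mult.left_commute)
  moreover have "card (M \<inter> Y) dvd c" unfolding c_def
    using M M'(3) by (intro lagrange_dvd) (auto simp: D_def fsub_Int fM fN fD[unfolded D_def] Y fM')
  ultimately have "card D dvd p ^ k * c" by (meson dvd_trans dvd_refl mult_dvd_mono)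
  moreover have "c dvd card D" unfolding c_def by (rule lagrange_dvd) (auto simp: fD fN fsub_Int)
  then obtain d where d: "card D = d * c" by (metis dvd_div_mult_self)
  ultimately have "d dvd p ^ k" using cpos by simp
  then obtain j where "d = p ^ j" using M'(1) divides_primepow_nat by blast
  then have "card L * c = p ^ j * card N * c" using c1 unfolding d by (simp add: mult_ac)
  then have "card L = p ^ j * card N" using cpos(1) by simp
  then show ?thesis using M' nL NL unfolding L_def D_def by blast
qed

lemma slv_subset: "slv X \<Longrightarrow> fsub Y \<Longrightarrow> Y \<subseteq> X \<Longrightarrow> slv Y"
proof -
  assume X: "slv X" and Y: "fsub Y" "Y \<subseteq> X"
  show "slv Y" unfolding slv_def
  proof (intro conjI allI impI)
    fix N assume "normal_in N Y" "N \<noteq> Y"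
    from slv_step[OF X Y this] show "\<exists>p L k. prime p \<and> normal_in L Y \<and> N \<subset> L \<and> card L = p ^ k * card N" by blast
  qed fact
qed

lemma slv_between:
  assumes X: "slv X" and Y: "normal_in Y X" and N: "normal_in N X" "N \<subset> Y"
  shows "\<exists>p L k. prime (p::nat) \<and> normal_in L X \<and> N \<subset> L \<and> L \<subseteq> Y \<and> card L = p ^ k * card N"
proof -
  have "normal_in N Y" using N Y normal_in_restrict normal_in_subset by blast
  from slv_step[OF X normal_in_fsub[OF Y] normal_in_subset[OF Y] this less_imp_neq[OF N(2)]]
  obtain p M k where h: "prime (p::nat)" "normal_in M X" "normal_in (sprod (M \<inter> Y) N) Y"
    "N \<subset> sprod (M \<inter> Y) N" "card (sprod (M \<inter> Y) N) = p ^ k * card N" by blast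
  have "normal_in (sprod (M \<inter> Y) N) X"
    using sprod_normal_normal[OF slv_fsub[OF X] N(1) normal_in_Int[OF h(2) Y]] .
  then show ?thesis using h normal_in_subset[OF h(3)] by blast
qed

lemma slv_normal_core:
  assumes X: "slv X" and K: "normal_in K X" "K \<noteq> {1}"
  shows "\<exists>p R. prime p \<and> normal_in R X \<and> R \<subseteq> K \<and> pgroup p R \<and> R \<noteq> {1}"
proof -
  have "{1} \<subset> K" using K normal_in_fsub fsub_one by blast
  then obtain p L k where "prime (p::nat)" "normal_in L X" "{1} \<subset> L" "L \<subseteq> K" "card L = p ^ k * card {1::'a}"
    using slv_between[OF X K(1) normal_in_triv[OF slv_fsub[OF X]]] by blast
  then have "pgroup p L" "L \<noteq> {1}" by (auto simp: pgroup_def normal_in_fsub)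
  then show ?thesis using \<open>prime p\<close> \<open>normal_in L X\<close> \<open>L \<subseteq> K\<close> by blast
qed

text \<open>This set generates the Fitting subgroup and has the same centraliser, so for statements
  about the centraliser no generated subgroup is formed.\<close>

definition fcore :: "'a::grp set \<Rightarrow> 'a set" where "fcore X = (\<Union>p\<in>{p. prime p}. core p X)"

lemma fcore_cj: "fsub X \<Longrightarrow> x \<in> X \<Longrightarrow> cj x ` fcore X = fcore X"
proof -
  assume "fsub X" "x \<in> X"
  then have "cj x ` core p X = core p X" if "prime p" for p
    using core_normal_pgroup(1)[OF that] normal_in_cj_image by blast
  then show ?thesis unfolding fcore_def image_UN by (intro SUP_cong) simp_all
qed

lemma nilp_central_if_parts:
  assumes N: "nilp N" and c: "\<And>p x. prime p \<Longrightarrow> x \<in> p_part p N \<Longrightarrow> x * c = c * x" and x: "x \<in> N"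
  shows "x * c = c * x"
proof -
  have "centraliser N {c} = N"
  proof (rule eq_if_all_syl)
    show "\<exists>Q. syl q N Q \<and> Q \<subseteq> centraliser N {c}" if "prime q" for q
      using nilp_syl(1)[OF N that] c[OF that] by (intro exI[of _ "p_part q N"]) (auto simp: centraliser_def p_part_def)
  qed (use N in \<open>simp_all add: nilp_fsub fsub_centraliser centraliser_subset\<close>)
  then show ?thesis using x unfolding centraliser_def by blast
qed

text \<open>The classical fact that in a solvable group the Fitting subgroup contains its
  centraliser C. A largest nilpotent normal subgroup N of X inside C is central in C, because its
  Sylow subgroups lie in the cores. If N were smaller than C, a step L above N of p-power index
  would have all its q-elements, q not p, in N and hence central, so L would be nilpotent.\<close>

lemma slv_centraliser_fcore:
  assumes X: "slv X"
  shows "nilp (centraliser X (fcore X))" "prime p \<Longrightarrow> p_part p (centraliser X (fcore X)) \<subseteq> core p X"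
proof -
  have fX: "fsub X" using X by (rule slv_fsub)
  define C where "C = centraliser X (fcore X)"
  have nC: "normal_in C X" unfolding C_def using normal_centraliser[OF fX] fcore_cj[OF fX] by blast
  let ?S = "{N. normal_in N X \<and> N \<subseteq> C \<and> nilp N}"
  have "{1} \<in> ?S" using normal_in_triv[OF fX] nC by (auto simp: nilp_def normal_in_fsub)
  then obtain N where N: "normal_in N X" "N \<subseteq> C" "nilp N" and mx: "\<And>M. M \<in> ?S \<Longrightarrow> card M \<le> card N"
    using ex_max_card[of ?S "\<lambda>x. x"] finite_normal_in[OF fX, of "\<lambda>N. N \<subseteq> C \<and> nilp N"] by blast
  have central: "x * c = c * x" if "x \<in> N" "c \<in> C" for x c
  proof (rule nilp_central_if_parts[OF N(3) _ that(1)])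
    fix p :: nat and y assume p: "prime p" and y: "y \<in> p_part p N"
    have "p_part p N \<subseteq> core p X" using core_greatest normal_p_part[OF N(3,1) p] nilp_p_part_pgroup[OF N(3) p] by blast
    then have "y \<in> fcore X" using y p by (auto simp: fcore_def)
    then show "y * c = c * y" using that(2) by (simp add: C_def centraliser_def)
  qed
  have "N = C"
  proof (rule ccontr)
    assume "N \<noteq> C"
    then obtain p L k where L: "prime (p::nat)" "normal_in L X" "N \<subset> L" "L \<subseteq> C" "card L = p ^ k * card N"
      using slv_between[OF X nC N(1)] N(2) by blast
    have fL: "fsub L" and fN: "fsub N" using L N by (auto simp: normal_in_fsub)
    \<comment> \<open>For q other than p, N contains a Sylow q-subgroup of L, and this one is normal
      in L, hence unique.\<close>
    have inN: "x \<in> N" if q: "prime q" "q \<noteq> p" "x \<in> L" "p_elt q x" for q x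
    proof -
      have "multiplicity q (p ^ k) = 0" using q L(1) by (metis multiplicity_distinct_prime_power)
      moreover have "multiplicity q (p ^ k * card N) = multiplicity q (p ^ k) + multiplicity q (card N)"
        using q L(1) fsub_card_pos[OF fN] by (intro prime_elem_multiplicity_mult_distrib) auto
      ultimately have "multiplicity q (card L) = multiplicity q (card N)" using L(5) by simp
      then have "syl q L (p_part q N)" using nilp_syl(1)[OF N(3) q(1)] L(3) by (auto simp: syl_def)
      moreover have "normal_in (p_part q N) L"
        by (rule normal_in_restrict[OF normal_p_part[OF N(3,1) q(1)]])
          (use L normal_in_subset[OF L(2)] p_part_subset[of q N] in auto)
      ultimately have "p_part q N = p_part q L" using syl_normal_unique q(1) fL by blast
      then show ?thesis using q by (auto simp: p_part_def)
    qed
    have "nilp L"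
      unfolding nilp_def
    proof (intro conjI allI impI fL)
      fix q r :: nat and x y
      assume "prime q" "prime r" "q \<noteq> r" "x \<in> L" "y \<in> L" "p_elt q x" "p_elt r y"
      then show "x * y = y * x" using inN[of q x] inN[of r y] central[of x y] central[of y x] L(4) by (cases "q = p") auto
    qed
    then have "card L \<le> card N" using mx[of L] L by blast
    moreover have "card N < card L" using psubset_card_mono[OF fsub_finite[OF fL] L(3)] .
    ultimately show False by simp
  qed
  then show "nilp (centraliser X (fcore X))" using N by (simp add: C_def)
  show "p_part p (centraliser X (fcore X)) \<subseteq> core p X" if "prime p"
    using core_greatest normal_p_part[OF N(3,1) that] nilp_p_part_pgroup[OF N(3) that] \<open>N = C\<close> by (auto simp: C_def)
qed

lemma multiplicity_prime_power_mult:
  fixes p q n :: nat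
  assumes "prime p" "prime q" "n > 0"
  shows "multiplicity q (p ^ k * n) = (if q = p then k else 0) + multiplicity q n"
proof -
  have "multiplicity q (p ^ k * n) = multiplicity q (p ^ k) + multiplicity q n"
    using assms by (intro prime_elem_multiplicity_mult_distrib) auto
  then show ?thesis using assms multiplicity_distinct_prime_power[of q p k] by auto
qed

text \<open>Hall subgroups of solvable groups. It suffices to find a proper subgroup whose index
  divides a power of a prime p outside sigma, and to apply induction to it. It is found from a
  normal section L/N of p-power order such that L has all of the sigma'-part of X. With L as large
  as possible, Frattini's argument for a section just above L supplies the subgroup.\<close>

lemma hall_exists:
  fixes \<sigma> :: "nat set" and X :: "'a::grp set"
  assumes "slv X"
  shows "\<exists>S. fsub S \<and> S \<subseteq> X \<and> (\<forall>p. prime p \<longrightarrow>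
    multiplicity p (card S) = (if p \<in> \<sigma> then multiplicity p (card X) else 0))"
  using assms
proof (induction "card X" arbitrary: X rule: less_induct)
  case less
  note X = less.prems
  have fX: "fsub X" using X by (rule slv_fsub)
  let ?H = "\<lambda>X S. fsub S \<and> S \<subseteq> X \<and> (\<forall>p. prime p \<longrightarrow>
    multiplicity p (card S) = (if p \<in> \<sigma> then multiplicity p (card X) else 0))"
  show ?case
  proof (cases "\<forall>p. prime p \<longrightarrow> p \<notin> \<sigma> \<longrightarrow> \<not> p dvd card X")
    case True
    then have "?H X X" using fX by (auto intro: not_dvd_imp_multiplicity_0)
    then show ?thesis by blast
  next
    case False
    have proper: ?thesis
      if Y: "fsub Y" "Y \<subseteq> X" "Y \<noteq> X" and p: "prime p" "p \<notin> \<sigma>" and d: "card X dvd p ^ k * card Y" for Y p k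
    proof -
      have "card Y < card X" using Y fX by (simp add: psubset_card_mono fsub_finite psubsetI)
      then obtain S where S: "?H Y S" using less.hyps[OF _ slv_subset[OF X Y(1,2)]] by blast
      have "multiplicity q (card Y) = multiplicity q (card X)" if q: "prime q" "q \<in> \<sigma>" for q
      proof -
        have "card Y > 0" using Y by (simp add: fsub_card_pos)
        then have "multiplicity q (card X) \<le> multiplicity q (p ^ k * card Y)"
          using d p by (intro dvd_imp_multiplicity_le) auto
        also have "\<dots> = multiplicity q (card Y)"
          using multiplicity_prime_power_mult[OF p(1) q(1) \<open>card Y > 0\<close>] q p by auto
        finally show ?thesis using multiplicity_card_mono[OF q(1) fX Y(1,2)] by simp
      qed
      then have "?H X S" using S Y by auto
      then show ?thesis by blast
    qed
    \<comment> \<open>The index of a \<open>full\<close> subgroup of X involves only primes of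
      sigma.\<close>
    define full where "full M \<longleftrightarrow> (\<forall>p. prime p \<longrightarrow> p \<notin> \<sigma> \<longrightarrow> multiplicity p (card M) = multiplicity p (card X))" for M :: "'a set"
    define good where "good N L \<longleftrightarrow> normal_in N X \<and> normal_in L X \<and> N \<subset> L \<and> full L \<and>
      (\<exists>p k. prime p \<and> p \<notin> \<sigma> \<and> card L = p ^ k * card N)" for N L
    have "\<exists>N L. good N L"
    proof -
      \<comment> \<open>A smallest full normal subgroup together with a maximal normal subgroup of X
        below it is a good pair: if the prime of this step were in sigma, the smaller subgroup would
        be full as well.\<close>
      let ?S = "{M. normal_in M X \<and> full M}"
      have "X \<in> ?S" by (simp add: normal_in_self fX full_def)
      then obtain M where M: "normal_in M X" "full M" and mn: "\<And>M'. normal_in M' X \<Longrightarrow> full M' \<Longrightarrow> card M \<le> card M'"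
        using ex_has_least_nat[of "\<lambda>M. M \<in> ?S" X card] by blast
      obtain p0 where p0: "prime p0" "p0 \<notin> \<sigma>" "p0 dvd card X" using False by blast
      then have "multiplicity p0 (card X) > 0" using fsub_card_pos[OF fX] by (simp add: prime_multiplicity_gt_zero_iff)
      then have "multiplicity p0 (card M) > 0" using M(2) p0 by (simp add: full_def)
      then have "M \<noteq> {1}" by auto
      have "normal_in {1} X \<and> {1} \<subset> M" using \<open>M \<noteq> {1}\<close> M normal_in_triv[OF fX] normal_in_fsub fsub_one by blast
      then have "{N. normal_in N X \<and> N \<subset> M} \<noteq> {}" by blast
      from ex_max_card[OF finite_normal_in[OF fX] this, of "\<lambda>x. x"]
      obtain N where N: "normal_in N X" "N \<subset> M" and mx: "\<And>N'. normal_in N' X \<Longrightarrow> N' \<subset> M \<Longrightarrow> card N' \<le> card N" by blast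
      obtain p L k where L: "prime (p::nat)" "normal_in L X" "N \<subset> L" "L \<subseteq> M" "card L = p ^ k * card N"
        using slv_between[OF X M(1) N] by blast
      have "card N < card L" using L(2,3) by (simp add: psubset_card_mono fsub_finite normal_in_fsub)
      then have LM: "L = M" using mx[of L] L by fastforce
      have "p \<notin> \<sigma>"
      proof
        assume "p \<in> \<sigma>"
        have "full N" unfolding full_def
        proof (intro allI impI)
          fix q :: nat assume q: "prime q" "q \<notin> \<sigma>"
          then have "multiplicity q (card M) = multiplicity q (card N)"
            using multiplicity_prime_power_mult[OF L(1) q(1) fsub_card_pos[OF normal_in_fsub[OF N(1)]], of k] \<open>p \<in> \<sigma>\<close> L(5) LM by auto
          then show "multiplicity q (card N) = multiplicity q (card X)" using M(2) q by (simp add: full_def)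
        qed
        then have "card M \<le> card N" using mn N by blast
        then show False using \<open>card N < card L\<close> LM by simp
      qed
      then have "good N L" using L N M LM by (auto simp: good_def)
      then show ?thesis by blast
    qed
    then obtain N1 L1 where g1: "good N1 L1" by blast
    have nl: "normal_in L' X" if "good N' L'" for N' L' using that unfolding good_def by blast
    from nl[OF g1] g1 have ne: "{L. normal_in L X \<and> (\<exists>N. good N L)} \<noteq> {}" by blast
    from ex_max_card[OF finite_normal_in[OF fX] ne, of "\<lambda>x. x"]
    obtain N L where NL: "good N L" and mx: "\<And>N' L'. good N' L' \<Longrightarrow> card L' \<le> card L" using nl by blast
    then obtain p k where p: "prime p" "p \<notin> \<sigma>" "card L = p ^ k * card N" by (auto simp: good_def)
    have nN: "normal_in N X" and nL: "normal_in L X" and NsL: "N \<subset> L" and fullL: "full L" using NL by (auto simp: good_def)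
    have fN: "fsub N" and fL: "fsub L" using nN nL by (auto simp: normal_in_fsub)
    have cNL: "card N < card L" using NsL fL by (simp add: psubset_card_mono fsub_finite)
    show ?thesis
    proof (cases "L = X")
      case True
      then show ?thesis using proper[of N p k] fN NsL p by auto
    next
      case False
      then obtain r R j where R: "prime (r::nat)" "normal_in R X" "L \<subset> R" "card R = r ^ j * card L"
        using X nL unfolding slv_def by blast
      have fR: "fsub R" using R by (simp add: normal_in_fsub)
      have cLR: "card L < card R" using psubset_card_mono[OF fsub_finite[OF fR] R(3)] .
      have "j > 0" using cLR R(4) by (cases j) auto
      have rs: "r \<in> \<sigma>"
      proof (rule ccontr)
        assume "r \<notin> \<sigma>"
        then have "multiplicity r (card L) = multiplicity r (card X)" using fullL R(1) by (simp add: full_def)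
        moreover have "multiplicity r (card R) = j + multiplicity r (card L)"
          using multiplicity_prime_power_mult[OF R(1,1) fsub_card_pos[OF fL], of j] R(4) by simp
        moreover have "multiplicity r (card R) \<le> multiplicity r (card X)"
          using multiplicity_card_mono[OF R(1) fX fR normal_in_subset[OF R(2)]] .
        ultimately show False using \<open>j > 0\<close> by simp
      qed
      have fullR: "full R" unfolding full_def
        using fullL multiplicity_prime_power_mult[OF R(1) _ fsub_card_pos[OF fL], of _ j] R(4) rs by (auto simp: full_def)
      obtain S where S: "syl r R S" using syl_exists[OF R(1) fR] by blast
      have fS: "fsub S" "S \<subseteq> R" using S by (auto simp: syl_def)
      define NS where "NS = normaliser X S"
      have SX: "S \<subseteq> X" using fS R normal_in_subset by blast
      have fNS: "fsub NS" "NS \<subseteq> X" "S \<subseteq> NS" unfolding NS_def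
        using fsub_normaliser[OF fX] normaliser_subset subset_normaliser[OF fS(1) SX] by auto
      have RLS: "R = sprod L S"
      proof -
        have sub: "sprod L S \<subseteq> R" using sprod_subset[OF fR] R(3) fS by auto
        have fLS: "fsub (sprod S L)" using sprod_normal_fsub[OF nL fS(1) SX] .
        have eq: "sprod L S = sprod S L" using sprod_normal_commute[OF nL fS(1) SX] .
        have "sprod L S = R"
        proof (rule eq_if_all_syl[OF fR _ sub])
          show "fsub (sprod L S)" using fLS eq by simp
          fix q :: nat assume q: "prime q"
          show "\<exists>Q. syl q R Q \<and> Q \<subseteq> sprod L S"
          proof (cases "q = r")
            case True then show ?thesis using S subset_sprod2[OF fL] by blast
          next
            case False
            obtain Q where Q: "syl q L Q" using syl_exists[OF q fL] by blast
            have "multiplicity q (card R) = multiplicity q (card L)"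
              using multiplicity_prime_power_mult[OF R(1) q fsub_card_pos[OF fL], of j] False R(4) by auto
            then have "syl q R Q" using Q R(3) by (auto simp: syl_def)
            then show ?thesis using syl_subset[OF Q] subset_sprod1[OF fS(1), of L] by blast
          qed
        qed
        then show ?thesis ..
      qed
      have XLNS: "X = sprod L NS"
      proof
        show "sprod L NS \<subseteq> X" using sprod_subset[OF fX normal_in_subset[OF nL] fNS(2)] .
        show "X \<subseteq> sprod L NS"
        proof
          fix x assume "x \<in> X"
          then obtain n where n: "n \<in> R" "gi n * x \<in> NS" using frattini[OF R(1) fX R(2) S] unfolding NS_def by blast
          then obtain l s where ls: "l \<in> L" "s \<in> S" "n = l * s" using RLS by (auto elim: sprodE)
          have "x = l * (s * (gi n * x))" using ls by (simp add: mult.assoc)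
          moreover have "s * (gi n * x) \<in> NS" using n ls fNS by (auto intro: fsub_mult)
          ultimately show "x \<in> sprod L NS" using ls by (metis sprodI)
        qed
      qed
      \<comment> \<open>X is the product of L and \<open>NS\<close> by Frattini, so the index of
        \<open>Y\<close> divides that of N in L, a power of p.\<close>
      define Y where "Y = sprod NS N"
      have fY: "fsub Y" "Y \<subseteq> X" unfolding Y_def
        using sprod_normal_fsub[OF nN fNS(1,2)] sprod_subset[OF fX fNS(2) normal_in_subset[OF nN]] by auto
      have dvdXY: "card X dvd p ^ k * card Y"
      proof -
        have 1: "card X * card (L \<inter> NS) = p ^ k * card N * card NS" using card_sprod[OF fL fNS(1)] XLNS p(3) by simp
        have 2: "card Y * card (NS \<inter> N) = card NS * card N" unfolding Y_def by (rule card_sprod[OF fNS(1) fN])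
        have "NS \<inter> N \<subseteq> L \<inter> NS" using NsL by auto
        then obtain d where d: "card (L \<inter> NS) = card (NS \<inter> N) * d"
          using lagrange_dvd[of "L \<inter> NS" "NS \<inter> N"] fL fNS fN fsub_Int by (metis dvdE)
        have "card (NS \<inter> N) * (card X * d) = card (NS \<inter> N) * (p ^ k * card Y)" using 1 2 d by (simp add: mult_ac)
        moreover have "card (NS \<inter> N) > 0" using fNS fN by (simp add: fsub_card_pos fsub_Int)
        ultimately have "card X * d = p ^ k * card Y" by simp
        then show ?thesis by (metis dvd_triv_left)
      qed
      show ?thesis
      proof (cases "Y = X")
        case False
        then show ?thesis using proper[OF fY _ p(1,2) dvdXY] by blast
      next
        case True
        \<comment> \<open>If \<open>Y\<close> is all of X, then S N is normal in X and forms with R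
          a good pair whose upper member is larger than L.\<close>
        define T where "T = sprod S N"
        have fT: "fsub T" unfolding T_def using sprod_normal_fsub[OF nN fS(1) SX] .
        have TR: "T \<subseteq> R" unfolding T_def using sprod_subset[OF fR fS(2)] NsL R(3) by blast
        have TNS: "T = sprod N S" unfolding T_def using sprod_normal_commute[OF nN fS(1) SX] by simp
        have nT: "normal_in T X"
        proof (rule normal_inI[OF fT])
          show "T \<subseteq> X" using TR normal_in_subset[OF R(2)] by blast
          fix x t assume x: "x \<in> X" and t: "t \<in> T"
          obtain g n where gn: "g \<in> NS" "n \<in> N" "x = g * n" using x True unfolding Y_def by (auto elim: sprodE)
          have "cj n t \<in> T" using gn t subset_sprod2[OF fS(1), of N] fT unfolding T_def by (intro fsub_cj) auto
          then obtain s m where "s \<in> S" "m \<in> N" "cj n t = s * m" unfolding T_def by (auto elim: sprodE)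
          then have "cj x t = cj g s * cj g m" "cj g s \<in> S" "cj g m \<in> N"
            using gn fNS nN by (auto simp: cj_mult NS_def normaliser_def normal_in_cj simp flip: cj_cj)
          then show "cj x t \<in> T" unfolding T_def by (simp add: sprodI)
        qed
        have "T \<noteq> R"
        proof
          assume "T = R"
          have "p \<noteq> r" using p rs by blast
          have m: "multiplicity p (card S) = 0" using S \<open>p \<noteq> r\<close> p(1) R(1) by (simp add: syl_def multiplicity_distinct_prime_power)
          have "multiplicity p (card R) \<le> multiplicity p (card S) + multiplicity p (card N)"
            using multiplicity_sprod[OF p(1) fS(1) fN] \<open>T = R\<close> unfolding T_def by simp
          moreover have "multiplicity p (card L) \<le> multiplicity p (card R)"
            using multiplicity_card_mono[OF p(1) fR fL] R(3) by blast
          moreover have "multiplicity p (card L) = k + multiplicity p (card N)"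
            using multiplicity_prime_power_mult[OF p(1,1) fsub_card_pos[OF fN], of k] p(3) by simp
          ultimately have "k = 0" using m by simp
          then show False using p(3) cNL by simp
        qed
        have "\<exists>i. card R = p ^ i * card T"
        proof -
          have "sprod L T = R"
          proof
            show "sprod L T \<subseteq> R" using sprod_subset[OF fR] TR R(3) by blast
            show "R \<subseteq> sprod L T" using RLS sprod_mono[of L L S T] subset_sprod1[OF fN, of S] unfolding T_def by blast
          qed
          then have 1: "card R * card (L \<inter> T) = p ^ k * card N * card T" using card_sprod[OF fL fT] p(3) by simp
          have "N \<subseteq> L \<inter> T" using NsL subset_sprod2[OF fS(1), of N] unfolding T_def by blast
          then obtain e where e: "card (L \<inter> T) = card N * e"
            using lagrange_dvd[of "L \<inter> T" N] fL fT fN fsub_Int by (metis dvdE)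
          have "card N * (card R * e) = card N * (p ^ k * card T)" using 1 e by (simp add: mult_ac)
          then have re: "card R * e = p ^ k * card T" using fsub_card_pos[OF fN] by simp
          obtain f where f: "card R = card T * f" using lagrange_dvd[OF fR fT TR] by (metis dvdE)
          have "card T * (f * e) = card T * p ^ k" using re f by (simp add: mult_ac)
          then have "f * e = p ^ k" using fsub_card_pos[OF fT] by simp
          then obtain i where "f = p ^ i" using p(1) divides_primepow_nat by (metis dvd_triv_left)
          then show ?thesis using f by (auto simp: mult.commute)
        qed
        then have "good T R" using nT R(2) TR \<open>T \<noteq> R\<close> fullR p by (auto simp: good_def)
        then show ?thesis using mx cLR by fastforce
      qed
    qed
  qed
qed

section \<open>Permuting conjugates\<close>

text \<open>The conjugates of A by g and of B by h are thus the conjugates of A and B by the single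
  element g a = h b.\<close>

lemma conjugate_pair:
  assumes G: "fsub G" and A: "fsub A" "A \<subseteq> G" and B: "fsub B" "B \<subseteq> G" and f: "sprod A B = G" and gh: "g \<in> G" "h \<in> G"
  shows "\<exists>a\<in>A. \<exists>b\<in>B. g * a = h * b"
proof -
  have "gi g * h \<in> sprod A B" using f gh G by (simp add: fsub_mult)
  then obtain a b where ab: "a \<in> A" "b \<in> B" "gi g * h = a * b" by (auto elim: sprodE)
  then have "g * a = g * (gi g * h) * gi b" by (simp add: mult.assoc)
  then have "g * a = h * gi b" by (simp add: mult.assoc)
  then show ?thesis using ab B by (metis fsub_gi)
qed

text \<open>The x in the join J with K x inside J K form a subgroup. It contains A and C, since both
  permute with K, and hence is J.\<close>

lemma fsub_sprod_gen:
  assumes G: "fsub G" and A: "fsub A" "A \<subseteq> G" and C: "fsub C" "C \<subseteq> G" and K: "fsub K" "K \<subseteq> G"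
    and AK: "fsub (sprod A K)" and CK: "fsub (sprod C K)"
  shows "fsub (sprod (gen G (A \<union> C)) K)"
proof -
  define J where "J = gen G (A \<union> C)"
  have fJ: "fsub J" "J \<subseteq> G" "A \<subseteq> J" "C \<subseteq> J"
    using fsub_gen[OF G, of "A \<union> C"] gen_subset[OF G, of "A \<union> C"] subset_gen[of "A \<union> C" G] A C unfolding J_def by auto
  define Z where "Z = {x \<in> J. \<forall>k\<in>K. k * x \<in> sprod J K}"
  have "fsub Z"
  proof (rule fsub_mult_closed)
    show "finite Z" using fJ by (simp add: Z_def fsub_finite)
    show "1 \<in> Z" using fJ subset_sprod2[OF fJ(1), of K] by (auto simp: Z_def)
    fix x y assume x: "x \<in> Z" and y: "y \<in> Z"
    have "k * (x * y) \<in> sprod J K" if k: "k \<in> K" for k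
    proof -
      have "k * x \<in> sprod J K" using x k by (simp add: Z_def)
      then obtain x' k' where 1: "x' \<in> J" "k' \<in> K" "k * x = x' * k'" by (auto elim: sprodE)
      have "k' * y \<in> sprod J K" using y 1(2) by (simp add: Z_def)
      then obtain y' k'' where 2: "y' \<in> J" "k'' \<in> K" "k' * y = y' * k''" by (auto elim: sprodE)
      have "k * (x * y) = (x' * y') * k''" using 1 2 by (metis mult.assoc)
      then show ?thesis using 1 2 fJ by (simp add: sprodI fsub_mult)
    qed
    then show "x * y \<in> Z" using x y fJ by (simp add: Z_def fsub_mult)
  qed
  moreover have "A \<subseteq> Z" "C \<subseteq> Z"
  proof -
    have "A' \<subseteq> Z" if A': "fsub A'" "A' \<subseteq> J" "fsub (sprod A' K)" for A'
    proof
      fix x assume x: "x \<in> A'"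
      have "k * x \<in> sprod J K" if "k \<in> K" for k
      proof -
        have "k * x \<in> sprod A' K" using sprod_commute[OF A'(1) K(1) A'(3)] x that by (simp add: sprodI)
        then show ?thesis using sprod_mono[OF A'(2), of K K] by blast
      qed
      then show "x \<in> Z" using x A' by (auto simp: Z_def)
    qed
    then show "A \<subseteq> Z" "C \<subseteq> Z" using A C fJ AK CK by auto
  qed
  moreover have "Z \<subseteq> G" using fJ by (auto simp: Z_def)
  ultimately have "J \<subseteq> Z" unfolding J_def by (intro gen_least) auto
  then have "sprod K J \<subseteq> sprod J K" by (auto simp: Z_def elim!: sprodE)
  then show ?thesis using fsub_sprod[OF fJ(1) K(1)] by (simp add: J_def)
qed

text \<open>The idea behind Kegel's lemma: a subgroup that permutes with all conjugates of \<open>B\<close> and is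
  maximal with this property (within a suitable class \<open>\<Phi>\<close>) is normalised by all of them.\<close>

lemma permuting_subgroup_normalised:
  assumes G: "fsub G" and A: "fsub A" "A \<subseteq> G" and B: "fsub B" "B \<subseteq> G"
    and perm: "\<And>g. g \<in> G \<Longrightarrow> fsub (sprod A (cj g ` B))" and base: "\<Phi> A"
    and step: "\<And>C D g. fsub C \<Longrightarrow> fsub D \<Longrightarrow> C \<subseteq> D \<Longrightarrow> D \<subseteq> G \<Longrightarrow> \<Phi> C \<Longrightarrow> g \<in> G \<Longrightarrow> fsub (sprod C (cj g ` B)) \<Longrightarrow>
      (\<And>g. g \<in> G \<Longrightarrow> fsub (sprod D (cj g ` B))) \<Longrightarrow> D \<subseteq> sprod C (cj g ` B) \<Longrightarrow> \<Phi> D"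
  shows "\<exists>C. fsub C \<and> A \<subseteq> C \<and> C \<subseteq> G \<and> \<Phi> C \<and> (\<forall>g\<in>G. fsub (sprod C (cj g ` B))) \<and>
    (\<forall>g\<in>G. \<forall>k\<in>cj g ` B. cj k ` C = C)"
proof -
  let ?S = "{C. fsub C \<and> A \<subseteq> C \<and> C \<subseteq> G \<and> \<Phi> C \<and> (\<forall>g\<in>G. fsub (sprod C (cj g ` B)))}"
  have "finite ?S" by (rule finite_subset[of _ "Pow G"]) (use G in \<open>auto simp: fsub_finite\<close>)
  moreover have "A \<in> ?S" using A base perm by simp
  ultimately obtain C where C: "fsub C" "A \<subseteq> C" "C \<subseteq> G" "\<Phi> C" "\<And>g. g \<in> G \<Longrightarrow> fsub (sprod C (cj g ` B))"
    and mx: "\<And>D. D \<in> ?S \<Longrightarrow> card D \<le> card C"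
    using ex_max_card[of ?S "\<lambda>x. x"] by blast
  have "cj k ` C = C" if g: "g \<in> G" and k: "k \<in> cj g ` B" for g k
  proof -
    have fgB: "fsub (cj g ` B)" "cj g ` B \<subseteq> G" if "g \<in> G" for g
      using B that G by (auto simp: fsub_cj_image intro!: fsub_cj)
    have kG: "k \<in> G" using fgB[OF g] k by blast
    \<comment> \<open>The join of C and its conjugate by k still permutes with all conjugates of B,
      and it lies in the product of C with one of them. So \<open>step\<close> transfers
      \<open>\<Phi>\<close> to it, and maximality of C forces D = C.\<close>
    define D where "D = gen G (C \<union> cj k ` C)"
    have kC: "fsub (cj k ` C)" "cj k ` C \<subseteq> G" using C kG G by (auto simp: fsub_cj_image intro!: fsub_cj)
    have D: "fsub D" "D \<subseteq> G" "C \<subseteq> D" "cj k ` C \<subseteq> D"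
      using fsub_gen[OF G, of "C \<union> cj k ` C"] gen_subset[OF G, of "C \<union> cj k ` C"] subset_gen[of "C \<union> cj k ` C" G] kC C
      unfolding D_def by auto
    have permD: "fsub (sprod D (cj x ` B))" if x: "x \<in> G" for x
      unfolding D_def
    proof (rule fsub_sprod_gen[OF G C(1,3) kC fgB[OF x] C(5)[OF x]])
      have "fsub (cj k ` sprod C (cj (gi k * x) ` B))" using C(5)[of "gi k * x"] kG x G by (simp add: fsub_cj_image fsub_mult)
      then show "fsub (sprod (cj k ` C) (cj x ` B))" by (simp only: cj_image_sprod cj_image_cj) (simp flip: mult.assoc)
    qed
    have "D \<subseteq> sprod C (cj g ` B)"
      unfolding D_def
    proof (rule gen_least[OF C(5)[OF g]])
      have k2: "k \<in> sprod C (cj g ` B)" using subset_sprod2[OF C(1)] k by blast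
      show "C \<union> cj k ` C \<subseteq> sprod C (cj g ` B)"
        using subset_sprod1[OF fgB(1)[OF g], of C] fsub_cj[OF C(5)[OF g] k2] by auto
      show "sprod C (cj g ` B) \<subseteq> G" using sprod_subset[OF G C(3) fgB(2)[OF g]] .
    qed
    then have "\<Phi> D" using step[OF C(1) D(1) D(3) D(2) C(4) g C(5)[OF g]] permD by blast
    then have "card D \<le> card C" using mx D C permD by blast
    then have "D = C" using D by (metis card_seteq fsub_finite)
    then show "cj k ` C = C" using D C by (metis card_cj_image card_subset_eq fsub_finite)
  qed
  then show ?thesis using C by blast
qed

section \<open>Transfer\<close>

lemma coprime_powers_one_complex:
  fixes z :: complex
  assumes "coprime a b" "z ^ a = 1" "z ^ b = 1" shows "z = 1"
proof (cases "a = 0")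
  case True then show ?thesis using assms by simp
next
  case False
  then obtain u v where "a * u = b * v + 1" using assms(1) bezout_nat[of a b] by (metis coprime_iff_gcd_eq_1)
  then have "(z ^ a) ^ u = (z ^ b) ^ v * z" by (simp flip: power_mult power_Suc2)
  then show ?thesis using assms by simp
qed

text \<open>V is the transfer from M to P followed by chi. For x in P, a cycle of length k of x on
  the cosets contributes chi of a conjugate of x^k, which by stability is chi(x)^k, and the lengths
  add up to the index of P.\<close>

lemma transfer_hom:
  fixes \<chi> :: "'a::grp \<Rightarrow> complex"
  assumes M: "fsub M" and P: "fsub P" "P \<subseteq> M"
    and hom: "\<And>x y. x \<in> P \<Longrightarrow> y \<in> P \<Longrightarrow> \<chi> (x * y) = \<chi> x * \<chi> y" and one: "\<chi> 1 = 1"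
    and stable: "\<And>x g. x \<in> P \<Longrightarrow> g \<in> M \<Longrightarrow> cj g x \<in> P \<Longrightarrow> \<chi> (cj g x) = \<chi> x"
    and n: "\<And>x. x \<in> P \<Longrightarrow> \<chi> x ^ n = 1"
  shows "\<exists>V. (\<forall>g\<in>M. \<forall>h\<in>M. V (g * h) = V g * V h) \<and> (\<forall>x\<in>P. V x = \<chi> x ^ (card M div card P)) \<and> (\<forall>g\<in>M. V g ^ n = (1::complex))"
proof -
  define W where "W = (\<lambda>x. (*) x ` P) ` M"
  define \<tau> where "\<tau> w = (SOME x. x \<in> M \<and> w = (*) x ` P)" for w
  have tau: "\<tau> w \<in> M" "w = (*) (\<tau> w) ` P" if "w \<in> W" for w
  proof -
    have "\<exists>x. x \<in> M \<and> w = (*) x ` P" using that by (auto simp: W_def)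
    from someI_ex[OF this] show "\<tau> w \<in> M" "w = (*) (\<tau> w) ` P" unfolding \<tau>_def by auto
  qed
  have finW: "finite W" using M by (simp add: W_def fsub_finite)
  have mulW: "(*) g ` w = (*) (g * \<tau> w) ` P" if "w \<in> W" for g w
  proof -
    have "(*) g ` w = (*) g ` (*) (\<tau> w) ` P" using tau(2)[OF that] by simp
    then show ?thesis by (simp add: image_image mult.assoc)
  qed
  have inW: "(*) g ` w \<in> W" if "g \<in> M" "w \<in> W" for g w
    unfolding mulW[OF that(2)] using that tau M by (auto simp: W_def fsub_mult)
  have comp: "(*) g ` (*) h ` w = (*) (g * h) ` w" for g h and w :: "'a set" by (simp add: image_image mult.assoc)
  \<comment> \<open>The element of P by which g times the representative of w differs from the
    representative of g w; \<open>a_mult\<close> is its cocycle rule.\<close>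
  define a where "a g w = gi (\<tau> ((*) g ` w)) * (g * \<tau> w)" for g w
  have aP: "a g w \<in> P" if "g \<in> M" "w \<in> W" for g w
    unfolding a_def using lcoset_eq_iff[OF P(1)] tau(2)[OF inW[OF that]] mulW[OF that(2), of g] by metis
  have a_mult: "a (g * h) w = a g ((*) h ` w) * a h w" for g h w
    by (simp add: a_def comp mult.assoc)
  define V where "V g = (\<Prod>w\<in>W. \<chi> (a g w))" for g
  have "V (g * h) = V g * V h" if g: "g \<in> M" and h: "h \<in> M" for g h
  proof -
    have "V (g * h) = (\<Prod>w\<in>W. \<chi> (a g ((*) h ` w)) * \<chi> (a h w))"
      unfolding V_def a_mult by (rule prod.cong) (simp_all add: hom aP inW g h)
    also have "\<dots> = (\<Prod>w\<in>W. \<chi> (a g ((*) h ` w))) * V h" by (simp add: prod.distrib V_def)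
    also have "(\<Prod>w\<in>W. \<chi> (a g ((*) h ` w))) = (\<Prod>w\<in>W. \<chi> (a g w))"
    proof (rule prod.reindex_bij_betw[of "(`) ((*) h)"])
      show "bij_betw ((`) ((*) h)) W W"
        by (rule bij_betw_byWitness[where f'="(`) ((*) (gi h))"]) (use inW h M in \<open>auto simp: comp\<close>)
    qed
    finally show ?thesis by (simp add: V_def)
  qed
  moreover have "V x = \<chi> x ^ (card M div card P)" if x: "x \<in> P" for x
  proof -
    have xM: "x \<in> M" using x P by blast
    have xjM: "x ^ j \<in> M" for j using xM M by (simp add: fsub_power)
    have chi_pow: "\<chi> (x ^ j) = \<chi> x ^ j" for j
      by (induction j) (simp_all add: one hom x fsub_power P)
    \<comment> \<open>Induction over sets of cosets invariant under x, removing one cycle of x at a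
      time.\<close>
    have "(\<Prod>w\<in>U. \<chi> (a x w)) = \<chi> x ^ card U" if "U \<subseteq> W" "\<And>w. w \<in> U \<Longrightarrow> (*) x ` w \<in> U" for U
      using finite_subset[OF that(1) finW] that
    proof (induction U rule: finite_psubset_induct)
      case (psubset U)
      show ?case
      proof (cases "U = {}")
        case False
        then obtain w where w: "w \<in> U" by blast
        then have wW: "w \<in> W" using psubset.prems by blast
        define k where "k = (LEAST k. k > 0 \<and> (*) (x ^ k) ` w = w)"
        have "card M > 0 \<and> (*) (x ^ card M) ` w = w" using fsub_power_card[OF M xM] fsub_card_pos[OF M] by simp
        then have k: "k > 0" "(*) (x ^ k) ` w = w" and mn: "\<And>j. j > 0 \<Longrightarrow> (*) (x ^ j) ` w = w \<Longrightarrow> k \<le> j"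
          using LeastI[of "\<lambda>k. k > 0 \<and> (*) (x ^ k) ` w = w"] Least_le[of "\<lambda>k. k > 0 \<and> (*) (x ^ k) ` w = w"]
          unfolding k_def by blast+
        let ?f = "\<lambda>j. (*) (x ^ j) ` w"
        have inj: "inj_on ?f {..<k}"
        proof (rule linorder_inj_onI')
          fix i j assume ij: "i \<in> {..<k}" "j \<in> {..<k}" "i < j"
          show "?f i \<noteq> ?f j"
          proof
            assume e: "?f i = ?f j"
            have "w = (*) (gi (x ^ i)) ` ?f i" by (simp add: comp)
            also have "\<dots> = (*) (gi (x ^ i) * x ^ j) ` w" unfolding e comp ..
            also have "x ^ j = x ^ i * x ^ (j - i)" using ij by (simp flip: power_add)
            finally have "k \<le> j - i" using mn[of "j - i"] ij by simp
            then show False using ij by auto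
          qed
        qed
        \<comment> \<open>By the cocycle rule the product along the cycle telescopes.\<close>
        have part: "(\<Prod>j<m. \<chi> (a x (?f j))) = \<chi> (a (x ^ m) w)" for m
        proof (induction m)
          case 0 then show ?case by (simp add: a_def one)
        next
          case (Suc m)
          have "a (x ^ Suc m) w = a x (?f m) * a (x ^ m) w" using a_mult[of x "x ^ m" w] by simp
          then show ?case using Suc by (simp add: hom aP inW xM xjM wW mult.commute)
        qed
        define O' where "O' = ?f ` {..<k}"
        have fU: "?f j \<in> U" for j by (induction j) (use w psubset.prems(2) comp in \<open>auto simp flip: comp\<close>)
        then have OU: "O' \<subseteq> U" by (auto simp: O'_def)
        \<comment> \<open>x^k returns w to itself, so the value is a conjugate of x^k inside P, to
          which \<open>stable\<close> applies.\<close>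
        have "a (x ^ k) w = cj (gi (\<tau> w)) (x ^ k)" by (simp add: a_def k(2) cj_def mult.assoc)
        then have "\<chi> (a (x ^ k) w) = \<chi> x ^ k"
          using stable[of "x ^ k" "gi (\<tau> w)"] aP[OF xjM wW, of k] tau(1)[OF wW] M P x by (simp add: fsub_power chi_pow)
        then have prodO: "(\<Prod>v\<in>O'. \<chi> (a x v)) = \<chi> x ^ k" using part[of k] by (simp add: O'_def prod.reindex[OF inj])
        have cO: "card O' = k" by (simp add: O'_def card_image[OF inj])
        have "O' \<noteq> {}" using k by (auto simp: O'_def)
        have inv: "(*) x ` v \<in> U - O'" if v: "v \<in> U - O'" for v
        proof -
          have "v \<in> O'" if vO: "(*) x ` v \<in> O'"
          proof -
            obtain j where j: "j < k" "(*) x ` v = ?f j" using vO by (auto simp: O'_def)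
            have v': "v = (*) (gi x) ` ?f j" unfolding j(2)[symmetric] by (simp add: comp)
            show ?thesis
            proof (cases j)
              case 0
              have "v = (*) (gi x) ` ?f k" using v' 0 k(2) by simp
              also have "\<dots> = ?f (k - 1)" using k(1) by (cases k) (simp_all add: comp)
              finally show ?thesis using k(1) by (auto simp: O'_def)
            next
              case (Suc i)
              then have "v = ?f i" using v' by (simp add: comp)
              then show ?thesis using j Suc by (auto simp: O'_def)
            qed
          qed
          then show ?thesis using v psubset.prems(2) by blast
        qed
        have "U - O' \<subset> U" using OU \<open>O' \<noteq> {}\<close> by blast
        moreover have "U - O' \<subseteq> W" using psubset.prems by blast
        ultimately have "(\<Prod>v\<in>U - O'. \<chi> (a x v)) = \<chi> x ^ card (U - O')" using psubset.IH inv by blast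
        moreover have "(\<Prod>v\<in>U. \<chi> (a x v)) = (\<Prod>v\<in>U - O'. \<chi> (a x v)) * (\<Prod>v\<in>O'. \<chi> (a x v))"
          using prod.subset_diff[OF OU psubset.hyps] by simp
        moreover have "card U = card (U - O') + k"
          using OU psubset.hyps cO by (metis card_Diff_subset card_mono finite_subset le_add_diff_inverse2)
        ultimately show ?thesis by (simp add: prodO power_add)
      qed simp
    qed
    from this[of W] have "V x = \<chi> x ^ card W" using inW xM by (simp add: V_def)
    moreover have "card W = card M div card P"
      using card_lcosets[OF M P] fsub_card_pos[OF P(1)] by (metis W_def nonzero_mult_div_cancel_right less_not_refl)
    ultimately show ?thesis by simp
  qed
  moreover have "V g ^ n = 1" if "g \<in> M" for g
    unfolding V_def prod_power_distrib by (rule prod.neutral) (simp add: n aP that)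
  ultimately show ?thesis by blast
qed

text \<open>Take N maximal among the normal subgroups of T properly inside P. The t-group T fixes a
  nontrivial element of P/N; a suitable power y of a representative has order t modulo N and
  generates with N a normal subgroup of T, which by maximality is P. The character sends y^i N to
  zeta^i.\<close>

lemma prime_quotient_character:
  assumes t: "prime t" and T: "pgroup t T" and P: "normal_in P T" "P \<noteq> {1}"
  shows "\<exists>\<chi> :: 'a::grp \<Rightarrow> complex. (\<forall>x\<in>P. \<forall>y\<in>P. \<chi> (x * y) = \<chi> x * \<chi> y) \<and> \<chi> 1 = 1 \<and> (\<forall>x\<in>P. \<chi> x ^ t = 1) \<and>
    (\<forall>x\<in>P. \<forall>h\<in>T. \<chi> (cj h x) = \<chi> x) \<and> (\<exists>y\<in>P. \<chi> y \<noteq> 1)"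
proof -
  have fT: "fsub T" and fP: "fsub P" "P \<subseteq> T" using T P by (auto simp: pgroup_fsub normal_in_def)
  have "{1} \<subset> P" using P(2) fP fsub_one by blast
  then have "{N. normal_in N T \<and> N \<subset> P} \<noteq> {}" using normal_in_triv[OF fT] by blast
  from ex_max_card[OF finite_normal_in[OF fT] this, of "\<lambda>x. x"]
  obtain N where N: "normal_in N T" "N \<subset> P" and mx: "\<And>L. normal_in L T \<Longrightarrow> L \<subset> P \<Longrightarrow> card L \<le> card N" by blast
  have fN: "fsub N" using N by (simp add: normal_in_fsub)
  have cjN: "cj h n \<in> N" if "h \<in> T" "n \<in> N" for h n using normal_in_cj[OF N(1) that] .
  have cjN': "gi w * (n * w) \<in> N" if "w \<in> P" "n \<in> N" for w n
    using cjN[of "gi w" n] that fP fT by (auto simp: cj_def mult.assoc)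
  define W where "W = (\<lambda>x. (*) x ` N) ` P"
  have cjW: "cj h ` (*) x ` N = (*) (cj h x) ` N" if "h \<in> T" for h x
  proof -
    have "cj h ` (*) x ` N = (*) (cj h x) ` (cj h ` N)" by (simp add: image_image cj_mult)
    then show ?thesis using normal_in_cj_image[OF fT N(1) that] by simp
  qed
  have act: "acts T W (\<lambda>h. (`) (cj h))"
    unfolding acts_def W_def using cjW normal_in_cj[OF P(1)] by (auto simp: cj_image_cj)
  have finW: "finite W" using fP by (simp add: W_def fsub_finite)
  obtain k where k: "card T = t ^ k" using T by (auto simp: pgroup_def)
  obtain i where i: "card P = t ^ i" using pgroup_subset[OF t T fP] by (auto simp: pgroup_def)
  have cW: "card W * card N = card P" using card_lcosets[OF fP(1) fN] N by (auto simp: W_def)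
  then obtain j where j: "card W = t ^ j" using i t divides_primepow_nat by (metis dvd_triv_left)
  have "card N < card P" using psubset_card_mono[OF fsub_finite[OF fP(1)] N(2)] .
  then have "j > 0" using cW j by (cases j) auto
  let ?F = "{w\<in>W. \<forall>h\<in>T. cj h ` w = w}"
  have "t dvd card W" using j \<open>j > 0\<close> by simp
  then have "t dvd card ?F" using acts_fixed_points[OF t fT k act finW] by (simp add: dvd_eq_mod_eq_0)
  moreover have NF: "N \<in> ?F"
  proof -
    have "(*) 1 ` N \<in> W" unfolding W_def using fP by (intro imageI) simp
    then show ?thesis using normal_in_cj_image[OF fT N(1)] by simp
  qed
  moreover have "finite ?F" using finW by simp
  ultimately have "?F \<noteq> {N}" using t by (metis card_1_singleton_iff One_nat_def not_prime_unit)
  then obtain w where w: "w \<in> W" "w \<noteq> N" "\<forall>h\<in>T. cj h ` w = w" using NF by auto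
  then obtain x where x: "x \<in> P" "w = (*) x ` N" by (auto simp: W_def)
  \<comment> \<open>The preimage of the T-fixed points of P/N.\<close>
  define D where "D = {z \<in> P. \<forall>h\<in>T. gi z * cj h z \<in> N}"
  have "x \<in> D"
  proof -
    have "(*) x ` N = (*) (cj h x) ` N" if "h \<in> T" for h using w(3) cjW[OF that, of x] x(2) that by auto
    then have "gi x * cj h x \<in> N" if "h \<in> T" for h using lcoset_eq_iff[OF fN] that by blast
    then show ?thesis using x(1) by (simp add: D_def)
  qed
  have xN: "x \<notin> N"
  proof
    assume "x \<in> N"
    then have "(*) x ` N = (*) 1 ` N" using lcoset_eq_iff[OF fN, of 1 x] by simp
    then show False using w x by simp
  qed
  have Dmult: "z * v \<in> D" if "z \<in> D" "v \<in> D" for z v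
  proof -
    have "gi (z * v) * cj h (z * v) \<in> N" if h: "h \<in> T" for h
    proof -
      have "gi (z * v) * cj h (z * v) = (gi v * ((gi z * cj h z) * v)) * (gi v * cj h v)" by (simp add: cj_mult mult.assoc)
      moreover have "gi v * ((gi z * cj h z) * v) \<in> N" using cjN' \<open>z \<in> D\<close> \<open>v \<in> D\<close> h by (simp add: D_def)
      ultimately show ?thesis using fN \<open>v \<in> D\<close> h by (simp add: D_def fsub_mult)
    qed
    then show ?thesis using that fP by (simp add: D_def fsub_mult)
  qed
  have "1 \<in> D" using fP fN by (simp add: D_def)
  have fD: "fsub D" by (rule fsub_mult_closed) (use fP Dmult \<open>1 \<in> D\<close> in \<open>auto simp: fsub_finite D_def\<close>)
  obtain m where m: "x ^ (t ^ m) = 1"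
    using pgroup_p_elt[OF T, of x] x fP by (auto simp: p_elt_def)
  define l where "l = (LEAST l. x ^ (t ^ l) \<in> N)"
  have l: "x ^ (t ^ l) \<in> N" unfolding l_def by (rule LeastI[of _ m]) (simp add: m fN)
  have "l \<noteq> 0" using l xN by (metis power_0 power_one_right)
  \<comment> \<open>The last iterated t-th power of x outside N, so that y has order t modulo
    N.\<close>
  define y where "y = x ^ (t ^ (l - 1))"
  have yN: "y \<notin> N" unfolding y_def using not_less_Least[of "l - 1" "\<lambda>l. x ^ (t ^ l) \<in> N"] \<open>l \<noteq> 0\<close> by (auto simp: l_def)
  have yt: "y ^ t \<in> N" using l \<open>l \<noteq> 0\<close> by (cases l) (simp_all add: y_def mult.commute flip: power_mult)
  have yD: "y \<in> D" unfolding y_def using fsub_power[OF fD \<open>x \<in> D\<close>] .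
  have yP: "y \<in> P" using yD by (simp add: D_def)
  define Q where "Q = {z \<in> P. \<exists>i. gi (y ^ i) * z \<in> N}"
  have prodN: "gi (y ^ (i + j)) * (z * v) \<in> N" if "gi (y ^ i) * z \<in> N" "gi (y ^ j) * v \<in> N" for i j z v
  proof -
    have "gi (y ^ (i + j)) * (z * v) = (gi (y ^ j) * ((gi (y ^ i) * z) * y ^ j)) * (gi (y ^ j) * v)" by (simp add: power_add mult.assoc)
    moreover have "gi (y ^ j) * ((gi (y ^ i) * z) * y ^ j) \<in> N" using cjN'[OF _ that(1), of "y ^ j"] yP fP by (simp add: fsub_power)
    ultimately show ?thesis using that(2) fN by (simp add: fsub_mult)
  qed
  have "N \<subseteq> D" using N cjN fN by (auto simp: D_def fsub_mult)
  have QD: "Q \<subseteq> D"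
  proof
    fix z assume "z \<in> Q"
    then obtain i where "gi (y ^ i) * z \<in> N" by (auto simp: Q_def)
    then have "gi (y ^ i) * z \<in> D" using \<open>N \<subseteq> D\<close> by blast
    from fsub_mult[OF fD fsub_power[OF fD yD] this] have "y ^ i * (gi (y ^ i) * z) \<in> D" .
    then show "z \<in> D" by simp
  qed
  have cjQ: "gi (y ^ i) * cj h z \<in> N" if "gi (y ^ i) * z \<in> N" "z \<in> D" "h \<in> T" for i z h
  proof -
    have "gi (y ^ i) * cj h z = (gi (y ^ i) * z) * (gi z * cj h z)" by (simp add: mult.assoc)
    then show ?thesis using that fN by (simp add: D_def fsub_mult)
  qed
  have "fsub Q"
  proof (rule fsub_mult_closed)
    show "finite Q" using fP by (simp add: Q_def fsub_finite)
    show "1 \<in> Q" using fP fN by (auto simp: Q_def intro!: exI[of _ 0])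
    show "z * v \<in> Q" if "z \<in> Q" "v \<in> Q" for z v using that prodN fP by (auto simp: Q_def fsub_mult) blast
  qed
  then have "normal_in Q T"
  proof (rule normal_inI)
    show "Q \<subseteq> T" using fP by (auto simp: Q_def)
    fix h z assume h: "h \<in> T" and z: "z \<in> Q"
    then obtain i where "gi (y ^ i) * z \<in> N" by (auto simp: Q_def)
    then have "gi (y ^ i) * cj h z \<in> N" using cjQ h z QD by blast
    then show "cj h z \<in> Q" using h z normal_in_cj[OF P(1)] by (auto simp: Q_def)
  qed
  moreover have "N \<subset> Q"
  proof -
    have "N \<subseteq> Q" using N by (auto simp: Q_def intro!: exI[of _ 0])
    moreover have "y \<in> Q" using yP fN by (auto simp: Q_def intro!: exI[of _ 1])
    ultimately show ?thesis using yN by blast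
  qed
  then have "card N < card Q" using psubset_card_mono[OF fsub_finite[OF \<open>fsub Q\<close>]] by blast
  ultimately have PQ: "Q = P" using mx[of Q] by (fastforce simp: Q_def)
  obtain \<zeta> :: complex where z: "\<zeta> ^ t = 1" "\<zeta> \<noteq> 1"
  proof -
    have "card {z::complex. z ^ t = 1} = t" using t by (intro card_roots_unity_eq) (simp add: prime_gt_0_nat)
    then have "{z::complex. z ^ t = 1} \<noteq> {1}" using t by (metis card_1_singleton_iff One_nat_def not_prime_1)
    then show ?thesis using that by auto
  qed
  \<comment> \<open>Exponents of y for the same coset agree modulo t, and zeta^t = 1, so the choice
    in the definition of the character is immaterial.\<close>
  have uniq: "\<zeta> ^ i = \<zeta> ^ j" if ij: "gi (y ^ i) * v \<in> N" "gi (y ^ j) * v \<in> N" for i j v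
  proof -
    have *: "\<zeta> ^ i = \<zeta> ^ j" if le: "i \<le> j" and 1: "gi (y ^ i) * v \<in> N" and 2: "gi (y ^ j) * v \<in> N" for i j
    proof -
      have "(gi (y ^ i) * v) * gi (gi (y ^ j) * v) = gi (y ^ i) * y ^ j" by (simp add: mult.assoc)
      moreover have "y ^ j = y ^ i * y ^ (j - i)" using le by (simp flip: power_add)
      ultimately have "y ^ (j - i) \<in> N" using 1 2 fN by (metis fsub_gi fsub_mult gi_left_cancel)
      have "t dvd (j - i)"
      proof (rule ccontr)
        assume "\<not> t dvd (j - i)"
        then have c: "coprime (j - i) t" using t by (metis coprime_commute prime_imp_coprime)
        then have "j - i \<noteq> 0" using \<open>\<not> t dvd (j - i)\<close> by auto
        then obtain u v where "(j - i) * u = t * v + 1" using c bezout_nat[of "j - i" t] by (metis coprime_iff_gcd_eq_1)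
        then have "(y ^ (j - i)) ^ u = (y ^ t) ^ v * y" by (simp flip: power_mult power_Suc2)
        then have "y = gi ((y ^ t) ^ v) * (y ^ (j - i)) ^ u" by simp
        then show False using yN yt \<open>y ^ (j - i) \<in> N\<close> fN by (metis fsub_power fsub_mult fsub_gi)
      qed
      then obtain u where "j = i + t * u" using le by (metis dvdE le_add_diff_inverse)
      then show ?thesis by (simp add: power_add power_mult z)
    qed
    show ?thesis
    proof (cases "i \<le> j")
      case True show ?thesis by (rule *[OF True ij])
    next
      case False
      then have "j \<le> i" by simp
      from *[OF this ij(2,1)] show ?thesis by (rule sym)
    qed
  qed
  define \<chi> where "\<chi> v = \<zeta> ^ (SOME i. gi (y ^ i) * v \<in> N)" for v
  have chi: "\<chi> v = \<zeta> ^ i" if "gi (y ^ i) * v \<in> N" for v i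
    unfolding \<chi>_def by (rule uniq[OF someI[of "\<lambda>i. gi (y ^ i) * v \<in> N", OF that] that])
  have ex: "\<exists>i. gi (y ^ i) * v \<in> N" if "v \<in> P" for v using that PQ by (auto simp: Q_def)
  have "\<chi> (u * v) = \<chi> u * \<chi> v" if uv: "u \<in> P" "v \<in> P" for u v
  proof -
    obtain i j where ij: "gi (y ^ i) * u \<in> N" "gi (y ^ j) * v \<in> N" using ex uv by blast
    show ?thesis using chi[OF ij(1)] chi[OF ij(2)] chi[OF prodN[OF ij]] by (simp add: power_add)
  qed
  moreover have "\<chi> 1 = 1" using chi[of 0 1] fN by simp
  moreover have "\<chi> u ^ t = 1" for u
    unfolding \<chi>_def power_mult[symmetric] mult.commute[of _ t] by (simp only: power_mult z power_one)
  moreover have "\<chi> (cj h u) = \<chi> u" if uh: "u \<in> P" "h \<in> T" for u h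
  proof -
    obtain i where i: "gi (y ^ i) * u \<in> N" using ex[OF uh(1)] by blast
    have "u \<in> D" using uh PQ QD by blast
    then show ?thesis using chi[OF i] chi[OF cjQ[OF i _ uh(2)]] by simp
  qed
  moreover have "\<chi> y \<noteq> 1" using chi[of 1 y] fN z by simp
  ultimately show ?thesis using yP by blast
qed

text \<open>A nontrivial P would carry a T-invariant character of exponent t. By
  \<open>fusion\<close> it is stable in M and can be transferred. The transfer kills the generators,
  whose orders are prime to t, so it is trivial; but on P it is a power of the character with
  exponent prime to t.\<close>

lemma transfer_trivial:
  assumes t: "prime t" and M: "fsub M" and P: "syl t M P" and T: "pgroup t T" "normal_in P T"
    and gens: "M \<subseteq> gen M {x \<in> M. \<exists>q. prime q \<and> q \<noteq> t \<and> p_elt q x}"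
    and fusion: "\<And>x g. x \<in> P \<Longrightarrow> g \<in> M \<Longrightarrow> cj g x \<in> P \<Longrightarrow> \<exists>h\<in>T. cj g x = cj h x"
  shows "P = {1}"
proof (rule ccontr)
  assume "P \<noteq> {1}"
  from prime_quotient_character[OF t T this]
  obtain \<chi> :: "'a \<Rightarrow> complex" and y where chi: "\<And>x y. x \<in> P \<Longrightarrow> y \<in> P \<Longrightarrow> \<chi> (x * y) = \<chi> x * \<chi> y" "\<chi> 1 = 1"
    "\<And>x. x \<in> P \<Longrightarrow> \<chi> x ^ t = 1" "\<And>x h. x \<in> P \<Longrightarrow> h \<in> T \<Longrightarrow> \<chi> (cj h x) = \<chi> x" and y: "y \<in> P" "\<chi> y \<noteq> 1" by blast
  have st: "\<chi> (cj g x) = \<chi> x" if "x \<in> P" "g \<in> M" "cj g x \<in> P" for x g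
    using fusion[OF that] chi(4)[OF that(1)] by auto
  have fP: "fsub P" "P \<subseteq> M" using P by (auto simp: syl_def)
  from transfer_hom[of M P \<chi> t, OF M fP chi(1,2) st chi(3)]
  obtain V where V: "\<And>g h. g \<in> M \<Longrightarrow> h \<in> M \<Longrightarrow> V (g * h) = V g * V h"
     "\<And>x. x \<in> P \<Longrightarrow> V x = \<chi> x ^ (card M div card P)" "\<And>g. g \<in> M \<Longrightarrow> V g ^ t = (1::complex)" by blast
  have V1: "V 1 = 1" using V(2)[of 1] fP chi(2) by simp
  have Vpow: "V (g ^ n) = V g ^ n" if "g \<in> M" for g n
    by (induction n) (simp_all add: V1 V(1) that fsub_power M)
  let ?K = "{g \<in> M. V g = 1}"
  have "fsub ?K" by (rule fsub_mult_closed) (use M V1 V(1) in \<open>auto simp: fsub_finite fsub_mult\<close>)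
  moreover have "{x \<in> M. \<exists>q. prime q \<and> q \<noteq> t \<and> p_elt q x} \<subseteq> ?K"
  proof safe
    fix x q assume x: "x \<in> M" "prime q" "q \<noteq> t" "p_elt q x"
    then obtain k where "x ^ (q ^ k) = 1" by (auto simp: p_elt_def)
    then have "V x ^ (q ^ k) = 1" using Vpow[OF x(1)] V1 by metis
    moreover have "coprime (q ^ k) t" using primes_coprime[OF x(2) t x(3)] by simp
    ultimately show "V x = 1" using coprime_powers_one_complex V(3)[OF x(1)] by blast
  qed
  ultimately have "gen M {x \<in> M. \<exists>q. prime q \<and> q \<noteq> t \<and> p_elt q x} \<subseteq> ?K" by (intro gen_least) auto
  then have "V y = 1" using gens y fP by blast
  then have "\<chi> y ^ (card M div card P) = 1" using V(2) y by simp
  moreover have "coprime (card M div card P) t"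
  proof -
    have d: "card M = card P * (card M div card P)" using lagrange_dvd[OF M fP] by simp
    have "\<not> t dvd card M div card P"
    proof
      assume "t dvd card M div card P"
      then have "t ^ Suc (multiplicity t (card M)) dvd card M"
        using d P unfolding syl_def by (metis dvd_refl mult_dvd_mono power_Suc2)
      then show False using fsub_card_pos[OF M] t
        by (metis multiplicity_geI not_less_eq_eq order_refl not_prime_unit less_not_refl)
    qed
    then show ?thesis using t by (metis coprime_commute prime_imp_coprime)
  qed
  ultimately show False using coprime_powers_one_complex chi(3)[OF y(1)] y(2) by blast
qed

section \<open>Products of nilpotent groups of coprime orders\<close>

lemma cj_image_sub: "fsub G \<Longrightarrow> S \<subseteq> G \<Longrightarrow> x \<in> G \<Longrightarrow> cj x ` S \<subseteq> G"
  by (intro image_subsetI fsub_cj) auto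

lemma p_part_cj_image: "p_part p (cj g ` X) = cj g ` p_part p X"
  by (auto simp: p_part_def)

text \<open>A Sylow q-subgroup of L meets the normal subgroup C in a Sylow subgroup of C, which by
  \<open>m\<close> is just as large.\<close>

lemma normal_contains_p_elt:
  assumes q: "prime q" and L: "fsub L" and C: "normal_in C L" and m: "multiplicity q (card L) = multiplicity q (card C)"
    and y: "y \<in> L" "p_elt q y"
  shows "y \<in> C"
proof -
  obtain Q where Q: "syl q L Q" "y \<in> Q" using p_elt_in_syl[OF q L y] by blast
  have "syl q C (C \<inter> Q)" using syl_normal_Int[OF q L C Q(1)] .
  then have "card (C \<inter> Q) = card Q" using Q m by (simp add: syl_def)
  then have "C \<inter> Q = Q" using Q by (simp add: card_subset_eq fsub_finite syl_fsub)
  then show ?thesis using Q by blast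
qed

text \<open>A nilpotent group is the product of its Sylow r-subgroup and the centraliser of that
  subgroup, and the latter acts trivially on it.\<close>

lemma nilp_part_action:
  assumes N: "nilp N" and r: "prime r" and h: "h \<in> N"
  shows "\<exists>k\<in>p_part r N. \<forall>x\<in>p_part r N. cj h x = cj k x"
proof -
  let ?P = "p_part r N" and ?C = "centraliser N (p_part r N)"
  have fN: "fsub N" using N by (rule nilp_fsub)
  have P: "syl r N ?P" "normal_in ?P N" using nilp_syl[OF N r] .
  have fC: "fsub ?C" "?C \<subseteq> N" using fsub_centraliser[OF fN] centraliser_subset by blast+
  have "sprod ?C ?P = N"
  proof (rule eq_if_all_syl[OF fN sprod_normal_fsub[OF P(2) fC] sprod_subset[OF fN fC(2) p_part_subset]])
    fix q :: nat assume q: "prime q"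
    show "\<exists>Q. syl q N Q \<and> Q \<subseteq> sprod ?C ?P"
    proof (cases "q = r")
      case True then show ?thesis using P(1) subset_sprod2[OF fC(1)] by blast
    next
      case False
      have "p_part q N \<subseteq> ?C" using nilp_commute[OF N q r False] by (auto simp: p_part_def centraliser_def)
      then show ?thesis using nilp_syl(1)[OF N q] subset_sprod1[OF syl_fsub[OF P(1)], of ?C] by blast
    qed
  qed
  then have "h \<in> sprod ?P ?C" using h sprod_normal_commute[OF P(2) fC] by simp
  then obtain k c where kc: "k \<in> ?P" "c \<in> ?C" "h = k * c" by (auto elim: sprodE)
  have "cj h x = cj k x" if "x \<in> ?P" for x
  proof -
    have "cj c x = x" using kc(2) that by (simp add: centraliser_def cj_eq_self_iff)
    then show ?thesis using kc(3) by (simp flip: cj_cj)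
  qed
  then show ?thesis using kc(1) by blast
qed

lemma nilp_central_elt:
  assumes "nilp X" "prime p" "p dvd card X"
  shows "\<exists>z\<in>p_part p X. z \<noteq> 1 \<and> (\<forall>x\<in>X. z * x = x * z)"
  using nilp_central[OF assms(1,2) normal_in_self[OF nilp_fsub[OF assms(1)]] assms(3)] by (auto simp: p_part_def)

text \<open>The configuration to be refuted. In its application \<open>fact_slv\<close> is the
  induction hypothesis for proper factorised subgroups, while \<open>twoA\<close> and
  \<open>twoB\<close>, with r arbitrary, say that neither order is a prime power, which is what
  Burnside's theorem provides. In the comments below, A_r and B_q denote the Sylow subgroups of the
  factors.\<close>

locale coprime_nilp_product =
  fixes G A B :: "'a::grp set"
  assumes fG: "fsub G" and nA: "nilp A" and AG: "A \<subseteq> G" and nB: "nilp B" and BG: "B \<subseteq> G"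
    and GAB: "sprod A B = G" and cop: "coprime (card A) (card B)"
    and simple: "normal_in N G \<Longrightarrow> N = {1} \<or> N = G"
    and fact_slv: "fsub X \<Longrightarrow> X \<subseteq> G \<Longrightarrow> X \<noteq> G \<Longrightarrow> X \<subseteq> sprod (X \<inter> A) (X \<inter> B) \<Longrightarrow> slv X"
    and twoA: "\<exists>t. prime t \<and> t \<noteq> r \<and> t dvd card A" and twoB: "\<exists>t. prime t \<and> t \<noteq> r \<and> t dvd card B"
begin

lemma fA: "fsub A" using nA by (rule nilp_fsub)
lemma fB: "fsub B" using nB by (rule nilp_fsub)

text \<open>The assumptions are symmetric; interpreting the locale with the factors exchanged makes
  every result available for B.\<close>

lemma swap: "coprime_nilp_product G B A"
proof
  show GBA: "sprod B A = G" using sprod_commute[OF fA fB] GAB fG by simp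
  show "slv X" if X: "fsub X" "X \<subseteq> G" "X \<noteq> G" "X \<subseteq> sprod (X \<inter> B) (X \<inter> A)" for X
  proof (rule fact_slv[OF X(1-3)])
    have "sprod (X \<inter> B) (X \<inter> A) \<subseteq> X" by (rule sprod_subset[OF X(1)]) auto
    then have "sprod (X \<inter> B) (X \<inter> A) = X" using X(4) by blast
    then show "X \<subseteq> sprod (X \<inter> A) (X \<inter> B)"
      using sprod_commute[of "X \<inter> B" "X \<inter> A"] X(1) fA fB by (simp add: fsub_Int)
  qed
  show "coprime (card B) (card A)" using cop by (simp add: coprime_commute)
qed (use fG nA AG nB BG simple twoA twoB in auto)

lemma AB_triv: "A \<inter> B = {1}"
proof -
  have f: "fsub (A \<inter> B)" using fA fB by (rule fsub_Int)
  have "card (A \<inter> B) dvd card A" "card (A \<inter> B) dvd card B"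
    using lagrange_dvd[OF fA f] lagrange_dvd[OF fB f] by auto
  then have "card (A \<inter> B) = 1" using cop by (metis coprime_common_divisor_nat nat_dvd_1_iff_1 coprime_def)
  then show ?thesis using fsub_card1[OF f] by simp
qed

lemma cardG: "card G = card A * card B"
  using card_sprod[OF fA fB] GAB AB_triv by simp

lemma not_both: "prime p \<Longrightarrow> p dvd card A \<Longrightarrow> \<not> p dvd card B"
  using cop by (metis coprime_common_divisor not_prime_unit)

lemma not_both': "prime p \<Longrightarrow> p dvd card B \<Longrightarrow> \<not> p dvd card A"
  using not_both by blast

lemma dvd_cardG: "prime p \<Longrightarrow> p dvd card G \<Longrightarrow> p dvd card A \<or> p dvd card B"
  by (simp add: cardG prime_dvd_mult_iff)

lemma mult_cardG: "prime p \<Longrightarrow> p dvd card A \<Longrightarrow> multiplicity p (card G) = multiplicity p (card A)"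
  using not_both[of p] fsub_card_pos[OF fA] fsub_card_pos[OF fB]
  by (simp add: cardG prime_elem_multiplicity_mult_distrib not_dvd_imp_multiplicity_0)

lemma sylA: "prime p \<Longrightarrow> p dvd card A \<Longrightarrow> syl p G (p_part p A)"
  using nilp_syl(1)[OF nA, of p] AG mult_cardG by (auto simp: syl_def)

lemma partA_nontriv: "prime p \<Longrightarrow> p dvd card A \<Longrightarrow> p_part p A \<noteq> {1}"
  using p_part_triv_iff[OF _ fA] by blast

lemma partA: "prime p \<Longrightarrow> fsub (p_part p A)" "p_part p A \<subseteq> A" "p_part p A \<subseteq> G" "prime p \<Longrightarrow> pgroup p (p_part p A)"
  using nilp_p_part_pgroup[OF nA, of p] AG p_part_subset[of p A] by (auto simp: pgroup_fsub)

lemma A_ne_G: "A \<noteq> G"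
proof
  assume "A = G"
  obtain t where "prime t" "t dvd card B" using twoB by blast
  moreover have "card B = 1" using cardG \<open>A = G\<close> fsub_card_pos[OF fG] by simp
  ultimately show False by auto
qed

text \<open>An element of A normalises each Sylow subgroup of A, and likewise for B, so the common
  element of \<open>conjugate_pair\<close> serves all primes at once.\<close>

lemma pair:
  assumes "g \<in> G" "h \<in> G"
  shows "\<exists>k\<in>G. (\<forall>r. prime r \<longrightarrow> cj g ` p_part r A = cj k ` p_part r A) \<and> (\<forall>r. prime r \<longrightarrow> cj h ` p_part r B = cj k ` p_part r B)"
proof -
  obtain a b where ab: "a \<in> A" "b \<in> B" "g * a = h * b" using conjugate_pair[OF fG fA AG fB BG GAB assms] by blast
  have "cj a ` p_part r A = p_part r A" if "prime r" for r
    using normal_in_cj_image[OF fA nilp_syl(2)[OF nA that] ab(1)] .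
  then have 1: "cj g ` p_part r A = cj (g * a) ` p_part r A" if "prime r" for r using that by (simp flip: cj_image_cj)
  have "cj b ` p_part r B = p_part r B" if "prime r" for r
    using normal_in_cj_image[OF fB nilp_syl(2)[OF nB that] ab(2)] .
  then have 2: "cj h ` p_part r B = cj (h * b) ` p_part r B" if "prime r" for r using that by (simp flip: cj_image_cj)
  have "g * a \<in> G" using ab(1) AG fG assms by (auto intro: fsub_mult)
  then show ?thesis using 1 2 ab(3) by auto
qed

text \<open>Dedekind's modular law.\<close>

lemma over_fact: "fsub H \<Longrightarrow> A \<subseteq> H \<Longrightarrow> H \<subseteq> G \<Longrightarrow> sprod A (H \<inter> B) = H"
proof
  assume H: "fsub H" "A \<subseteq> H" "H \<subseteq> G"
  show "sprod A (H \<inter> B) \<subseteq> H" by (rule sprod_subset) (use H in auto)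
  show "H \<subseteq> sprod A (H \<inter> B)"
  proof
    fix x assume x: "x \<in> H"
    then have "x \<in> sprod A B" using GAB H by blast
    then obtain a b where ab: "a \<in> A" "b \<in> B" "x = a * b" by (auto elim: sprodE)
    then have "b \<in> H" using x H fsub_mult_left_iff by blast
    then show "x \<in> sprod A (H \<inter> B)" using ab by (simp add: sprodI)
  qed
qed

lemma over_slv:
  assumes "fsub H" "A \<subseteq> H" "H \<subseteq> G" "H \<noteq> G" shows "slv H"
proof (rule fact_slv[OF assms(1,3,4)])
  show "H \<subseteq> sprod (H \<inter> A) (H \<inter> B)" using over_fact[OF assms(1-3)] assms(2) by (simp add: Int_absorb1)
qed

text \<open>q does not divide the order of the factor in A, so the whole q-part of X comes from the
  factor in B.\<close>

lemma fact_syl: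
  assumes X: "fsub X" "X \<subseteq> G" "X \<subseteq> sprod (X \<inter> A) (X \<inter> B)" and q: "prime q" "q dvd card B"
  shows "syl q X (X \<inter> p_part q B)"
proof -
  have fXA: "fsub (X \<inter> A)" and fXB: "fsub (X \<inter> B)" using X fA fB by (auto simp: fsub_Int)
  have "sprod (X \<inter> A) (X \<inter> B) \<subseteq> X" by (rule sprod_subset[OF X(1)]) auto
  then have eq: "sprod (X \<inter> A) (X \<inter> B) = X" using X by blast
  have "\<not> q dvd card (X \<inter> A)" using not_both'[OF q] lagrange_dvd[OF fA fXA] dvd_trans by blast
  then have "multiplicity q (card (X \<inter> A)) = 0" by (rule not_dvd_imp_multiplicity_0)
  moreover have "X \<inter> A \<inter> (X \<inter> B) = {1}" using AB_triv X(1) by auto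
  ultimately have "multiplicity q (card X) = multiplicity q (card (X \<inter> B))"
    using multiplicity_sprod[OF q(1) fXA fXB] eq by simp
  moreover have "syl q (X \<inter> B) (p_part q (X \<inter> B))" using nilp_syl(1)[OF nilp_subset[OF nB fXB] q(1)] by blast
  moreover have "p_part q (X \<inter> B) = X \<inter> p_part q B" by (auto simp: p_part_def)
  ultimately show ?thesis by (auto simp: syl_def)
qed

lemma over_syl:
  assumes "fsub H" "A \<subseteq> H" "H \<subseteq> G" and q: "prime q" "q dvd card B"
  shows "syl q H (H \<inter> p_part q B)"
  by (rule fact_syl[OF assms(1,3) _ q]) (use over_fact[OF assms(1-3)] assms(2) in \<open>simp add: Int_absorb1\<close>)

lemma centre_triv:
  assumes "z \<in> G" "\<And>x. x \<in> G \<Longrightarrow> z * x = x * z" shows "z = 1"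
proof (rule ccontr)
  assume "z \<noteq> 1"
  have "cj x ` G = G" if "x \<in> G" for x using cj_image_self[OF fG that] .
  then have "normal_in (centraliser G G) G" by (intro normal_centraliser[OF fG]) auto
  moreover have "z \<in> centraliser G G" using assms by (simp add: centraliser_def)
  ultimately have "centraliser G G = G" using simple \<open>z \<noteq> 1\<close> by blast
  then have ab: "x * y = y * x" if "x \<in> G" "y \<in> G" for x y using that unfolding centraliser_def by blast
  have "normal_in A G"
  proof (rule normal_inI[OF fA AG])
    fix x n assume "x \<in> G" "n \<in> A"
    then have "cj x n = n" using ab AG by (auto simp: cj_eq_self_iff)
    then show "cj x n \<in> A" using \<open>n \<in> A\<close> by simp
  qed
  then have "A = {1}" using simple A_ne_G by blast
  then show False using twoA[of 0] by (auto dest: prime_gt_1_nat)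
qed

text \<open>As z is central in B, all its conjugates in G = A B are conjugates by elements of A and
  stay in N. They generate a normal subgroup, which simplicity makes equal to G.\<close>

lemma conj_in_imp_all:
  assumes z: "z \<in> B" "z \<noteq> 1" "\<And>b. b \<in> B \<Longrightarrow> z * b = b * z" and N: "fsub N" "N \<subseteq> G" "A \<subseteq> N" "z \<in> N"
  shows "N = G"
proof -
  let ?S = "(\<lambda>g. cj g z) ` G"
  have SN: "?S \<subseteq> N"
  proof
    fix y assume "y \<in> ?S"
    then obtain a b where ab: "a \<in> A" "b \<in> B" "y = cj (a * b) z" using GAB by (auto elim: sprodE)
    have "cj b z = z" using z(3)[OF ab(2)] by (simp add: cj_eq_self_iff)
    then have "y = cj a z" using ab by (simp flip: cj_cj)
    then show "y \<in> N" using ab N by (auto intro: fsub_cj)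
  qed
  have SG: "?S \<subseteq> G" using SN N by blast
  have "normal_in (gen G ?S) G"
    by (rule gen_cj_invariant[OF fG SG]) (auto simp: cj_cj fsub_mult[OF fG])
  moreover have "z \<in> gen G ?S"
    using subset_gen[of ?S G] fG by (metis (no_types, lifting) cj_one(1) fsub_one image_eqI subsetD)
  ultimately have "gen G ?S = G" using simple z(2) by blast
  moreover have "gen G ?S \<subseteq> N" by (rule gen_least[OF N(1) SN N(2)])
  ultimately show ?thesis using N by blast
qed

text \<open>A Hall subgroup of L for r and q is the product of a conjugate of A_r and a conjugate of
  B_q, so by \<open>pair\<close> A_r permutes with every conjugate of B_q. A largest subgroup C
  above A_r that permutes with all of them, each product being proper, is normalised by all
  conjugates of B_q. These generate G, so C is normal and equals G, which is absurd.\<close>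

lemma no_slv:
  assumes r: "prime r" "r dvd card A" and q: "prime q" "q dvd card B" and L: "slv L" "L \<subseteq> G"
    and g: "g \<in> G" "cj g ` p_part r A \<subseteq> L" and h: "h \<in> G" "cj h ` p_part q B \<subseteq> L"
  shows False
proof -
  interpret sw: coprime_nilp_product G B A by (rule swap)
  have fL: "fsub L" using L(1) by (rule slv_fsub)
  have rq: "r \<noteq> q" using r q not_both by blast
  have "syl r L (cj g ` p_part r A)"
    using syl_sub[OF r(1) fG syl_cj[OF fG sylA[OF r] g(1)] fL g(2) L(2)] .
  then have mr: "multiplicity r (card L) = multiplicity r (card G)"
    using syl_cj[OF fG sylA[OF r] g(1)] r(1) unfolding syl_def by (metis multiplicity_prime_elem_times_other multiplicity_same_power not_prime_0 not_prime_unit)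
  have "syl q L (cj h ` p_part q B)"
    using syl_sub[OF q(1) fG syl_cj[OF fG sw.sylA[OF q] h(1)] fL h(2) L(2)] .
  then have mq: "multiplicity q (card L) = multiplicity q (card G)"
    using syl_cj[OF fG sw.sylA[OF q] h(1)] q(1) unfolding syl_def by (metis multiplicity_prime_elem_times_other multiplicity_same_power not_prime_0 not_prime_unit)
  obtain S where S: "fsub S" "S \<subseteq> L" and mS: "\<And>p. prime p \<Longrightarrow> multiplicity p (card S) = (if p \<in> {r, q} then multiplicity p (card L) else 0)"
    using hall_exists[OF L(1), of "{r, q}"] by blast
  have SG: "S \<subseteq> G" using S L by blast
  obtain P Q where P: "syl r S P" and Q: "syl q S Q" using syl_exists r(1) q(1) S(1) by blast
  have PG: "syl r G P" "syl q G Q" using P Q SG mS[OF r(1)] mS[OF q(1)] mr mq by (auto simp: syl_def)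
  obtain g' h' where g': "g' \<in> G" "P = cj g' ` p_part r A" and h': "h' \<in> G" "Q = cj h' ` p_part q B"
    using syl_conjugate[OF r(1) fG sylA[OF r] PG(1)] syl_conjugate[OF q(1) fG sw.sylA[OF q] PG(2)] by blast
  have PQ1: "P \<inter> Q = {1}" using pgroup_coprime_Int[OF r(1) q(1) rq syl_pgroup[OF P] syl_pgroup[OF Q]] .
  have fP: "fsub P" and fQ: "fsub Q" using P Q by (auto simp: syl_def)
  have cPQ: "card (sprod P Q) = card P * card Q" using card_sprod[OF fP fQ] PQ1 by simp
  \<comment> \<open>Only r and q divide the order of S, so its two Sylow subgroups account for all
    of it.\<close>
  have "card (sprod P Q) = card S"
  proof (rule multiplicity_eq_nat)
    show "card (sprod P Q) > 0" using cPQ fP fQ by (simp add: fsub_card_pos)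
    show "card S > 0" using S by (simp add: fsub_card_pos)
    fix p :: nat assume p: "prime p"
    have "multiplicity p (card (sprod P Q)) = multiplicity p (card P) + multiplicity p (card Q)"
      unfolding cPQ using p fP fQ by (intro prime_elem_multiplicity_mult_distrib) (auto dest: fsub_card_pos)
    also have "\<dots> = multiplicity p (card S)"
      using P Q p r q rq mS[OF p] by (auto simp: syl_def multiplicity_distinct_prime_power)
    finally show "multiplicity p (card (sprod P Q)) = multiplicity p (card S)" .
  qed
  then have SPQ: "sprod P Q = S"
    using sprod_subset[OF S(1) syl_subset[OF P] syl_subset[OF Q]] S(1) by (simp add: card_subset_eq fsub_finite)
  let ?A = "p_part r A" and ?B = "p_part q B"
  have fAr: "fsub ?A" "?A \<subseteq> G" and fBq: "fsub ?B" "?B \<subseteq> G" using partA r sw.partA q by auto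
  have base: "fsub (sprod ?A ?B)"
  proof -
    obtain k where k0: "k \<in> G" "\<forall>r. prime r \<longrightarrow> cj g' ` p_part r A = cj k ` p_part r A"
      "\<forall>r. prime r \<longrightarrow> cj h' ` p_part r B = cj k ` p_part r B" using pair[OF g'(1) h'(1)] by meson
    have k: "k \<in> G" "P = cj k ` ?A" "Q = cj k ` ?B"
      using k0(1) mp[OF spec[OF k0(2)] r(1)] mp[OF spec[OF k0(3)] q(1)] g'(2) h'(2) by simp_all
    then have "cj k ` sprod ?A ?B = S" using SPQ by (simp add: cj_image_sprod)
    then have "sprod ?A ?B = cj (gi k) ` S" by (metis cj_image_inv(1))
    then show ?thesis using S by (simp add: fsub_cj_image)
  qed
  have perm: "fsub (sprod ?A (cj x ` ?B))" if x: "x \<in> G" for x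
  proof -
    obtain k where k0: "k \<in> G" "\<forall>r. prime r \<longrightarrow> cj 1 ` p_part r A = cj k ` p_part r A"
      "\<forall>r. prime r \<longrightarrow> cj x ` p_part r B = cj k ` p_part r B" using pair[OF fsub_one[OF fG] x] by meson
    have k: "k \<in> G" "cj 1 ` ?A = cj k ` ?A" "cj x ` ?B = cj k ` ?B"
      using k0(1) mp[OF spec[OF k0(2)] r(1)] mp[OF spec[OF k0(3)] q(1)] .
    have "sprod ?A (cj x ` ?B) = sprod (cj 1 ` ?A) (cj x ` ?B)" by simp
    also have "\<dots> = cj k ` sprod ?A ?B" by (simp only: k(2,3) cj_image_sprod)
    finally have "sprod ?A (cj x ` ?B) = cj k ` sprod ?A ?B" .
    then show ?thesis using base by (simp add: fsub_cj_image)
  qed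
  \<comment> \<open>A third prime divides the order of A, but not the order of such a
    product.\<close>
  have phi0: "sprod ?A (cj x ` ?B) \<noteq> G" for x
  proof
    assume e: "sprod ?A (cj x ` ?B) = G"
    obtain t where t: "prime t" "t \<noteq> r" "t dvd card A" using twoA by blast
    have "t \<noteq> q" using t q not_both by blast
    have "card G dvd card ?A * card (cj x ` ?B)" using card_sprod[OF fAr(1) fsub_cj_image[OF fBq(1)], of x] e by (metis dvd_triv_left)
    then have "t dvd card ?A * card ?B" using t cardG by (metis card_cj_image dvd_mult2 dvd_trans)
    then have "t dvd card ?A \<or> t dvd card ?B" using t by (simp add: prime_dvd_mult_iff)
    then show False using sylA[OF r] sw.sylA[OF q] t \<open>t \<noteq> q\<close> r(1) q(1) unfolding syl_def
      by (metis prime_dvd_power primes_dvd_imp_eq)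
  qed
  define \<Phi> where "\<Phi> C \<longleftrightarrow> (\<forall>x\<in>G. sprod C (cj x ` ?B) \<noteq> G)" for C
  have "\<exists>C. fsub C \<and> ?A \<subseteq> C \<and> C \<subseteq> G \<and> \<Phi> C \<and> (\<forall>x\<in>G. fsub (sprod C (cj x ` ?B))) \<and>
    (\<forall>x\<in>G. \<forall>k\<in>cj x ` ?B. cj k ` C = C)"
  proof (rule permuting_subgroup_normalised[OF fG fAr fBq perm])
    show "\<Phi> ?A" using phi0 by (simp add: \<Phi>_def)
    fix C D y assume C: "fsub C" and D: "fsub D" "C \<subseteq> D" "D \<subseteq> G" and phi: "\<Phi> C" and y: "y \<in> G"
      and fCB: "fsub (sprod C (cj y ` ?B))" and DC: "D \<subseteq> sprod C (cj y ` ?B)"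
    show "\<Phi> D" unfolding \<Phi>_def
    proof (intro ballI notI)
      fix x assume x: "x \<in> G" and e: "sprod D (cj x ` ?B) = G"
      \<comment> \<open>If D and the conjugate of B_q by x gave G, so would D and the conjugate by
        y, since the two conjugates differ by an element d of D. But the latter product lies in that
        of C with the conjugate by y, which is proper.\<close>
      have "y * gi x \<in> sprod D (cj x ` ?B)" using e x y fG by (simp add: fsub_mult)
      then obtain d k where dk: "d \<in> D" "k \<in> cj x ` ?B" "y * gi x = d * k" by (rule sprodE)
      have "cj y ` ?B = cj (y * gi x) ` (cj x ` ?B)" by (simp only: cj_image_cj) (simp add: mult.assoc)
      also have "\<dots> = cj d ` cj k ` cj x ` ?B" by (simp only: dk(3) cj_image_cj mult.assoc)
      also have "cj k ` cj x ` ?B = cj x ` ?B" using cj_image_self[OF fsub_cj_image[OF fBq(1)] dk(2)] .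
      finally have "cj y ` ?B = cj d ` cj x ` ?B" .
      then have "sprod D (cj y ` ?B) = cj d ` sprod D (cj x ` ?B)"
        using cj_image_self[OF D(1) dk(1)] by (simp add: cj_image_sprod)
      also have "\<dots> = G" using e cj_image_self[OF fG] dk D by auto
      finally have DG: "sprod D (cj y ` ?B) = G" .
      have "cj y ` ?B \<subseteq> sprod C (cj y ` ?B)" using subset_sprod2[OF C] .
      then have "sprod D (cj y ` ?B) \<subseteq> sprod C (cj y ` ?B)" using sprod_subset[OF fCB DC] by blast
      moreover have "sprod C (cj y ` ?B) \<subseteq> G"
        using sprod_subset[OF fG _ cj_image_sub[OF fG fBq(2) y]] D by blast
      ultimately show False using DG phi y by (auto simp: \<Phi>_def)
    qed
  qed
  then obtain C where C: "fsub C" "?A \<subseteq> C" "C \<subseteq> G" "\<Phi> C" and C5: "\<forall>x\<in>G. \<forall>k\<in>cj x ` ?B. cj k ` C = C"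
    by (elim exE conjE) (rule that; assumption)
  let ?S = "\<Union>x\<in>G. cj x ` ?B"
  have SG': "?S \<subseteq> G" using cj_image_sub[OF fG fBq(2)] by blast
  have Sn: "?S \<subseteq> normaliser G C" using C5 SG' unfolding normaliser_def by blast
  have "normal_in (gen G ?S) G"
  proof (rule gen_cj_invariant[OF fG SG'])
    fix x assume x: "x \<in> G"
    show "cj x ` ?S \<subseteq> ?S"
    proof
      fix y assume "y \<in> cj x ` ?S"
      then obtain x' b where xb: "x' \<in> G" "b \<in> ?B" "y = cj (x * x') b" by (auto simp: cj_cj)
      then show "y \<in> ?S" using x fG by (intro UN_I[of "x * x'"]) (auto simp: fsub_mult)
    qed
  qed
  moreover have "?B \<subseteq> gen G ?S"
  proof -
    have "cj 1 ` ?B \<subseteq> ?S" using fsub_one[OF fG] by blast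
    then show ?thesis using subset_gen[of ?S G] by simp
  qed
  ultimately have "gen G ?S = G" using simple sw.partA_nontriv[OF q] fBq(1) fsub_one by blast
  moreover have "gen G ?S \<subseteq> normaliser G C" by (rule gen_least[OF fsub_normaliser[OF fG] Sn normaliser_subset])
  ultimately have "normaliser G C = G" using normaliser_subset by blast
  then have "normal_in C G" using normaliser_eq_iff[OF fG C(1,3)] by simp
  then have "C = G" using simple C(2) partA_nontriv[OF r] fAr(1) fsub_one by blast
  moreover have "sprod G (cj 1 ` ?B) = G"
    using subset_sprod1[OF fBq(1), of G] sprod_subset[OF fG order_refl fBq(2)] by auto
  ultimately show False using C(4) fsub_one[OF fG] unfolding \<Phi>_def by blast
qed

text \<open>Write an element of the normaliser as a b. Then b carries X to its conjugate by a^-1,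
  which lies in L, so the weak closure condition \<open>wc\<close> puts b, and then a, in the
  normaliser. Hence the normaliser is factorised, and simplicity makes it proper.\<close>

lemma slv_normaliser:
  assumes L: "fsub L" "A \<subseteq> L" "L \<subseteq> G" and X: "fsub X" "X \<subseteq> L" "X \<subseteq> B" "X \<noteq> {1}"
    and wc: "\<And>b. b \<in> B \<Longrightarrow> cj b ` X \<subseteq> L \<Longrightarrow> cj b ` X \<subseteq> X"
  shows "slv (normaliser G X)" "normaliser G X \<subseteq> sprod (normaliser G X \<inter> A) (normaliser G X \<inter> B)"
proof -
  interpret sw: coprime_nilp_product G B A by (rule swap)
  let ?N = "normaliser G X"
  have XG: "X \<subseteq> G" using X L by blast
  show f: "?N \<subseteq> sprod (?N \<inter> A) (?N \<inter> B)"
  proof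
    fix g assume g: "g \<in> ?N"
    then obtain a b where ab: "a \<in> A" "b \<in> B" "g = a * b" using GAB by (auto simp: normaliser_def elim: sprodE)
    have "cj a ` cj b ` X = X" using g ab by (simp only: cj_image_cj) (simp add: normaliser_def)
    then have "cj b ` X = cj (gi a) ` X" by (metis cj_image_inv(1))
    also have "\<dots> \<subseteq> L"
    proof (intro image_subsetI fsub_cj[OF L(1)])
      show "gi a \<in> L" using ab(1) L fsub_gi by blast
    qed (use X in blast)
    finally have "cj b ` X \<subseteq> X" using wc ab by blast
    then have b: "b \<in> ?N" using normaliserI[OF X(1)] ab BG by blast
    then have "a \<in> ?N" using g ab fsub_mult_right_iff[OF fsub_normaliser[OF fG]] by blast
    then show "g \<in> sprod (?N \<inter> A) (?N \<inter> B)" using ab b by (simp add: sprodI)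
  qed
  have "?N \<noteq> G"
  proof
    assume "?N = G"
    then have "normal_in X G" using normaliser_eq_iff[OF fG X(1) XG] by simp
    then show False using simple X sw.A_ne_G BG by blast
  qed
  then show "slv ?N" using fact_slv[OF fsub_normaliser[OF fG] normaliser_subset] f by blast
qed

text \<open>The normaliser of X contains A_t, which centralises X, and also B_s for a prime s other
  than q; \<open>no_slv\<close> forbids this.\<close>

lemma no_slv_centraliser:
  assumes t: "prime t" "t dvd card A" and q: "prime q" "q dvd card B"
    and X: "fsub X" "X \<subseteq> p_part q B" "slv (normaliser G X)" and c: "\<And>a x. a \<in> p_part t A \<Longrightarrow> x \<in> X \<Longrightarrow> a * x = x * a"
  shows False
proof -
  interpret sw: coprime_nilp_product G B A by (rule swap)
  obtain s where s: "prime s" "s \<noteq> q" "s dvd card B" using twoB by blast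
  have "p_part t A \<subseteq> centraliser G X" using c partA(3)[of t] by (auto simp: centraliser_def)
  then have 1: "cj 1 ` p_part t A \<subseteq> normaliser G X" using centraliser_in_normaliser by fastforce
  have "b * x = x * b" if "b \<in> p_part s B" "x \<in> X" for b x
    using nilp_commute[OF nB s(1) q(1) s(2)] that X(2) by (auto simp: p_part_def)
  then have "p_part s B \<subseteq> centraliser G X" using sw.partA(3)[of s] by (auto simp: centraliser_def)
  then have 2: "cj 1 ` p_part s B \<subseteq> normaliser G X" using centraliser_in_normaliser by fastforce
  show False
    by (rule no_slv[OF t s(1,3) X(3) normaliser_subset fsub_one[OF fG] 1 fsub_one[OF fG] 2])
qed

text \<open>Otherwise a prime q of B divides the order of the intersection. With C the centraliser
  of A_t and L = A C, the part X of L in B_q lies in C, because C has the full q-part of L. As an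
  intersection with L, X is weakly closed in the sense of \<open>slv_normaliser\<close>, and its
  solvable normaliser contradicts \<open>no_slv_centraliser\<close>.\<close>

lemma centraliser_partA_Int_B:
  assumes t: "prime t" "t dvd card A" and x: "x \<in> B" "x \<in> centraliser G (p_part t A)"
  shows "x = 1"
proof (rule ccontr)
  assume "x \<noteq> 1"
  let ?At = "p_part t A"
  define C where "C = centraliser G ?At"
  define N where "N = normaliser G ?At"
  have fC: "fsub C" and fN: "fsub N" unfolding C_def N_def using fsub_centraliser fsub_normaliser fG by auto
  have nC: "normal_in C N" unfolding C_def N_def by (rule normal_centraliser_normaliser[OF fG])
  have AN: "A \<subseteq> N" unfolding N_def normaliser_def using AG normal_in_cj_image[OF fA nilp_syl(2)[OF nA t(1)]] by blast
  define L where "L = sprod A C"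
  have L: "fsub L" "A \<subseteq> L" "C \<subseteq> L" "L \<subseteq> G"
    unfolding L_def using sprod_normal_fsub[OF nC fA AN] subset_sprod1[OF fC] subset_sprod2[OF fA]
      sprod_subset[OF fG AG centraliser_subset] by (auto simp: C_def)
  have "L \<subseteq> N" unfolding L_def using sprod_subset[OF fN AN normal_in_subset[OF nC]] .
  then have nCL: "normal_in C L" using normal_in_restrict[OF nC L(3)] by blast
  have fBC: "fsub (B \<inter> C)" using fB fC by (rule fsub_Int)
  have "B \<inter> C \<noteq> {1}" using x \<open>x \<noteq> 1\<close> by (auto simp: C_def)
  then have "card (B \<inter> C) \<noteq> 1" using fsub_card1[OF fBC] by simp
  then obtain q where q: "prime q" "q dvd card (B \<inter> C)" using prime_factor_nat by blast
  have qB: "q dvd card B" using q lagrange_dvd[OF fB fBC] dvd_trans by blast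
  define X where "X = L \<inter> p_part q B"
  interpret sw: coprime_nilp_product G B A by (rule swap)
  have fX: "fsub X" unfolding X_def using L(1) sw.partA(1)[OF q(1)] by (rule fsub_Int)
  have mL: "multiplicity q (card L) = multiplicity q (card C)"
  proof -
    have "fsub (A \<inter> C)" using fA fC by (rule fsub_Int)
    then have "multiplicity q (card (A \<inter> C)) = 0" "multiplicity q (card A) = 0"
      using not_both'[OF q(1) qB] lagrange_dvd[OF fA, of "A \<inter> C"] dvd_trans by (blast intro: not_dvd_imp_multiplicity_0)+
    then show ?thesis using multiplicity_sprod[OF q(1) fA fC] by (simp add: L_def)
  qed
  have XC: "X \<subseteq> C" using normal_contains_p_elt[OF q(1) L(1) nCL mL] by (auto simp: X_def p_part_def)
  have "X \<noteq> {1}"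
  proof -
    obtain y where "y \<in> B \<inter> C" "y \<noteq> 1" "y ^ q = 1" using cauchy_thm[OF q(1) fBC q(2)] by blast
    then have "y \<in> X" unfolding X_def p_part_def p_elt_def using L by (auto intro!: exI[of _ 1])
    then show ?thesis using \<open>y \<noteq> 1\<close> by blast
  qed
  have "slv (normaliser G X)"
  proof (rule slv_normaliser(1)[OF L(1,2,4) fX _ _ \<open>X \<noteq> {1}\<close>])
    show "X \<subseteq> L" "X \<subseteq> B" by (auto simp: X_def p_part_def)
    fix b assume "b \<in> B" "cj b ` X \<subseteq> L"
    then show "cj b ` X \<subseteq> X" unfolding X_def p_part_def using fsub_cj[OF fB] by auto
  qed
  moreover have "a * y = y * a" if "a \<in> ?At" "y \<in> X" for a y using XC that by (auto simp: C_def centraliser_def)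
  ultimately show False using no_slv_centraliser[OF t q(1) qB fX] by (auto simp: X_def)
qed

text \<open>Inside the normaliser of A_t, where the centraliser of A_t is normal, a q-element can be
  conjugated into B.\<close>

lemma centraliser_partA:
  assumes t: "prime t" "t dvd card A" and q: "prime q" "q dvd card B" and x: "x \<in> centraliser G (p_part t A)" "p_elt q x"
  shows "x = 1"
proof -
  let ?L = "normaliser G (p_part t A)"
  have fL: "fsub ?L" using fsub_normaliser[OF fG] .
  have AL: "A \<subseteq> ?L" unfolding normaliser_def using AG normal_in_cj_image[OF fA nilp_syl(2)[OF nA t(1)]] by blast
  have xL: "x \<in> ?L" using x centraliser_in_normaliser by blast
  obtain Q where Q: "syl q ?L Q" "x \<in> Q" using p_elt_in_syl[OF q(1) fL xL x(2)] by blast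
  obtain l where l: "l \<in> ?L" "Q = cj l ` (?L \<inter> p_part q B)"
    using syl_conjugate[OF q(1) fL over_syl[OF fL AL normaliser_subset q] Q(1)] by blast
  then obtain y where y: "y \<in> p_part q B" "x = cj l y" using Q(2) by blast
  have "y = cj (gi l) x" by (simp add: y)
  moreover have "gi l \<in> ?L" using l fL by simp
  ultimately have "y \<in> centraliser G (p_part t A)"
    using normal_in_cj[OF normal_centraliser_normaliser[OF fG] _ x(1)] by blast
  then have "y = 1" using centraliser_partA_Int_B[OF t] y by (simp add: p_part_def)
  then show ?thesis using y by simp
qed

text \<open>The intersection with A contains a Sylow subgroup of C for each prime; a prime not
  dividing card G contributes only the trivial one.\<close>

lemma pi_sub_in_A:
  assumes C: "fsub C" "C \<subseteq> G" and parts: "\<And>p. prime p \<Longrightarrow> p dvd card G \<Longrightarrow> \<exists>Q. syl p C Q \<and> Q \<subseteq> A"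
  shows "C \<subseteq> A"
proof -
  have "C \<inter> A = C"
  proof (rule eq_if_all_syl[OF C(1) fsub_Int[OF C(1) fA] Int_lower1])
    fix p :: nat assume p: "prime p"
    show "\<exists>Q. syl p C Q \<and> Q \<subseteq> C \<inter> A"
    proof (cases "p dvd card G")
      case True
      then show ?thesis using parts[OF p] syl_subset by blast
    next
      case False
      obtain P where P: "syl p C P" using syl_exists[OF p C(1)] by blast
      from False have "p_part p G = {1}" using p_part_triv_iff[OF p fG] by simp
      moreover have "P \<subseteq> p_part p G" using P C pgroup_p_elt[OF syl_pgroup[OF P]] by (auto simp: p_part_def dest: syl_subset)
      ultimately have "P \<subseteq> A" using fA by auto
      then show ?thesis using P syl_subset by blast
    qed
  qed
  then show ?thesis by blast
qed

lemma syl_in_A_if_p_elts: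
  assumes C: "fsub C" "prime p" and "\<And>x. x \<in> C \<Longrightarrow> p_elt p x \<Longrightarrow> x \<in> A"
  shows "\<exists>Q. syl p C Q \<and> Q \<subseteq> A"
proof -
  obtain P where P: "syl p C P" using syl_exists[OF C(2,1)] by blast
  have "P \<subseteq> A" using assms(3) pgroup_p_elt[OF syl_pgroup[OF P]] syl_subset[OF P] by blast
  then show ?thesis using P by blast
qed

text \<open>The core lies in B_q and is centralised by the centre of B. So its normaliser contains A
  and a nontrivial central element of B and is G by \<open>conj_in_imp_all\<close>, against
  simplicity.\<close>

lemma core_over_B:
  assumes H: "fsub H" "A \<subseteq> H" "H \<subseteq> G" "H \<noteq> G" and q: "prime q" "q dvd card B"
  shows "core q H = {1}"
proof (rule ccontr)
  assume ne: "core q H \<noteq> {1}"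
  interpret sw: coprime_nilp_product G B A by (rule swap)
  let ?C = "core q H"
  have C: "normal_in ?C H" "pgroup q ?C" using core_normal_pgroup[OF q(1) H(1)] by auto
  have CB: "?C \<subseteq> p_part q B" using core_in_syl[OF q(1) H(1) over_syl[OF H(1-3) q]] by blast
  obtain z where z: "z \<in> p_part q B" "z \<noteq> 1" "\<And>x. x \<in> B \<Longrightarrow> z * x = x * z" using nilp_central_elt[OF nB q] by blast
  let ?N = "normaliser G ?C"
  have CG: "?C \<subseteq> G" using CB sw.partA(3) by blast
  have "A \<subseteq> ?N" using normal_in_cj_image[OF H(1) C(1)] H by (auto simp: normaliser_def)
  moreover have "z \<in> ?N"
  proof -
    have "z \<in> centraliser G ?C" using z CB sw.partA(2,3)[of q] by (auto simp: centraliser_def)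
    then show ?thesis using centraliser_in_normaliser by blast
  qed
  ultimately have "?N = G" using conj_in_imp_all[of z ?N] z sw.partA(2) fsub_normaliser[OF fG] normaliser_subset by blast
  then have "normal_in ?C G" using normaliser_eq_iff[OF fG pgroup_fsub[OF C(2)] CG] by simp
  then have "?C = G" using simple ne by blast
  then show False using CB sw.partA(2) sw.A_ne_G BG by blast
qed

lemma core_over_in_A:
  assumes H: "fsub H" "A \<subseteq> H" "H \<subseteq> G" "H \<noteq> G" and p: "prime p"
  shows "core p H \<subseteq> p_part p A"
proof -
  have C: "normal_in (core p H) H" "pgroup p (core p H)" using core_normal_pgroup[OF p H(1)] by auto
  show ?thesis
  proof (cases "p dvd card A")
    case True
    then show ?thesis using core_in_syl[OF p H(1) syl_sub[OF p fG sylA[OF p True] H(1)]] partA(2)[of p] H by blast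
  next
    case False
    show ?thesis
    proof (cases "p dvd card B")
      case True then show ?thesis using core_over_B[OF H p] partA(1)[OF p] by simp
    next
      case nB: False
      then have "\<not> p dvd card G" using False dvd_cardG[OF p] by blast
      then have "p_part p G = {1}" using p_part_triv_iff[OF p fG] by simp
      moreover have "core p H \<subseteq> p_part p G"
        using pgroup_p_elt[OF C(2)] normal_in_subset[OF C(1)] H by (auto simp: p_part_def)
      ultimately show ?thesis using partA(1)[OF p] by auto
    qed
  qed
qed

text \<open>Let F consist of the cores of H for the primes other than t, and let C be its
  centraliser in H. A nontrivial q-element of C with q dividing card B would centralise some A_s
  with s other than t, which \<open>centraliser_partA\<close> excludes. So C is a normal subgroup of
  H inside A, hence nilpotent, and A_t is its Sylow t-subgroup.\<close>

lemma over_normal: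
  assumes H: "fsub H" "A \<subseteq> H" "H \<subseteq> G" "H \<noteq> G" and t: "prime t" "t dvd card A"
  shows "normal_in (p_part t A) H"
proof -
  have sH: "slv H" using over_slv[OF H] .
  note coreA = core_over_in_A[OF H]
  have coren: "normal_in (core p H) H" if "prime p" for p using core_normal_pgroup(1)[OF that H(1)] .
  define F where "F = (\<Union>p\<in>{p. prime p \<and> p \<noteq> t}. core p H)"
  define C where "C = centraliser H F"
  have cjF: "cj x ` F = F" if "x \<in> H" for x
    unfolding F_def image_UN by (intro SUP_cong refl) (use normal_in_cj_image[OF H(1) coren that] in auto)
  have nC: "normal_in C H" unfolding C_def using normal_centraliser[OF H(1) cjF] .
  have fC: "fsub C" using nC by (rule normal_in_fsub)
  define Z where "Z = centraliser H (fcore H)"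
  have fZ: "fsub Z" unfolding Z_def by (rule fsub_centraliser[OF H(1)])
  have Zp: "p_part p Z \<subseteq> core p H" if "prime p" for p using slv_centraliser_fcore(2)[OF sH that] by (simp add: Z_def)
  have ZA: "Z \<subseteq> A"
  proof (rule pi_sub_in_A[OF fZ])
    show "Z \<subseteq> G" using H(3) centraliser_subset[of H "fcore H"] unfolding Z_def by blast
    fix p :: nat assume p: "prime p"
    have "p_part p Z \<subseteq> A" using Zp[OF p] coreA[OF p] p_part_subset by blast
    then show "\<exists>Q. syl p Z Q \<and> Q \<subseteq> A" by (intro syl_in_A_if_p_elts[OF fZ p]) (auto simp: p_part_def)
  qed
  \<comment> \<open>With D the centraliser of O_t(H), the groups C and D meet inside the centraliser
    Z of the Fitting subgroup of H, and Z lies in A.\<close>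
  have noq: "x = 1" if x: "x \<in> C" and q: "prime q" "q dvd card B" and xq: "p_elt q x" for x q
  proof -
    obtain s where s: "prime s" "s \<noteq> t" "s dvd card A" using twoA by blast
    let ?As = "p_part s A"
    define D where "D = centraliser H (core t H)"
    have nD: "normal_in D H" unfolding D_def by (rule normal_centraliser[OF H(1)]) (rule normal_in_cj_image[OF H(1) coren[OF t(1)]])
    have AsD: "?As \<subseteq> D"
      using nilp_commute[OF nA s(1) t(1) s(2)] coreA[OF t(1)] H(2) by (auto simp: D_def centraliser_def p_part_def subset_iff)
    have CDZ: "C \<inter> D \<subseteq> Z"
    proof
      fix y assume y: "y \<in> C \<inter> D"
      have "y * f = f * y" if "f \<in> fcore H" for f
      proof -
        obtain p where p: "prime p" "f \<in> core p H" using \<open>f \<in> fcore H\<close> by (auto simp: fcore_def)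
        show ?thesis using y p by (cases "p = t") (auto simp: C_def D_def F_def centraliser_def)
      qed
      then show "y \<in> Z" using y by (auto simp: Z_def C_def centraliser_def)
    qed
    have xH: "x \<in> H" using x by (auto simp: C_def centraliser_def)
    have "x * b = b * x" if b: "b \<in> ?As" for b
    proof -
      \<comment> \<open>A commutator of b and x. It lies in C and in D, hence in A; it turns out to
        be an s-element, thus to lie in O_s(H) and to commute with x.\<close>
      define e where "e = gi b * cj x b"
      have bD: "b \<in> D" and bH: "b \<in> H" using b AsD nD normal_in_subset by blast+
      have fD: "fsub D" using nD by (rule normal_in_fsub)
      have "e \<in> D" unfolding e_def using bD normal_in_cj[OF nD xH bD] fD by (simp add: fsub_mult)
      moreover have "e \<in> C"
      proof -
        have "cj (gi b) x * gi x = e" by (simp add: e_def cj_def mult.assoc)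
        moreover have "cj (gi b) x \<in> C" using normal_in_cj[OF nC _ x, of "gi b"] bH H(1) by simp
        ultimately show ?thesis using x fC by (metis fsub_gi fsub_mult)
      qed
      ultimately have eZ: "e \<in> Z" using CDZ by blast
      have xb: "cj x b = b * e" by (simp add: e_def)
      have "b * e \<in> A" using b eZ ZA fA p_part_subset by (blast intro: fsub_mult)
      moreover have "p_elt s (b * e)" using b by (simp add: p_part_def flip: xb)
      ultimately have "b * e \<in> ?As" by (simp add: p_part_def)
      then have "e \<in> ?As" using b partA(1)[OF s(1)] fsub_mult_left_iff by blast
      then have es: "p_elt s e" by (simp add: p_part_def)
      then have "e \<in> core s H" using Zp[OF s(1)] eZ by (auto simp: p_part_def)
      then have "x * e = e * x" using x s by (auto simp: C_def F_def centraliser_def)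
      then have xe: "cj x e = e" by (simp add: cj_eq_self_iff)
      \<comment> \<open>Conjugation by x multiplies b by e each time. As x has q-power order, so has
        e, and an s-element of q-power order is 1.\<close>
      have pow: "cj (x ^ n) b = b * e ^ n" for n
        by (induction n) (simp_all add: xb xe cj_mult cj_power mult.assoc flip: cj_cj)
      obtain k where "x ^ (q ^ k) = 1" using xq by (auto simp: p_elt_def)
      then have "e ^ (q ^ k) = 1" using pow[of "q ^ k"] by (metis cj_one(1) grp_left_eq_self)
      then have "p_elt q e" by (auto simp: p_elt_def)
      then have "e = 1" using p_elt_p_elt[OF s(1) q(1) _ es] not_both s q by blast
      then show ?thesis using xb by (simp add: cj_eq_self_iff)
    qed
    then have "x \<in> centraliser G ?As" using xH H by (auto simp: centraliser_def)
    then show "x = 1" using centraliser_partA[OF s(1,3) q _ xq] by blast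
  qed
  have CA: "C \<subseteq> A"
  proof (rule pi_sub_in_A[OF fC])
    show "C \<subseteq> G" using H(3) centraliser_subset[of H F] unfolding C_def by blast
    fix p :: nat assume p: "prime p" "p dvd card G"
    show "\<exists>Q. syl p C Q \<and> Q \<subseteq> A"
    proof (cases "p dvd card A")
      case True
      have "syl p H (p_part p A)" using syl_sub[OF p(1) fG sylA[OF p(1) True] H(1)] partA(2)[of p] H by blast
      then have "syl p C (C \<inter> p_part p A)" by (rule syl_normal_Int[OF p(1) H(1) nC])
      then show ?thesis using partA(2)[of p] by blast
    next
      case False
      then have "p dvd card B" using dvd_cardG[OF p] by blast
      then have "x \<in> A" if "x \<in> C" "p_elt p x" for x using noq[OF that(1) p(1) _ that(2)] fA by simp
      then show ?thesis by (intro syl_in_A_if_p_elts[OF fC p(1)])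
    qed
  qed
  have nilC: "nilp C" using nilp_subset[OF nA fC CA] .
  have "a * f = f * a" if a: "a \<in> p_part t A" and f: "f \<in> F" for a f
  proof -
    obtain p where p: "prime p" "p \<noteq> t" "f \<in> core p H" using f by (auto simp: F_def)
    then have "f \<in> p_part p A" using coreA by blast
    then show ?thesis using nilp_commute[OF nA t(1) p(1) p(2)[symmetric], of a f] a by (simp add: p_part_def)
  qed
  then have "p_part t A \<subseteq> C" using partA(2)[of t] H(2) by (auto simp: C_def centraliser_def)
  then have "p_part t C = p_part t A" using CA by (auto simp: p_part_def)
  then show ?thesis using normal_p_part[OF nilC nC t(1)] by simp
qed

text \<open>By \<open>over_sub_NA\<close> this is the largest proper subgroup of G that contains
  A.\<close>

definition NA :: "'a set" where "NA = normaliser G A"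

lemma fNA: "fsub NA" "A \<subseteq> NA" "NA \<subseteq> G" "NA \<noteq> G"
proof -
  show "fsub NA" "A \<subseteq> NA" "NA \<subseteq> G"
    unfolding NA_def using fsub_normaliser[OF fG] subset_normaliser[OF fA AG] normaliser_subset[of G A] by auto
  show "NA \<noteq> G"
  proof
    assume "NA = G"
    then have "normal_in A G" using normaliser_eq_iff[OF fG fA AG] by (simp add: NA_def)
    then have "A = {1}" using simple A_ne_G by blast
    then show False using twoA[of 0] by (auto dest: prime_gt_1_nat)
  qed
qed

text \<open>Every Sylow subgroup of A is normal in H by \<open>over_normal\<close>, so H normalises
  A.\<close>

lemma over_sub_NA:
  assumes H: "fsub H" "A \<subseteq> H" "H \<subseteq> G" "H \<noteq> G" shows "H \<subseteq> NA"
proof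
  fix h assume h: "h \<in> H"
  have "A \<inter> cj h ` A = A"
  proof (rule eq_if_all_syl[OF fA fsub_Int[OF fA fsub_cj_image[OF fA]] Int_lower1])
    fix p :: nat assume p: "prime p"
    have "p_part p A \<subseteq> cj h ` A"
    proof (cases "p dvd card A")
      case True
      then show ?thesis using normal_in_cj_image[OF H(1) over_normal[OF H p True] h] p_part_subset by blast
    next
      case False
      then have "p_part p A = {1}" using p_part_triv_iff[OF p fA] by simp
      then show ?thesis using fsub_one[OF fsub_cj_image[OF fA, of h]] by simp
    qed
    then show "\<exists>Q. syl p A Q \<and> Q \<subseteq> A \<inter> cj h ` A" using nilp_syl(1)[OF nA p] p_part_subset by blast
  qed
  then have "A \<subseteq> cj h ` A" by blast
  then have "cj h ` A = A" by (metis card_cj_image card_subset_eq finite_imageI fsub_finite fA)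
  then show "h \<in> NA" using h H by (auto simp: NA_def normaliser_def)
qed

lemma normaliser_partA:
  assumes t: "prime t" "t dvd card A" shows "normaliser G (p_part t A) = NA"
proof
  have "normaliser G (p_part t A) \<noteq> G"
  proof
    assume "normaliser G (p_part t A) = G"
    then have "normal_in (p_part t A) G" using normaliser_eq_iff[OF fG partA(1)[OF t(1)] partA(3)] by simp
    then have "p_part t A = G" using simple partA_nontriv[OF t] by blast
    then show False using partA(2)[of t] A_ne_G AG by blast
  qed
  moreover have "A \<subseteq> normaliser G (p_part t A)"
    unfolding normaliser_def using AG normal_in_cj_image[OF fA nilp_syl(2)[OF nA t(1)]] by blast
  ultimately show "normaliser G (p_part t A) \<subseteq> NA"
    using over_sub_NA[OF fsub_normaliser[OF fG] _ normaliser_subset] by blast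
  show "NA \<subseteq> normaliser G (p_part t A)"
    using normal_in_cj_image[OF fNA(1) over_normal[OF fNA t]] fNA(3) by (auto simp: normaliser_def)
qed

lemma NA_cj_part: "prime t \<Longrightarrow> h \<in> NA \<Longrightarrow> cj h ` p_part t A = p_part t A"
  by (simp add: NA_def normaliser_def flip: p_part_cj_image)

text \<open>For a prime t of A other than r, both A_t and its conjugate by g centralise U and are
  Sylow subgroups of the centraliser, so some c in it conjugates one to the other. The quotient of g
  by c normalises A_t, and the normaliser of A_t is \<open>NA\<close>.\<close>

lemma fusion:
  assumes r: "prime r" "r dvd card A" and U: "U \<subseteq> p_part r A" and g: "g \<in> G" "U \<subseteq> cj g ` p_part r A"
  shows "\<exists>c\<in>centraliser G U. gi c * g \<in> NA"
proof -
  obtain t where t: "prime t" "t \<noteq> r" "t dvd card A" using twoA by blast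
  let ?C = "centraliser G U"
  have fC: "fsub ?C" using fsub_centraliser[OF fG] .
  have comm: "a * u = u * a" if "a \<in> p_part t A" "u \<in> p_part r A" for a u
    using nilp_commute[OF nA t(1) r(1) t(2)] that by (auto simp: p_part_def)
  have 1: "p_part t A \<subseteq> ?C" using comm U partA(3)[of t] by (auto simp: centraliser_def)
  have "cj g a * u = u * cj g a" if au: "a \<in> p_part t A" "u \<in> U" for a u
  proof -
    obtain v where "v \<in> p_part r A" "u = cj g v" using g au by blast
    then show ?thesis using comm[OF au(1)] by (simp add: commute_cj)
  qed
  then have 2: "cj g ` p_part t A \<subseteq> ?C" using cj_image_sub[OF fG partA(3)[of t] g(1)] by (auto simp: centraliser_def)
  have s1: "syl t ?C (p_part t A)" using syl_sub[OF t(1) fG sylA[OF t(1,3)] fC 1 centraliser_subset] .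
  have s2: "syl t ?C (cj g ` p_part t A)"
    using syl_sub[OF t(1) fG syl_cj[OF fG sylA[OF t(1,3)] g(1)] fC 2 centraliser_subset] .
  obtain c where c: "c \<in> ?C" "cj g ` p_part t A = cj c ` p_part t A" using syl_conjugate[OF t(1) fC s1 s2] by blast
  have "cj (gi c * g) ` p_part t A = p_part t A" using c(2) by (metis cj_image_cj cj_image_inv(1))
  moreover have "gi c * g \<in> G" using c(1) g(1) fG by (auto simp: centraliser_def fsub_mult)
  ultimately have "gi c * g \<in> normaliser G (p_part t A)" by (simp add: normaliser_def)
  then show ?thesis using c normaliser_partA[OF t(1,3)] by blast
qed

text \<open>\<open>slv_normaliser\<close> applies with L = X A: since A meets B trivially, the part
  of L in B is X itself.\<close>

lemma slv_normaliser_NA: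
  assumes q: "prime q" and X: "fsub X" "X \<subseteq> NA" "X \<subseteq> B" "X \<noteq> {1}"
  shows "slv (normaliser G X)" "normaliser G X \<subseteq> sprod (normaliser G X \<inter> A) (normaliser G X \<inter> B)"
proof -
  have nA': "normal_in A NA" unfolding NA_def by (rule normal_in_normaliser[OF fA AG])
  define L where "L = sprod X A"
  have L: "fsub L" "A \<subseteq> L" "X \<subseteq> L" "L \<subseteq> G"
    unfolding L_def using sprod_normal_fsub[OF nA' X(1,2)] subset_sprod1[OF fA] subset_sprod2[OF X(1)]
      sprod_subset[OF fG _ AG, of X] X BG by auto
  have wc: "cj b ` X \<subseteq> X" if b: "b \<in> B" "cj b ` X \<subseteq> L" for b
  proof
    fix y assume y: "y \<in> cj b ` X"
    then have yB: "y \<in> B" using cj_image_sub[OF fB X(3) b(1)] by blast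
    obtain x a where xa: "x \<in> X" "a \<in> A" "y = x * a" using y b(2) unfolding L_def by (blast elim: sprodE)
    then have "a \<in> B" using yB X(3) fB fsub_mult_left_iff by blast
    then have "a = 1" using xa(2) AB_triv by blast
    then show "y \<in> X" using xa by simp
  qed
  show "slv (normaliser G X)" "normaliser G X \<subseteq> sprod (normaliser G X \<inter> A) (normaliser G X \<inter> B)"
    using slv_normaliser[OF L(1,2,4) X(1) L(3) X(3,4) wc] by auto
qed

end

section \<open>Subgroups of one factor normalised by a Sylow subgroup of the other\<close>

lemma pgroup_nontriv_dvd: "pgroup p K \<Longrightarrow> K \<noteq> {1} \<Longrightarrow> p dvd card K"
  unfolding pgroup_def by (metis dvd_power fsub_card1 neq0_conv power_0)

lemma normaliser_cj_swap:
  assumes "fsub G" "k \<in> G" "S \<subseteq> G" "cj k ` S \<subseteq> normaliser G U" shows "S \<subseteq> normaliser G (cj (gi k) ` U)"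
proof
  fix s assume s: "s \<in> S"
  then have "cj (cj k s) ` U = U" using assms(4) by (auto simp: normaliser_def)
  then have "cj (gi k) ` cj (cj k s) ` U = cj (gi k) ` U" by simp
  moreover have "gi k * cj k s = s * gi k" by (simp add: cj_def mult.assoc)
  ultimately have "cj s ` cj (gi k) ` U = cj (gi k) ` U" by (simp only: cj_image_cj)
  then show "s \<in> normaliser G (cj (gi k) ` U)" using s assms(3) by (auto simp: normaliser_def)
qed

context coprime_nilp_product
begin

lemma NA_slv: "slv NA" using over_slv[OF fNA] .

text \<open>The centraliser contains A and is proper, because the centre of G is trivial.\<close>

lemma centraliser_central_sub:
  assumes z: "z \<in> A" "z \<noteq> 1" "\<And>x. x \<in> A \<Longrightarrow> z * x = x * z"
  shows "centraliser G {z} \<subseteq> NA"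
proof (rule over_sub_NA[OF fsub_centraliser[OF fG] _ centraliser_subset])
  show "A \<subseteq> centraliser G {z}" using z AG by (auto simp: centraliser_def)
  show "centraliser G {z} \<noteq> G"
  proof
    assume "centraliser G {z} = G"
    then have "x * z = z * x" if "x \<in> G" for x using that unfolding centraliser_def by blast
    then show False using centre_triv[of z] z AG by (metis subsetD)
  qed
qed

text \<open>If B_s meets the centraliser of U trivially, fusion factors N(U) into C(U) and the
  normaliser of U in \<open>NA\<close>; comparing s-parts, the solvable group \<open>NA\<close>
  contains A_r and a Sylow s-subgroup of G. Otherwise a nontrivial central element of B centralises
  U, so U normalises B, and N(U) is solvable by the swapped \<open>slv_normaliser_NA\<close>, yet
  contains B_s and some A_t. Both contradict \<open>no_slv\<close>.\<close>

lemma no_normalised_base: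
  assumes r: "prime r" "r dvd card A" and s: "prime s" "s dvd card B"
    and U: "fsub U" "U \<subseteq> p_part r A" "U \<noteq> {1}" "p_part s B \<subseteq> normaliser G U"
  shows False
proof -
  interpret sw: coprime_nilp_product G B A by (rule swap)
  let ?N = "normaliser G U" and ?C = "centraliser G U" and ?NH = "normaliser NA U" and ?Bs = "p_part s B"
  have fN: "fsub ?N" "?N \<subseteq> G" using fsub_normaliser[OF fG] normaliser_subset by auto
  have nC: "normal_in ?C ?N" using normal_centraliser_normaliser[OF fG] .
  have fC: "fsub ?C" "?C \<subseteq> ?N" using nC by (auto simp: normal_in_def)
  have fNH: "fsub ?NH" "?NH \<subseteq> ?N" using fsub_normaliser[OF fNA(1)] fNA(3) by (auto simp: normaliser_def)
  have fBs: "fsub ?Bs" using sw.partA(1)[OF s(1)] .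
  have mBs: "multiplicity s (card ?Bs) = multiplicity s (card G)"
    using sw.sylA[OF s] s(1) by (simp add: syl_def)
  show False
  proof (cases "?Bs \<inter> ?C = {1}")
    case True
    have "?N \<subseteq> sprod ?C ?NH"
    proof
      fix x assume x: "x \<in> ?N"
      then have "x \<in> G" "cj x ` U = U" by (auto simp: normaliser_def)
      then have "U \<subseteq> cj x ` p_part r A" using U(2) by (metis image_mono)
      then obtain c where c: "c \<in> ?C" "gi c * x \<in> NA" using fusion[OF r U(2) \<open>x \<in> G\<close>] by blast
      have "gi c \<in> ?N" using c(1) fC fsub_gi by blast
      then have "gi c * x \<in> ?N" using fsub_mult[OF fN(1) _ x] by blast
      then have "gi c * x \<in> ?NH" using c(2) by (simp add: normaliser_def)
      then have "c * (gi c * x) \<in> sprod ?C ?NH" using c(1) by (intro sprodI)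
      then show "x \<in> sprod ?C ?NH" by simp
    qed
    then have eq: "sprod ?C ?NH = ?N" using sprod_subset[OF fN(1) fC(2) fNH(2)] by blast
    have "fsub (sprod ?Bs ?C)" "sprod ?Bs ?C \<subseteq> ?N"
      using sprod_normal_fsub[OF nC fBs U(4)] sprod_subset[OF fN(1) U(4) fC(2)] by auto
    then have "multiplicity s (card (sprod ?Bs ?C)) \<le> multiplicity s (card ?N)" using multiplicity_card_mono[OF s(1) fN(1)] by blast
    moreover have "multiplicity s (card (sprod ?Bs ?C)) = multiplicity s (card ?Bs) + multiplicity s (card ?C)"
      using multiplicity_sprod[OF s(1) fBs fC(1)] True by simp
    moreover have "multiplicity s (card ?N) \<le> multiplicity s (card ?C) + multiplicity s (card ?NH)"
      using multiplicity_sprod[OF s(1) fC(1) fNH(1)] eq by simp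
    moreover have "multiplicity s (card ?NH) \<le> multiplicity s (card NA)"
      using multiplicity_card_mono[OF s(1) fNA(1) fNH(1) normaliser_subset] .
    ultimately have "multiplicity s (card G) \<le> multiplicity s (card NA)" using mBs by simp
    then have m: "multiplicity s (card NA) = multiplicity s (card G)" using multiplicity_card_mono[OF s(1) fG fNA(1,3)] by simp
    obtain P where P: "syl s NA P" using syl_exists[OF s(1) fNA(1)] by blast
    then have "syl s G P" using m fNA(3) by (auto simp: syl_def)
    then obtain g where g: "g \<in> G" "P = cj g ` ?Bs" using syl_conjugate[OF s(1) fG sw.sylA[OF s]] by blast
    have "cj g ` ?Bs \<subseteq> NA" using g P syl_subset by blast
    moreover have "cj 1 ` p_part r A \<subseteq> NA" using partA(2)[of r] fNA(2) by simp
    ultimately show False using no_slv[OF r s NA_slv fNA(3) fsub_one[OF fG] _ g(1)] by blast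
  next
    case False
    let ?K = "?C \<inter> ?Bs"
    have K: "normal_in ?K ?Bs" using normal_in_Int_sub[OF nC fBs U(4)] .
    have pBs: "pgroup s ?Bs" using sw.partA(4)[OF s(1)] .
    have "pgroup s ?K" using pgroup_subset[OF s(1) pBs normal_in_fsub[OF K]] by blast
    then have "s dvd card ?K" using pgroup_nontriv_dvd[of s ?K] False by (simp add: Int_commute)
    then obtain z where z: "z \<in> ?K" "z \<noteq> 1" "\<forall>x\<in>?Bs. z * x = x * z"
      using nilp_central[OF pgroup_nilp[OF s(1) pBs] s(1) K] by blast
    have zB: "z \<in> B" "p_elt s z" using z by (auto simp: p_part_def)
    \<comment> \<open>z is central in B_s, and elements of B of order a power of another prime
      commute with it anyway.\<close>
    have zc: "z * x = x * z" if "x \<in> B" for x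
    proof -
      have "x * z = z * x"
      proof (rule nilp_central_if_parts[OF nB _ that])
        fix p :: nat and y assume p: "prime p" "y \<in> p_part p B"
        show "y * z = z * y"
        proof (cases "p = s")
          case True then show ?thesis using z(3) p by simp
        next
          case False then show ?thesis using nilp_commute[OF nB p(1) s(1) False, of y z] p(2) zB by (simp add: p_part_def)
        qed
      qed
      then show ?thesis by simp
    qed
    have "U \<subseteq> centraliser G {z}" using z(1) U(2) partA(3)[of r] by (auto simp: centraliser_def)
    then have "U \<subseteq> sw.NA" using sw.centraliser_central_sub[OF zB(1) z(2) zc] by blast
    then have "slv ?N" using sw.slv_normaliser_NA(1)[OF r(1) U(1) _ _ U(3)] U(2) partA(2)[of r] by blast
    moreover obtain t where t: "prime t" "t \<noteq> r" "t dvd card A" using twoA by blast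
    have "a * u = u * a" if "a \<in> p_part t A" "u \<in> U" for a u
      using nilp_commute[OF nA t(1) r(1) t(2), of a u] that U(2) by (auto simp: p_part_def)
    then have "p_part t A \<subseteq> ?C" using partA(3)[of t] by (auto simp: centraliser_def)
    then have "cj 1 ` p_part t A \<subseteq> ?N" using fC(2) by simp
    moreover have "cj 1 ` ?Bs \<subseteq> ?N" using U(4) by simp
    ultimately show False using no_slv[OF t(1,3) s _ fN(2) fsub_one[OF fG] _ fsub_one[OF fG]] by blast
  qed
qed

text \<open>Conjugating back by the common element of \<open>pair\<close> reduces this to the base
  case.\<close>

lemma no_normalised:
  assumes r: "prime r" "r dvd card A" and s: "prime s" "s dvd card B" and g: "g \<in> G" and h: "h \<in> G"
    and U: "fsub U" "U \<subseteq> cj g ` p_part r A" "U \<noteq> {1}" "cj h ` p_part s B \<subseteq> normaliser G U"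
  shows False
proof -
  interpret sw: coprime_nilp_product G B A by (rule swap)
  obtain k where k0: "k \<in> G" "\<forall>r. prime r \<longrightarrow> cj g ` p_part r A = cj k ` p_part r A"
    "\<forall>r. prime r \<longrightarrow> cj h ` p_part r B = cj k ` p_part r B" using pair[OF g h] by meson
  have k: "cj g ` p_part r A = cj k ` p_part r A" "cj h ` p_part s B = cj k ` p_part s B"
    using mp[OF spec[OF k0(2)] r(1)] mp[OF spec[OF k0(3)] s(1)] .
  let ?U = "cj (gi k) ` U"
  have "fsub ?U" using U(1) by (rule fsub_cj_image)
  moreover have "?U \<subseteq> p_part r A" using U(2) k(1) by (metis cj_image_inv(1) image_mono)
  moreover have "?U \<noteq> {1}" using U(3) by (metis cj_image_inv(2) image_empty image_insert cj_one(2))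
  moreover have "p_part s B \<subseteq> normaliser G ?U"
    using normaliser_cj_swap[OF fG k0(1) sw.partA(3)] U(4) k(2) by simp
  ultimately show False using no_normalised_base[OF r s] by blast
qed

text \<open>Let R be the normaliser of X. By \<open>no_normalised\<close> the core of R for a prime
  of A is trivial, so the Fitting subgroup of R lies in B, and a nontrivial central element z of B
  in B_q falls into O_q(R). The centraliser D of O_q(R) in R then centralises z and so normalises B.
  For a prime s other than q it contains B_s as its only Sylow s-subgroup, so R, which normalises D,
  normalises B_s and therefore B.\<close>

lemma normaliser_sub_swap:
  assumes q: "prime q" "q dvd card B" and X: "fsub X" "X \<subseteq> NA" "X \<subseteq> p_part q B" "X \<noteq> {1}"
  shows "normaliser G X \<subseteq> normaliser G B"
proof -
  interpret sw: coprime_nilp_product G B A by (rule swap)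
  let ?R = "normaliser G X"
  have XB: "X \<subseteq> B" using X(3) p_part_subset by blast
  have sR: "slv ?R" and fact: "?R \<subseteq> sprod (?R \<inter> A) (?R \<inter> B)" using slv_normaliser_NA[OF q(1) X(1,2) XB X(4)] by auto
  have fR: "fsub ?R" "?R \<subseteq> G" using fsub_normaliser[OF fG] normaliser_subset by auto
  obtain s where s: "prime s" "s \<noteq> q" "s dvd card B" using twoB by blast
  have comm: "b * x = x * b" if "b \<in> p_part s B" "x \<in> p_part q B" for b x
    using nilp_commute[OF nB s(1) q(1) s(2), of b x] that by (simp add: p_part_def)
  have BsR: "p_part s B \<subseteq> ?R"
  proof -
    have "p_part s B \<subseteq> centraliser G X" using comm X(3) sw.partA(3)[of s] by (auto simp: centraliser_def)
    then show ?thesis using centraliser_in_normaliser by blast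
  qed
  have coreA: "core r ?R = {1}" if r: "prime r" "r dvd card A" for r
  proof (rule ccontr)
    assume ne: "core r ?R \<noteq> {1}"
    have C: "normal_in (core r ?R) ?R" "pgroup r (core r ?R)" using core_normal_pgroup[OF r(1) fR(1)] by auto
    have CG: "core r ?R \<subseteq> G" using normal_in_subset[OF C(1)] fR(2) by blast
    obtain g where g: "g \<in> G" "core r ?R \<subseteq> cj g ` p_part r A" using syl_dominates[OF r(1) fG sylA[OF r] C(2) CG] by blast
    have "?R \<subseteq> normaliser G (core r ?R)" using normal_in_cj_image[OF fR(1) C(1)] fR(2) by (auto simp: normaliser_def)
    then have "cj 1 ` p_part s B \<subseteq> normaliser G (core r ?R)" using BsR by simp
    then show False using no_normalised[OF r s(1,3) g(1) fsub_one[OF fG] pgroup_fsub[OF C(2)] g(2) ne] by blast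
  qed
  have coreB: "core p ?R \<subseteq> p_part p B" if p: "prime p" for p
  proof (cases "p dvd card B")
    case True
    then show ?thesis using core_in_syl[OF p fR(1) fact_syl[OF fR fact p]] by blast
  next
    case False
    have "core p ?R = {1}"
    proof (rule ccontr)
      assume ne: "core p ?R \<noteq> {1}"
      have C: "normal_in (core p ?R) ?R" "pgroup p (core p ?R)" using core_normal_pgroup[OF p fR(1)] by auto
      have "core p ?R \<subseteq> G" using normal_in_subset[OF C(1)] fR(2) by blast
      then have "p dvd card G" using pgroup_nontriv_dvd[OF C(2) ne] lagrange_dvd[OF fG pgroup_fsub[OF C(2)]] dvd_trans by blast
      then show False using dvd_cardG[OF p] False coreA[OF p] ne by blast
    qed
    then show ?thesis using fsub_one[OF sw.partA(1)[OF p]] by simp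
  qed
  obtain z where z: "z \<in> p_part q B" "z \<noteq> 1" "\<And>x. x \<in> B \<Longrightarrow> z * x = x * z" using nilp_central_elt[OF nB q] by blast
  have zB: "z \<in> B" "p_elt q z" using z(1) by (auto simp: p_part_def)
  have "z \<in> centraliser G X" using z(3) zB BG XB by (auto simp: centraliser_def)
  then have zR: "z \<in> ?R" using centraliser_in_normaliser by blast
  have "z * f = f * z" if "f \<in> fcore ?R" for f
  proof -
    obtain p where "prime p" "f \<in> core p ?R" using \<open>f \<in> fcore ?R\<close> by (auto simp: fcore_def)
    then have "f \<in> B" using coreB p_part_subset by blast
    then show ?thesis using z(3) by blast
  qed
  then have "z \<in> p_part q (centraliser ?R (fcore ?R))" using zR zB by (simp add: p_part_def centraliser_def)
  then have zcore: "z \<in> core q ?R" using slv_centraliser_fcore(2)[OF sR q(1)] by blast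
  define D where "D = centraliser ?R (core q ?R)"
  have nD: "normal_in D ?R" unfolding D_def
    by (rule normal_centraliser[OF fR(1)]) (rule normal_in_cj_image[OF fR(1) core_normal_pgroup(1)[OF q(1) fR(1)]])
  have "D \<subseteq> centraliser G {z}" using zcore fR(2) by (auto simp: D_def centraliser_def)
  then have DK: "D \<subseteq> sw.NA" using sw.centraliser_central_sub[OF zB(1) z(2,3)] by blast
  have BsD: "p_part s B \<subseteq> D" unfolding D_def using BsR comm coreB[OF q(1)] by (auto simp: centraliser_def)
  have fD: "fsub D" using nD by (rule normal_in_fsub)
  have sD: "syl s D (p_part s B)" using syl_sub[OF s(1) fG sw.sylA[OF s(1,3)] fD BsD] normal_in_subset[OF nD] fR(2) by blast
  have "normal_in (p_part s B) D"
    using normal_in_restrict[OF sw.over_normal[OF sw.fNA s(1,3)] BsD DK] .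
  then have eq: "p_part s B = p_part s D" using syl_normal_unique[OF s(1) fD sD] by blast
  have "?R \<subseteq> normaliser G (p_part s B)"
  proof
    fix x assume x: "x \<in> ?R"
    have "cj x ` p_part s D = p_part s D"
      using normal_in_cj_image[OF fR(1) nD x] by (simp flip: p_part_cj_image)
    then show "x \<in> normaliser G (p_part s B)" using x fR(2) by (auto simp: normaliser_def eq)
  qed
  then show ?thesis using sw.normaliser_partA[OF s(1,3)] by (simp add: sw.NA_def)
qed

end

section \<open>A transfer argument and the comparison of the two orders\<close>

lemma card_triv_prime_power:
  assumes "card S = p ^ n" "S = {1::'a::grp}" "prime (p::nat)" shows "n = 0"
proof -
  have "p ^ n = 1" using assms by simp
  then show ?thesis using prime_gt_1_nat[OF assms(3)] by simp
qed

context coprime_nilp_product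
begin

text \<open>Let C be the centraliser of U and M the subgroup generated by its q-elements for the
  primes q of B. Transfer shows that M meets Sylow subgroups of C for the primes of A trivially,
  first for r and then for the others. If M is not 1, Frattini yields a Sylow subgroup of M
  normalised by a conjugate of some A_t, against \<open>no_normalised\<close>. So M = 1, and for
  every prime dividing card G a Sylow subgroup of C lies in A.\<close>

lemma centraliser_in_NA:
  assumes r: "prime r" "r dvd card A" and U: "fsub U" "U \<subseteq> p_part r A" "U \<noteq> {1}"
    and CA: "centraliser NA U \<subseteq> A"
  shows "centraliser G U \<subseteq> NA"
proof -
  interpret sw: coprime_nilp_product G B A by (rule swap)
  let ?C = "centraliser G U"
  have fC: "fsub ?C" "?C \<subseteq> G" using fsub_centraliser[OF fG] centraliser_subset by auto
  have CNA: "x \<in> A" if "x \<in> ?C" "x \<in> NA" for x using CA that by (auto simp: centraliser_def)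
  have comm: "a * u = u * a" if "a \<in> p_part t A" "u \<in> p_part s A" "prime s" "prime t" "t \<noteq> s" for a u s t
    using nilp_commute[OF nA that(4,3,5), of a u] that(1,2) by (simp add: p_part_def)
  have AtC: "p_part t A \<subseteq> ?C" if "prime t" "t \<noteq> r" for t
    using comm[OF _ _ r(1) that] U(2) partA(3)[of t] by (auto simp: centraliser_def)
  define T where "T = p_part r A \<inter> ?C"
  have fT: "fsub T" unfolding T_def using partA(1)[OF r(1)] fC(1) by (rule fsub_Int)
  have pT: "pgroup r T" using pgroup_subset[OF r(1) partA(4)[OF r(1)] fT] by (auto simp: T_def)
  have TA: "T \<subseteq> p_part r A" "T \<subseteq> ?C" by (auto simp: T_def)
  \<comment> \<open>A Sylow r-subgroup P of C above T lies together with U in a conjugate of A_r. By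
    fusion this is a conjugate by an element of C, so P is no larger than T.\<close>
  have sT: "syl r ?C T"
  proof -
    obtain P where P: "syl r ?C P" "T \<subseteq> P" using pgroup_in_syl[OF r(1) fC(1) pT TA(2)] by blast
    have fP: "fsub P" "P \<subseteq> ?C" using P by (auto simp: syl_def)
    have "sprod P U \<subseteq> sprod U P"
      using fP(2) by (auto simp: sprod_def centraliser_def)
    then have fUP: "fsub (sprod U P)" by (rule fsub_sprod[OF U(1) fP(1)])
    have pU: "pgroup r U" using pgroup_subset[OF r(1) partA(4)[OF r(1)] U(1,2)] .
    have "pgroup r (sprod U P)" using pgroup_sprod[OF r(1) pU syl_pgroup[OF P(1)] fUP] .
    moreover have "sprod U P \<subseteq> G" using sprod_subset[OF fG] U(2) partA(3)[of r] fP(2) fC(2) by blast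
    ultimately obtain g where g: "g \<in> G" "sprod U P \<subseteq> cj g ` p_part r A" using syl_dominates[OF r(1) fG sylA[OF r]] by blast
    have "U \<subseteq> cj g ` p_part r A" using g(2) subset_sprod1[OF fP(1), of U] by blast
    then obtain c where c: "c \<in> ?C" "gi c * g \<in> NA" using fusion[OF r U(2) g(1)] by blast
    have "cj g ` p_part r A = cj c ` cj (gi c * g) ` p_part r A" by (simp only: cj_image_cj gi_right_cancel)
    also have "\<dots> = cj c ` p_part r A" using NA_cj_part[OF r(1) c(2)] by simp
    finally have "P \<subseteq> cj c ` p_part r A" using g(2) subset_sprod2[OF U(1), of P] by blast
    then have "cj (gi c) ` P \<subseteq> p_part r A" by (metis cj_image_subset_swap gi_gi)
    moreover have "cj (gi c) ` P \<subseteq> ?C" using cj_image_sub[OF fC(1) fP(2), of "gi c"] c(1) fC(1) by simp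
    ultimately have "cj (gi c) ` P \<subseteq> T" by (simp add: T_def)
    then have "card P \<le> card T" using card_mono[OF fsub_finite[OF fT]] by (metis card_cj_image)
    then have "T = P" using P(2) fP(1) by (metis card_seteq fsub_finite)
    then show ?thesis using P by simp
  qed
  define S where "S = {x \<in> ?C. \<exists>q. prime q \<and> q dvd card B \<and> p_elt q x}"
  define M where "M = gen ?C S"
  have SC: "S \<subseteq> ?C" by (auto simp: S_def)
  have nM: "normal_in M ?C" unfolding M_def
    by (rule gen_cj_invariant[OF fC(1) SC]) (auto simp: S_def fsub_cj[OF fC(1)])
  have fM: "fsub M" "M \<subseteq> ?C" using nM by (auto simp: normal_in_def)
  have SM: "S \<subseteq> M" unfolding M_def by (rule subset_gen)
  have gens: "M \<subseteq> gen M {x \<in> M. \<exists>q. prime q \<and> q \<noteq> t \<and> p_elt q x}" if t: "prime t" "t dvd card A" for t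
  proof -
    let ?S = "{x \<in> M. \<exists>q. prime q \<and> q \<noteq> t \<and> p_elt q x}"
    have "S \<subseteq> ?S" using SM not_both[OF t] by (auto simp: S_def)
    then have "S \<subseteq> gen M ?S" using subset_gen by blast
    moreover have "?S \<subseteq> M" by blast
    then have "fsub (gen M ?S)" "gen M ?S \<subseteq> ?C" using fsub_gen[OF fM(1)] gen_subset[OF fM(1), of ?S] fM(2) by auto
    ultimately show ?thesis unfolding M_def[symmetric] using gen_least[of "gen M ?S" S ?C] M_def by blast
  qed
  define A' where "A' = A \<inter> ?C"
  have fA': "fsub A'" unfolding A'_def using fA fC(1) by (rule fsub_Int)
  have nA': "nilp A'" using nilp_subset[OF nA fA'] by (auto simp: A'_def)
  have partA': "p_part r A' = T" "\<And>t. prime t \<Longrightarrow> t \<noteq> r \<Longrightarrow> p_part t A' = p_part t A"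
    using AtC by (auto simp: A'_def T_def p_part_def)
  have M1: "M \<inter> T = {1}"
  proof (rule transfer_trivial[OF r(1) fM(1) syl_normal_Int[OF r(1) fC(1) nM sT] pT _ gens[OF r]])
    show "normal_in (M \<inter> T) T" using normal_in_Int_sub[OF nM fT TA(2)] .
    \<comment> \<open>A_t and its conjugate by g^-1 are Sylow subgroups of the centraliser of x in
      C. Correcting g by an element c of this centraliser does not change its effect on x and leads
      into the normaliser of A_t, hence into A'.\<close>
    fix x g assume x: "x \<in> M \<inter> T" and g: "g \<in> M" and gx: "cj g x \<in> M \<inter> T"
    obtain t where t: "prime t" "t \<noteq> r" "t dvd card A" using twoA by blast
    let ?Y = "centraliser ?C {x}"
    have fY: "fsub ?Y" "?Y \<subseteq> ?C" using fsub_centraliser[OF fC(1)] centraliser_subset by auto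
    have gC: "g \<in> ?C" using g fM by blast
    have "a * x = x * a" if "a \<in> p_part t A" for a using comm[OF that _ r(1) t(1,2)] x TA by blast
    then have 1: "p_part t A \<subseteq> ?Y" using AtC[OF t(1,2)] unfolding centraliser_def[of ?C] by blast
    have "cj (gi g) a * x = x * cj (gi g) a" if "a \<in> p_part t A" for a
    proof -
      have "a * cj g x = cj g x * a" using comm[OF that _ r(1) t(1,2)] gx TA by blast
      then have "cj (gi g) a * cj (gi g) (cj g x) = cj (gi g) (cj g x) * cj (gi g) a" by (rule commute_cj)
      then show ?thesis by simp
    qed
    then have 2: "cj (gi g) ` p_part t A \<subseteq> ?Y"
      using cj_image_sub[OF fC(1) AtC[OF t(1,2)], of "gi g"] gC fC(1) by (auto simp: centraliser_def[of ?C])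
    have YG: "?Y \<subseteq> G" using fY fC by blast
    have s1: "syl t ?Y (p_part t A)" using syl_sub[OF t(1) fG sylA[OF t(1,3)] fY(1) 1 YG] .
    have gG: "gi g \<in> G" using gC fC fG by auto
    have s2: "syl t ?Y (cj (gi g) ` p_part t A)"
      using syl_sub[OF t(1) fG syl_cj[OF fG sylA[OF t(1,3)] gG] fY(1) 2 YG] .
    obtain c where c: "c \<in> ?Y" "cj (gi g) ` p_part t A = cj c ` p_part t A" using syl_conjugate[OF t(1) fY(1) s1 s2] by blast
    have "p_part t A = cj (g * c) ` p_part t A" using c(2) by (metis cj_image_cj cj_image_inv(2))
    moreover have gcC: "g * c \<in> ?C" using gC c(1) fY(2) fC(1) by (auto intro: fsub_mult)
    ultimately have "g * c \<in> normaliser G (p_part t A)" using fC(2) by (auto simp: normaliser_def)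
    then have "g * c \<in> A'" using CNA[OF gcC] gcC normaliser_partA[OF t(1,3)] by (simp add: A'_def)
    then obtain k where k: "k \<in> p_part r A'" "\<forall>y\<in>p_part r A'. cj (g * c) y = cj k y"
      using nilp_part_action[OF nA' r(1)] by blast
    have "cj c x = x" using c(1) by (simp add: centraliser_def cj_eq_self_iff)
    then have "cj g x = cj (g * c) x" by (simp flip: cj_cj)
    also have "\<dots> = cj k x" using k(2) x partA'(1) by blast
    finally show "\<exists>h\<in>T. cj g x = cj h x" using k(1) partA'(1) by blast
  qed
  have rM: "\<not> r dvd card M"
  proof
    assume "r dvd card M"
    then have "multiplicity r (card M) > 0" using fsub_card_pos[OF fM(1)] r(1) by (simp add: prime_multiplicity_gt_zero_iff)
    moreover have "card (M \<inter> T) = r ^ multiplicity r (card M)"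
      using syl_normal_Int[OF r(1) fC(1) nM sT] by (simp add: syl_def)
    ultimately show False using card_triv_prime_power[OF _ M1 r(1), of "multiplicity r (card M)"] by simp
  qed
  obtain z where z: "z \<in> p_part r A" "z \<noteq> 1" "\<And>x. x \<in> A \<Longrightarrow> z * x = x * z" using nilp_central_elt[OF nA r] by blast
  have zA: "z \<in> A" using z(1) by (simp add: p_part_def)
  have zT: "z \<in> T" using z zA U(2) AG by (auto simp: T_def centraliser_def p_part_def)
  have M2: "M \<inter> p_part t A = {1}" if t: "prime t" "t \<noteq> r" "t dvd card A" for t
  proof -
    let ?At = "p_part t A"
    have AtC': "?At \<subseteq> ?C" using AtC[OF t(1,2)] .
    have sAt: "syl t ?C ?At" using syl_sub[OF t(1) fG sylA[OF t(1,3)] fC(1) AtC' fC(2)] .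
    show ?thesis
    proof (rule transfer_trivial[OF t(1) fM(1) syl_normal_Int[OF t(1) fC(1) nM sAt] partA(4)[OF t(1)] _ gens[OF t(1,3)]])
      show "normal_in (M \<inter> ?At) ?At" using normal_in_Int_sub[OF nM partA(1)[OF t(1)] AtC'] .
      fix x g assume x: "x \<in> M \<inter> ?At" and g: "g \<in> M" and gx: "cj g x \<in> M \<inter> ?At"
      \<comment> \<open>For the remaining primes T takes over the role of A_t, and the correction is
        made in T M. The corrected element is \<open>\<tau> * m\<close>, and it normalises T, so m
        does.\<close>
      define Y0 where "Y0 = sprod T M"
      have Y0: "fsub Y0" "Y0 \<subseteq> ?C" "T \<subseteq> Y0" "M \<subseteq> Y0"
        unfolding Y0_def using sprod_normal_fsub[OF nM fT TA(2)] sprod_subset[OF fC(1) TA(2) fM(2)]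
          subset_sprod1[OF fM(1)] subset_sprod2[OF fT] by auto
      let ?Y = "centraliser Y0 {x}"
      have fY: "fsub ?Y" "?Y \<subseteq> Y0" using fsub_centraliser[OF Y0(1)] centraliser_subset by auto
      have gY: "g \<in> Y0" using g Y0 by blast
      have "a * x = x * a" if "a \<in> T" for a using comm[OF _ _ t(1) r(1) t(2)[symmetric], of a x] that x TA by blast
      then have 1: "T \<subseteq> ?Y" using Y0(3) unfolding centraliser_def[of Y0] by blast
      have "cj (gi g) a * x = x * cj (gi g) a" if "a \<in> T" for a
      proof -
        have "a * cj g x = cj g x * a" using comm[OF _ _ t(1) r(1) t(2)[symmetric], of a "cj g x"] that gx TA by blast
        then have "cj (gi g) a * cj (gi g) (cj g x) = cj (gi g) (cj g x) * cj (gi g) a" by (rule commute_cj)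
        then show ?thesis by simp
      qed
      then have 2: "cj (gi g) ` T \<subseteq> ?Y"
        using cj_image_sub[OF Y0(1,3), of "gi g"] gY Y0(1) by (auto simp: centraliser_def[of Y0])
      have sTY: "syl r Y0 T" using syl_sub[OF r(1) fC(1) sT Y0(1,3,2)] .
      have s1: "syl r ?Y T" using syl_sub[OF r(1) Y0(1) sTY fY(1) 1 fY(2)] .
      have s2: "syl r ?Y (cj (gi g) ` T)"
        using syl_sub[OF r(1) Y0(1) syl_cj[OF Y0(1) sTY, of "gi g"] fY(1) 2 fY(2)] gY Y0(1) by simp
      obtain c where c: "c \<in> ?Y" "cj (gi g) ` T = cj c ` T" using syl_conjugate[OF r(1) fY(1) s1 s2] by blast
      have hT: "cj (g * c) ` T = T" using c(2) by (metis cj_image_cj cj_image_inv(2))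
      have "g * c \<in> Y0" using gY c(1) fY(2) Y0(1) by (auto intro: fsub_mult)
      then obtain \<tau> m where tm: "\<tau> \<in> T" "m \<in> M" "g * c = \<tau> * m" unfolding Y0_def by (rule sprodE)
      have "cj m ` T = cj (gi \<tau>) ` cj (g * c) ` T" by (simp only: cj_image_cj tm(3) gi_left_cancel)
      then have mT: "cj m ` T = T" using hT cj_image_self[OF fT, of "gi \<tau>"] tm(1) fT by simp
      \<comment> \<open>The commutator of m with the central element z lies in M and in T, which
        meet trivially. So m centralises z and belongs to \<open>NA\<close>.\<close>
      have "cj m z * gi z \<in> M"
      proof -
        have "cj m z * gi z = m * cj z (gi m)" by (simp add: cj_def mult.assoc)
        moreover have "cj z (gi m) \<in> M" using normal_in_cj[OF nM, of z "gi m"] zT TA tm(2) fM(1) by auto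
        ultimately show ?thesis using tm(2) fM(1) by (simp add: fsub_mult)
      qed
      moreover have "cj m z * gi z \<in> T" using mT zT fT by (blast intro: fsub_mult fsub_gi)
      ultimately have "cj m z * gi z = 1" using M1 by blast
      then have "cj m z = z" by (metis gi_left mult.assoc mult_1_left mult_1_right)
      then have "m \<in> centraliser G {z}" using tm(2) fM(2) fC(2) by (auto simp: centraliser_def[of G "{z}"] cj_eq_self_iff)
      then have "m \<in> NA" using centraliser_central_sub[OF zA z(2,3)] by blast
      then have "m \<in> A'" using CNA tm(2) fM(2) by (auto simp: A'_def)
      moreover have "\<tau> \<in> A'" using tm(1) TA p_part_subset[of r A] by (auto simp: A'_def)
      ultimately have "g * c \<in> A'" using tm(3) fA' by (simp add: fsub_mult)
      then obtain k where k: "k \<in> p_part t A'" "\<forall>y\<in>p_part t A'. cj (g * c) y = cj k y"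
        using nilp_part_action[OF nA' t(1)] by blast
      have "cj c x = x" using c(1) by (simp add: centraliser_def cj_eq_self_iff)
      then have "cj g x = cj (g * c) x" by (simp flip: cj_cj)
      also have "\<dots> = cj k x" using k(2) x partA'(2)[OF t(1,2)] by blast
      finally show "\<exists>h\<in>?At. cj g x = cj h x" using k(1) partA'(2)[OF t(1,2)] by blast
    qed
  qed
  obtain t where t: "prime t" "t \<noteq> r" "t dvd card A" using twoA by blast
  have sAt: "syl t ?C (p_part t A)" using syl_sub[OF t(1) fG sylA[OF t(1,3)] fC(1) AtC[OF t(1,2)] fC(2)] .
  have tM: "multiplicity t (card M) = 0"
  proof (rule ccontr)
    assume "multiplicity t (card M) \<noteq> 0"
    moreover have "card (M \<inter> p_part t A) = t ^ multiplicity t (card M)"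
      using syl_normal_Int[OF t(1) fC(1) nM sAt] by (simp add: syl_def)
    ultimately show False using card_triv_prime_power[OF _ M2[OF t] t(1), of "multiplicity t (card M)"] by simp
  qed
  have "M = {1}"
  proof (rule ccontr)
    assume "M \<noteq> {1}"
    then have "card M \<noteq> 1" using fsub_card1[OF fM(1)] by simp
    then obtain q where q: "prime q" "q dvd card M" using prime_factor_nat by blast
    have MG: "M \<subseteq> G" using fM(2) fC(2) by blast
    have "q dvd card G" using q lagrange_dvd[OF fG fM(1) MG] dvd_trans by blast
    have "\<not> q dvd card A"
    proof
      assume qA: "q dvd card A"
      have "q \<noteq> r" using rM q by blast
      then have s: "syl q ?C (p_part q A)" using syl_sub[OF q(1) fG sylA[OF q(1) qA] fC(1) AtC[OF q(1)] fC(2)] by blast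
      have "card (M \<inter> p_part q A) = q ^ multiplicity q (card M)"
        using syl_normal_Int[OF q(1) fC(1) nM s] by (simp add: syl_def)
      moreover have "multiplicity q (card M) > 0" using q fsub_card_pos[OF fM(1)] by (simp add: prime_multiplicity_gt_zero_iff)
      ultimately show False using card_triv_prime_power[OF _ M2[OF q(1) \<open>q \<noteq> r\<close> qA] q(1), of "multiplicity q (card M)"] by simp
    qed
    then have qB: "q dvd card B" using dvd_cardG[OF q(1) \<open>q dvd card G\<close>] by blast
    obtain Q where Q: "syl q M Q" using syl_exists[OF q(1) fM(1)] by blast
    have fQ: "fsub Q" "Q \<subseteq> M" using Q by (auto simp: syl_def)
    have "multiplicity q (card M) > 0" using q fsub_card_pos[OF fM(1)] by (simp add: prime_multiplicity_gt_zero_iff)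
    moreover have "card Q = q ^ multiplicity q (card M)" using Q by (simp add: syl_def)
    ultimately have "Q \<noteq> {1}" using card_triv_prime_power[OF _ _ q(1), of Q "multiplicity q (card M)"] by force
    have QG: "Q \<subseteq> G" using fQ MG by blast
    obtain g where g: "g \<in> G" "Q \<subseteq> cj g ` p_part q B"
      using syl_dominates[OF q(1) fG sw.sylA[OF q(1) qB] syl_pgroup[OF Q] QG] by blast
    \<comment> \<open>C is the product of M and N by Frattini. As t does not divide card M, N
      contains a Sylow t-subgroup of C.\<close>
    define N where "N = normaliser ?C Q"
    have fN: "fsub N" "N \<subseteq> ?C" unfolding N_def using fsub_normaliser[OF fC(1)] normaliser_subset by auto
    have "?C \<subseteq> sprod M N"
    proof
      fix x assume "x \<in> ?C"
      then obtain n where n: "n \<in> M" "gi n * x \<in> N" using frattini[OF q(1) fC(1) nM Q] unfolding N_def by blast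
      have "n * (gi n * x) \<in> sprod M N" using n by (rule sprodI)
      then show "x \<in> sprod M N" by simp
    qed
    then have "sprod M N = ?C" using sprod_subset[OF fC(1) fM(2) fN(2)] by blast
    then have "multiplicity t (card ?C) \<le> multiplicity t (card N)" using multiplicity_sprod[OF t(1) fM(1) fN(1)] tM by simp
    then have m: "multiplicity t (card N) = multiplicity t (card ?C)" using multiplicity_card_mono[OF t(1) fC(1) fN] by simp
    obtain P where P: "syl t N P" using syl_exists[OF t(1) fN(1)] by blast
    then have "syl t ?C P" using m fN(2) by (auto simp: syl_def)
    then obtain y where y: "y \<in> ?C" "P = cj y ` p_part t A" using syl_conjugate[OF t(1) fC(1) sAt] by blast
    have "cj y ` p_part t A \<subseteq> normaliser G Q" using P y syl_subset[OF P] fC(2) by (auto simp: N_def normaliser_def)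
    then show False using sw.no_normalised[OF q(1) qB t(1,3) g(1) _ fQ(1) g(2) \<open>Q \<noteq> {1}\<close>] y(1) fC(2) by blast
  qed
  have "?C \<subseteq> A"
  proof (rule pi_sub_in_A[OF fC])
    fix p :: nat assume p: "prime p" "p dvd card G"
    show "\<exists>Q. syl p ?C Q \<and> Q \<subseteq> A"
    proof (cases "p dvd card A")
      case True
      show ?thesis
      proof (cases "p = r")
        case True then show ?thesis using sT TA p_part_subset by blast
      next
        case False
        then show ?thesis
          using syl_sub[OF p(1) fG sylA[OF p(1) True] fC(1) AtC[OF p(1) False] fC(2)] p_part_subset by blast
      qed
    next
      case False
      then have "p dvd card B" using dvd_cardG[OF p] by blast
      have "x \<in> A" if "x \<in> ?C" "p_elt p x" for x
      proof -
        have "x \<in> S" using that p \<open>p dvd card B\<close> by (auto simp: S_def)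
        then have "x = 1" using SM \<open>M = {1}\<close> by blast
        then show ?thesis using fA by simp
      qed
      then show ?thesis by (intro syl_in_A_if_p_elts[OF fC(1) p(1)])
    qed
  qed
  then show ?thesis using fNA(2) by blast
qed

text \<open>If card A is larger, A meets its conjugate by a nontrivial central element b of B in a
  subgroup with nontrivial r-part U. Some elements of B centralising U force U to normalise B, and
  then b commutes with U. So b lies in the normaliser of U, hence in \<open>NA\<close>; but a proper
  subgroup containing A cannot contain b.\<close>

lemma card_le: "card A \<le> card B"
proof (rule ccontr)
  assume "\<not> card A \<le> card B"
  interpret sw: coprime_nilp_product G B A by (rule swap)
  obtain q0 where q0: "prime q0" "q0 dvd card B" using twoB by blast
  obtain b where b: "b \<in> p_part q0 B" "b \<noteq> 1" "\<And>x. x \<in> B \<Longrightarrow> b * x = x * b" using nilp_central_elt[OF nB q0] by blast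
  have bB: "b \<in> B" "b \<in> G" using b(1) BG by (auto simp: p_part_def)
  have bNA: "b \<notin> NA" using conj_in_imp_all[OF bB(1) b(2,3) fNA(1,3,2)] fNA(4) by blast
  let ?D = "A \<inter> cj b ` A"
  have fbA: "fsub (cj b ` A)" using fA by (rule fsub_cj_image)
  have fD: "fsub ?D" using fA fbA by (rule fsub_Int)
  have "?D \<noteq> {1}"
  proof
    assume "?D = {1}"
    then have "card (sprod A (cj b ` A)) = card A * card A" using card_sprod[OF fA fbA] by simp
    moreover have "card (sprod A (cj b ` A)) \<le> card G"
      using sprod_subset[OF fG AG cj_image_sub[OF fG AG bB(2)]] fG by (simp add: card_mono fsub_finite)
    ultimately have "card A * card A \<le> card A * card B" by (simp add: cardG)
    then show False using \<open>\<not> card A \<le> card B\<close> fsub_card_pos[OF fA] by simp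
  qed
  then have "card ?D \<noteq> 1" using fsub_card1[OF fD] by simp
  then obtain r where r: "prime r" "r dvd card ?D" using prime_factor_nat by blast
  have rA: "r dvd card A" using r lagrange_dvd[OF fA fD] dvd_trans by blast
  define U where "U = p_part r A \<inter> cj b ` p_part r A"
  have fU: "fsub U" unfolding U_def using partA(1)[OF r(1)] by (intro fsub_Int fsub_cj_image)
  have UA: "U \<subseteq> p_part r A" "U \<subseteq> cj b ` p_part r A" by (auto simp: U_def)
  have U1: "U \<noteq> {1}"
  proof -
    obtain x where x: "x \<in> ?D" "x \<noteq> 1" "x ^ r = 1" using cauchy_thm[OF r(1) fD r(2)] by blast
    then have "p_elt r x" unfolding p_elt_def by (intro exI[of _ 1]) simp
    then have "x \<in> U" using x by (auto simp: U_def p_part_def simp flip: p_part_cj_image)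
    then show ?thesis using x by blast
  qed
  \<comment> \<open>b is c times an element of \<open>NA\<close>, so c lies outside
    \<open>NA\<close>. By \<open>centraliser_in_NA\<close> the centraliser of U in \<open>NA\<close>
    is therefore not contained in A.\<close>
  obtain c where c: "c \<in> centraliser G U" "gi c * b \<in> NA" using fusion[OF r(1) rA UA(1) bB(2) UA(2)] by blast
  have CnNA: "\<not> centraliser G U \<subseteq> NA"
  proof
    assume "centraliser G U \<subseteq> NA"
    then have "c * (gi c * b) \<in> NA" using c fNA(1) by (blast intro: fsub_mult)
    then show False using bNA by simp
  qed
  let ?W = "centraliser NA U"
  have fW: "fsub ?W" "?W \<subseteq> NA" using fsub_centraliser[OF fNA(1)] centraliser_subset by auto
  have "\<exists>q x. prime q \<and> q dvd card B \<and> x \<in> ?W \<and> x \<noteq> 1 \<and> p_elt q x"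
  proof (rule ccontr)
    assume none: "\<not> ?thesis"
    have "?W \<subseteq> A"
    proof (rule pi_sub_in_A[OF fW(1)])
      show "?W \<subseteq> G" using fW fNA by blast
      fix p :: nat assume p: "prime p" "p dvd card G"
      show "\<exists>Q. syl p ?W Q \<and> Q \<subseteq> A"
      proof (rule syl_in_A_if_p_elts[OF fW(1) p(1)])
        fix x assume x: "x \<in> ?W" "p_elt p x"
        show "x \<in> A"
        proof (cases "p dvd card A")
          case True
          have s: "syl p NA (p_part p A)"
            using syl_sub[OF p(1) fG sylA[OF p(1) True] fNA(1) _ fNA(3)] p_part_subset fNA(2) by blast
          have "p_part p A = p_part p NA" using syl_normal_unique[OF p(1) fNA(1) s over_normal[OF fNA p(1) True]] .
          then show ?thesis using x fW by (auto simp: p_part_def)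
        next
          case False
          then show ?thesis using dvd_cardG[OF p] none x p fA by (metis fsub_one)
        qed
      qed
    qed
    then show False using centraliser_in_NA[OF r(1) rA fU UA(1) U1] CnNA by blast
  qed
  then obtain q x where q: "prime q" "q dvd card B" and x: "x \<in> ?W" "x \<noteq> 1" "p_elt q x" by blast
  define E where "E = NA \<inter> p_part q B"
  have sE: "syl q NA E" unfolding E_def by (rule over_syl[OF fNA(1-3) q])
  have fE: "fsub E" using sE by (rule syl_fsub)
  have EB: "E \<subseteq> B" "E \<subseteq> NA" by (auto simp: E_def p_part_def)
  let ?N = "normaliser NA U"
  have fN: "fsub ?N" "?N \<subseteq> NA" using fsub_normaliser[OF fNA(1)] normaliser_subset by auto
  \<comment> \<open>E lies in \<open>NA\<close>, which normalises A_r, and commutes with b, so it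
    normalises both members of the intersection U.\<close>
  have EN: "E \<subseteq> ?N"
  proof
    fix e assume e: "e \<in> E"
    have 1: "cj e ` p_part r A = p_part r A" using NA_cj_part[OF r(1)] e EB by blast
    have "e * b = b * e" using b(3) e EB by (metis subsetD)
    then have "cj e ` cj b ` p_part r A = cj b ` cj e ` p_part r A" by (simp only: cj_image_cj)
    then have 2: "cj e ` cj b ` p_part r A = cj b ` p_part r A" using 1 by simp
    have "cj e ` U = U" unfolding U_def by (simp only: image_Int[OF inj_cj[of e UNIV, simplified]] 1 2)
    then show "e \<in> ?N" using e EB by (auto simp: normaliser_def)
  qed
  have sEN: "syl q ?N E" using syl_sub[OF q(1) fNA(1) sE fN(1) EN fN(2)] .
  \<comment> \<open>A Sylow q-subgroup of the centraliser of U in \<open>NA\<close>, nontrivial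
    because of x. As U centralises X, \<open>normaliser_sub_swap\<close> puts U in the normaliser of
    B.\<close>
  define X where "X = ?W \<inter> E"
  have nW: "normal_in ?W ?N" by (rule normal_centraliser_normaliser[OF fNA(1)])
  have sX: "syl q ?W X" unfolding X_def by (rule syl_normal_Int[OF q(1) fN(1) nW sEN])
  have X1: "X \<noteq> {1}"
  proof
    assume "X = {1}"
    obtain Q where Q: "syl q ?W Q" "x \<in> Q" using p_elt_in_syl[OF q(1) fW(1) x(1,3)] by blast
    have "card Q = 1" using Q(1) sX \<open>X = {1}\<close> by (simp add: syl_def)
    then show False using Q(2) x(2) fsub_card1[OF syl_fsub[OF Q(1)]] by simp
  qed
  have X: "fsub X" "X \<subseteq> NA" "X \<subseteq> p_part q B" using sX syl_fsub EB by (auto simp: X_def E_def)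
  have "U \<subseteq> centraliser G X" using UA(1) partA(3)[of r] by (auto simp: X_def centraliser_def)
  then have UK: "U \<subseteq> sw.NA"
    using centraliser_in_normaliser[of G X] normaliser_sub_swap[OF q X X1] by (auto simp: sw.NA_def)
  have "b \<in> centraliser G U"
  proof -
    have "b * u = u * b" if u: "u \<in> U" for u
    proof -
      have uA: "u \<in> A" "u \<in> cj b ` A" using u UA p_part_subset by blast+
      \<comment> \<open>A commutator of b and u. It is in A because u lies in A and in its conjugate
        by b, and in B because u normalises B; hence it is 1.\<close>
      have 1: "cj (gi b) u * gi u \<in> A" using uA fA by (auto intro: fsub_mult)
      have "cj u b \<in> B" using UK u bB(1) by (auto simp: sw.NA_def normaliser_def)
      moreover have "cj (gi b) u * gi u = gi b * cj u b" by (simp add: cj_def mult.assoc)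
      ultimately have "cj (gi b) u * gi u \<in> B" using bB(1) fB by (simp add: fsub_mult)
      then have "cj (gi b) u * gi u = 1" using 1 AB_triv by blast
      then have "cj (gi b) u = u" by (metis gi_left mult.assoc mult_1_left mult_1_right)
      then have "cj b (cj (gi b) u) = cj b u" by simp
      then have "cj b u = u" by simp
      then show ?thesis by (simp add: cj_eq_self_iff)
    qed
    then show ?thesis using bB by (simp add: centraliser_def)
  qed
  then have "b \<in> normaliser G U" using centraliser_in_normaliser by blast
  then have "b \<in> NA" using sw.normaliser_sub_swap[OF r(1) rA fU UK UA(1) U1] by (auto simp: NA_def)
  then show False using bNA by blast
qed

end

lemma coprime_nilp_product_absurd: "\<not> coprime_nilp_product G A B"
proof
  assume "coprime_nilp_product G A B"
  then interpret coprime_nilp_product G A B .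
  interpret sw: coprime_nilp_product G B A by (rule swap)
  have "card A = card B" using card_le sw.card_le by simp
  moreover obtain t where "prime t" "t dvd card A" using twoA by blast
  ultimately show False using not_both by metis
qed

section \<open>Algebraic integers and complex matrices\<close>

text \<open>The polynomial is the characteristic polynomial. Allowing an arbitrary finite index set
  confines the passage of integer matrices to \<open>mat\<close> to this proof.\<close>

lemma int_matrix_poly:
  fixes M :: "'i \<Rightarrow> 'i \<Rightarrow> int"
  assumes I: "finite I"
  shows "\<exists>p::int poly. lead_coeff p = 1 \<and> (\<forall>\<mu>::complex. poly (map_poly of_int p) \<mu> = 0 \<longleftrightarrow>
    (\<exists>v. (\<exists>i\<in>I. v i \<noteq> 0) \<and> (\<forall>i\<in>I. \<mu> * v i = (\<Sum>j\<in>I. of_int (M i j) * v j))))"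
proof -
  define n where "n = card I"
  obtain e where e: "bij_betw e {..<n} I" using ex_bij_betw_nat_finite[OF I] by (auto simp: n_def atLeast0LessThan)
  define f where "f = the_inv_into {..<n} e"
  have fe: "f (e i) = i" if "i < n" for i using e that by (simp add: f_def bij_betw_def the_inv_into_f_f)
  have ef: "e (f x) = x" "f x < n" if "x \<in> I" for x
    using e that by (auto simp: f_def bij_betw_def f_the_inv_into_f dest: the_inv_into_into[of e "{..<n}" x "{..<n}"])
  define A where "A = mat n n (\<lambda>(i, j). M (e i) (e j))"
  have A: "A \<in> carrier_mat n n" by (simp add: A_def)
  let ?C = "map_mat of_int A :: complex mat"
  have C: "?C \<in> carrier_mat n n" using A by simp
  have ev: "eigenvalue ?C \<mu> \<longleftrightarrow> (\<exists>v. (\<exists>i\<in>I. v i \<noteq> 0) \<and> (\<forall>i\<in>I. \<mu> * v i = (\<Sum>j\<in>I. of_int (M i j) * v j)))" (is "_ \<longleftrightarrow> ?R") for \<mu>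
  proof
    have sums: "(\<Sum>j\<in>I. of_int (M i j) * v j) = (\<Sum>j<n. of_int (M i (e j)) * v (e j))" for i and v :: "'i \<Rightarrow> complex"
      by (rule sum.reindex_bij_betw[OF e, symmetric])
    {
      assume "eigenvalue ?C \<mu>"
      then obtain v where v: "v \<in> carrier_vec n" "v \<noteq> 0\<^sub>v n" "?C *\<^sub>v v = \<mu> \<cdot>\<^sub>v v"
        using A by (auto simp: eigenvalue_def eigenvector_def)
      have "\<exists>k<n. v $ k \<noteq> 0"
      proof (rule ccontr)
        assume "\<not> ?thesis"
        then have "v = 0\<^sub>v n" using v(1) by (intro eq_vecI) auto
        then show False using v by simp
      qed
      then obtain k where k: "k < n" "v $ k \<noteq> 0" by blast
      let ?v = "\<lambda>x. v $ f x"
      have "\<mu> * ?v i = (\<Sum>j\<in>I. of_int (M i j) * ?v j)" if i: "i \<in> I" for i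
      proof -
        have "\<mu> * v $ f i = (?C *\<^sub>v v) $ f i" using v ef[OF i] by simp
        also have "\<dots> = (\<Sum>j<n. of_int (M (e (f i)) (e j)) * v $ j)"
          using v(1) A ef[OF i] by (auto simp: A_def scalar_prod_def atLeast0LessThan intro!: sum.cong)
        also have "\<dots> = (\<Sum>j\<in>I. of_int (M i j) * ?v j)" unfolding sums using ef[OF i] by (auto simp: fe intro!: sum.cong)
        finally show ?thesis .
      qed
      moreover have "e k \<in> I" using e k by (auto simp: bij_betw_def)
      ultimately show ?R using k fe by (intro exI[of _ ?v] conjI bexI[of _ "e k"] ballI) simp_all
    }
    {
      assume ?R
      then obtain v where v: "\<exists>i\<in>I. v i \<noteq> 0" "\<And>i. i \<in> I \<Longrightarrow> \<mu> * v i = (\<Sum>j\<in>I. of_int (M i j) * v j)" by blast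
      let ?v = "vec n (\<lambda>k. v (e k))"
      have "?v \<noteq> 0\<^sub>v n"
      proof
        assume z: "?v = 0\<^sub>v n"
        obtain i where i: "i \<in> I" "v i \<noteq> 0" using v by blast
        have "?v $ f i = 0" using z ef[OF i(1)] by simp
        then show False using i ef[OF i(1)] by simp
      qed
      moreover have "?C *\<^sub>v ?v = \<mu> \<cdot>\<^sub>v ?v"
      proof (rule eq_vecI)
        fix k assume "k < dim_vec (\<mu> \<cdot>\<^sub>v ?v)"
        then have k: "k < n" by simp
        have "e k \<in> I" using e k by (auto simp: bij_betw_def)
        have "(?C *\<^sub>v ?v) $ k = (\<Sum>j<n. of_int (M (e k) (e j)) * v (e j))"
          using A k by (auto simp: A_def scalar_prod_def atLeast0LessThan intro!: sum.cong)
        also have "\<dots> = \<mu> * v (e k)" using v(2)[OF \<open>e k \<in> I\<close>] unfolding sums by simp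
        finally show "(?C *\<^sub>v ?v) $ k = (\<mu> \<cdot>\<^sub>v ?v) $ k" using k by simp
      qed (use A in simp)
      ultimately show "eigenvalue ?C \<mu>" unfolding eigenvalue_def eigenvector_def using A by (intro exI[of _ ?v]) auto
    }
  qed
  have "poly (map_poly of_int (char_poly A)) \<mu> = 0 \<longleftrightarrow> eigenvalue ?C \<mu>" for \<mu> :: complex
    unfolding eigenvalue_root_char_poly[OF C] of_int_hom.char_poly_hom[OF A] ..
  then show ?thesis using ev degree_monic_char_poly[OF A] by (intro exI[of _ "char_poly A"]) auto
qed

lemma algebraic_int_eigenvalue:
  fixes b :: "'i \<Rightarrow> complex"
  assumes "finite I" "i0 \<in> I" "b i0 \<noteq> 0" "\<And>i. i \<in> I \<Longrightarrow> \<alpha> * b i = (\<Sum>j\<in>I. of_int (M i j) * b j)"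
  shows "algebraic_int \<alpha>"
proof -
  obtain p :: "int poly" where "lead_coeff p = 1" "poly (map_poly of_int p) \<alpha> = 0"
    using int_matrix_poly[OF assms(1), of M] assms(2-) by blast
  then show ?thesis by (auto simp: algebraic_int_altdef_ipoly)
qed

text \<open>\<open>M\<close> is the companion matrix of a monic equation; its last row expresses x^n
  by lower powers.\<close>

lemma algebraic_int_companion:
  assumes "algebraic_int (x::complex)"
  shows "\<exists>n>0. \<exists>M::nat \<Rightarrow> nat \<Rightarrow> int. \<forall>i<n. x * x ^ i = (\<Sum>j<n. of_int (M i j) * x ^ j)"
proof -
  obtain p :: "int poly" where p: "lead_coeff p = 1" "poly (map_poly of_int p) x = 0" using assms by (auto simp: algebraic_int_altdef_ipoly)
  define n where "n = degree p"
  have d: "degree (map_poly complex_of_int p) = n" by (simp add: n_def degree_map_poly)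
  have s: "(\<Sum>i\<le>n. of_int (coeff p i) * x ^ i) = 0"
    using p(2) unfolding poly_altdef d by (simp add: coeff_map_poly)
  have n0: "n > 0"
  proof (rule ccontr)
    assume "\<not> n > 0"
    then have "n = 0" by simp
    then have "of_int (coeff p 0) = (0::complex)" using s by simp
    then show False using p(1) \<open>n = 0\<close> by (simp add: n_def)
  qed
  have xn: "x ^ n = (\<Sum>j<n. of_int (- coeff p j) * x ^ j)"
  proof -
    have "(\<Sum>i<n. of_int (coeff p i) * x ^ i) + x ^ n = 0"
      using s p(1) by (simp add: n_def flip: lessThan_Suc_atMost)
    then show ?thesis by (simp add: sum_negf eq_neg_iff_add_eq_0 add.commute)
  qed
  define M :: "nat \<Rightarrow> nat \<Rightarrow> int" where "M i j = (if Suc i < n then (if j = Suc i then 1 else 0) else - coeff p j)" for i j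
  have "x * x ^ i = (\<Sum>j<n. of_int (M i j) * x ^ j)" if i: "i < n" for i
  proof (cases "Suc i < n")
    case True
    have "(\<Sum>j<n. of_int (M i j) * x ^ j) = (\<Sum>j<n. if j = Suc i then x ^ j else 0)"
      using True by (intro sum.cong) (auto simp: M_def)
    also have "\<dots> = x ^ Suc i" using True by (simp add: sum.delta)
    finally show ?thesis by simp
  next
    case False
    then have "Suc i = n" using i by simp
    have "(\<Sum>j<n. of_int (M i j) * x ^ j) = (\<Sum>j<n. of_int (- coeff p j) * x ^ j)"
      using False by (intro sum.cong) (simp_all add: M_def)
    also have "\<dots> = x ^ Suc i" using xn \<open>Suc i = n\<close> by simp
    finally show ?thesis by simp
  qed
  then show ?thesis using n0 by blast
qed

text \<open>The vector of all x^i y^k is an eigenvector of the Kronecker product of the two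
  companion matrices for the eigenvalue x y, and of their Kronecker sum for x + y.\<close>

lemma algebraic_int_add_mult:
  assumes "algebraic_int (x::complex)" "algebraic_int y"
  shows "algebraic_int (x + y)" "algebraic_int (x * y)"
proof -
  obtain n M where n: "n > 0" and M: "\<And>i. i < n \<Longrightarrow> x * x ^ i = (\<Sum>j<n. of_int (M i j) * x ^ j)"
    using algebraic_int_companion[OF assms(1)] by blast
  obtain m N where m: "m > 0" and N: "\<And>i. i < m \<Longrightarrow> y * y ^ i = (\<Sum>j<m. of_int (N i j) * y ^ j)"
    using algebraic_int_companion[OF assms(2)] by blast
  let ?I = "{..<n} \<times> {..<m}" and ?b = "\<lambda>(i, k). x ^ i * y ^ k"
  have zero: "(0, 0) \<in> ?I" "?b (0, 0) \<noteq> 0" using n m by auto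
  have prodsum: "(\<Sum>j<n. f j) * (\<Sum>l<m. g l) = (\<Sum>(j, l)\<in>?I. f j * g l)" for f g :: "nat \<Rightarrow> complex"
    by (simp add: sum_product sum.cartesian_product)
  have pw: "x ^ i = (\<Sum>j<n. (if j = i then 1 else 0) * x ^ j)" if "i < n" for i
  proof -
    have "(\<Sum>j<n. (if j = i then 1 else 0) * x ^ j) = (\<Sum>j<n. if j = i then x ^ j else 0)" by (intro sum.cong) auto
    then show ?thesis using that by (simp add: sum.delta)
  qed
  have pw': "y ^ i = (\<Sum>j<m. (if j = i then 1 else 0) * y ^ j)" if "i < m" for i
  proof -
    have "(\<Sum>j<m. (if j = i then 1 else 0) * y ^ j) = (\<Sum>j<m. if j = i then y ^ j else 0)" by (intro sum.cong) auto
    then show ?thesis using that by (simp add: sum.delta)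
  qed
  show "algebraic_int (x * y)"
  proof (rule algebraic_int_eigenvalue[where I="?I" and b="?b" and ?i0.0="(0, 0)" and M="\<lambda>p q. M (fst p) (fst q) * N (snd p) (snd q)"])
    fix p assume "p \<in> ?I"
    then obtain i k where p: "p = (i, k)" "i < n" "k < m" by auto
    have "x * y * ?b p = (x * x ^ i) * (y * y ^ k)" by (simp add: p)
    also have "\<dots> = (\<Sum>(j, l)\<in>?I. (of_int (M i j) * x ^ j) * (of_int (N k l) * y ^ l))"
      unfolding M[OF p(2)] N[OF p(3)] by (rule prodsum)
    finally show "x * y * ?b p = (\<Sum>q\<in>?I. of_int (M (fst p) (fst q) * N (snd p) (snd q)) * ?b q)"
      by (simp add: p case_prod_unfold mult_ac)
  qed (use zero in simp_all)
  show "algebraic_int (x + y)"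
  proof (rule algebraic_int_eigenvalue[where I="?I" and b="?b" and ?i0.0="(0, 0)" and M="\<lambda>p q. M (fst p) (fst q) * (if snd q = snd p then 1 else 0) + (if fst q = fst p then 1 else 0) * N (snd p) (snd q)"])
    fix p assume "p \<in> ?I"
    then obtain i k where p: "p = (i, k)" "i < n" "k < m" by auto
    have "(x + y) * ?b p = (x * x ^ i) * y ^ k + x ^ i * (y * y ^ k)" by (simp add: p algebra_simps)
    also have "(x * x ^ i) * y ^ k = (\<Sum>(j, l)\<in>?I. (of_int (M i j) * x ^ j) * ((if l = k then 1 else 0) * y ^ l))"
      unfolding M[OF p(2)] pw'[OF p(3)] by (rule prodsum)
    also have "x ^ i * (y * y ^ k) = (\<Sum>(j, l)\<in>?I. ((if j = i then 1 else 0) * x ^ j) * (of_int (N k l) * y ^ l))"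
      unfolding N[OF p(3)] pw[OF p(2)] by (rule prodsum)
    finally show "(x + y) * ?b p = (\<Sum>q\<in>?I. of_int (M (fst p) (fst q) * (if snd q = snd p then 1 else 0) + (if fst q = fst p then 1 else 0) * N (snd p) (snd q)) * ?b q)"
      unfolding sum.distrib[symmetric] by (simp add: p case_prod_unfold algebra_simps if_distrib[of "of_int"] cong: if_cong)
  qed (use zero in simp_all)
qed

lemma algebraic_int_sum: "(\<And>x. x \<in> S \<Longrightarrow> algebraic_int (f x :: complex)) \<Longrightarrow> algebraic_int (sum f S)"
  by (induction S rule: infinite_finite_induct) (auto intro: algebraic_int_add_mult)

lemma prod_norm_lt_one:
  fixes xs :: "complex list"
  assumes "\<And>x. x \<in> set xs \<Longrightarrow> norm x \<le> 1" "a \<in> set xs" "norm a < 1"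
  shows "norm (prod_list xs) < 1"
  using assms
proof (induction xs)
  case (Cons y ys)
  have le: "norm (prod_list ys) \<le> 1"
    using Cons.prems(1)
  proof (induction ys)
    case (Cons b bs)
    then have "norm b \<le> 1" "norm (prod_list bs) \<le> 1" by auto
    then show ?case by (simp add: norm_mult mult_le_one)
  qed simp
  show ?case
  proof (cases "a = y")
    case True
    have "norm y * norm (prod_list ys) \<le> norm y * 1" using le by (intro mult_left_mono) auto
    then show ?thesis using True Cons.prems(3) by (simp add: norm_mult)
  next
    case False
    then have "norm (prod_list ys) < 1" using Cons by auto
    moreover have "norm y \<le> 1" using Cons.prems(1) by simp
    ultimately have "norm y * norm (prod_list ys) < 1"
      by (metis mult_left_le_one_le norm_ge_zero order_le_less_trans)
    then show ?thesis by (simp add: norm_mult)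
  qed
qed simp

text \<open>All conjugates of \<open>\<alpha>\<close> are among the roots of \<open>g\<close>, so the constant coefficient of its minimal polynomial
  has absolute value below one and hence vanishes.\<close>

lemma algebraic_int_small_zero:
  fixes g :: "int poly"
  assumes \<alpha>: "algebraic_int (\<alpha>::complex)" and g: "g \<noteq> 0" "poly (map_poly of_int g) \<alpha> = 0"
    and roots: "\<And>\<mu>::complex. poly (map_poly of_int g) \<mu> = 0 \<Longrightarrow> norm \<mu> \<le> 1" and small: "norm \<alpha> < 1"
  shows "\<alpha> = 0"
proof (rule ccontr)
  assume a0: "\<alpha> \<noteq> 0"
  let ?c = "map_poly complex_of_int"
  obtain f :: "int poly" where f: "lead_coeff f = 1" "poly (?c f) \<alpha> = 0" using \<alpha> by (auto simp: algebraic_int_altdef_ipoly)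
  define P where "P h \<longleftrightarrow> h \<noteq> 0 \<and> poly (?c h) \<alpha> = 0" for h :: "int poly"
  have "P g" using g by (simp add: P_def)
  then obtain h0 where h0: "P h0" and mn: "\<And>k. P k \<Longrightarrow> degree h0 \<le> degree k"
    using ex_has_least_nat[of P g degree] by blast
  \<comment> \<open>A primitive integer polynomial of least degree with root alpha, that is, its
    minimal polynomial up to a constant factor.\<close>
  define h where "h = primitive_part h0"
  have h0h: "h0 = smult (content h0) h" by (simp add: h_def)
  have c0: "content h0 \<noteq> 0" using h0 by (simp add: P_def)
  have "poly (?c h0) \<alpha> = of_int (content h0) * poly (?c h) \<alpha>" by (subst h0h) (simp add: of_int_hom.map_poly_hom_smult)
  then have Ph: "P h" using h0 c0 by (auto simp: P_def h_def)
  have dh: "degree h = degree h0" by (simp add: h_def)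
  have cont: "content h = 1" using h0 by (simp add: h_def P_def)
  have dvd: "\<exists>a q. a \<noteq> 0 \<and> smult a k = h * q" if k: "poly (?c k) \<alpha> = 0" for k
  proof -
    obtain a q where aq: "a \<noteq> 0" "smult a k = h * q + pseudo_mod k h" and d: "pseudo_mod k h = 0 \<or> degree (pseudo_mod k h) < degree h"
      using pseudo_mod[of h k] Ph by (auto simp: P_def)
    have "poly (?c (smult a k)) \<alpha> = 0" using k by (simp add: map_poly_smult)
    then have "poly (?c (h * q) + ?c (pseudo_mod k h)) \<alpha> = 0" unfolding aq(2) by (simp add: of_int_poly_hom.hom_add)
    then have "poly (?c (pseudo_mod k h)) \<alpha> = 0" using Ph by (simp add: of_int_poly_hom.hom_mult P_def)
    then have "pseudo_mod k h = 0" using mn[of "pseudo_mod k h"] d dh by (metis P_def not_le)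
    then show ?thesis using aq by auto
  qed
  \<comment> \<open>By Gauss's lemma on contents, h divides the monic f over the integers, so its
    leading coefficient is a unit.\<close>
  have lch: "lead_coeff h dvd 1"
  proof -
    obtain a q where aq: "a \<noteq> 0" "smult a f = h * q" using dvd[OF f(2)] by blast
    have "content f dvd lead_coeff f" by (rule content_dvd_coeff)
    then have cf: "content f = 1" using f(1) by (metis is_unit_content_iff content_dvd_coeff)
    have "content q = \<bar>a\<bar>"
    proof -
      have "content (smult a f) = content (h * q)" by (simp add: aq)
      then show ?thesis using cf cont by (simp add: content_mult)
    qed
    then have q: "q = smult \<bar>a\<bar> (primitive_part q)" by (metis content_times_primitive_part)
    have lq: "lead_coeff q = \<bar>a\<bar> * lead_coeff (primitive_part q)" using arg_cong[OF q, of lead_coeff] by (simp only: lead_coeff_smult)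
    have "lead_coeff (smult a f) = lead_coeff (h * q)" by (simp only: aq)
    then have "a * lead_coeff f = lead_coeff h * (\<bar>a\<bar> * lead_coeff (primitive_part q))"
      by (simp only: lead_coeff_mult lead_coeff_smult lq)
    then have "a = lead_coeff h * (\<bar>a\<bar> * lead_coeff (primitive_part q))" using f(1) by simp
    then have "\<bar>a\<bar> = \<bar>a\<bar> * \<bar>lead_coeff h * lead_coeff (primitive_part q)\<bar>" by (metis abs_abs abs_mult mult.left_commute)
    then have "\<bar>lead_coeff h * lead_coeff (primitive_part q)\<bar> = 1" using aq(1) by simp
    then show ?thesis by (metis dvd_abs_iff dvd_triv_left)
  qed
  then have lc1: "\<bar>lead_coeff h\<bar> = 1" by (metis zdvd1_eq)
  obtain a q where aq: "a \<noteq> 0" "smult a g = h * q" using dvd[OF g(2)] by blast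
  have hroot: "norm \<mu> \<le> 1" if "poly (?c h) \<mu> = 0" for \<mu>
  proof -
    have "poly (?c (smult a g)) \<mu> = 0" unfolding aq(2) using that by (simp add: of_int_poly_hom.hom_mult)
    then have "poly (?c g) \<mu> = 0" using aq(1) by (simp add: map_poly_smult)
    then show ?thesis by (rule roots)
  qed
  obtain as where as: "smult (lead_coeff (?c h)) (\<Prod>a\<leftarrow>as. [:- a, 1:]) = ?c h"
    using fundamental_theorem_algebra_factorized[of "?c h"] by auto
  have nz: "?c h \<noteq> 0" using Ph by (simp add: P_def)
  have pol: "poly (?c h) x = lead_coeff (?c h) * (\<Prod>a\<leftarrow>as. x - a)" for x
    by (subst as[symmetric]) (simp add: poly_prod_list o_def)
  have lcc: "lead_coeff (?c h) = of_int (lead_coeff h)" by (simp add: degree_map_poly coeff_map_poly)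
  have lcn: "norm (lead_coeff (?c h)) = 1" unfolding lcc using lc1 by (metis norm_of_int of_int_1 of_int_abs)
  have root_iff: "poly (?c h) x = 0 \<longleftrightarrow> x \<in> set as" for x
    unfolding pol using lcn by (auto simp: prod_list_zero_iff)
  \<comment> \<open>The constant coefficient is up to sign the product of the roots, all of modulus
    at most 1 and one of them, alpha, smaller. Being an integer, it is 0, so h has the variable as a
    factor, against minimality of its degree.\<close>
  have "norm (prod_list (map (\<lambda>a. 0 - a) as)) < 1"
  proof (rule prod_norm_lt_one)
    show "norm x \<le> 1" if "x \<in> set (map (\<lambda>a. 0 - a) as)" for x using that hroot root_iff by auto
    show "- \<alpha> \<in> set (map (\<lambda>a. 0 - a) as)" using Ph root_iff by (auto simp: P_def)
  qed (use small in simp)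
  then have "norm (poly (?c h) 0) < 1" by (simp only: pol norm_mult lcn mult_1_left)
  moreover have "poly (?c h) 0 = of_int (coeff h 0)" by (simp add: poly_0_coeff_0 coeff_map_poly)
  ultimately have "coeff h 0 = 0" by (simp only: norm_of_int)
  then have "poly h 0 = 0" by (simp add: poly_0_coeff_0)
  then obtain k where k: "h = [:0, 1:] * k" by (metis dvdE minus_zero poly_eq_0_iff_dvd)
  have "k \<noteq> 0" using k Ph by (auto simp: P_def)
  have "poly (?c h) \<alpha> = \<alpha> * poly (?c k) \<alpha>" unfolding k by (simp add: of_int_hom.map_poly_pCons_hom)
  then have "P k" using Ph a0 \<open>k \<noteq> 0\<close> by (auto simp: P_def)
  then have "degree h \<le> degree k" using mn dh by simp
  moreover have "degree h = Suc (degree k)" unfolding k using \<open>k \<noteq> 0\<close> by (subst degree_mult_eq) auto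
  ultimately show False by simp
qed

text \<open>By the bound on row sums every eigenvalue of M has modulus at most N. Substituting N x
  in the characteristic polynomial gives an integer polynomial with all roots in the unit disc,
  alpha among them, as \<open>algebraic_int_small_zero\<close> requires.\<close>

lemma stochastic_eigenvalue:
  fixes M :: "'i \<Rightarrow> 'i \<Rightarrow> int"
  assumes I: "finite I" and N: "N > 0" and rows: "\<And>i. i \<in> I \<Longrightarrow> (\<Sum>j\<in>I. \<bar>M i j\<bar>) \<le> int N"
    and v: "i0 \<in> I" "v i0 \<noteq> (0::complex)" "\<And>i. i \<in> I \<Longrightarrow> of_nat N * \<alpha> * v i = (\<Sum>j\<in>I. of_int (M i j) * v j)"
    and alg: "algebraic_int \<alpha>" and small: "norm \<alpha> < 1"
  shows "\<alpha> = 0"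
proof -
  obtain p :: "int poly" where p: "lead_coeff p = 1" and root: "\<And>\<mu>::complex. poly (map_poly of_int p) \<mu> = 0 \<longleftrightarrow>
    (\<exists>v. (\<exists>i\<in>I. v i \<noteq> 0) \<and> (\<forall>i\<in>I. \<mu> * v i = (\<Sum>j\<in>I. of_int (M i j) * v j)))"
    using int_matrix_poly[OF I, of M] by blast
  have bound: "norm \<mu> \<le> of_nat N" if \<mu>: "poly (map_poly of_int p) \<mu> = 0" for \<mu> :: complex
  proof -
    obtain w where w: "\<exists>i\<in>I. w i \<noteq> 0" "\<And>i. i \<in> I \<Longrightarrow> \<mu> * w i = (\<Sum>j\<in>I. of_int (M i j) * w j)"
      using root[of \<mu>] \<mu> by blast
    have ne: "(\<lambda>i. norm (w i)) ` I \<noteq> {}" "finite ((\<lambda>i. norm (w i)) ` I)" using w(1) I by auto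
    obtain m where m: "m \<in> I" "norm (w m) = Max ((\<lambda>i. norm (w i)) ` I)" using Max_in[OF ne(2,1)] by auto
    have mx: "norm (w i) \<le> norm (w m)" if "i \<in> I" for i using Max_ge[OF ne(2), of "norm (w i)"] that m(2) by simp
    obtain i1 where i1: "i1 \<in> I" "w i1 \<noteq> 0" using w(1) by blast
    have pos: "norm (w m) > 0" using mx[OF i1(1)] i1(2) by (metis norm_le_zero_iff not_le order_trans)
    have "norm \<mu> * norm (w m) = norm (\<Sum>j\<in>I. of_int (M m j) * w j)" using w(2)[OF m(1)] by (simp flip: norm_mult)
    also have "\<dots> \<le> (\<Sum>j\<in>I. norm (of_int (M m j) * w j))" by (rule norm_sum)
    also have "\<dots> \<le> (\<Sum>j\<in>I. of_int \<bar>M m j\<bar> * norm (w m))"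
      by (rule sum_mono) (auto simp: norm_mult intro!: mult_left_mono mx)
    also have "\<dots> = of_int (\<Sum>j\<in>I. \<bar>M m j\<bar>) * norm (w m)" by (simp add: sum_distrib_right)
    also have "\<dots> \<le> of_nat N * norm (w m)"
    proof (rule mult_right_mono)
      have "of_int (\<Sum>j\<in>I. \<bar>M m j\<bar>) \<le> (of_int (int N) :: real)" using rows[OF m(1)] by (simp only: of_int_le_iff)
      then show "of_int (\<Sum>j\<in>I. \<bar>M m j\<bar>) \<le> (of_nat N :: real)" by simp
    qed simp
    finally show ?thesis using pos by simp
  qed
  define g where "g = pcompose p [:0, int N:]"
  have pg: "poly (map_poly of_int g) \<mu> = poly (map_poly of_int p) (of_nat N * \<mu>)" for \<mu> :: complex
    by (simp add: g_def of_int_hom.map_poly_pcompose of_int_hom.map_poly_pCons_hom poly_pcompose mult.commute)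
  show ?thesis
  proof (rule algebraic_int_small_zero[OF alg, of g])
    show "g \<noteq> 0" unfolding g_def using p N by (auto simp: pcompose_eq_0_iff)
    show "poly (map_poly of_int g) \<alpha> = 0" unfolding pg root using v by (auto intro!: exI[of _ v])
    show "norm \<mu> \<le> 1" if "poly (map_poly of_int g) \<mu> = 0" for \<mu> :: complex
      using bound[of "of_nat N * \<mu>"] that N unfolding pg by (simp add: norm_mult)
  qed (rule small)
qed

section \<open>Upper triangular form\<close>

lemma complex_triangularise:
  assumes A: "(A :: complex mat) \<in> carrier_mat n n"
  shows "\<exists>B P Q. B \<in> carrier_mat n n \<and> P \<in> carrier_mat n n \<and> Q \<in> carrier_mat n n \<and> upper_triangular B \<and>
    P * Q = 1\<^sub>m n \<and> Q * P = 1\<^sub>m n \<and> A = P * B * Q"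
proof -
  obtain es where "char_poly A = (\<Prod>a\<leftarrow>es. [:- a, 1:])" using char_poly_factorized[OF A] by blast
  then obtain B where B: "B \<in> carrier_mat n n" "upper_triangular B" "similar_mat A B"
    using schur_decomposition_exists[OF A] by blast
  obtain P Q where "similar_mat_wit A B P Q" using B(3) by (auto simp: similar_mat_def)
  from similar_mat_witD2[OF A this] show ?thesis using B by blast
qed

definition mtrace :: "complex mat \<Rightarrow> complex" where "mtrace A = (\<Sum>i<dim_row A. A $$ (i, i))"

lemma mtrace_comm:
  assumes "A \<in> carrier_mat n n" "B \<in> carrier_mat n n" shows "mtrace (A * B) = mtrace (B * A)"
proof -
  have "mtrace (A * B) = (\<Sum>i<n. \<Sum>j<n. A $$ (i, j) * B $$ (j, i))"
    using assms by (auto simp: mtrace_def scalar_prod_def atLeast0LessThan intro!: sum.cong)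
  also have "\<dots> = (\<Sum>j<n. \<Sum>i<n. B $$ (j, i) * A $$ (i, j))" by (subst sum.swap) (simp add: mult.commute)
  also have "\<dots> = mtrace (B * A)"
    using assms by (auto simp: mtrace_def scalar_prod_def atLeast0LessThan intro!: sum.cong)
  finally show ?thesis .
qed

lemma upper_triangular_mult_entry:
  assumes "B \<in> carrier_mat n n" "C \<in> carrier_mat n n" "upper_triangular B" "upper_triangular C" "i < n" "j < n"
  shows "(B * C) $$ (i, j) = (\<Sum>k\<in>{i..j}. B $$ (i, k) * C $$ (k, j))"
proof -
  have "(B * C) $$ (i, j) = (\<Sum>k<n. B $$ (i, k) * C $$ (k, j))"
    using assms by (auto simp: scalar_prod_def atLeast0LessThan intro!: sum.cong)
  also have "\<dots> = (\<Sum>k\<in>{i..j}. B $$ (i, k) * C $$ (k, j))"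
  proof (rule sum.mono_neutral_right)
    show "\<forall>k\<in>{..<n} - {i..j}. B $$ (i, k) * C $$ (k, j) = 0"
    proof
      fix k assume "k \<in> {..<n} - {i..j}"
      then have "k < n" "k < i \<or> j < k" by auto
      then show "B $$ (i, k) * C $$ (k, j) = 0" using assms upper_triangularD[of B] upper_triangularD[of C] by auto
    qed
  qed (use assms in auto)
  finally show ?thesis .
qed

lemma upper_triangular_mult:
  assumes "B \<in> carrier_mat n n" "C \<in> carrier_mat n n" "upper_triangular B" "upper_triangular C"
  shows "upper_triangular (B * C)"
proof (rule upper_triangularI)
  fix i j assume "j < i" "i < dim_row (B * C)"
  then show "(B * C) $$ (i, j) = 0" using assms upper_triangular_mult_entry[OF assms, of i j] by simp
qed

lemma upper_triangular_pow_diag: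
  assumes "B \<in> carrier_mat n n" "upper_triangular B"
  shows "upper_triangular (B ^\<^sub>m k) \<and> (\<forall>i<n. (B ^\<^sub>m k) $$ (i, i) = B $$ (i, i) ^ k)"
proof (induction k)
  case 0
  then show ?case using assms by (auto intro!: upper_triangularI)
next
  case (Suc k)
  have c: "B ^\<^sub>m k \<in> carrier_mat n n" using assms by (simp add: pow_carrier_mat)
  have ut: "upper_triangular (B ^\<^sub>m k)" and d: "\<forall>i<n. (B ^\<^sub>m k) $$ (i, i) = B $$ (i, i) ^ k" using Suc by blast+
  have "(B ^\<^sub>m Suc k) $$ (i, i) = B $$ (i, i) ^ Suc k" if "i < n" for i
    using upper_triangular_mult_entry[OF c assms(1) ut assms(2) that that] d that by (simp add: power_commutes)
  then show ?case using upper_triangular_mult[OF c assms(1) ut assms(2)] by simp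
qed

lemma mtrace_similar:
  assumes "B \<in> carrier_mat n n" "P \<in> carrier_mat n n" "Q \<in> carrier_mat n n" "Q * P = 1\<^sub>m n"
  shows "mtrace (P * B * Q) = (\<Sum>i<n. B $$ (i, i))"
proof -
  have "mtrace (P * B * Q) = mtrace (Q * (P * B))" by (rule mtrace_comm[of _ n]) (use assms in auto)
  also have "Q * (P * B) = (Q * P) * B" by (rule assoc_mult_mat[symmetric, of _ n n _ n _ n]) (use assms in auto)
  also have "\<dots> = B" using assms by simp
  finally show ?thesis using assms by (simp add: mtrace_def)
qed

text \<open>The diagonal entries of a triangular form satisfy b^(m+1) = b, so each is 0 or a root of
  unity.\<close>

lemma mtrace_periodic_algebraic_int:
  assumes A: "(A :: complex mat) \<in> carrier_mat n n" and m: "m > 0" "A ^\<^sub>m (Suc m) = A"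
  shows "algebraic_int (mtrace A)"
proof -
  obtain B P Q where B: "B \<in> carrier_mat n n" "upper_triangular B" and P: "P \<in> carrier_mat n n" and Q: "Q \<in> carrier_mat n n"
    and PQ: "P * Q = 1\<^sub>m n" "Q * P = 1\<^sub>m n" "A = P * B * Q" using complex_triangularise[OF A] by blast
  have BA: "B = Q * A * P"
  proof -
    have "Q * A * P = Q * (P * B * Q) * P" by (simp add: PQ)
    also have "\<dots> = (Q * P) * B * (Q * P)" using B(1) P Q by (simp add: assoc_mult_mat[of _ n n _ n _ n])
    finally show ?thesis using PQ B(1) by simp
  qed
  have "similar_mat_wit B A Q P" by (rule similar_mat_witI[OF PQ(2,1) BA B(1) A Q P])
  from similar_mat_wit_pow[OF this, of "Suc m"] have "B ^\<^sub>m (Suc m) = Q * (A ^\<^sub>m (Suc m)) * P"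
    unfolding similar_mat_wit_def Let_def by blast
  then have Bm: "B ^\<^sub>m (Suc m) = B" using m BA by simp
  have "algebraic_int (B $$ (i, i))" if i: "i < n" for i
  proof -
    have d: "B $$ (i, i) ^ Suc m = B $$ (i, i)" using upper_triangular_pow_diag[OF B, of "Suc m"] i Bm by metis
    show ?thesis
    proof (cases "B $$ (i, i) = 0")
      case False
      then have "poly (monom 1 m) (B $$ (i, i)) = 1" using d by (simp add: poly_monom)
      from algebraic_int_root[OF algebraic_int_1 this] show ?thesis using m by (auto simp: degree_monom_eq)
    qed simp
  qed
  then have "algebraic_int (\<Sum>i<n. B $$ (i, i))" by (intro algebraic_int_sum) auto
  then show ?thesis using mtrace_similar[OF B(1) P Q PQ(2)] PQ(3) by simp
qed

lemma idempotent_mtrace: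
  assumes A: "(A :: complex mat) \<in> carrier_mat n n" and idem: "A * A = A"
  shows "\<exists>k::nat. mtrace A = of_nat k"
proof -
  obtain B P Q where B: "B \<in> carrier_mat n n" "upper_triangular B" and P: "P \<in> carrier_mat n n" and Q: "Q \<in> carrier_mat n n"
    and PQ: "P * Q = 1\<^sub>m n" "Q * P = 1\<^sub>m n" "A = P * B * Q" using complex_triangularise[OF A] by blast
  have BA: "B = Q * A * P"
  proof -
    have "Q * A * P = Q * (P * B * Q) * P" by (simp add: PQ)
    also have "\<dots> = (Q * P) * B * (Q * P)" using B(1) P Q by (simp add: assoc_mult_mat[of _ n n _ n _ n])
    finally show ?thesis using PQ B(1) by simp
  qed
  have "B * B = Q * A * (P * Q) * A * P" using A P Q unfolding BA by (simp add: assoc_mult_mat[of _ n n _ n _ n])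
  also have "\<dots> = Q * (A * A) * P" using A P Q PQ by (simp add: assoc_mult_mat[of _ n n _ n _ n])
  also have "\<dots> = B" by (simp add: idem BA)
  finally have BB: "B * B = B" .
  have "B $$ (i, i) = of_nat (if B $$ (i, i) = 0 then 0 else 1)" if i: "i < n" for i
  proof -
    have "B $$ (i, i) * B $$ (i, i) = B $$ (i, i)" using upper_triangular_mult_entry[OF B(1,1,2,2) i i] BB by simp
    then show ?thesis by auto
  qed
  then have "(\<Sum>i<n. B $$ (i, i)) = (\<Sum>i<n. of_nat (if B $$ (i, i) = 0 then 0 else 1))" by (intro sum.cong) auto
  also have "\<dots> = of_nat (\<Sum>i<n. if B $$ (i, i) = 0 then 0 else 1)" by simp
  finally show ?thesis using mtrace_similar[OF B(1) P Q PQ(2)] PQ(3) by metis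
qed

text \<open>The product of the factors A - l, for l in the list, applied to \<open>X\<close>. A list
  of roots stands for an annihilating polynomial.\<close>

definition kill :: "complex mat \<Rightarrow> complex list \<Rightarrow> complex mat \<Rightarrow> complex mat" where
  "kill A ls X = foldr (\<lambda>l X. A * X - l \<cdot>\<^sub>m X) ls X"

lemma kill_carrier: "A \<in> carrier_mat n n \<Longrightarrow> X \<in> carrier_mat n n \<Longrightarrow> kill A ls X \<in> carrier_mat n n"
  by (induction ls) (auto simp: kill_def)

lemma kill_mult:
  assumes "A \<in> carrier_mat n n" "X \<in> carrier_mat n n" "Y \<in> carrier_mat n n"
  shows "kill A ls (X * Y) = kill A ls X * Y"
proof (induction ls)
  case (Cons l ls)
  have c: "kill A ls X \<in> carrier_mat n n" using kill_carrier assms by blast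
  have "kill A (l # ls) (X * Y) = A * (kill A ls X * Y) - l \<cdot>\<^sub>m (kill A ls X * Y)" using Cons by (simp add: kill_def)
  also have "\<dots> = (A * kill A ls X) * Y - (l \<cdot>\<^sub>m kill A ls X) * Y"
    using c assms by (simp add: assoc_mult_mat[of _ n n _ n _ n] mult_smult_assoc_mat[of _ n n _ n])
  also have "\<dots> = (A * kill A ls X - l \<cdot>\<^sub>m kill A ls X) * Y" using c assms by (subst minus_mult_distrib_mat[of _ n n]) auto
  finally show ?case by (simp add: kill_def)
qed (simp add: kill_def)

text \<open>Cayley-Hamilton by triangular form: the product of the first k diagonal factors has
  zeros in its first k columns. Similarity carries the result back to A.\<close>

lemma annihilating_list:
  assumes A: "(A :: complex mat) \<in> carrier_mat n n"
  shows "\<exists>ls. kill A ls (1\<^sub>m n) = 0\<^sub>m n n"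
proof -
  obtain B P Q where B: "B \<in> carrier_mat n n" "upper_triangular B" and P: "P \<in> carrier_mat n n" and Q: "Q \<in> carrier_mat n n"
    and PQ: "P * Q = 1\<^sub>m n" "Q * P = 1\<^sub>m n" "A = P * B * Q" using complex_triangularise[OF A] by blast
  let ?ls = "\<lambda>k. map (\<lambda>i. B $$ (i, i)) [0..<k]"
  have cols: "\<forall>i<n. \<forall>j<k. kill B (?ls k) (1\<^sub>m n) $$ (i, j) = 0" if "k \<le> n" for k
    using that
  proof (induction k)
    case (Suc k)
    let ?K = "kill B (?ls k) (1\<^sub>m n)" and ?D = "B - B $$ (k, k) \<cdot>\<^sub>m 1\<^sub>m n"
    have K: "?K \<in> carrier_mat n n" and D: "?D \<in> carrier_mat n n" using B(1) kill_carrier by auto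
    have "kill B (?ls (Suc k)) (1\<^sub>m n) = kill B (?ls k) (B * 1\<^sub>m n - B $$ (k, k) \<cdot>\<^sub>m 1\<^sub>m n)" by (simp add: kill_def)
    also have "\<dots> = kill B (?ls k) (1\<^sub>m n * ?D)" using B(1) D by simp
    also have "\<dots> = ?K * ?D" using B(1) D by (intro kill_mult) auto
    finally have e: "kill B (?ls (Suc k)) (1\<^sub>m n) = ?K * ?D" .
    show ?case
    proof (intro allI impI)
      fix i j assume i: "i < n" and j: "j < Suc k"
      have "(?K * ?D) $$ (i, j) = (\<Sum>l<n. ?K $$ (i, l) * ?D $$ (l, j))"
        using K D i j Suc.prems by (auto simp: scalar_prod_def atLeast0LessThan intro!: sum.cong)
      also have "\<dots> = 0"
      proof (rule sum.neutral, safe)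
        fix l assume l: "l < n"
        show "?K $$ (i, l) * ?D $$ (l, j) = 0"
        proof (cases "l < k")
          case True then show ?thesis using Suc i by auto
        next
          case False
          have "?D $$ (l, j) = B $$ (l, j) - B $$ (k, k) * (if l = j then 1 else 0)" using B(1) l j Suc.prems by simp
          also have "\<dots> = 0"
          proof (cases "l = j")
            case True then show ?thesis using False j by (metis diff_self less_antisym mult.right_neutral)
          next
            case l2: False
            then have "j < l" using False j by simp
            then show ?thesis using upper_triangularD[OF B(2)] l B(1) l2 by auto
          qed
          finally show ?thesis by simp
        qed
      qed
      finally show "kill B (?ls (Suc k)) (1\<^sub>m n) $$ (i, j) = 0" unfolding e .
    qed
  qed simp
  have KB: "kill B (?ls n) (1\<^sub>m n) = 0\<^sub>m n n"
    by (rule eq_matI) (use cols[of n] kill_carrier[OF B(1), of "1\<^sub>m n"] in auto)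
  have "kill A ls (1\<^sub>m n) = P * kill B ls (1\<^sub>m n) * Q" for ls
  proof (induction ls)
    case Nil then show ?case using P Q PQ by (simp add: kill_def)
  next
    case (Cons l ls)
    let ?K = "kill B ls (1\<^sub>m n)"
    have K: "?K \<in> carrier_mat n n" using kill_carrier[OF B(1)] by auto
    have "kill A (l # ls) (1\<^sub>m n) = A * (P * ?K * Q) - l \<cdot>\<^sub>m (P * ?K * Q)" using Cons by (simp add: kill_def)
    also have "A * (P * ?K * Q) = P * B * (Q * P) * ?K * Q"
      unfolding PQ(3) using P Q B(1) K by (simp add: assoc_mult_mat[of _ n n _ n _ n])
    also have "\<dots> = P * (B * ?K) * Q" using P Q B(1) K PQ(2) by (simp add: assoc_mult_mat[of _ n n _ n _ n])
    also have "l \<cdot>\<^sub>m (P * ?K * Q) = P * (l \<cdot>\<^sub>m ?K) * Q" using P Q K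
      by (simp add: mult_smult_distrib[of _ n n _ n] mult_smult_assoc_mat[of _ n n _ n])
    also have "P * (B * ?K) * Q - P * (l \<cdot>\<^sub>m ?K) * Q = P * (B * ?K - l \<cdot>\<^sub>m ?K) * Q"
      using P Q B(1) K by (simp add: minus_mult_distrib_mat[of _ n n _ _ n] mult_minus_distrib_mat[of _ n n _ n])
    finally show ?case by (simp add: kill_def)
  qed
  then have "kill A (?ls n) (1\<^sub>m n) = P * 0\<^sub>m n n * Q" using KB by simp
  then show ?thesis using P Q by (intro exI[of _ "?ls n"]) simp
qed

section \<open>Conjugacy classes of prime power size\<close>

text \<open>Complex matrices indexed by the elements of a finite set \<open>I\<close> are functions of two arguments that vanish outside of \<open>I \<times> I\<close> (\<open>ksup\<close>).\<close>

definition kp :: "'i set \<Rightarrow> ('i \<Rightarrow> 'i \<Rightarrow> complex) \<Rightarrow> ('i \<Rightarrow> 'i \<Rightarrow> complex) \<Rightarrow> 'i \<Rightarrow> 'i \<Rightarrow> complex" where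
  "kp I K L = (\<lambda>x y. \<Sum>w\<in>I. K x w * L w y)"

definition kid :: "'i set \<Rightarrow> 'i \<Rightarrow> 'i \<Rightarrow> complex" where "kid I = (\<lambda>x y. if x = y \<and> x \<in> I then 1 else 0)"

definition ktr :: "'i set \<Rightarrow> ('i \<Rightarrow> 'i \<Rightarrow> complex) \<Rightarrow> complex" where "ktr I K = (\<Sum>x\<in>I. K x x)"

definition ksup :: "'i set \<Rightarrow> ('i \<Rightarrow> 'i \<Rightarrow> complex) \<Rightarrow> bool" where
  "ksup I K \<longleftrightarrow> (\<forall>x y. x \<notin> I \<or> y \<notin> I \<longrightarrow> K x y = 0)"

definition kad :: "('i \<Rightarrow> 'i \<Rightarrow> complex) \<Rightarrow> 'i \<Rightarrow> 'i \<Rightarrow> complex" where "kad K = (\<lambda>x y. cnj (K y x))"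

lemma kp_assoc: "kp I (kp I K L) M = kp I K (kp I L M)"
proof (intro ext)
  fix x y
  have "kp I (kp I K L) M x y = (\<Sum>w\<in>I. \<Sum>v\<in>I. K x v * L v w * M w y)" by (simp add: kp_def sum_distrib_right)
  also have "\<dots> = (\<Sum>v\<in>I. \<Sum>w\<in>I. K x v * L v w * M w y)" by (rule sum.swap)
  also have "\<dots> = kp I K (kp I L M) x y" by (simp add: kp_def sum_distrib_left mult.assoc)
  finally show "kp I (kp I K L) M x y = kp I K (kp I L M) x y" .
qed

lemma kp_cmult_left: "kp I (\<lambda>x y. c * K x y) L = (\<lambda>x y. c * kp I K L x y)"
  by (simp add: kp_def sum_distrib_left mult.assoc)

lemma kp_cmult_right: "kp I K (\<lambda>x y. c * L x y) = (\<lambda>x y. c * kp I K L x y)"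
  by (simp add: kp_def sum_distrib_left mult.left_commute)

lemma kp_diff_left: "kp I (\<lambda>x y. K x y - L x y) M = (\<lambda>x y. kp I K M x y - kp I L M x y)"
  by (simp add: kp_def sum_subtractf left_diff_distrib)

lemma kp_diff_right: "kp I M (\<lambda>x y. K x y - L x y) = (\<lambda>x y. kp I M K x y - kp I M L x y)"
  by (simp add: kp_def sum_subtractf right_diff_distrib)

lemma kp_sum_left: "kp I (\<lambda>x y. \<Sum>l\<in>S. F l x y) M = (\<lambda>x y. \<Sum>l\<in>S. kp I (F l) M x y)"
  unfolding kp_def sum_distrib_right by (intro ext) (rule sum.swap)

lemma kp_sum_right: "kp I M (\<lambda>x y. \<Sum>l\<in>S. F l x y) = (\<lambda>x y. \<Sum>l\<in>S. kp I M (F l) x y)"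
  unfolding kp_def sum_distrib_left by (intro ext) (rule sum.swap)

lemma kp_zero [simp]: "kp I K (\<lambda>_ _. 0) = (\<lambda>_ _. 0)" "kp I (\<lambda>_ _. 0) K = (\<lambda>_ _. 0)"
  by (simp_all add: kp_def)

lemma kp_kid:
  assumes "finite I" "ksup I K" shows "kp I (kid I) K = K" "kp I K (kid I) = K"
proof (intro ext)
  fix x y
  have "kp I (kid I) K x y = (\<Sum>w\<in>I. if w = x then K x y else 0)"
    unfolding kp_def kid_def by (intro sum.cong) auto
  then show "kp I (kid I) K x y = K x y" using assms by (simp add: ksup_def)
next
  show "kp I K (kid I) = K"
  proof (intro ext)
    fix x y
    have "kp I K (kid I) x y = (\<Sum>w\<in>I. if w = y then K x y else 0)"
      unfolding kp_def kid_def by (intro sum.cong) auto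
    then show "kp I K (kid I) x y = K x y" using assms by (simp add: ksup_def)
  qed
qed

lemma ksup_kid: "ksup I (kid I)" by (auto simp: ksup_def kid_def)

lemma ksup_kp: "ksup I K \<Longrightarrow> ksup I L \<Longrightarrow> ksup I (kp I K L)" by (auto simp: ksup_def kp_def)

lemma ksup_kad: "ksup I K \<Longrightarrow> ksup I (kad K)" by (auto simp: ksup_def kad_def)

lemma kad_kp: "kad (kp I K L) = kp I (kad L) (kad K)"
  by (simp add: kad_def kp_def mult.commute)

text \<open>The diagonal entries of the product are the sums of squared absolute values down the
  columns of K.\<close>

lemma kad_square_zero:
  assumes "finite I" "ksup I K" "kp I (kad K) K = (\<lambda>_ _. 0)" shows "K = (\<lambda>_ _. 0)"
proof (intro ext)
  fix x y
  have z: "(\<Sum>w\<in>I. (norm (K w y))\<^sup>2) = 0" for y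
  proof -
    have "complex_of_real (\<Sum>w\<in>I. (norm (K w y))\<^sup>2) = kp I (kad K) K y y"
      unfolding kp_def kad_def of_real_sum by (intro sum.cong refl) (simp only: complex_norm_square mult.commute)
    also have "\<dots> = 0" using assms(3) by simp
    finally show ?thesis by (simp only: of_real_eq_0_iff)
  qed
  show "K x y = 0"
  proof (cases "x \<in> I")
    case True
    have "(norm (K x y))\<^sup>2 = 0" using z[of y] True assms(1) by (subst (asm) sum_nonneg_eq_0_iff) auto
    then show ?thesis by simp
  next
    case False then show ?thesis using assms(2) by (simp add: ksup_def)
  qed
qed

text \<open>Normality moves the adjoint past N, so that \<open>kad_square_zero\<close> applies first
  to the adjoint of N times N Z and then to N Z. This replaces the diagonalisation of normal
  matrices.\<close>

lemma normal_square_zero: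
  assumes I: "finite I" and N: "ksup I N" "kp I N (kad N) = kp I (kad N) N" and Z: "ksup I Z"
    and zero: "kp I N (kp I N Z) = (\<lambda>_ _. 0)"
  shows "kp I N Z = (\<lambda>_ _. 0)"
proof -
  let ?W = "kp I N Z" and ?V = "kp I (kad N) (kp I N Z)"
  have sW: "ksup I ?W" and sV: "ksup I ?V" using N Z by (auto intro!: ksup_kp ksup_kad)
  have kk: "kad (kad N) = N" by (simp add: kad_def)
  have "kp I (kad ?V) ?V = kp I (kad ?W) (kp I N (kp I (kad N) ?W))" by (simp only: kad_kp[of I "kad N"] kk kp_assoc)
  also have "kp I N (kp I (kad N) ?W) = kp I (kad N) (kp I N ?W)" using N(2) by (simp only: kp_assoc[symmetric])
  finally have "kp I (kad ?V) ?V = (\<lambda>_ _. 0)" using zero by simp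
  then have "?V = (\<lambda>_ _. 0)" by (rule kad_square_zero[OF I sV])
  then have "kp I (kad ?W) ?W = (\<lambda>_ _. 0)" by (simp add: kad_kp[of I N Z] kp_assoc)
  then show ?thesis by (rule kad_square_zero[OF I sW])
qed

lemma normal_shift:
  fixes l :: complex
  assumes I: "finite I" and T: "ksup I T" "kp I T (kad T) = kp I (kad T) T"
  defines "N \<equiv> (\<lambda>x y. T x y - l * kid I x y)"
  shows "ksup I N" "kp I N (kad N) = kp I (kad N) N" "\<And>Z. ksup I Z \<Longrightarrow> kp I N Z = (\<lambda>x y. kp I T Z x y - l * Z x y)"
proof -
  have kN: "kad N = (\<lambda>x y. kad T x y - cnj l * kid I x y)" by (auto simp: N_def kad_def kid_def fun_eq_iff)
  have *: "kp I N Z = (\<lambda>x y. kp I T Z x y - l * Z x y)" if "ksup I Z" for Z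
    by (simp add: N_def kp_diff_left kp_cmult_left kp_kid(1)[OF I that])
  have **: "kp I (kad N) Z = (\<lambda>x y. kp I (kad T) Z x y - cnj l * Z x y)" if "ksup I Z" for Z
    unfolding kN by (simp add: kp_diff_left kp_cmult_left kp_kid(1)[OF I that])
  show s: "ksup I N" using T(1) ksup_kid[of I] by (simp add: N_def ksup_def)
  show "kp I N (kad N) = kp I (kad N) N"
    unfolding *[OF ksup_kad[OF s]] **[OF s] kN
    by (simp add: N_def kp_diff_left kp_diff_right kp_cmult_left kp_cmult_right kp_kid(1)[OF I T(1)] kp_kid(1)[OF I ksup_kad[OF T(1)]]
      kp_kid(1)[OF I ksup_kid] kp_kid(2)[OF I T(1)] kp_kid(2)[OF I ksup_kad[OF T(1)]] T(2) fun_eq_iff algebra_simps)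
  show "\<And>Z. ksup I Z \<Longrightarrow> kp I N Z = (\<lambda>x y. kp I T Z x y - l * Z x y)" by (rule *)
qed

text \<open>The counterpart of \<open>kill\<close>. Here the head of the list acts first, which
  explains the \<open>rev\<close> in \<open>kmat_kkill\<close>.\<close>

fun kkill :: "'i set \<Rightarrow> ('i \<Rightarrow> 'i \<Rightarrow> complex) \<Rightarrow> complex list \<Rightarrow> ('i \<Rightarrow> 'i \<Rightarrow> complex) \<Rightarrow> 'i \<Rightarrow> 'i \<Rightarrow> complex" where
  "kkill I T [] Y = Y"
| "kkill I T (l # ls) Y = kkill I T ls (\<lambda>x y. kp I T Y x y - l * Y x y)"

text \<open>Induction on the list of roots. The components of (T - l) Y for eigenvalues m other than
  l are divided by m - l and subtracted from Y. The remainder is annihilated by (T - l)^2, hence by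
  T - l because T is normal. Commutation with X is carried along, since all components are built
  from T and Y.\<close>

lemma spectral_decomposition:
  assumes I: "finite I" and T: "ksup I T" "kp I T (kad T) = kp I (kad T) T"
  shows "kkill I T ls Y = (\<lambda>_ _. 0) \<Longrightarrow> ksup I Y \<Longrightarrow> \<exists>S F. finite S \<and> Y = (\<lambda>x y. \<Sum>l\<in>S. F l x y) \<and>
    (\<forall>l\<in>S. ksup I (F l) \<and> kp I T (F l) = (\<lambda>x y. l * F l x y) \<and>
      (\<forall>X. kp I X T = kp I T X \<and> kp I X Y = kp I Y X \<longrightarrow> kp I X (F l) = kp I (F l) X))"
proof (induction ls arbitrary: Y)
  case Nil
  then show ?case by (intro exI[of _ "{}"]) auto
next
  case (Cons l ls)
  define Y' where "Y' = (\<lambda>x y. kp I T Y x y - l * Y x y)"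
  have sY': "ksup I Y'" using ksup_kp[OF T(1) Cons.prems(2)] Cons.prems(2) by (simp add: Y'_def ksup_def)
  have "kkill I T ls Y' = (\<lambda>_ _. 0)" using Cons.prems(1) by (simp add: Y'_def)
  from Cons.IH[OF this sY'] obtain S F where S: "finite S" and sum: "Y' = (\<lambda>x y. \<Sum>l\<in>S. F l x y)"
    and F: "\<forall>l\<in>S. ksup I (F l) \<and> kp I T (F l) = (\<lambda>x y. l * F l x y) \<and>
      (\<forall>X. kp I X T = kp I T X \<and> kp I X Y' = kp I Y' X \<longrightarrow> kp I X (F l) = kp I (F l) X)" by (elim exE conjE)
  have Fs: "ksup I (F m)" and FT: "kp I T (F m) = (\<lambda>x y. m * F m x y)" if "m \<in> S" for m using F that by auto
  have FX: "kp I X (F m) = kp I (F m) X" if "m \<in> S" "kp I X T = kp I T X" "kp I X Y' = kp I Y' X" for m X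
    using F that by blast
  let ?S = "S - {l}"
  define H where "H = (\<lambda>m x y. inverse (m - l) * F m x y)"
  \<comment> \<open>The part of Y left for the eigenvalue l; T - l maps it to the l-component P of
    (T - l) Y, which will turn out to be zero.\<close>
  define R where "R = (\<lambda>x y. Y x y - (\<Sum>m\<in>?S. H m x y))"
  define P where "P = (\<lambda>x y. if l \<in> S then F l x y else 0)"
  have HT: "kp I T (H m) = (\<lambda>x y. m * H m x y)" if "m \<in> ?S" for m
    using FT[of m] that by (simp add: H_def kp_cmult_right mult.left_commute)
  have Hs: "ksup I (H m)" if "m \<in> ?S" for m using Fs[of m] that by (simp add: H_def ksup_def)
  have sR: "ksup I R" using Cons.prems(2) Hs by (auto simp: R_def ksup_def intro!: sum.neutral)
  have TR: "(\<lambda>x y. kp I T R x y - l * R x y) = P"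
  proof (intro ext)
    fix x y
    have "kp I T R x y - l * R x y = Y' x y - (\<Sum>m\<in>?S. m * H m x y) + l * (\<Sum>m\<in>?S. H m x y)"
      using HT by (simp add: R_def kp_diff_right kp_sum_right Y'_def algebra_simps)
    also have "\<dots> = Y' x y - (\<Sum>m\<in>?S. (m - l) * H m x y)" by (simp add: sum_distrib_left left_diff_distrib sum_subtractf)
    also have "(\<Sum>m\<in>?S. (m - l) * H m x y) = (\<Sum>m\<in>?S. F m x y)"
    proof (rule sum.cong[OF refl])
      fix m assume "m \<in> ?S"
      then have "m - l \<noteq> 0" by simp
      then show "(m - l) * H m x y = F m x y" by (simp add: H_def flip: mult.assoc)
    qed
    also have "Y' x y - \<dots> = P x y" using S by (simp add: sum P_def sum_diff1)
    finally show "kp I T R x y - l * R x y = P x y" .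
  qed
  have sP: "ksup I P" and PT: "kp I T P = (\<lambda>x y. l * P x y)"
    using Fs[of l] FT[of l] by (cases "l \<in> S"; simp add: P_def ksup_def)+
  define N where "N = (\<lambda>x y. T x y - l * kid I x y)"
  note N = normal_shift[OF I T, where l = l, folded N_def]
  have "kp I N (kp I N R) = (\<lambda>_ _. 0)" unfolding N(3)[OF sR] TR N(3)[OF sP] by (simp add: PT)
  from normal_square_zero[OF I N(1,2) sR this] have "P = (\<lambda>_ _. 0)" unfolding N(3)[OF sR] TR .
  then have RT: "kp I T R = (\<lambda>x y. l * R x y)" using TR by (simp add: fun_eq_iff)
  have HX: "kp I X (H m) = kp I (H m) X" and RX: "kp I X R = kp I R X"
    if "m \<in> ?S \<or> m = l" "kp I X T = kp I T X" "kp I X Y = kp I Y X" for m X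
  proof -
    have "kp I X (kp I T Y) = kp I (kp I T Y) X" using that(2,3) by (metis kp_assoc)
    then have Y'X: "kp I X Y' = kp I Y' X" by (simp add: Y'_def kp_diff_left kp_diff_right kp_cmult_left kp_cmult_right that(3))
    have a: "kp I X (H m) = kp I (H m) X" if "m \<in> ?S" for m
      using FX[of m X] that \<open>kp I X T = kp I T X\<close> Y'X by (simp add: H_def kp_cmult_left kp_cmult_right)
    show "kp I X R = kp I R X"
      using a by (simp add: R_def kp_diff_left kp_diff_right kp_sum_left kp_sum_right that(3))
    show "kp I X (H m) = kp I (H m) X"
    proof (cases "m = l")
      case True then show ?thesis by (simp add: H_def)
    next
      case False then show ?thesis using a that(1) by blast
    qed
  qed
  show ?case
  proof (intro exI conjI ballI allI impI)
    let ?F = "\<lambda>m. if m = l then R else H m"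
    show "finite (insert l S)" using S by simp
    show "Y = (\<lambda>x y. \<Sum>m\<in>insert l S. ?F m x y)"
    proof (intro ext)
      fix x y
      have "(\<Sum>m\<in>insert l S. ?F m x y) = R x y + (\<Sum>m\<in>?S. ?F m x y)" using S by (simp add: sum.insert_remove)
      also have "(\<Sum>m\<in>?S. ?F m x y) = (\<Sum>m\<in>?S. H m x y)" by (intro sum.cong) auto
      finally show "Y x y = (\<Sum>m\<in>insert l S. ?F m x y)" by (simp add: R_def)
    qed
    fix m assume m: "m \<in> insert l S"
    show "ksup I (?F m)" using sR Hs m by auto
    show "kp I T (?F m) = (\<lambda>x y. m * ?F m x y)" using RT HT m by auto
    show "kp I X (?F m) = kp I (?F m) X" if "kp I X T = kp I T X \<and> kp I X Y = kp I Y X" for X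
      using HX[of m X] RX[of m X] m that by auto
  qed
qed

section \<open>Transfer from functions of two arguments to matrices\<close>

definition kmat :: "(nat \<Rightarrow> 'i) \<Rightarrow> nat \<Rightarrow> ('i \<Rightarrow> 'i \<Rightarrow> complex) \<Rightarrow> complex mat" where
  "kmat e n K = mat n n (\<lambda>(i, j). K (e i) (e j))"

context
  fixes I :: "'i set" and e :: "nat \<Rightarrow> 'i" and n :: nat
  assumes e: "bij_betw e {..<n} I"
begin

lemma kmat_carrier [simp]: "kmat e n K \<in> carrier_mat n n" "dim_row (kmat e n K) = n" "dim_col (kmat e n K) = n"
  by (simp_all add: kmat_def)

lemma kmat_kp: "kmat e n (kp I K L) = kmat e n K * kmat e n L"
proof (rule eq_matI)
  fix i j assume "i < dim_row (kmat e n K * kmat e n L)" "j < dim_col (kmat e n K * kmat e n L)"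
  then have ij: "i < n" "j < n" by simp_all
  have "kmat e n (kp I K L) $$ (i, j) = (\<Sum>k<n. K (e i) (e k) * L (e k) (e j))"
    using ij by (simp add: kmat_def kp_def sum.reindex_bij_betw[OF e, of "\<lambda>w. K (e i) w * L w (e j)"])
  then show "kmat e n (kp I K L) $$ (i, j) = (kmat e n K * kmat e n L) $$ (i, j)"
    using ij by (simp add: kmat_def scalar_prod_def atLeast0LessThan)
qed simp_all

lemma kmat_trace: "mtrace (kmat e n K) = ktr I K"
  by (simp add: mtrace_def ktr_def kmat_def flip: sum.reindex_bij_betw[OF e, of "\<lambda>x. K x x"])

lemma kmat_kid: "kmat e n (kid I) = 1\<^sub>m n"
proof (rule eq_matI)
  fix i j assume ij: "i < dim_row (1\<^sub>m n :: complex mat)" "j < dim_col (1\<^sub>m n :: complex mat)"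
  then have "e i \<in> I" "e i = e j \<longleftrightarrow> i = j" using e by (auto simp: bij_betw_def inj_on_def)
  then show "kmat e n (kid I) $$ (i, j) = 1\<^sub>m n $$ (i, j)" using ij by (simp add: kmat_def kid_def)
qed simp_all

lemma kmat_zero:
  assumes "ksup I K" "kmat e n K = 0\<^sub>m n n" shows "K = (\<lambda>_ _. 0)"
proof (intro ext)
  fix x y
  show "K x y = 0"
  proof (cases "x \<in> I \<and> y \<in> I")
    case True
    then obtain i j where "i < n" "j < n" "x = e i" "y = e j" using e by (auto simp: bij_betw_def)
    then show ?thesis using arg_cong[OF assms(2), of "\<lambda>M. M $$ (i, j)"] by (simp add: kmat_def)
  qed (use assms in \<open>auto simp: ksup_def\<close>)
qed

lemma kmat_kkill: "kill (kmat e n T) (rev ls) (kmat e n Y) = kmat e n (kkill I T ls Y)"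
proof (induction ls arbitrary: Y)
  case (Cons l ls)
  have "kmat e n T * kmat e n Y - l \<cdot>\<^sub>m kmat e n Y = kmat e n (\<lambda>x y. kp I T Y x y - l * Y x y)"
    unfolding kmat_kp[symmetric] by (rule eq_matI) (simp_all add: kmat_def)
  then show ?case using Cons by (simp add: kill_def)
qed (simp add: kill_def)

end

lemma ksup_kkill: "ksup I T \<Longrightarrow> ksup I Y \<Longrightarrow> ksup I (kkill I T ls Y)"
proof (induction ls arbitrary: Y)
  case (Cons l ls)
  have "ksup I (\<lambda>x y. kp I T Y x y - l * Y x y)" using ksup_kp[OF Cons.prems] Cons.prems(2) by (simp add: ksup_def)
  then show ?case using Cons by simp
qed simp

lemma finite_enum: "finite I \<Longrightarrow> \<exists>e. bij_betw e {..<card I} I"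
  using ex_bij_betw_nat_finite[of I] by (simp add: atLeast0LessThan)

lemma ex_kkill_zero:
  assumes I: "finite I" and T: "ksup I T" shows "\<exists>ls. kkill I T ls (kid I) = (\<lambda>_ _. 0)"
proof -
  obtain e where e: "bij_betw e {..<card I} I" using finite_enum[OF I] by blast
  obtain ls where "kill (kmat e (card I) T) ls (1\<^sub>m (card I)) = 0\<^sub>m (card I) (card I)"
    using annihilating_list[OF kmat_carrier(1)[OF e]] by blast
  then have "kmat e (card I) (kkill I T (rev ls) (kid I)) = 0\<^sub>m (card I) (card I)"
    by (simp add: kmat_kkill[OF e, symmetric] kmat_kid[OF e])
  then show ?thesis using kmat_zero[OF e ksup_kkill[OF T ksup_kid]] by blast
qed

lemma idempotent_ktr:
  assumes I: "finite I" and E: "kp I E E = E" shows "\<exists>k::nat. ktr I E = of_nat k"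
proof -
  obtain e where e: "bij_betw e {..<card I} I" using finite_enum[OF I] by blast
  show ?thesis using idempotent_mtrace[OF kmat_carrier(1)[OF e], of E] by (simp add: kmat_kp[OF e, symmetric] E kmat_trace[OF e])
qed

text \<open>Since the idempotent E commutes with X, the positive powers of X E are X^j E, so the
  matrix of X E is periodic.\<close>

lemma periodic_ktr_algebraic_int:
  assumes I: "finite I" and E: "kp I E E = E" "kp I X E = kp I E X" and m: "m > 0" "(kp I X ^^ m) E = E"
  shows "algebraic_int (ktr I (kp I X E))"
proof -
  obtain e where e: "bij_betw e {..<card I} I" using finite_enum[OF I] by blast
  let ?n = "card I"
  let ?A = "kmat e ?n (kp I X E)"
  have it: "kp I ((kp I X ^^ j) E) H = (kp I X ^^ j) (kp I E H)" for j H
    by (induction j) (simp_all add: kp_assoc)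
  have pw: "?A ^\<^sub>m Suc j = kmat e ?n ((kp I X ^^ Suc j) E)" for j
  proof (induction j)
    case 0
    have "?A ^\<^sub>m Suc 0 = 1\<^sub>m ?n * ?A" by (simp add: kmat_carrier[OF e])
    also have "\<dots> = ?A" by (rule left_mult_one_mat[OF kmat_carrier(1)[OF e]])
    finally show ?case by simp
  next
    case (Suc j)
    have EX: "kp I E (kp I X E) = kp I X E" using E by (metis kp_assoc)
    have "?A ^\<^sub>m Suc (Suc j) = kmat e ?n ((kp I X ^^ Suc j) E) * ?A" using Suc by simp
    also have "\<dots> = kmat e ?n (kp I ((kp I X ^^ Suc j) E) (kp I X E))" by (rule kmat_kp[OF e, symmetric])
    also have "kp I ((kp I X ^^ Suc j) E) (kp I X E) = (kp I X ^^ Suc j) (kp I X E)" unfolding it EX ..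
    also have "\<dots> = (kp I X ^^ Suc (Suc j)) E" by (metis funpow_Suc_right comp_apply)
    finally show ?case .
  qed
  have "(kp I X ^^ Suc m) E = kp I X E" using m(2) by simp
  then have "?A ^\<^sub>m Suc m = ?A" using pw[of m] by simp
  from mtrace_periodic_algebraic_int[OF kmat_carrier(1)[OF e] m(1) this] show ?thesis by (simp add: kmat_trace[OF e])
qed

text \<open>The average of the real parts of f(k) times the conjugate of w attains its upper bound,
  so each term does, and the bound on the modulus leaves only f(k) = w.\<close>

lemma average_extremal:
  fixes f :: "'i \<Rightarrow> complex"
  assumes K: "finite K" and le: "\<And>k. k \<in> K \<Longrightarrow> norm (f k) \<le> norm w"
    and sum: "(\<Sum>k\<in>K. f k) = of_nat (card K) * w" and k: "k \<in> K"
  shows "f k = w"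
proof -
  let ?M = "(norm w)\<^sup>2"
  have ww: "(Re w)\<^sup>2 + (Im w)\<^sup>2 = ?M" by (simp add: cmod_power2)
  have up: "Re (f j * cnj w) \<le> ?M" if "j \<in> K" for j
  proof -
    have "Re (f j * cnj w) \<le> norm (f j * cnj w)" by (rule complex_Re_le_cmod)
    also have "\<dots> = norm (f j) * norm w" by (simp add: norm_mult)
    also have "\<dots> \<le> norm w * norm w" using le[OF that] by (intro mult_right_mono) auto
    finally show ?thesis by (simp add: power2_eq_square)
  qed
  have "(\<Sum>j\<in>K. Re (f j * cnj w)) = Re (of_nat (card K) * (w * cnj w))"
    by (simp only: Re_sum[symmetric] sum_distrib_right[symmetric] sum mult.assoc)
  also have "\<dots> = card K * ?M" unfolding ww[symmetric] by (simp add: power2_eq_square)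
  finally have "(\<Sum>j\<in>K. ?M - Re (f j * cnj w)) = 0" by (simp add: sum_subtractf)
  then have "?M - Re (f k * cnj w) = 0" using up K k by (subst (asm) sum_nonneg_eq_0_iff) auto
  then have re: "Re (f k) * Re w + Im (f k) * Im w = ?M" by simp
  have "(Re (f k))\<^sup>2 + (Im (f k))\<^sup>2 \<le> ?M" using le[OF k] by (simp add: cmod_power2[symmetric])
  then have "(Re (f k) - Re w)\<^sup>2 + (Im (f k) - Im w)\<^sup>2 \<le> 0" using re ww by (simp add: power2_diff)
  then have "Re (f k) = Re w" "Im (f k) = Im w" by (simp_all add: sum_power2_le_zero_iff)
  then show ?thesis by (rule complex_eqI)
qed

lemma closed_fsub:
  assumes G: "fsub G" and H: "H \<subseteq> G" "1 \<in> H" "\<And>x y. x \<in> H \<Longrightarrow> y \<in> H \<Longrightarrow> x * y \<in> H"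
  shows "fsub H"
  by (rule fsub_mult_closed[OF finite_subset[OF H(1) fsub_finite[OF G]] H(2,3)])

text \<open>The bound follows at a point of maximal |v|. If |alpha| = 1, equality in the average
  forces v(k y) = alpha v(y) for all k in K at such points. As K generates the simple group G, |v|
  is constant and every element of G multiplies v by a scalar. The elements fixing v form a normal
  subgroup containing k1 k0^-1, which is not 1, so v is constant.\<close>

lemma class_average_eigenvector:
  fixes G :: "'a::grp set"
  assumes G: "fsub G" and simple: "\<And>N. normal_in N G \<Longrightarrow> N = {1} \<or> N = G"
    and K: "K \<subseteq> G" "\<And>g k. g \<in> G \<Longrightarrow> k \<in> K \<Longrightarrow> cj g k \<in> K" "k0 \<in> K" "k1 \<in> K" "k0 \<noteq> k1"
    and v: "x0 \<in> G" "v x0 \<noteq> (0::complex)"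
    and ev: "\<And>x. x \<in> G \<Longrightarrow> (\<Sum>k\<in>K. v (k * x)) = of_nat (card K) * (\<alpha> * v x)"
  shows "norm \<alpha> \<le> 1" "norm \<alpha> = 1 \<Longrightarrow> x \<in> G \<Longrightarrow> v x = v 1" "norm \<alpha> = 1 \<Longrightarrow> \<alpha> = 1"
proof -
  have fK: "finite K" using K(1) fsub_finite[OF G] by (rule finite_subset)
  have cK: "card K > 0" using fK K(3) by (auto simp: card_gt_0_iff)
  have ne: "finite ((\<lambda>x. norm (v x)) ` G)" "(\<lambda>x. norm (v x)) ` G \<noteq> {}" using fsub_finite[OF G] v(1) by auto
  define M where "M = Max ((\<lambda>x. norm (v x)) ` G)"
  have mx: "norm (v x) \<le> M" if "x \<in> G" for x unfolding M_def using ne that by simp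
  obtain m where m: "m \<in> G" "norm (v m) = M" using Max_in[OF ne] unfolding M_def by auto
  have M0: "M > 0" using mx[OF v(1)] v(2) by (metis norm_le_zero_iff not_le order_trans)
  have KG: "k * x \<in> G" if "k \<in> K" "x \<in> G" for k x using that K(1) fsub_mult[OF G] by blast
  have genK: "H = G" if H: "fsub H" "K \<subseteq> H" "H \<subseteq> G" for H
  proof -
    have "normal_in (gen G K) G" by (rule gen_cj_invariant[OF G K(1)]) (use K(2) in auto)
    moreover have "\<not> gen G K \<subseteq> {1}" using subset_gen[of K G] K(3-5) by auto
    ultimately have "gen G K = G" using simple by blast
    then show ?thesis using gen_least[OF H] H(3) by simp
  qed
  show "norm \<alpha> \<le> 1"
  proof -
    have "card K * (norm \<alpha> * M) = norm (\<Sum>k\<in>K. v (k * m))" by (simp add: ev[OF m(1)] norm_mult m(2))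
    also have "\<dots> \<le> (\<Sum>k\<in>K. norm (v (k * m)))" by (rule norm_sum)
    also have "\<dots> \<le> (\<Sum>k\<in>K. M)" by (intro sum_mono mx KG m(1))
    finally have "norm \<alpha> * M \<le> M" using cK by simp
    then show ?thesis using M0 by simp
  qed
  have main: "v x = v 1" if a1: "norm \<alpha> = 1" and x: "x \<in> G" for x
  proof -
    have step: "v (k * y) = \<alpha> * v y" if y: "y \<in> G" "norm (v y) = M" and k: "k \<in> K" for k y
    proof (rule average_extremal[OF fK _ _ k, of "\<lambda>k. v (k * y)" "\<alpha> * v y"])
      show "norm (v (k * y)) \<le> norm (\<alpha> * v y)" if "k \<in> K" for k
        using mx[OF KG[OF that y(1)]] y(2) a1 by (simp add: norm_mult)
    qed (use ev[OF y(1)] in simp)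
    define H where "H = {h \<in> G. \<forall>y\<in>G. norm (v y) = M \<longrightarrow> norm (v (h * y)) = M}"
    have "fsub H"
    proof (rule closed_fsub[OF G])
      show "h * h' \<in> H" if "h \<in> H" "h' \<in> H" for h h'
        using that fsub_mult[OF G] by (simp add: H_def mult.assoc)
    qed (use G in \<open>auto simp: H_def\<close>)
    moreover have "K \<subseteq> H" using step K(1) a1 by (auto simp: H_def norm_mult)
    ultimately have "H = G" by (rule genK) (auto simp: H_def)
    have allM: "norm (v y) = M" if y: "y \<in> G" for y
    proof -
      have "y * gi m \<in> H" using \<open>H = G\<close> y m(1) G by (simp add: fsub_mult)
      then have "norm (v (y * gi m * m)) = M" using m unfolding H_def by blast
      then show ?thesis by (simp add: mult.assoc)
    qed
    have a0: "\<alpha> \<noteq> 0" using a1 by auto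
    define C where "C = {h \<in> G. \<exists>c. c \<noteq> 0 \<and> (\<forall>y\<in>G. v (h * y) = c * v y)}"
    have "fsub C"
    proof (rule closed_fsub[OF G])
      show "h * h' \<in> C" if h: "h \<in> C" "h' \<in> C" for h h'
      proof -
        obtain c where c: "c \<noteq> 0" "\<And>y. y \<in> G \<Longrightarrow> v (h * y) = c * v y" and hG: "h \<in> G" using h(1) by (auto simp: C_def)
        obtain d where d: "d \<noteq> 0" "\<And>y. y \<in> G \<Longrightarrow> v (h' * y) = d * v y" and hG': "h' \<in> G" using h(2) by (auto simp: C_def)
        have "v (h * h' * y) = c * d * v y" if y: "y \<in> G" for y
          using c(2)[OF fsub_mult[OF G hG' y]] d(2)[OF y] by (simp add: mult.assoc)
        moreover have "c * d \<noteq> 0" using c d by simp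
        ultimately show ?thesis using fsub_mult[OF G hG hG'] unfolding C_def by blast
      qed
      show "1 \<in> C" using G by (auto simp: C_def intro!: exI[of _ 1])
    qed (auto simp: C_def)
    moreover have "K \<subseteq> C"
    proof
      fix k assume k: "k \<in> K"
      have "\<forall>y\<in>G. v (k * y) = \<alpha> * v y" using step allM k by blast
      then show "k \<in> C" using a0 k K(1) unfolding C_def by blast
    qed
    ultimately have CG: "C = G" by (rule genK) (auto simp: C_def)
    define D where "D = {h \<in> G. \<forall>y\<in>G. v (h * y) = v y}"
    have "normal_in D G"
    proof (rule normal_inI)
      show "fsub D"
      proof (rule closed_fsub[OF G])
        show "h * h' \<in> D" if "h \<in> D" "h' \<in> D" for h h'
          using that fsub_mult[OF G] by (simp add: D_def mult.assoc)
      qed (use G in \<open>auto simp: D_def\<close>)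
      fix g h assume g: "g \<in> G" and h: "h \<in> D"
      obtain c where c: "\<And>y. y \<in> G \<Longrightarrow> v (g * y) = c * v y" using g unfolding CG[symmetric] by (auto simp: C_def)
      have hG: "h \<in> G" and hv: "\<And>y. y \<in> G \<Longrightarrow> v (h * y) = v y" using h by (auto simp: D_def)
      have "v (cj g h * y) = v y" if y: "y \<in> G" for y
      proof -
        have gy: "gi g * y \<in> G" using g y G by (simp add: fsub_mult)
        have "v (cj g h * y) = v (g * (h * (gi g * y)))" by (simp add: cj_def mult.assoc)
        also have "\<dots> = c * v (gi g * y)" using c[OF fsub_mult[OF G hG gy]] hv[OF gy] by simp
        also have "\<dots> = v y" using c[OF gy] by simp
        finally show ?thesis .
      qed
      then show "cj g h \<in> D" using fsub_cj[OF G g hG] by (simp add: D_def)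
    qed (auto simp: D_def)
    moreover have "k1 * gi k0 \<in> D"
    proof -
      have "v (k1 * gi k0 * y) = v y" if y: "y \<in> G" for y
      proof -
        have y0: "gi k0 * y \<in> G" using K(1,3) y G by (auto simp: fsub_mult)
        have "v (k1 * (gi k0 * y)) = v (k0 * (gi k0 * y))"
          using step[OF y0 allM[OF y0] K(3)] step[OF y0 allM[OF y0] K(4)] by simp
        then show ?thesis by (simp add: mult.assoc)
      qed
      moreover have "k0 \<in> G" "k1 \<in> G" using K(1,3,4) by auto
      ultimately show ?thesis using G by (simp add: D_def fsub_mult)
    qed
    moreover have "k1 * gi k0 \<noteq> 1" using K(5) gi_unique[of k1 "gi k0"] by auto
    ultimately have "D = G" using simple by blast
    then have "x \<in> D" using x by simp
    then have "v (x * 1) = v 1" using fsub_one[OF G] unfolding D_def by blast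
    then show ?thesis by simp
  qed
  show "norm \<alpha> = 1 \<Longrightarrow> x \<in> G \<Longrightarrow> v x = v 1" for x by (rule main)
  show "\<alpha> = 1" if a1: "norm \<alpha> = 1"
  proof -
    have v1: "v 1 \<noteq> 0" using main[OF a1 v(1)] v(2) by simp
    have "(\<Sum>k\<in>K. v (k * 1)) = (\<Sum>k\<in>K. v 1)" by (intro sum.cong main[OF a1]) (use K(1) in auto)
    then have "of_nat (card K) * v 1 = of_nat (card K) * (\<alpha> * v 1)" using ev[of 1] G by simp
    then show ?thesis using cK v1 by simp
  qed
qed

text \<open>Permutation matrices of left and right translation. Multiplied from the left they turn
  F(x, y) into F(g x, y) and F(x g, y); from the right they move y by the inverse of g.\<close>

definition kl :: "'a::grp set \<Rightarrow> 'a \<Rightarrow> 'a \<Rightarrow> 'a \<Rightarrow> complex" where "kl G g = (\<lambda>x y. if x \<in> G \<and> y = g * x then 1 else 0)"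
definition kr :: "'a::grp set \<Rightarrow> 'a \<Rightarrow> 'a \<Rightarrow> 'a \<Rightarrow> complex" where "kr G g = (\<lambda>x y. if x \<in> G \<and> y = x * g then 1 else 0)"

lemma fsub_mult_iff:
  assumes "fsub G" "g \<in> G" shows "g * x \<in> G \<longleftrightarrow> x \<in> G" "x * g \<in> G \<longleftrightarrow> x \<in> G"
proof -
  show "g * x \<in> G \<longleftrightarrow> x \<in> G" 
    using fsub_mult[OF assms, of x] fsub_mult[OF assms(1) fsub_gi[OF assms], of "g * x"] by auto
  show "x * g \<in> G \<longleftrightarrow> x \<in> G" 
    using fsub_mult[OF assms(1) _ assms(2), of x] fsub_mult[OF assms(1) _ fsub_gi[OF assms], of "x * g"]
    by (auto simp: mult.assoc)
qed

lemma kl_kr_action: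
  assumes G: "fsub G" and g: "g \<in> G"
  shows "kp G (kl G g) F = (\<lambda>x y. if x \<in> G then F (g * x) y else 0)"
    "kp G (kr G g) F = (\<lambda>x y. if x \<in> G then F (x * g) y else 0)"
    "ksup G F \<Longrightarrow> kp G F (kl G g) = (\<lambda>x y. F x (gi g * y))"
    "ksup G F \<Longrightarrow> kp G F (kr G g) = (\<lambda>x y. F x (y * gi g))"
proof -
  have f: "finite G" using G by (rule fsub_finite)
  show "kp G (kl G g) F = (\<lambda>x y. if x \<in> G then F (g * x) y else 0)"
  proof (intro ext)
    fix x y
    have "kp G (kl G g) F x y = (\<Sum>w\<in>G. if w = g * x then (if x \<in> G then F w y else 0) else 0)"
      unfolding kp_def kl_def by (intro sum.cong) auto
    then show "kp G (kl G g) F x y = (if x \<in> G then F (g * x) y else 0)"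
      using f by (simp add: fsub_mult_iff[OF G g])
  qed
  show "kp G (kr G g) F = (\<lambda>x y. if x \<in> G then F (x * g) y else 0)"
  proof (intro ext)
    fix x y
    have "kp G (kr G g) F x y = (\<Sum>w\<in>G. if w = x * g then (if x \<in> G then F w y else 0) else 0)"
      unfolding kp_def kr_def by (intro sum.cong) auto
    then show "kp G (kr G g) F x y = (if x \<in> G then F (x * g) y else 0)"
      using f by (simp add: fsub_mult_iff[OF G g])
  qed
  have e1: "y = g * w \<longleftrightarrow> w = gi g * y" for w y by auto
  have e2: "y = w * g \<longleftrightarrow> w = y * gi g" for w y by (auto simp: mult.assoc)
  show "kp G F (kl G g) = (\<lambda>x y. F x (gi g * y))" if "ksup G F"
  proof (intro ext)
    fix x y
    have "kp G F (kl G g) x y = (\<Sum>w\<in>G. if w = gi g * y then F x w else 0)"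
      unfolding kp_def kl_def by (intro sum.cong refl) (simp add: e1)
    then show "kp G F (kl G g) x y = F x (gi g * y)" using f that by (simp add: ksup_def)
  qed
  show "kp G F (kr G g) = (\<lambda>x y. F x (y * gi g))" if "ksup G F"
  proof (intro ext)
    fix x y
    have "kp G F (kr G g) x y = (\<Sum>w\<in>G. if w = y * gi g then F x w else 0)"
      unfolding kp_def kr_def by (intro sum.cong refl) (simp add: e2)
    then show "kp G F (kr G g) x y = F x (y * gi g)" using f that by (simp add: ksup_def)
  qed
qed

lemma ksup_kl_kr: "fsub G \<Longrightarrow> g \<in> G \<Longrightarrow> ksup G (kl G g)" "fsub G \<Longrightarrow> g \<in> G \<Longrightarrow> ksup G (kr G g)"
  by (auto simp: ksup_def kl_def kr_def fsub_mult)

text \<open>Let T be translation averaged over the class K, with eigenprojections E l of rank n l.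
  The traces of left translation by z, and of translation by z on both sides, on the image of E l
  are n l times l and n l times l^2, both algebraic integers. For l other than 0 and 1 the prime q
  divides n l, so n l times l, divided by sqrt q, is an algebraic integer. Since n 1 = 1 and the
  traces of z add up to 0, 1/sqrt q would be an algebraic integer.\<close>

theorem burnside_class:
  fixes G :: "'a::grp set"
  assumes G: "fsub G" and simple: "\<And>N. normal_in N G \<Longrightarrow> N = {1} \<or> N = G"
    and z: "z \<in> G" and q: "prime q" and card: "card ((\<lambda>g. cj g z) ` G) = q ^ b" and x: "x \<in> G"
  shows "z * x = x * z"
proof (rule ccontr)
  assume nc: "z * x \<noteq> x * z"
  then have z1: "z \<noteq> 1" by auto
  define K where "K = (\<lambda>g. cj g z) ` G"
  have fG: "finite G" using G by (rule fsub_finite)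
  have KG: "K \<subseteq> G" using z G by (auto simp: K_def fsub_cj)
  have fK: "finite K" using fG by (simp add: K_def)
  have Kcj: "cj g k \<in> K" if "g \<in> G" "k \<in> K" for g k using that fsub_mult[OF G] by (auto simp: K_def cj_cj)
  have zK: "z \<in> K" using fsub_one[OF G] unfolding K_def by (metis cj_one(1) image_eqI)
  have xK: "cj x z \<in> K" using x by (simp add: K_def)
  have xz: "z \<noteq> cj x z"
  proof
    assume "z = cj x z"
    then have "z * x = x * z * gi x * x" by (simp add: cj_def)
    then show False using nc by (simp add: mult.assoc)
  qed
  have cK: "card K = q ^ b" using card by (simp add: K_def)
  have cK0: "of_nat (card K) \<noteq> (0::complex)" using fK zK by auto
  have cG0: "of_nat (card G) \<noteq> (0::complex)" using fG z by auto
  have Kiff: "cj g k \<in> K \<longleftrightarrow> k \<in> K" if "g \<in> G" for g k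
    using Kcj[OF that] Kcj[OF fsub_gi[OF G that], of "cj g k"] by (auto simp: cj_cj)
  have cjK: "cj g ` K = K" if g: "g \<in> G" for g
  proof
    show "cj g ` K \<subseteq> K" using Kcj[OF g] by blast
    show "K \<subseteq> cj g ` K"
    proof
      fix k assume "k \<in> K"
      then have "cj (gi g) k \<in> K" "k = cj g (cj (gi g) k)" using Kcj[OF fsub_gi[OF G g]] by (auto simp: cj_cj)
      then show "k \<in> cj g ` K" by blast
    qed
  qed
  have bij: "bij_betw (cj g) K K" if "g \<in> G" for g
    using cjK[OF that] by (auto simp: bij_betw_def inj_on_def cj_def)
  define c where "c = inverse (of_nat (card K) :: complex)"
  have cc: "of_nat (card K) * c = 1" using cK0 by (simp add: c_def)
  define T where "T = (\<lambda>x y. if x \<in> G \<and> y \<in> G \<and> y * gi x \<in> K then c else 0)"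
  have Tsum: "T = (\<lambda>x y. \<Sum>k\<in>K. c * kl G k x y)"
  proof (intro ext)
    fix x y :: 'a
    have e: "y = k * x \<longleftrightarrow> k = y * gi x" for k by (auto simp: mult.assoc)
    have "(\<Sum>k\<in>K. c * kl G k x y) = (\<Sum>k\<in>K. if k = y * gi x then (if x \<in> G then c else 0) else 0)"
      unfolding kl_def by (intro sum.cong refl) (simp add: e)
    also have "\<dots> = (if x \<in> G \<and> y * gi x \<in> K then c else 0)" using fK by simp
    also have "\<dots> = T x y"
    proof -
      have "y \<in> G" if "x \<in> G" "y * gi x \<in> K"
        using KG that fsub_mult_iff(2)[OF G, of "gi x" y] G by auto
      then show ?thesis by (auto simp: T_def)
    qed
    finally show "T x y = (\<Sum>k\<in>K. c * kl G k x y)" by simp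
  qed
  have sT: "ksup G T" by (auto simp: ksup_def T_def)
  have clT: "kp G (kl G g) T = kp G T (kl G g)" and crT: "kp G (kr G g) T = kp G T (kr G g)" if g: "g \<in> G" for g
  proof -
    note it = fsub_mult_iff[OF G g] fsub_mult_iff[OF G fsub_gi[OF G g]]
    have 1: "y * (gi x * gi g) \<in> K \<longleftrightarrow> gi g * y * gi x \<in> K" for x y
      using Kiff[OF fsub_gi[OF G g], of "y * gi (g * x)"] by (simp add: cj_def mult.assoc)
    show "kp G (kl G g) T = kp G T (kl G g)"
      unfolding kl_kr_action(1)[OF G g] kl_kr_action(3)[OF G g sT] by (simp add: T_def it 1 fun_eq_iff)
    have 2: "y * (gi g * gi x) \<in> K \<longleftrightarrow> y * gi g * gi x \<in> K" for x y by (simp add: mult.assoc)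
    show "kp G (kr G g) T = kp G T (kr G g)"
      unfolding kl_kr_action(2)[OF G g] kl_kr_action(4)[OF G g sT] by (simp add: T_def it 2 fun_eq_iff)
  qed
  \<comment> \<open>The adjoint of a left translation is the inverse translation. T commutes with
    all of them, so its adjoint does too, and T is a combination of them.\<close>
  have normal: "kp G T (kad T) = kp G (kad T) T"
  proof -
    have kadl: "kad (kl G (gi g)) = kl G g" if "g \<in> G" for g
    proof (intro ext)
      fix x y
      have "x = gi g * y \<longleftrightarrow> y = g * x" by auto
      then show "kad (kl G (gi g)) x y = kl G g x y"
        using fsub_mult_iff[OF G that] by (auto simp: kad_def kl_def)
    qed
    have "kp G (kl G k) (kad T) = kp G (kad T) (kl G k)" if "k \<in> G" for k
      using arg_cong[OF clT[OF fsub_gi[OF G that]], of kad] by (simp only: kad_kp kadl[OF that])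
    then have "\<forall>k\<in>K. kp G (kl G k) (kad T) = kp G (kad T) (kl G k)" using KG by blast
    then show ?thesis
      by (subst (1 3) Tsum) (simp add: kp_sum_left kp_sum_right kp_cmult_left kp_cmult_right)
  qed
  \<comment> \<open>Decomposing the identity yields the eigenprojections of T.\<close>
  obtain ls where ls: "kkill G T ls (kid G) = (\<lambda>_ _. 0)" using ex_kkill_zero[OF fG sT] by blast
  obtain S E where S: "finite S" and E1: "kid G = (\<lambda>x y. \<Sum>l\<in>S. E l x y)"
    and E: "\<forall>l\<in>S. ksup G (E l) \<and> kp G T (E l) = (\<lambda>x y. l * E l x y) \<and>
      (\<forall>X. kp G X T = kp G T X \<and> kp G X (kid G) = kp G (kid G) X \<longrightarrow> kp G X (E l) = kp G (E l) X)"
    using spectral_decomposition[OF fG sT normal ls ksup_kid] by (elim exE conjE)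
  have sE: "ksup G (E l)" and TE: "kp G T (E l) = (\<lambda>x y. l * E l x y)" if "l \<in> S" for l using E that by auto
  have com: "kp G X (E l) = kp G (E l) X" if "l \<in> S" "ksup G X" "kp G X T = kp G T X" for l X
    using E that kp_kid[OF fG that(2)] by auto
  have ETl: "kp G (E l) T = (\<lambda>x y. l * E l x y)" if "l \<in> S" for l
    using com[OF that sT refl] TE[OF that] by simp
  have orth: "kp G (E l) (E m) = (\<lambda>_ _. 0)" if lm: "l \<in> S" "m \<in> S" "l \<noteq> m" for l m
  proof -
    have "(\<lambda>x y. l * kp G (E l) (E m) x y) = kp G (kp G (E l) T) (E m)"
      by (simp add: ETl[OF lm(1)] kp_cmult_left)
    also have "\<dots> = (\<lambda>x y. m * kp G (E l) (E m) x y)" by (simp add: kp_assoc TE[OF lm(2)] kp_cmult_right)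
    finally have "l * kp G (E l) (E m) x y = m * kp G (E l) (E m) x y" for x y by meson
    then show ?thesis using lm(3) by (intro ext) simp
  qed
  have idem: "kp G (E l) (E l) = E l" if l: "l \<in> S" for l
  proof -
    have "E l = kp G (E l) (kid G)" using kp_kid(2)[OF fG sE[OF l]] by simp
    also have "\<dots> = (\<lambda>x y. \<Sum>m\<in>S. kp G (E l) (E m) x y)" by (simp add: E1 kp_sum_right)
    also have "\<dots> = kp G (E l) (E l)"
    proof (intro ext)
      fix x y
      have "(\<Sum>m\<in>S. kp G (E l) (E m) x y) = (\<Sum>m\<in>S. if m = l then kp G (E l) (E l) x y else 0)"
        by (intro sum.cong refl) (use orth[OF l] in auto)
      then show "(\<Sum>m\<in>S. kp G (E l) (E m) x y) = kp G (E l) (E l) x y" using S l by simp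
    qed
    finally show ?thesis by simp
  qed
  have "\<forall>l\<in>S. \<exists>k::nat. ktr G (E l) = of_nat k" using idempotent_ktr[OF fG idem] by blast
  then obtain n where n: "\<And>l. l \<in> S \<Longrightarrow> ktr G (E l) = of_nat (n l)" by metis
  have El: "E l (g * u) y = E l u (gi g * y)" and Er: "E l (u * g) y = E l u (y * gi g)"
    if "l \<in> S" "g \<in> G" "u \<in> G" for l g u y
  proof -
    have "kp G (kl G g) (E l) = kp G (E l) (kl G g)" by (rule com[OF that(1) ksup_kl_kr(1)[OF G that(2)] clT[OF that(2)]])
    then have "kp G (kl G g) (E l) u y = kp G (E l) (kl G g) u y" by simp
    then show "E l (g * u) y = E l u (gi g * y)"
      unfolding kl_kr_action(1)[OF G that(2)] kl_kr_action(3)[OF G that(2) sE[OF that(1)]] using that(3) by simp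
    have "kp G (kr G g) (E l) = kp G (E l) (kr G g)" by (rule com[OF that(1) ksup_kl_kr(2)[OF G that(2)] crT[OF that(2)]])
    then have "kp G (kr G g) (E l) u y = kp G (E l) (kr G g) u y" by simp
    then show "E l (u * g) y = E l u (y * gi g)"
      unfolding kl_kr_action(2)[OF G that(2)] kl_kr_action(4)[OF G that(2) sE[OF that(1)]] using that(3) by simp
  qed
  have El2: "E l (g * u) (g * y) = E l u y" and Er2: "E l (u * g) (y * g) = E l u y"
    if "l \<in> S" "g \<in> G" "u \<in> G" for l g u y using El[OF that, of "g * y"] Er[OF that, of "y * g"] by (simp_all add: mult.assoc)
  have avl: "(\<Sum>k\<in>K. E l (k * u) y) = of_nat (card K) * (l * E l u y)" if l: "l \<in> S" and u: "u \<in> G" for l u y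
  proof -
    have "l * E l u y = kp G T (E l) u y" using TE[OF l] by simp
    also have "\<dots> = (\<Sum>k\<in>K. c * kp G (kl G k) (E l) u y)" by (subst Tsum) (simp add: kp_sum_left kp_cmult_left)
    also have "\<dots> = c * (\<Sum>k\<in>K. E l (k * u) y)"
      unfolding sum_distrib_left by (intro sum.cong refl) (use KG u in \<open>auto simp: kl_kr_action(1)[OF G]\<close>)
    finally show ?thesis using cc by (simp flip: mult.assoc)
  qed
  have avr: "(\<Sum>k\<in>K. E l (u * k) y) = of_nat (card K) * (l * E l u y)" if l: "l \<in> S" and u: "u \<in> G" for l u y
  proof -
    have "(\<Sum>k\<in>K. E l (k * u) y) = (\<Sum>k\<in>K. E l (cj u k * u) y)"
      by (rule sum.reindex_bij_betw[OF bij[OF u], symmetric])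
    also have "\<dots> = (\<Sum>k\<in>K. E l (u * k) y)" by (simp add: cj_def mult.assoc)
    finally show ?thesis using avl[OF l u] by simp
  qed
  have bl: "bij_betw ((*) g) G G" if g: "g \<in> G" for g
    by (rule bij_betwI[of _ _ _ "(*) (gi g)"])
      (use fsub_mult_iff[OF G g] fsub_mult_iff[OF G fsub_gi[OF G g]] in auto)
  have br: "bij_betw (\<lambda>u. u * g) G G" if g: "g \<in> G" for g
    by (rule bij_betwI[of _ _ _ "\<lambda>u. u * gi g"])
      (use fsub_mult_iff[OF G g] fsub_mult_iff[OF G fsub_gi[OF G g]] in \<open>auto simp: mult.assoc\<close>)
  have avg_const: "(\<Sum>k\<in>K. f k) = of_nat (card K) * t" if "\<And>g. g \<in> G \<Longrightarrow> f (cj g z) = (t::complex)" for f t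
  proof -
    have "(\<Sum>k\<in>K. f k) = (\<Sum>k\<in>K. t)" by (intro sum.cong refl) (use that in \<open>auto simp: K_def\<close>)
    then show ?thesis by simp
  qed
  \<comment> \<open>The eigenvalue equation is summed over the diagonal; by translation invariance
    of E l every element of K contributes as much as z.\<close>
  have tr1: "(\<Sum>u\<in>G. E l (z * u) u) = l * ktr G (E l)" if l: "l \<in> S" for l
  proof -
    let ?t = "\<Sum>u\<in>G. E l (z * u) u"
    have "of_nat (card K) * (l * ktr G (E l)) = (\<Sum>u\<in>G. \<Sum>k\<in>K. E l (k * u) u)"
      unfolding ktr_def sum_distrib_left by (intro sum.cong refl) (simp add: avl[OF l])
    also have "\<dots> = (\<Sum>k\<in>K. \<Sum>u\<in>G. E l (k * u) u)" by (rule sum.swap)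
    also have "\<dots> = of_nat (card K) * ?t"
    proof (rule avg_const)
      fix g assume g: "g \<in> G"
      have "(\<Sum>u\<in>G. E l (cj g z * u) u) = (\<Sum>u\<in>G. E l (cj g z * (g * u)) (g * u))"
        by (rule sum.reindex_bij_betw[OF bl[OF g], symmetric])
      also have "\<dots> = (\<Sum>u\<in>G. E l (z * u) u)"
      proof (intro sum.cong refl)
        fix u assume "u \<in> G"
        then have "E l (g * (z * u)) (g * u) = E l (z * u) u" by (intro El2 l g fsub_mult[OF G z])
        then show "E l (cj g z * (g * u)) (g * u) = E l (z * u) u" by (simp add: cj_def mult.assoc)
      qed
      finally show "(\<Sum>u\<in>G. E l (cj g z * u) u) = ?t" .
    qed
    finally show ?thesis using cK0 by simp
  qed
  \<comment> \<open>The same averaging, once over a factor on the right and once over a factor on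
    the left, each giving a factor l.\<close>
  have tr2: "(\<Sum>u\<in>G. E l (z * u * z) u) = l * (l * ktr G (E l))" if l: "l \<in> S" for l
  proof -
    let ?s = "\<Sum>u\<in>G. E l (u * z) u"
    let ?t = "\<Sum>u\<in>G. E l (z * u * z) u"
    have "of_nat (card K) * (l * ktr G (E l)) = (\<Sum>u\<in>G. \<Sum>k\<in>K. E l (u * k) u)"
      unfolding ktr_def sum_distrib_left by (intro sum.cong refl) (simp add: avr[OF l])
    also have "\<dots> = (\<Sum>k\<in>K. \<Sum>u\<in>G. E l (u * k) u)" by (rule sum.swap)
    also have "\<dots> = of_nat (card K) * ?s"
    proof (rule avg_const)
      fix g assume g: "g \<in> G"
      have "(\<Sum>u\<in>G. E l (u * cj g z) u) = (\<Sum>u\<in>G. E l (u * gi g * cj g z) (u * gi g))"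
        by (rule sum.reindex_bij_betw[OF br[OF fsub_gi[OF G g]], symmetric])
      also have "\<dots> = (\<Sum>u\<in>G. E l (u * z) u)"
      proof (intro sum.cong refl)
        fix u assume "u \<in> G"
        then have "E l (u * z * gi g) (u * gi g) = E l (u * z) u" by (intro Er2 l fsub_gi[OF G g] fsub_mult[OF G _ z])
        then show "E l (u * gi g * cj g z) (u * gi g) = E l (u * z) u" by (simp add: cj_def mult.assoc)
      qed
      finally show "(\<Sum>u\<in>G. E l (u * cj g z) u) = ?s" .
    qed
    finally have s: "?s = l * ktr G (E l)" using cK0 by simp
    have "of_nat (card K) * (l * ?s) = (\<Sum>u\<in>G. \<Sum>k\<in>K. E l (k * (u * z)) u)"
      unfolding sum_distrib_left by (intro sum.cong refl) (simp add: avl[OF l] fsub_mult[OF G _ z])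
    also have "\<dots> = (\<Sum>k\<in>K. \<Sum>u\<in>G. E l (k * (u * z)) u)" by (rule sum.swap)
    also have "\<dots> = of_nat (card K) * ?t"
    proof (rule avg_const)
      fix g assume g: "g \<in> G"
      have "(\<Sum>u\<in>G. E l (cj g z * (u * z)) u) = (\<Sum>u\<in>G. E l (cj g z * (g * u * z)) (g * u))"
        by (rule sum.reindex_bij_betw[OF bl[OF g], symmetric])
      also have "\<dots> = ?t"
      proof (intro sum.cong refl)
        fix u assume "u \<in> G"
        then have "E l (g * (z * u * z)) (g * u) = E l (z * u * z) u" by (intro El2 l g fsub_mult[OF G] z)
        then show "E l (cj g z * (g * u * z)) (g * u) = E l (z * u * z) u" by (simp add: cj_def mult.assoc)
      qed
      finally show "(\<Sum>u\<in>G. E l (cj g z * (u * z)) u) = ?t" .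
    qed
    finally show ?thesis using cK0 s by simp
  qed
  have Ezero: "E l u y = 0" if "l \<in> S" "u \<notin> G" for l u y using sE[OF that(1)] that(2) by (simp add: ksup_def)
  have cardG: "card G > 0" using fG z by (auto simp: card_gt_0_iff)
  have zn: "z ^ j \<in> G" for j by (induction j) (use z G in \<open>auto simp: fsub_mult\<close>)
  have zcard: "z ^ card G = 1" by (rule fsub_power_card[OF G z])
  have alg1: "algebraic_int (of_nat (n l) * l)" if l: "l \<in> S" for l
  proof -
    have it: "(kp G (kl G z) ^^ j) (E l) = (\<lambda>u y. if u \<in> G then E l (z ^ j * u) y else 0)" for j
    proof (induction j)
      case 0 then show ?case using Ezero[OF l] by (auto simp: fun_eq_iff)
    next
      case (Suc j)
      then show ?case using z G by (auto simp: kl_kr_action(1)[OF G z] fun_eq_iff fsub_mult mult.assoc power_Suc2 simp del: power_Suc)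
    qed
    have "algebraic_int (ktr G (kp G (kl G z) (E l)))"
    proof (rule periodic_ktr_algebraic_int[OF fG idem[OF l] _ cardG])
      show "kp G (kl G z) (E l) = kp G (E l) (kl G z)" by (rule com[OF l ksup_kl_kr(1)[OF G z] clT[OF z]])
      show "(kp G (kl G z) ^^ card G) (E l) = E l" unfolding it zcard using Ezero[OF l] by (auto simp: fun_eq_iff)
    qed
    also have "ktr G (kp G (kl G z) (E l)) = of_nat (n l) * l"
      using tr1[OF l] n[OF l] by (simp add: ktr_def kl_kr_action(1)[OF G z])
    finally show ?thesis .
  qed
  have alg2: "algebraic_int (of_nat (n l) * l * l)" if l: "l \<in> S" for l
  proof -
    let ?X = "kp G (kl G z) (kr G z)"
    have X: "kp G ?X F = (\<lambda>u y. if u \<in> G then F (z * u * z) y else 0)" for F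
      unfolding kp_assoc unfolding kl_kr_action(1)[OF G z] kl_kr_action(2)[OF G z] using z by (auto simp: fun_eq_iff fsub_mult[OF G])
    have it: "(kp G ?X ^^ j) (E l) = (\<lambda>u y. if u \<in> G then E l (z ^ j * u * z ^ j) y else 0)" for j
    proof (induction j)
      case 0 then show ?case using Ezero[OF l] by (auto simp: fun_eq_iff)
    next
      case (Suc j)
      have "z ^ j * (z * u * z) * z ^ j = z ^ Suc j * u * z ^ Suc j" for u
      proof -
        have "z ^ j * (z * u * z) * z ^ j = (z ^ j * z) * u * (z * z ^ j)" by (simp add: mult.assoc)
        then show ?thesis by (simp only: power_Suc[symmetric] power_Suc2[symmetric])
      qed
      then show ?case using Suc z G by (simp add: X fun_eq_iff fsub_mult del: power_Suc)
    qed
    have "algebraic_int (ktr G (kp G ?X (E l)))"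
    proof (rule periodic_ktr_algebraic_int[OF fG idem[OF l] _ cardG])
      have "kp G (kl G z) (E l) = kp G (E l) (kl G z)" "kp G (kr G z) (E l) = kp G (E l) (kr G z)"
        by (rule com[OF l ksup_kl_kr(1)[OF G z] clT[OF z]], rule com[OF l ksup_kl_kr(2)[OF G z] crT[OF z]])
      then show "kp G ?X (E l) = kp G (E l) ?X" by (metis kp_assoc)
      show "(kp G ?X ^^ card G) (E l) = E l" unfolding it zcard using Ezero[OF l] by (auto simp: fun_eq_iff)
    qed
    also have "ktr G (kp G ?X (E l)) = of_nat (n l) * l * l"
      using tr2[OF l] n[OF l] by (simp add: ktr_def X)
    finally show ?thesis .
  qed
  \<comment> \<open>The column of a nonzero entry of E l is an eigenfunction of the class
    average.\<close>
  have eig: "algebraic_int (of_nat (card K) * l)" "norm l \<le> 1" "norm l = 1 \<Longrightarrow> l = 1"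
    "algebraic_int l \<Longrightarrow> norm l < 1 \<Longrightarrow> l = 0"
    if l: "l \<in> S" and nz: "E l x0 y0 \<noteq> 0" for l x0 y0
  proof -
    have x0: "x0 \<in> G" using Ezero[OF l, of x0] nz by blast
    define M :: "'a \<Rightarrow> 'a \<Rightarrow> int" where "M = (\<lambda>u w. if w * gi u \<in> K then 1 else 0)"
    have ev: "(\<Sum>k\<in>K. E l (k * u) y0) = of_nat (card K) * (l * E l u y0)" if "u \<in> G" for u by (rule avl[OF l that])
    have bK: "bij_betw (\<lambda>k. k * u) K {w \<in> G. w * gi u \<in> K}" if u: "u \<in> G" for u
      by (rule bij_betwI[of _ _ _ "\<lambda>w. w * gi u"]) (use KG u fsub_mult[OF G] in \<open>auto simp: mult.assoc\<close>)
    have Mev: "of_nat (card K) * l * E l u y0 = (\<Sum>w\<in>G. of_int (M u w) * E l w y0)" if u: "u \<in> G" for u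
    proof -
      have "(\<Sum>w\<in>G. of_int (M u w) * E l w y0) = (\<Sum>w\<in>{w \<in> G. w * gi u \<in> K}. E l w y0)"
        by (rule sum.mono_neutral_cong_right[OF fG]) (auto simp: M_def)
      also have "\<dots> = (\<Sum>k\<in>K. E l (k * u) y0)" by (rule sum.reindex_bij_betw[OF bK[OF u], symmetric])
      finally show ?thesis using ev[OF u] by (simp add: mult.assoc)
    qed
    show "algebraic_int (of_nat (card K) * l)" by (rule algebraic_int_eigenvalue[OF fG x0, of "\<lambda>u. E l u y0" _ M]) (use nz Mev in auto)
    note cae = class_average_eigenvector[OF G simple KG Kcj zK xK xz x0, of "\<lambda>u. E l u y0", OF _ _ _ nz ev]
    show "norm l \<le> 1" "norm l = 1 \<Longrightarrow> l = 1" using cae(1,3) by blast+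
    show "l = 0" if "algebraic_int l" "norm l < 1"
    proof (rule stochastic_eigenvalue[OF fG, of "card K" M x0 "\<lambda>u. E l u y0"])
      show "card K > 0" using fK zK by (auto simp: card_gt_0_iff)
      show "(\<Sum>j\<in>G. \<bar>M i j\<bar>) \<le> int (card K)" if "i \<in> G" for i
      proof -
        have "(\<Sum>j\<in>G. \<bar>M i j\<bar>) = (\<Sum>j\<in>{w \<in> G. w * gi i \<in> K}. 1)"
          by (rule sum.mono_neutral_cong_right[OF fG]) (auto simp: M_def)
        also have "\<dots> = int (card K)" using bij_betw_same_card[OF bK[OF that]] by simp
        finally show ?thesis by simp
      qed
    qed (use x0 nz Mev that in auto)
  qed
  \<comment> \<open>The columns of E 1 are constant functions, and invariance under simultaneous
    translation identifies the constants, so the image of E 1 is one-dimensional.\<close>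
  have const: "E 1 u y = E 1 1 1" if u: "u \<in> G" "y \<in> G" and S1: "1 \<in> S" for u y
  proof -
    have c1: "E 1 u' y' = E 1 1 y'" if "u' \<in> G" for u' y'
    proof (cases "\<exists>x0. E 1 x0 y' \<noteq> 0")
      case True
      then obtain x0 where nz: "E 1 x0 y' \<noteq> 0" by blast
      have x0: "x0 \<in> G" using Ezero[OF S1, of x0] nz by blast
      have "norm (1::complex) = 1" by simp
      from class_average_eigenvector(2)[OF G simple KG Kcj zK xK xz x0 nz avl[OF S1] this that] show ?thesis by simp
    qed auto
    have "E 1 u y = E 1 1 y" by (rule c1[OF u(1)])
    also have "\<dots> = E 1 (y * 1) (y * 1)" using c1[of y y] u(2) by simp
    also have "\<dots> = E 1 1 1" by (rule El2[OF S1 u(2)]) (use G in simp)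
    finally show ?thesis .
  qed
  \<comment> \<open>T has row sums 1, so summing the rows in E l T = l E l shows that l times the
    sum equals the sum.\<close>
  have rowsum: "(\<Sum>y\<in>G. E l u y) = 0" if l: "l \<in> S" "l \<noteq> 1" and u: "u \<in> G" for l u
  proof -
    have col: "(\<Sum>y\<in>G. T w y) = 1" if w: "w \<in> G" for w
    proof -
      have "(\<Sum>y\<in>G. T w y) = (\<Sum>k\<in>K. c * (\<Sum>y\<in>G. kl G k w y))"
        unfolding Tsum by (subst sum.swap) (simp add: sum_distrib_left)
      also have "\<dots> = (\<Sum>k\<in>K. c)"
      proof (intro sum.cong refl)
        fix k assume "k \<in> K"
        then have "k * w \<in> G" using KG w fsub_mult[OF G] by blast
        then show "c * (\<Sum>y\<in>G. kl G k w y) = c" using fG w by (simp add: kl_def)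
      qed
      finally show ?thesis using cc by simp
    qed
    have "l * (\<Sum>y\<in>G. E l u y) = (\<Sum>y\<in>G. kp G (E l) T u y)" by (simp add: ETl[OF l(1)] sum_distrib_left)
    also have "\<dots> = (\<Sum>w\<in>G. E l u w * (\<Sum>y\<in>G. T w y))" unfolding kp_def by (subst sum.swap) (simp add: sum_distrib_left)
    also have "\<dots> = (\<Sum>w\<in>G. E l u w)" by (simp add: col)
    finally show ?thesis using l(2) by simp
  qed
  have rows1: "(\<Sum>l\<in>S. \<Sum>y\<in>G. E l 1 y) = 1"
  proof -
    have "(\<Sum>l\<in>S. \<Sum>y\<in>G. E l 1 y) = (\<Sum>y\<in>G. kid G 1 y)" unfolding E1 by (rule sum.swap)
    also have "\<dots> = (\<Sum>y\<in>G. if 1 = y then 1 else 0)" using G by (intro sum.cong refl) (simp add: kid_def)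
    finally show ?thesis using fG G by simp
  qed
  have S1: "1 \<in> S"
  proof (rule ccontr)
    assume "1 \<notin> S"
    then have "\<forall>l\<in>S. (\<Sum>y\<in>G. E l 1 y) = 0" using rowsum[OF _ _ fsub_one[OF G]] by metis
    then have "(\<Sum>l\<in>S. \<Sum>y\<in>G. E l 1 y) = 0" by (rule sum.neutral)
    then show False using rows1 by simp
  qed
  have n1: "of_nat (n 1) = (1::complex)"
  proof -
    have "(\<Sum>l\<in>S. \<Sum>y\<in>G. E l 1 y) = (\<Sum>l\<in>S. if l = 1 then \<Sum>y\<in>G. E 1 1 y else 0)"
      by (intro sum.cong refl) (use rowsum G in auto)
    then have "(\<Sum>y\<in>G. E 1 1 y) = 1" using rows1 S S1 by simp
    also have "(\<Sum>y\<in>G. E 1 1 y) = ktr G (E 1)"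
      unfolding ktr_def
    proof (rule sum.cong[OF refl])
      fix y assume "y \<in> G"
      then show "E 1 1 y = E 1 y y" using const[OF fsub_one[OF G] _ S1, of y] const[OF _ _ S1, of y y] by metis
    qed
    finally show ?thesis using n[OF S1] by simp
  qed
  \<comment> \<open>This is the trace of translation by z, which has no fixed points.\<close>
  have total: "(\<Sum>l\<in>S. of_nat (n l) * l) = 0"
  proof -
    have "(\<Sum>l\<in>S. of_nat (n l) * l) = (\<Sum>l\<in>S. \<Sum>u\<in>G. E l (z * u) u)"
      by (intro sum.cong refl) (simp add: tr1 n)
    also have "\<dots> = (\<Sum>u\<in>G. kid G (z * u) u)" unfolding E1 by (rule sum.swap)
    also have "\<dots> = 0" using z1 by (intro sum.neutral) (simp add: kid_def)
    finally show ?thesis .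
  qed
  define r where "r = csqrt (of_nat q)"
  have r2: "r * r = of_nat q" by (metis power2_csqrt power2_eq_square r_def)
  have q0: "q > 0" using q by (simp add: prime_gt_0_nat)
  then have r0: "r \<noteq> 0" using r2 by auto
  have main: "algebraic_int (of_nat (n l) * l / r)" if l: "l \<in> S" "l \<noteq> 1" for l
  proof (cases "n l = 0 \<or> l = 0")
    case True then show ?thesis by auto
  next
    case False
    then have "ktr G (E l) \<noteq> 0" using n[OF l(1)] by simp
    then obtain u where nz: "E l u u \<noteq> 0" unfolding ktr_def by (meson sum.neutral)
    note e = eig[OF l(1) nz]
    \<comment> \<open>Otherwise n l and the q-power |K| are coprime, and l is an integral
      combination of the algebraic integers n l times l and |K| times l; having modulus below 1, it
      would be 0.\<close>
    have "q dvd n l"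
    proof (rule ccontr)
      assume "\<not> q dvd n l"
      then have "coprime (n l) (card K)" unfolding cK using q by (metis coprime_commute coprime_power_left_iff prime_imp_coprime)
      then obtain a b where ab: "a * int (n l) + b * int (card K) = 1"
        using bezout_int[of "int (n l)" "int (card K)"] by (auto simp: coprime_int_iff)
      have "l = of_int (a * int (n l) + b * int (card K)) * l" by (simp only: ab of_int_1 mult_1_left)
      also have "\<dots> = of_int a * (of_nat (n l) * l) + of_int b * (of_nat (card K) * l)" by (simp add: algebra_simps)
      finally have "l = of_int a * (of_nat (n l) * l) + of_int b * (of_nat (card K) * l)" .
      moreover have "algebraic_int (of_int a * (of_nat (n l) * l) + of_int b * (of_nat (card K) * l))"
        by (intro algebraic_int_add_mult algebraic_int_of_int alg1 e(1) l(1))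
      ultimately have "algebraic_int l" by simp
      moreover have "norm l < 1" using e(2,3) l(2) by fastforce
      ultimately have "l = 0" by (rule e(4))
      then show False using False by simp
    qed
    then obtain m where m: "n l = q * m" by (rule dvdE)
    \<comment> \<open>Its square is n l / q times the trace n l l^2, an algebraic integer.\<close>
    let ?y = "of_nat (n l) * l / r"
    have "?y * ?y = of_nat (n l) * (of_nat (n l) * l * l) / (r * r)" by simp
    also have "\<dots> = of_nat m * (of_nat (n l) * l * l)" using q0 unfolding r2 by (simp add: m)
    finally have "poly (monom 1 2) ?y = of_nat m * (of_nat (n l) * l * l)" by (simp add: poly_monom power2_eq_square)
    moreover have "algebraic_int (of_nat m * (of_nat (n l) * l * l))"
      by (rule algebraic_int_add_mult(2)[OF algebraic_int_of_nat alg2[OF l(1)]])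
    ultimately show ?thesis using algebraic_int_root[of _ "monom 1 2" ?y] by (auto simp: degree_monom_eq)
  qed
  have "1 / r = - (\<Sum>l\<in>S - {1}. of_nat (n l) * l / r)"
  proof -
    have "(\<Sum>l\<in>S - {1}. of_nat (n l) * l) = - 1" using total n1 S S1 by (simp add: sum_diff1)
    then show ?thesis by (simp only: sum_divide_distrib[symmetric]) simp
  qed
  moreover have "algebraic_int (\<Sum>l\<in>S - {1}. of_nat (n l) * l / r)" by (rule algebraic_int_sum) (use main in auto)
  ultimately have "algebraic_int (1 / r)" by simp
  then have "algebraic_int (1 / r * (1 / r))" by (intro algebraic_int_add_mult(2))
  then have ai: "algebraic_int (1 / of_nat q :: complex)" by (simp add: r2)
  have "1 / of_nat q \<in> (\<rat> :: complex set)" by simp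
  then have "1 / of_nat q \<in> (\<int> :: complex set)" by (rule rational_algebraic_int_is_int[OF ai])
  then obtain k where k: "1 / of_nat q = complex_of_int k" by (elim Ints_cases)
  then have "1 = complex_of_int k * of_nat q" using q0 by (simp add: field_simps)
  then have "complex_of_int 1 = of_int (k * int q)" by simp
  then have "1 = k * int q" by (simp only: of_int_eq_iff)
  then have "int q dvd 1" by (metis dvd_triv_right)
  then show False using q by (simp add: prime_nat_iff)
qed

section \<open>Homomorphisms on finite subgroups\<close>

definition hom_on :: "'a::grp set \<Rightarrow> ('a \<Rightarrow> 'b::grp) \<Rightarrow> bool" where
  "hom_on X \<phi> \<longleftrightarrow> (\<forall>x\<in>X. \<forall>y\<in>X. \<phi> (x * y) = \<phi> x * \<phi> y)"

lemma hom_on_mult: "hom_on X \<phi> \<Longrightarrow> x \<in> X \<Longrightarrow> y \<in> X \<Longrightarrow> \<phi> (x * y) = \<phi> x * \<phi> y"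
  by (simp add: hom_on_def)

lemma hom_on_subset: "hom_on X \<phi> \<Longrightarrow> Y \<subseteq> X \<Longrightarrow> hom_on Y \<phi>"
  by (auto simp: hom_on_def)

lemma hom_on_simps:
  assumes h: "hom_on X \<phi>" and X: "fsub X"
  shows "\<phi> 1 = 1" "x \<in> X \<Longrightarrow> \<phi> (gi x) = gi (\<phi> x)" "x \<in> X \<Longrightarrow> \<phi> (x ^ n) = \<phi> x ^ n"
    "x \<in> X \<Longrightarrow> y \<in> X \<Longrightarrow> \<phi> (cj x y) = cj (\<phi> x) (\<phi> y)"
proof -
  have "\<phi> 1 * \<phi> 1 = \<phi> 1" using hom_on_mult[OF h, of 1 1] X by simp
  then show one: "\<phi> 1 = 1" by (simp only: grp_left_eq_self)
  have inv: "\<phi> (gi x) = gi (\<phi> x)" if "x \<in> X" for x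
  proof -
    have "\<phi> x * \<phi> (gi x) = 1" using hom_on_mult[OF h that fsub_gi[OF X that]] one by simp
    then show ?thesis using gi_unique by metis
  qed
  show "x \<in> X \<Longrightarrow> \<phi> (gi x) = gi (\<phi> x)" by (rule inv)
  show "\<phi> (x ^ n) = \<phi> x ^ n" if "x \<in> X"
    by (induction n) (simp_all add: one hom_on_mult[OF h that fsub_power[OF X that]])
  show "\<phi> (cj x y) = cj (\<phi> x) (\<phi> y)" if "x \<in> X" "y \<in> X"
    using that X by (simp add: cj_def hom_on_mult[OF h] inv fsub_mult fsub_gi)
qed

lemma hom_on_image_fsub:
  assumes h: "hom_on X \<phi>" and X: "fsub X" and Y: "fsub Y" "Y \<subseteq> X" shows "fsub (\<phi> ` Y)"
proof (rule fsubI)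
  show "finite (\<phi> ` Y)" using Y fsub_finite by blast
  show "1 \<in> \<phi> ` Y" using hom_on_simps(1)[OF h X] fsub_one[OF Y(1)] by (metis image_eqI)
  fix x assume "x \<in> \<phi> ` Y"
  then obtain a where a: "a \<in> Y" "x = \<phi> a" by blast
  have "gi x = \<phi> (gi a)" using a Y hom_on_simps(2)[OF h X] by auto
  then show "gi x \<in> \<phi> ` Y" using fsub_gi[OF Y(1) a(1)] by blast
  fix y assume "y \<in> \<phi> ` Y"
  then obtain b where b: "b \<in> Y" "y = \<phi> b" by blast
  have "x * y = \<phi> (a * b)" using a b hom_on_mult[OF h subsetD[OF Y(2)] subsetD[OF Y(2)]] by simp
  then show "x * y \<in> \<phi> ` Y" using fsub_mult[OF Y(1) a(1) b(1)] by blast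
qed

lemma hom_on_vimage_fsub:
  assumes h: "hom_on X \<phi>" and X: "fsub X" and R: "fsub R" shows "fsub {x \<in> X. \<phi> x \<in> R}"
  by (rule fsubI) (use X R hom_on_simps[OF h X] hom_on_mult[OF h] in \<open>auto simp: fsub_mult fsub_finite\<close>)

lemma hom_on_vimage_normal:
  assumes h: "hom_on X \<phi>" and X: "fsub X" and R: "normal_in R (\<phi> ` X)" shows "normal_in {x \<in> X. \<phi> x \<in> R} X"
proof (rule normal_inI)
  show "fsub {x \<in> X. \<phi> x \<in> R}" by (rule hom_on_vimage_fsub[OF h X normal_in_fsub[OF R]])
  fix x n assume "x \<in> X" "n \<in> {x \<in> X. \<phi> x \<in> R}"
  then show "cj x n \<in> {x \<in> X. \<phi> x \<in> R}"
    using hom_on_simps(4)[OF h X] normal_in_cj[OF R] fsub_cj[OF X] by simp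
qed auto

lemma hom_on_card:
  assumes h: "hom_on X \<phi>" and X: "fsub X" shows "card (\<phi> ` X) * card {x \<in> X. \<phi> x = 1} = card X"
proof -
  let ?K = "{x \<in> X. \<phi> x = 1}"
  have K: "fsub ?K" using hom_on_vimage_fsub[OF h X fsub_triv] by simp
  have fin: "finite X" using X by (rule fsub_finite)
  have fib: "card {x \<in> X. \<phi> x = \<phi> a} = card ?K" if a: "a \<in> X" for a
  proof (rule bij_betw_same_card[symmetric])
    have "\<phi> (gi a * x) = 1 \<longleftrightarrow> \<phi> x = \<phi> a" if "x \<in> X" for x
    proof -
      have "\<phi> (gi a * x) = gi (\<phi> a) * \<phi> x"
        by (simp add: hom_on_mult[OF h fsub_gi[OF X a] that] hom_on_simps(2)[OF h X a])
      moreover have "gi (\<phi> a) * \<phi> x = 1 \<longleftrightarrow> \<phi> x = \<phi> a" using gi_unique[of "gi (\<phi> a)" "\<phi> x"] by auto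
      ultimately show ?thesis by simp
    qed
    moreover have "a * x \<in> X" "\<phi> (a * x) = \<phi> a * \<phi> x" if "x \<in> X" for x
      using fsub_mult[OF X a that] hom_on_mult[OF h a that] by auto
    moreover have "gi a * x \<in> X" if "x \<in> X" for x using fsub_mult[OF X fsub_gi[OF X a] that] .
    ultimately show "bij_betw ((*) a) ?K {x \<in> X. \<phi> x = \<phi> a}"
      by (intro bij_betwI[of _ _ _ "(*) (gi a)"]) auto
  qed
  have "card X = (\<Sum>y\<in>\<phi> ` X. card {x \<in> X. \<phi> x = y})" using sum.image_gen[OF fin, of "\<lambda>_. 1::nat" \<phi>] by simp
  also have "\<dots> = (\<Sum>y\<in>\<phi> ` X. card ?K)" by (intro sum.cong refl) (elim imageE, simp only: fib)
  finally show ?thesis by simp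
qed

text \<open>For e congruent to 1 modulo a power of p that annihilates the image and to 0 modulo the
  p'-part of card X, the power x^e is a p-element with the same image.\<close>

lemma p_elt_lift:
  assumes h: "hom_on X \<phi>" and X: "fsub X" and p: "prime p" and x: "x \<in> X" "p_elt p (\<phi> x)"
  shows "\<exists>y\<in>X. p_elt p y \<and> \<phi> y = \<phi> x"
proof -
  obtain k where k: "\<phi> x ^ (p ^ k) = 1" using x(2) by (auto simp: p_elt_def)
  have c0: "card X \<noteq> 0" using fsub_card_pos[OF X] by simp
  obtain m where m: "card X = p ^ multiplicity p (card X) * m" "\<not> p dvd m"
    using multiplicity_decompose'[of "card X" p] c0 p by (metis not_prime_unit)
  have "coprime (p ^ k) m" using m(2) p by (metis coprime_power_left_iff prime_imp_coprime)
  then obtain e where e: "[e = 1] (mod p ^ k)" "[e = 0] (mod m)" using binary_chinese_remainder_nat by blast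
  have "m dvd e" using e(2) by (simp add: cong_0_iff)
  then obtain j where j: "e * p ^ multiplicity p (card X) = card X * j" using m(1) by (metis dvdE mult.assoc mult.commute)
  have "(x ^ e) ^ (p ^ multiplicity p (card X)) = 1"
    by (simp only: power_mult[symmetric] j) (simp add: power_mult fsub_power_card[OF X x(1)])
  then have "p_elt p (x ^ e)" by (auto simp: p_elt_def)
  moreover have "\<phi> (x ^ e) = \<phi> x"
  proof -
    have pr: "\<phi> x ^ i = \<phi> x ^ (i mod p ^ k)" for i
    proof -
      have "\<phi> x ^ i = \<phi> x ^ (p ^ k * (i div p ^ k) + i mod p ^ k)" by simp
      also have "\<dots> = \<phi> x ^ (i mod p ^ k)" by (simp only: power_add power_mult k power_one mult_1_left)
      finally show ?thesis .
    qed
    have "\<phi> x ^ e = \<phi> x ^ 1" using pr[of e] pr[of 1] e(1) by (simp only: cong_def)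
    then show ?thesis using hom_on_simps(3)[OF h X x(1)] by simp
  qed
  ultimately show ?thesis using fsub_power[OF X x(1)] by blast
qed

lemma nilp_image:
  assumes h: "hom_on X \<phi>" and X: "nilp X" shows "nilp (\<phi> ` X)"
  unfolding nilp_def
proof (intro conjI allI impI)
  have fX: "fsub X" using X by (rule nilp_fsub)
  show "fsub (\<phi> ` X)" by (rule hom_on_image_fsub[OF h fX fX subset_refl])
  fix p q :: nat and x y assume pq: "prime p" "prime q" "p \<noteq> q" and xy: "x \<in> \<phi> ` X" "y \<in> \<phi> ` X" "p_elt p x" "p_elt q y"
  obtain a0 where a0: "a0 \<in> X" "x = \<phi> a0" using xy(1) by (elim imageE)
  obtain b0 where b0: "b0 \<in> X" "y = \<phi> b0" using xy(2) by (elim imageE)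
  obtain a where a: "a \<in> X" "p_elt p a" "x = \<phi> a"
    using p_elt_lift[OF h fX pq(1) a0(1) xy(3)[unfolded a0(2)]] a0(2) by (elim bexE conjE) metis
  obtain b where b: "b \<in> X" "p_elt q b" "y = \<phi> b"
    using p_elt_lift[OF h fX pq(2) b0(1) xy(4)[unfolded b0(2)]] b0(2) by (elim bexE conjE) metis
  show "x * y = y * x"
    using nilp_commute[OF X pq a(1) b(1) a(2) b(2)] hom_on_mult[OF h a(1) b(1)] hom_on_mult[OF h b(1) a(1)] a(3) b(3) by simp
qed

lemma hom_on_sprod:
  assumes h: "hom_on X \<phi>" and HK: "H \<subseteq> X" "K \<subseteq> X" shows "\<phi> ` sprod H K = sprod (\<phi> ` H) (\<phi> ` K)"
proof
  show "\<phi> ` sprod H K \<subseteq> sprod (\<phi> ` H) (\<phi> ` K)"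
  proof
    fix x assume "x \<in> \<phi> ` sprod H K"
    then obtain a b where ab: "a \<in> H" "b \<in> K" "x = \<phi> (a * b)" by (elim imageE sprodE) blast
    then have "x = \<phi> a * \<phi> b" using hom_on_mult[OF h subsetD[OF HK(1) ab(1)] subsetD[OF HK(2) ab(2)]] by simp
    then show "x \<in> sprod (\<phi> ` H) (\<phi> ` K)" using ab(1,2) by (simp only: sprodI imageI)
  qed
  show "sprod (\<phi> ` H) (\<phi> ` K) \<subseteq> \<phi> ` sprod H K"
  proof
    fix x assume "x \<in> sprod (\<phi> ` H) (\<phi> ` K)"
    then obtain a b where ab: "a \<in> H" "b \<in> K" "x = \<phi> a * \<phi> b" by (elim imageE sprodE) blast
    then have "x = \<phi> (a * b)" using hom_on_mult[OF h subsetD[OF HK(1) ab(1)] subsetD[OF HK(2) ab(2)]] by simp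
    then show "x \<in> \<phi> ` sprod H K" using sprodI[OF ab(1,2)] by (simp only: imageI)
  qed
qed

section \<open>Quotients as permutation groups\<close>

text \<open>\<open>nat bperm\<close> contains a copy of every finite group, so an induction through
  quotients stays in one type. For the brace, permutations of its own element type are used.\<close>

typedef 'a bperm = "{f :: 'a \<Rightarrow> 'a. bij f}" by (rule exI[of _ id]) simp

lemma bij_Rep_bperm: "bij (Rep_bperm f)" using Rep_bperm by auto

instantiation bperm :: (type) grp
begin

definition "times_bperm f g = Abs_bperm (Rep_bperm f \<circ> Rep_bperm g)"
definition "one_bperm = Abs_bperm id"
definition "gi_bperm f = Abs_bperm (inv_into UNIV (Rep_bperm f))"

lemma Rep_bperm_times: "Rep_bperm (f * g) = Rep_bperm f \<circ> Rep_bperm g"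
  unfolding times_bperm_def by (rule Abs_bperm_inverse) (auto intro: bij_comp bij_Rep_bperm)

lemma Rep_bperm_one: "Rep_bperm 1 = id"
  unfolding one_bperm_def by (rule Abs_bperm_inverse) simp

lemma Rep_bperm_gi: "Rep_bperm (gi f) = inv_into UNIV (Rep_bperm f)"
  unfolding gi_bperm_def by (rule Abs_bperm_inverse) (auto intro: bij_imp_bij_inv bij_Rep_bperm)

instance
proof
  fix f g h :: "'a bperm"
  show "f * g * h = f * (g * h)" by (simp add: Rep_bperm_inject[symmetric] Rep_bperm_times comp_assoc)
  show "1 * f = f" "f * 1 = f" by (simp_all add: Rep_bperm_inject[symmetric] Rep_bperm_times Rep_bperm_one)
  show "gi f * f = 1"
    by (simp add: Rep_bperm_inject[symmetric] Rep_bperm_times Rep_bperm_one Rep_bperm_gi inv_o_cancel[OF bij_is_inj[OF bij_Rep_bperm]])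
qed

end

lemma quotient_hom:
  fixes X :: "'a::grp set"
  assumes X: "fsub X" and N: "normal_in N X"
  shows "\<exists>\<phi> :: 'a \<Rightarrow> nat bperm. hom_on X \<phi> \<and> (\<forall>x\<in>X. \<phi> x = 1 \<longleftrightarrow> x \<in> N)"
proof -
  let ?C = "(\<lambda>x. (*) x ` N) ` X"
  have fN: "fsub N" by (rule normal_in_fsub[OF N])
  have "finite ?C" using fsub_finite[OF X] by simp
  from finite_imp_inj_to_nat_seg[OF this] obtain e :: "'a set \<Rightarrow> nat" and n where e: "inj_on e ?C" by (elim exE conjE)
  define d where "d = inv_into ?C e"
  have de: "d (e c) = c" if "c \<in> ?C" for c unfolding d_def using e that by (rule inv_into_f_f)
  have mC: "(*) x ` c \<in> ?C" if x: "x \<in> X" and c: "c \<in> ?C" for x c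
  proof -
    obtain y where y: "y \<in> X" "c = (*) y ` N" using c by blast
    have "(*) x ` c = (*) (x * y) ` N" by (simp add: y(2) image_image mult.assoc)
    then show ?thesis using fsub_mult[OF X x y(1)] by blast
  qed
  \<comment> \<open>Cosets are coded by natural numbers; the other numbers are fixed, so each map is
    a bijection of the whole type.\<close>
  define f where "f x i = (if i \<in> e ` ?C then e ((*) x ` d i) else i)" for x i
  have fin: "f x i \<in> e ` ?C \<longleftrightarrow> i \<in> e ` ?C" if "x \<in> X" for x i
    using mC[OF that] by (auto simp: f_def de)
  have fe: "f x (e c) = e ((*) x ` c)" if "c \<in> ?C" for x c using that by (simp add: f_def de)
  have fm: "f (x * y) i = f x (f y i)" if "x \<in> X" "y \<in> X" for x y i
  proof (cases "i \<in> e ` ?C")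
    case True
    then obtain c where c: "c \<in> ?C" "i = e c" by blast
    show ?thesis unfolding c(2) fe[OF c(1)] fe[OF mC[OF that(2) c(1)]] by (simp add: image_image mult.assoc)
  next
    case False
    then show ?thesis by (simp add: f_def)
  qed
  have f1: "f 1 i = i" for i
  proof (cases "i \<in> e ` ?C")
    case True
    then obtain c where "c \<in> ?C" "i = e c" by blast
    then show ?thesis using fe by simp
  next
    case False
    then show ?thesis by (simp add: f_def)
  qed
  have bij: "bij (f x)" if x: "x \<in> X" for x
    by (rule o_bij[of "f (gi x)"]) (use fm[OF x fsub_gi[OF X x]] fm[OF fsub_gi[OF X x] x] f1 in \<open>auto simp: fun_eq_iff\<close>)
  define \<phi> where "\<phi> x = Abs_bperm (f x)" for x
  have R: "Rep_bperm (\<phi> x) = f x" if "x \<in> X" for x unfolding \<phi>_def by (rule Abs_bperm_inverse) (use bij that in simp)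
  have "hom_on X \<phi>" unfolding hom_on_def
    by (auto simp: Rep_bperm_inject[symmetric] Rep_bperm_times R fsub_mult[OF X] fm fun_eq_iff)
  moreover have "\<phi> x = 1 \<longleftrightarrow> x \<in> N" if x: "x \<in> X" for x
  proof
    assume "\<phi> x = 1"
    then have "f x = id" using R[OF x] by (metis Rep_bperm_one)
    moreover have NC: "N \<in> ?C" using fsub_one[OF X] by (rule rev_image_eqI) simp
    ultimately have "e ((*) x ` N) = e N" using fe[OF NC] by (metis id_apply)
    then have "(*) x ` N = N" using e mC[OF x NC] NC by (meson inj_onD)
    then have "x * 1 \<in> N" using fsub_one[OF fN] by blast
    then show "x \<in> N" by simp
  next
    assume xN: "x \<in> N"
    have "f x i = i" for i
    proof (cases "i \<in> e ` ?C")
      case True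
      then obtain y where y: "y \<in> X" "i = e ((*) y ` N)" by blast
      have c: "(*) y ` N \<in> ?C" using y(1) by blast
      have "(*) (x * y) ` N = (*) y ` N"
      proof (subst lcoset_eq_iff[OF fN])
        have "cj (gi y) (gi x) \<in> N" by (rule normal_in_cj[OF N fsub_gi[OF X y(1)] fsub_gi[OF fN xN]])
        then show "gi (x * y) * y \<in> N" by (simp add: cj_def mult.assoc)
      qed
      then show ?thesis unfolding y(2) fe[OF c] by (simp add: image_image mult.assoc)
    next
      case False
      then show ?thesis by (simp add: f_def)
    qed
    then have "Rep_bperm (\<phi> x) = Rep_bperm 1" using R[OF x] by (auto simp: Rep_bperm_one)
    then show "\<phi> x = 1" by (simp only: Rep_bperm_inject)
  qed
  ultimately show ?thesis by blast
qed

text \<open>The preimage of a normal p-subgroup of X/N is the next step above N. Solvability is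
  thereby reduced to finding one normal p-subgroup in every nontrivial image.\<close>

lemma slv_if_quotients:
  fixes X :: "'a::grp set"
  assumes X: "fsub X" and q: "\<And>\<phi> :: 'a \<Rightarrow> nat bperm. hom_on X \<phi> \<Longrightarrow> \<phi> ` X \<noteq> {1} \<Longrightarrow>
    \<exists>p R. prime p \<and> normal_in R (\<phi> ` X) \<and> pgroup p R \<and> R \<noteq> {1}"
  shows "slv X"
  unfolding slv_def
proof (intro conjI allI impI)
  fix N assume N: "normal_in N X" "N \<noteq> X"
  obtain \<phi> :: "'a \<Rightarrow> nat bperm" where h: "hom_on X \<phi>" and ker: "\<And>x. x \<in> X \<Longrightarrow> \<phi> x = 1 \<longleftrightarrow> x \<in> N"
    using quotient_hom[OF X N(1)] by blast
  obtain x where "x \<in> X" "x \<notin> N" using N normal_in_subset by blast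
  then have "\<phi> ` X \<noteq> {1}" using ker by blast
  then obtain p R where R: "prime p" "normal_in R (\<phi> ` X)" "pgroup p R" "R \<noteq> {1}" using q[OF h] by blast
  let ?L = "{x \<in> X. \<phi> x \<in> R}"
  have fR: "fsub R" by (rule pgroup_fsub[OF R(3)])
  have L: "normal_in ?L X" by (rule hom_on_vimage_normal[OF h X R(2)])
  have NL: "N \<subseteq> ?L"
  proof
    fix x assume x: "x \<in> N"
    then have "x \<in> X" using normal_in_subset[OF N(1)] by blast
    moreover have "\<phi> x = 1" using ker[OF \<open>x \<in> X\<close>] x by simp
    ultimately show "x \<in> ?L" using fsub_one[OF fR] by simp
  qed
  have im: "\<phi> ` ?L = R" using normal_in_subset[OF R(2)] by auto
  have hL: "hom_on ?L \<phi>" using h by (rule hom_on_subset) auto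
  have "{x \<in> ?L. \<phi> x = 1} = N" using ker NL by auto
  then have c: "card R * card N = card ?L" using hom_on_card[OF hL normal_in_fsub[OF L]] im by simp
  obtain k where k: "card R = p ^ k" using R(3) by (auto simp: pgroup_def)
  have "N \<noteq> ?L"
  proof
    assume e: "N = ?L"
    have "\<phi> ` N \<subseteq> {1}" using ker normal_in_subset[OF N(1)] by blast
    moreover have "1 \<in> \<phi> ` N" using im e fsub_one[OF fR] by simp
    ultimately have "\<phi> ` N = {1}" by blast
    then show False using R(4) im e by simp
  qed
  then show "\<exists>p L k. prime p \<and> normal_in L X \<and> N \<subset> L \<and> card L = p ^ k * card N"
    using R(1) L NL c k by (intro exI[of _ p] exI[of _ ?L] exI[of _ k]) auto
qed (rule X)

section \<open>Products of nilpotent groups\<close>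

text \<open>For g = d m the conjugate of M by g is that by d, and conjugation by d fixes D and
  G.\<close>

lemma conjugate_factorisation:
  assumes G: "fsub G" and D: "fsub D" "D \<subseteq> G" and M: "fsub M" "M \<subseteq> G" and f: "sprod D M = G" and g: "g \<in> G"
  shows "sprod D (cj g ` M) = G"
proof -
  obtain d m where dm: "d \<in> D" "m \<in> M" "g = d * m" using g unfolding f[symmetric] by (elim sprodE)
  have "cj g ` M = cj d ` M" unfolding dm(3) by (simp only: cj_image_cj[symmetric] cj_image_self[OF M(1) dm(2)])
  moreover have "cj d ` D = D" by (rule cj_image_self[OF D(1) dm(1)])
  moreover have "cj d ` G = G" by (rule cj_image_self[OF G]) (use dm(1) D(2) in blast)
  ultimately show ?thesis using cj_image_sprod[of d D M] f by (simp only:)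
qed

text \<open>By \<open>conjugate_pair\<close> both p-parts lie in one Sylow p-subgroup of G. The
  order formulas for G and for the product of the p-parts show that the product fills it.\<close>

lemma p_part_product_syl:
  assumes G: "fsub G" and D: "nilp D" "D \<subseteq> G" and M: "nilp M" "M \<subseteq> G" and f: "sprod D M = G" and p: "prime p"
  shows "syl p G (sprod (p_part p D) (p_part p M))"
proof -
  let ?D = "p_part p D" and ?M = "p_part p M"
  have fD: "fsub D" and fM: "fsub M" using D(1) M(1) nilp_fsub by blast+
  have pD: "pgroup p ?D" and pM: "pgroup p ?M" by (rule nilp_p_part_pgroup[OF D(1) p], rule nilp_p_part_pgroup[OF M(1) p])
  have DG: "?D \<subseteq> G" and MG: "?M \<subseteq> G" using p_part_subset[of p D] p_part_subset[of p M] D(2) M(2) by (meson subset_trans)+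
  obtain P where P: "syl p G P" "?D \<subseteq> P" using pgroup_in_syl[OF p G pD DG] by blast
  obtain x where x: "x \<in> G" "?M \<subseteq> cj x ` P" using syl_dominates[OF p G P(1) pM MG] by blast
  obtain a b where ab: "a \<in> D" "b \<in> M" "1 * a = gi x * b"
    using conjugate_pair[OF G fD D(2) fM M(2) f fsub_one[OF G] fsub_gi[OF G x(1)]] by (elim bexE)
  have aG: "a \<in> G" using ab(1) D(2) by blast
  let ?P = "cj (gi a) ` P"
  have P': "syl p G ?P" by (rule syl_cj[OF G P(1) fsub_gi[OF G aG]])
  have "cj b ` ?M = ?M" by (rule normal_in_cj_image[OF fM nilp_syl(2)[OF M(1) p] ab(2)])
  moreover have "cj a ` ?M = cj (gi x) ` cj b ` ?M" using ab(3) by (simp add: cj_image_cj)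
  ultimately have "cj a ` ?M = cj (gi x) ` ?M" by (simp only:)
  also have "\<dots> \<subseteq> P" using x(2) by (simp add: cj_image_subset_swap)
  finally have MP: "?M \<subseteq> ?P" by (simp add: cj_image_subset_swap)
  have "cj a ` ?D = ?D" by (rule normal_in_cj_image[OF fD nilp_syl(2)[OF D(1) p] ab(1)])
  then have "cj a ` ?D \<subseteq> P" using P(2) by (simp only:)
  then have DP: "?D \<subseteq> ?P" by (simp add: cj_image_subset_swap)
  have sub: "sprod ?D ?M \<subseteq> ?P" by (rule sprod_subset[OF syl_fsub[OF P'] DP MP])
  have fDp: "fsub ?D" and fMp: "fsub ?M" using pD pM pgroup_fsub by blast+
  have sD: "card ?D = p ^ multiplicity p (card D)" and sM: "card ?M = p ^ multiplicity p (card M)"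
    using nilp_syl(1)[OF D(1) p] nilp_syl(1)[OF M(1) p] by (auto simp: syl_def)
  have mpow: "multiplicity p (p ^ k) = k" for k by (rule multiplicity_same_power) (use p in \<open>auto simp: prime_nat_iff\<close>)
  have "multiplicity p (card (sprod ?D ?M)) + multiplicity p (card (?D \<inter> ?M)) = multiplicity p (card D) + multiplicity p (card M)"
    using multiplicity_sprod[OF p fDp fMp] by (simp only: sD sM mpow)
  moreover have "multiplicity p (card G) + multiplicity p (card (D \<inter> M)) = multiplicity p (card D) + multiplicity p (card M)"
    using multiplicity_sprod[OF p fD fM] by (simp only: f)
  moreover have "multiplicity p (card (?D \<inter> ?M)) \<le> multiplicity p (card (D \<inter> M))"
    by (rule multiplicity_card_mono[OF p fsub_Int[OF fD fM] fsub_Int[OF fDp fMp]])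
      (use p_part_subset[of p D] p_part_subset[of p M] in blast)
  ultimately have ge: "multiplicity p (card G) \<le> multiplicity p (card (sprod ?D ?M))" by linarith
  have fin: "finite (sprod ?D ?M)" by (rule finite_sprod[OF fsub_finite[OF fDp] fsub_finite[OF fMp]])
  have "1 * 1 \<in> sprod ?D ?M" by (rule sprodI[OF fsub_one[OF fDp] fsub_one[OF fMp]])
  then have c0: "card (sprod ?D ?M) \<noteq> 0" using fin by auto
  have "p ^ multiplicity p (card G) dvd card (sprod ?D ?M)" by (rule multiplicity_dvd'[OF ge])
  then have "card ?P \<le> card (sprod ?D ?M)" using P' c0 by (simp add: syl_def dvd_imp_le)
  then have "sprod ?D ?M = ?P" by (rule card_seteq[OF fsub_finite[OF syl_fsub[OF P']] sub])
  then show ?thesis using P' by (simp only:)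
qed

lemma nilp_if_commute: "fsub X \<Longrightarrow> (\<And>x y. x \<in> X \<Longrightarrow> y \<in> X \<Longrightarrow> x * y = y * x) \<Longrightarrow> nilp X"
  unfolding nilp_def by blast

lemma nontrivial_prime:
  assumes "fsub N" "N \<noteq> {1}" shows "\<exists>p. prime p \<and> p dvd card N"
proof -
  have "card N \<noteq> 1" using assms fsub_card1 by blast
  then show ?thesis using prime_factor_nat by blast
qed

text \<open>The centraliser of a central z of D contains D, so the class size of z divides the prime
  power card M. Burnside's theorem makes z central in G, while \<open>nonil\<close> makes the centre
  trivial.\<close>

lemma prime_power_factor_not_simple:
  assumes G: "fsub G" and simple: "\<And>N. normal_in N G \<Longrightarrow> N = {1} \<or> N = G"
    and nonil: "\<And>N. normal_in N G \<Longrightarrow> nilp N \<Longrightarrow> N = {1}"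
    and D: "nilp D" "D \<subseteq> G" "D \<noteq> {1}" and M: "fsub M" and f: "sprod D M = G"
    and DM: "D \<inter> M = {1}" and r: "\<And>t. prime t \<Longrightarrow> t dvd card M \<Longrightarrow> t = r"
  shows False
proof -
  have fD: "fsub D" by (rule nilp_fsub[OF D(1)])
  obtain q where q: "prime q" "q dvd card D" using nontrivial_prime[OF fD D(3)] by blast
  obtain z where z: "z \<in> D" "z \<noteq> 1" "\<forall>x\<in>D. z * x = x * z" using nilp_central[OF D(1) q(1) normal_in_self[OF fD] q(2)] by blast
  have zG: "z \<in> G" using z(1) D(2) by blast
  let ?C = "{g \<in> G. cj g z = z}"
  have act: "acts G G cj" unfolding acts_def by (auto simp: cj_cj fsub_cj[OF G])
  have oc: "card ((\<lambda>g. cj g z) ` G) * card ?C = card G" by (rule acts_orbit_stabiliser[OF G act zG])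
  have C: "fsub ?C"
  proof (rule fsub_mult_closed)
    show "finite ?C" using fsub_finite[OF G] by simp
    show "x * y \<in> ?C" if "x \<in> ?C" "y \<in> ?C" for x y
      using that fsub_mult[OF G] by (simp add: cj_cj[symmetric])
  qed (use fsub_one[OF G] in simp)
  have "D \<subseteq> ?C"
  proof
    fix d assume d: "d \<in> D"
    have "d * z = z * d" by (rule bspec[OF z(3) d, symmetric])
    then have "cj d z = z" by (simp only: cj_eq_self_iff)
    then show "d \<in> ?C" using d D(2) by blast
  qed
  then have "card D dvd card ?C" by (rule lagrange_dvd[OF C fD])
  then obtain k where k: "card ?C = card D * k" by (rule dvdE)
  have "card G = card D * card M" using card_sprod[OF fD M] by (simp add: f DM)
  then have "card D * (card ((\<lambda>g. cj g z) ` G) * k) = card D * card M" using oc k by (simp add: ac_simps)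
  then have e: "card M = card ((\<lambda>g. cj g z) ` G) * k" using fsub_card_pos[OF fD] by simp
  \<comment> \<open>If r is not prime, M has order 1, the power of 2 with exponent 0.\<close>
  have "\<exists>q b. prime q \<and> card M = q ^ b"
  proof (cases "prime r")
    case True
    then show ?thesis using prime_power_if_unique_prime[OF fsub_card_pos[OF M] True r] by blast
  next
    case False
    then have "\<not> (\<exists>t. prime t \<and> t dvd card M)" using r by blast
    then have "card M = 1" using prime_factor_nat by blast
    then show ?thesis by (intro exI[of _ 2] exI[of _ 0]) (simp add: two_is_prime_nat)
  qed
  then obtain q b where qb: "prime q" "card M = q ^ b" by (elim exE conjE)
  have "card ((\<lambda>g. cj g z) ` G) dvd q ^ b" using e unfolding qb(2) by (rule dvdI)
  then have "\<exists>b'. card ((\<lambda>g. cj g z) ` G) = q ^ b'" using divides_primepow_nat[OF qb(1)] by blast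
  then obtain b' where b': "card ((\<lambda>g. cj g z) ` G) = q ^ b'" by (elim exE)
  have cen: "z * x = x * z" if "x \<in> G" for x by (rule burnside_class[OF G simple zG qb(1) b' that])
  let ?Z = "centraliser G G"
  have Z: "normal_in ?Z G" by (rule normal_centraliser[OF G]) (rule cj_image_self[OF G])
  have "nilp ?Z"
  proof (rule nilp_if_commute[OF normal_in_fsub[OF Z]])
    fix x y assume "x \<in> ?Z" "y \<in> ?Z"
    then show "x * y = y * x" unfolding centraliser_def by blast
  qed
  then have "?Z = {1}" by (rule nonil[OF Z])
  moreover have "z \<in> ?Z" unfolding centraliser_def using cen zG by blast
  ultimately show False using z(2) by blast
qed

text \<open>A minimal counterexample G, kept in the type \<open>nat bperm\<close> so that images of
  subgroups stay within the induction. It has no nontrivial nilpotent normal subgroup, and no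
  solvable subgroup of it contains a nontrivial normal subgroup of G.\<close>

lemma nilp_product_normal_pgroup:
  fixes G :: "nat bperm set"
  assumes "fsub G" "nilp D" "nilp M" "sprod D M = G" "G \<noteq> {1}"
  shows "\<exists>p R. prime p \<and> normal_in R G \<and> pgroup p R \<and> R \<noteq> {1}"
  using assms
proof (induction "card G" arbitrary: G D M rule: less_induct)
  case less
  note G = less.prems(1) and nD = less.prems(2) and nM = less.prems(3) and f = less.prems(4)
  have IH: "slv X" if X: "fsub X" "nilp D'" "nilp M'" "sprod D' M' = X" "card X < card G" for X :: "nat bperm set" and D' M'
  proof (rule slv_if_quotients[OF X(1)])
    fix \<phi> :: "nat bperm \<Rightarrow> nat bperm" assume h: "hom_on X \<phi>" and ne: "\<phi> ` X \<noteq> {1}"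
    have DX: "D' \<subseteq> X" and MX: "M' \<subseteq> X"
      using subset_sprod1[OF nilp_fsub[OF X(3)], of D'] subset_sprod2[OF nilp_fsub[OF X(2)], of M'] X(4) by auto
    have "card (\<phi> ` X) \<le> card X" by (rule card_image_le[OF fsub_finite[OF X(1)]])
    then have lt: "card (\<phi> ` X) < card G" using X(5) by linarith
    have "sprod (\<phi> ` D') (\<phi> ` M') = \<phi> ` X" using hom_on_sprod[OF h DX MX] X(4) by simp
    from less.hyps[OF lt hom_on_image_fsub[OF h X(1) X(1) subset_refl] nilp_image[OF hom_on_subset[OF h DX] X(2)]
        nilp_image[OF hom_on_subset[OF h MX] X(3)] this ne]
    show "\<exists>p R. prime p \<and> normal_in R (\<phi> ` X) \<and> pgroup p R \<and> R \<noteq> {1}" .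
  qed
  show ?case
  proof (rule ccontr)
    assume "\<not> ?case"
    then have nop: "R = {1}" if "prime p" "normal_in R G" "pgroup p R" for p R using that by blast
    have fD: "fsub D" and fM: "fsub M" using nD nM nilp_fsub by blast+
    have DG: "D \<subseteq> G" and MG: "M \<subseteq> G" using subset_sprod1[OF fM, of D] subset_sprod2[OF fD, of M] f by auto
    have nonil: "N = {1}" if N: "normal_in N G" "nilp N" for N
    proof (rule ccontr)
      assume "N \<noteq> {1}"
      then obtain p where p: "prime p" "p dvd card N" using nontrivial_prime[OF normal_in_fsub[OF N(1)]] by blast
      have "p_part p N = {1}" by (rule nop[OF p(1) normal_p_part[OF N(2,1) p(1)] nilp_p_part_pgroup[OF N(2) p(1)]])
      then show False using p_part_triv_iff[OF p(1) normal_in_fsub[OF N(1)]] p(2) by simp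
    qed
    have nocore: "core p N = {1}" if p: "prime p" and N: "normal_in N G" for p N
    proof -
      have "core p G = {1}" by (rule nop[OF p core_normal_pgroup[OF p G]])
      then have "core p N \<subseteq> {1}" using core_core[OF p G N] by simp
      then show ?thesis using fsub_one[OF pgroup_fsub[OF core_normal_pgroup(2)[OF p normal_in_fsub[OF N]]]] by blast
    qed
    have factorised_slv: "slv X" if X: "fsub X" "X \<subseteq> G" "X \<noteq> G" "X \<subseteq> sprod (X \<inter> D) (X \<inter> M)" for X
    proof (rule IH[OF X(1), of "X \<inter> D" "X \<inter> M"])
      show "nilp (X \<inter> D)" "nilp (X \<inter> M)" by (rule nilp_subset[OF nD fsub_Int[OF X(1) fD]], blast, rule nilp_subset[OF nM fsub_Int[OF X(1) fM]], blast)
      show "sprod (X \<inter> D) (X \<inter> M) = X" using X(4) sprod_subset[OF X(1), of "X \<inter> D" "X \<inter> M"] by blast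
      show "card X < card G" using X(2,3) fsub_finite[OF G] by (simp add: psubset_card_mono psubsetI)
    qed
    have noslv: "N = {1}" if N: "normal_in N G" "N \<subseteq> X" and X: "slv X" "X \<subseteq> G" for N X
    proof (rule ccontr)
      assume ne: "N \<noteq> {1}"
      have NX: "normal_in N X" by (rule normal_in_restrict[OF N X(2)])
      obtain r R where R: "prime r" "normal_in R X" "R \<subseteq> N" "pgroup r R" "R \<noteq> {1}" using slv_normal_core[OF X(1) NX ne] by blast
      have "normal_in R N" by (rule normal_in_restrict[OF R(2,3) N(2)])
      then have "R \<subseteq> core r N" using R(4) by (rule core_greatest)
      then show False using nocore[OF R(1) N(1)] R(5) fsub_one[OF pgroup_fsub[OF R(4)]] by blast
    qed
    \<comment> \<open>Kegel's argument. D_p times any conjugate of M_p is a Sylow subgroup, so D_p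
      lies in a p-group C normalised by all these conjugates, hence by their closure V. Then C meets
      V in a normal p-subgroup of V, which is trivial, and so D_p commutes with V.\<close>
    have one_triv: "p_part p D = {1} \<or> p_part p M = {1}" if p: "prime p" for p
    proof (rule ccontr)
      assume "\<not> ?thesis"
      then have Dp1: "p_part p D \<noteq> {1}" and Mp1: "p_part p M \<noteq> {1}" by blast+
      let ?D = "p_part p D" and ?M = "p_part p M"
      have pD: "pgroup p ?D" and pM: "pgroup p ?M" by (rule nilp_p_part_pgroup[OF nD p], rule nilp_p_part_pgroup[OF nM p])
      have fDp: "fsub ?D" and fMp: "fsub ?M" using pD pM pgroup_fsub by blast+
      have DpG: "?D \<subseteq> G" and MpG: "?M \<subseteq> G" using p_part_subset[of p D] p_part_subset[of p M] DG MG by (meson subset_trans)+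
      have perm: "fsub (sprod ?D (cj g ` ?M))" if g: "g \<in> G" for g
      proof -
        have "cj g ` M \<subseteq> G" by (rule cj_image_sub[OF G MG g])
        from p_part_product_syl[OF G nD DG nilp_cj_image[OF nM] this conjugate_factorisation[OF G fD DG fM MG f g] p]
        show ?thesis by (simp only: p_part_cj_image syl_fsub)
      qed
      have "\<exists>C. fsub C \<and> ?D \<subseteq> C \<and> C \<subseteq> G \<and> pgroup p C \<and> (\<forall>g\<in>G. fsub (sprod C (cj g ` ?M))) \<and>
        (\<forall>g\<in>G. \<forall>k\<in>cj g ` ?M. cj k ` C = C)"
      proof (rule permuting_subgroup_normalised[where \<Phi> = "pgroup p", OF G fDp DpG fMp MpG perm pD])
        fix C E g assume h: "fsub C" "fsub E" "pgroup p C" "fsub (sprod C (cj g ` ?M))" "E \<subseteq> sprod C (cj g ` ?M)"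
        have "pgroup p (sprod C (cj g ` ?M))" by (rule pgroup_sprod[OF p h(3) _ h(4)]) (simp add: pM)
        then show "pgroup p E" using pgroup_subset[OF p] h(2,5) by blast
      qed
      then obtain C where C: "fsub C" "?D \<subseteq> C" "C \<subseteq> G" "pgroup p C" and Cn: "\<And>g k. g \<in> G \<Longrightarrow> k \<in> cj g ` ?M \<Longrightarrow> cj k ` C = C"
        by (elim exE conjE) blast
      define SM where "SM = (\<Union>g\<in>G. cj g ` ?M)"
      define SD where "SD = (\<Union>g\<in>G. cj g ` ?D)"
      have SMG: "SM \<subseteq> G" and SDG: "SD \<subseteq> G" unfolding SM_def SD_def using cj_image_sub[OF G MpG] cj_image_sub[OF G DpG] by blast+
      define V where "V = gen G SM"
      define U where "U = gen G SD"
      have inv: "cj x ` (\<Union>g\<in>G. cj g ` S) \<subseteq> (\<Union>g\<in>G. cj g ` S)" if "x \<in> G" for x S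
      proof
        fix y assume "y \<in> cj x ` (\<Union>g\<in>G. cj g ` S)"
        then obtain g s where gs: "g \<in> G" "s \<in> S" "y = cj x (cj g s)" by blast
        then have "y = cj (x * g) s" by (simp only: cj_cj)
        then show "y \<in> (\<Union>g\<in>G. cj g ` S)" using fsub_mult[OF G that gs(1)] gs(2) by blast
      qed
      have V: "normal_in V G" unfolding V_def by (rule gen_cj_invariant[OF G SMG]) (unfold SM_def, rule inv)
      have U: "normal_in U G" unfolding U_def by (rule gen_cj_invariant[OF G SDG]) (unfold SD_def, rule inv)
      have fV: "fsub V" and VG: "V \<subseteq> G" and fU: "fsub U" and UG: "U \<subseteq> G"
        using V U normal_in_fsub normal_in_subset by blast+
      have "cj 1 ` ?M \<subseteq> SM" "cj 1 ` ?D \<subseteq> SD" unfolding SM_def SD_def using fsub_one[OF G] by blast+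
      then have MV: "?M \<subseteq> V" and DU: "?D \<subseteq> U"
        using subset_gen[of SM G] subset_gen[of SD G] unfolding V_def U_def by auto
      have VC: "V \<subseteq> normaliser G C" unfolding V_def
      proof (rule gen_least[OF fsub_normaliser[OF G]])
        show "SM \<subseteq> normaliser G C"
        proof
          fix k assume k: "k \<in> SM"
          then have "cj k ` C = C" unfolding SM_def using Cn by blast
          then show "k \<in> normaliser G C" using k SMG by (auto simp only: normaliser_def mem_Collect_eq)
        qed
      qed (rule normaliser_subset)
      have fCV: "fsub (C \<inter> V)" by (rule fsub_Int[OF C(1) fV])
      have "normal_in (C \<inter> V) V"
      proof (rule normal_inI[OF fCV])
        fix v c assume v: "v \<in> V" and c: "c \<in> C \<inter> V"
        have "cj v ` C = C" using VC v by (auto simp only: normaliser_def)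
        then show "cj v c \<in> C \<inter> V" using c fsub_cj[OF fV v] by blast
      qed blast
      then have "C \<inter> V \<subseteq> core p V" using pgroup_subset[OF p C(4) fCV] by (intro core_greatest) auto
      then have CV1: "C \<inter> V \<subseteq> {1}" using nocore[OF p V] by simp
      have comDV: "d * v = v * d" if d: "d \<in> ?D" and v: "v \<in> V" for d v
      proof -
        have dC: "d \<in> C" and dG: "d \<in> G" using d C(2) DpG by blast+
        have "cj v ` C = C" using VC v by (auto simp only: normaliser_def)
        then have "cj v (gi d) \<in> C" using fsub_gi[OF C(1) dC] by blast
        then have "d * cj v (gi d) \<in> C" by (rule fsub_mult[OF C(1) dC])
        moreover have "d * cj v (gi d) = cj d v * gi v" by (simp add: cj_def mult.assoc)
        moreover have "cj d v * gi v \<in> V" by (rule fsub_mult[OF fV normal_in_cj[OF V dG v] fsub_gi[OF fV v]])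
        ultimately have "cj d v * gi v = 1" using CV1 by auto
        then have "gi (cj d v) = gi v" by (rule gi_unique)
        then have "cj d v = v" by simp
        then show ?thesis by (simp only: cj_eq_self_iff)
      qed
      \<comment> \<open>With D_p its normal closure U commutes with V, so the intersection of U and
        V is abelian and thus trivial.\<close>
      have UVcom: "u * v = v * u" if u: "u \<in> U" and v: "v \<in> V" for u v
      proof -
        have "U \<subseteq> centraliser G V" unfolding U_def
        proof (rule gen_least[OF fsub_centraliser[OF G]])
          show "SD \<subseteq> centraliser G V"
          proof
            fix s assume s: "s \<in> SD"
            then obtain g d where gd: "g \<in> G" "d \<in> ?D" "s = cj g d" unfolding SD_def by blast
            have "s * w = w * s" if w: "w \<in> V" for w
            proof -
              have w': "cj (gi g) w \<in> V" by (rule normal_in_cj[OF V fsub_gi[OF G gd(1)] w])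
              have "cj g d * cj g (cj (gi g) w) = cj g (cj (gi g) w) * cj g d" by (rule commute_cj[OF comDV[OF gd(2) w']])
              then show ?thesis by (simp add: gd(3))
            qed
            then show "s \<in> centraliser G V" using s SDG by (auto simp only: centraliser_def mem_Collect_eq)
          qed
        qed (rule centraliser_subset)
        then show ?thesis using u v by (auto simp only: centraliser_def)
      qed
      have "nilp (U \<inter> V)"
      proof (rule nilp_if_commute[OF fsub_Int[OF fU fV]])
        fix x y assume xy: "x \<in> U \<inter> V" "y \<in> U \<inter> V"
        show "x * y = y * x" by (rule UVcom) (use xy in blast)+
      qed
      then have UV1: "U \<inter> V = {1}" by (rule nonil[OF normal_in_Int[OF U V]])
      \<comment> \<open>The factoriser of V. It is factorised and contains V, so it would be
        solvable if proper; hence it is G, and G = D V.\<close>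
      define X where "X = sprod D V \<inter> sprod M V"
      have fDV: "fsub (sprod D V)" and fMV: "fsub (sprod M V)" by (rule sprod_normal_fsub[OF V fD DG], rule sprod_normal_fsub[OF V fM MG])
      have fX: "fsub X" unfolding X_def by (rule fsub_Int[OF fDV fMV])
      have XG: "X \<subseteq> G" unfolding X_def using sprod_subset[OF G DG VG] by blast
      have VX: "V \<subseteq> X" unfolding X_def using subset_sprod2[OF fD] subset_sprod2[OF fM] by blast
      have DDV: "D \<subseteq> sprod D V" and MMV: "M \<subseteq> sprod M V" by (rule subset_sprod1[OF fV])+
      have Xf: "X \<subseteq> sprod (X \<inter> D) (X \<inter> M)"
      proof
        fix x assume x: "x \<in> X"
        then obtain d m where dm: "d \<in> D" "m \<in> M" "x = d * m" using XG f by (metis sprodE subsetD)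
        have "m \<in> sprod D V" using x dm fDV DDV unfolding X_def by (metis IntD1 fsub_mult_left_iff subsetD)
        moreover have "d \<in> sprod M V" using x dm fMV MMV unfolding X_def by (metis IntD2 fsub_mult_right_iff subsetD)
        ultimately have "d \<in> X \<inter> D" "m \<in> X \<inter> M" using dm DDV MMV unfolding X_def by blast+
        then show "x \<in> sprod (X \<inter> D) (X \<inter> M)" unfolding dm(3) by (rule sprodI)
      qed
      have "V \<noteq> {1}" using MV Mp1 fsub_one[OF fMp] by blast
      then have "X = G" using noslv[OF V VX factorised_slv[OF fX XG _ Xf] XG] by blast
      then have DVG: "G \<subseteq> sprod D V" unfolding X_def by blast
      \<comment> \<open>As G = D V, the projection of U V to U maps the subgroup Y of D onto U. So U
        is nilpotent and trivial, although it contains D_p.\<close>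
      define Y where "Y = {d \<in> D. \<exists>u\<in>U. \<exists>v\<in>V. d = u * v}"
      define \<phi> where "\<phi> y = (SOME u. u \<in> U \<and> (\<exists>v\<in>V. y = u * v))" for y
      have uniq: "u = u'" if "u \<in> U" "u' \<in> U" "v \<in> V" "v' \<in> V" "u * v = u' * v'" for u u' v v'
      proof -
        have "gi u' * u = v' * gi v"
        proof -
          have "gi u' * (u * v) * gi v = gi u' * (u' * v') * gi v" using that(5) by simp
          then show ?thesis by (simp add: mult.assoc)
        qed
        moreover have "gi u' * u \<in> U" "v' * gi v \<in> V" using that fU fV by (simp_all add: fsub_mult)
        ultimately have "gi u' * u = 1" using UV1 by auto
        then have "gi (gi u') = u" by (rule gi_unique)
        then show ?thesis by simp
      qed
      have phi: "\<phi> (u * v) = u" if uv: "u \<in> U" "v \<in> V" for u v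
      proof -
        have "\<phi> (u * v) \<in> U \<and> (\<exists>w\<in>V. u * v = \<phi> (u * v) * w)" unfolding \<phi>_def
          by (rule someI[of "\<lambda>x. x \<in> U \<and> (\<exists>w\<in>V. u * v = x * w)" u]) (use uv in blast)
        then obtain w where w: "w \<in> V" "u * v = \<phi> (u * v) * w" and pU: "\<phi> (u * v) \<in> U" by blast
        show ?thesis by (rule uniq[OF pU uv(1) w(1) uv(2) w(2)[symmetric]])
      qed
      have mul: "(u * v) * (u' * v') = (u * u') * (v * v')" if "u' \<in> U" "v \<in> V" for u v u' v'
        using UVcom[OF that] by (metis mult.assoc)
      have fY: "fsub Y"
      proof (rule fsub_mult_closed)
        show "finite Y" unfolding Y_def using fsub_finite[OF fD] by simp
        have "1 = 1 * (1::nat bperm)" by simp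
        then show "1 \<in> Y" unfolding Y_def using fsub_one[OF fD] fsub_one[OF fU] fsub_one[OF fV] by blast
        fix x y assume "x \<in> Y" "y \<in> Y"
        then obtain u v u' v' where uv: "x \<in> D" "y \<in> D" "u \<in> U" "v \<in> V" "u' \<in> U" "v' \<in> V" "x = u * v" "y = u' * v'" unfolding Y_def by auto
        have "x * y = (u * u') * (v * v')" unfolding uv(7,8) by (rule mul[OF uv(5,4)])
        then show "x * y \<in> Y" unfolding Y_def using fsub_mult[OF fD uv(1,2)] fsub_mult[OF fU uv(3,5)] fsub_mult[OF fV uv(4,6)] by blast
      qed
      have nY: "nilp Y" by (rule nilp_subset[OF nD fY]) (auto simp: Y_def)
      have hY: "hom_on Y \<phi>" unfolding hom_on_def
      proof (intro ballI)
        fix x y assume "x \<in> Y" "y \<in> Y"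
        then obtain u v u' v' where uv: "u \<in> U" "v \<in> V" "u' \<in> U" "v' \<in> V" "x = u * v" "y = u' * v'" unfolding Y_def by auto
        have "\<phi> (x * y) = \<phi> ((u * u') * (v * v'))" unfolding uv(5,6) mul[OF uv(3,2)] ..
        also have "\<dots> = u * u'" by (rule phi[OF fsub_mult[OF fU uv(1,3)] fsub_mult[OF fV uv(2,4)]])
        finally show "\<phi> (x * y) = \<phi> x * \<phi> y" unfolding uv(5,6) phi[OF uv(1,2)] phi[OF uv(3,4)] .
      qed
      have "\<phi> ` Y = U"
      proof
        show "\<phi> ` Y \<subseteq> U" unfolding Y_def using phi by auto
        show "U \<subseteq> \<phi> ` Y"
        proof
          fix u assume u: "u \<in> U"
          then have "u \<in> sprod D V" using UG DVG by blast
          then obtain d v where dv: "d \<in> D" "v \<in> V" "u = d * v" by (elim sprodE)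
          have d: "d = u * gi v" by (simp add: dv(3) mult.assoc)
          have "d \<in> Y" unfolding Y_def using dv(1) u fsub_gi[OF fV dv(2)] d by blast
          moreover have "\<phi> d = u" unfolding d by (rule phi[OF u fsub_gi[OF fV dv(2)]])
          ultimately show "u \<in> \<phi> ` Y" by blast
        qed
      qed
      then have "nilp U" using nilp_image[OF hY nY] by simp
      then have "U = {1}" by (rule nonil[OF U])
      then show False using DU Dp1 fsub_one[OF fDp] by blast
    qed
    have notboth: "\<not> (p dvd card D \<and> p dvd card M)" if "prime p" for p
      using one_triv[OF that] p_part_triv_iff[OF that fD] p_part_triv_iff[OF that fM] by blast
    have cop: "coprime (card D) (card M)"
    proof (rule ccontr)
      assume "\<not> ?thesis"
      then have "gcd (card D) (card M) \<noteq> 1" by (simp add: coprime_iff_gcd_eq_1)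
      then obtain p where "prime p" "p dvd gcd (card D) (card M)" using prime_factor_nat by blast
      then show False using notboth by auto
    qed
    have DM1: "D \<inter> M = {1}"
    proof -
      have "card (D \<inter> M) dvd card D" "card (D \<inter> M) dvd card M"
        by (rule lagrange_dvd[OF fD fsub_Int[OF fD fM]], blast, rule lagrange_dvd[OF fM fsub_Int[OF fD fM]], blast)
      then have "card (D \<inter> M) = 1" using cop by (metis coprime_common_divisor_nat)
      then show ?thesis using fsub_card1[OF fsub_Int[OF fD fM]] by simp
    qed
    \<comment> \<open>For each p one of the two p-parts is trivial, so some Sylow p-subgroup of N
      lies in D or in M. Counting shows that N is factorised, and a proper N is then solvable by
      induction.\<close>
    have simple: "N = {1} \<or> N = G" if N: "normal_in N G" for N
    proof (rule ccontr)
      assume ne: "\<not> ?thesis"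
      have fN: "fsub N" and NG: "N \<subseteq> G" using N normal_in_fsub normal_in_subset by blast+
      have fI: "fsub (N \<inter> D)" "fsub (N \<inter> M)" by (rule fsub_Int[OF fN fD], rule fsub_Int[OF fN fM])
      have I1: "(N \<inter> D) \<inter> (N \<inter> M) = {1}" using DM1 fsub_one[OF fN] by blast
      let ?S = "sprod (N \<inter> D) (N \<inter> M)"
      have sub: "?S \<subseteq> N" by (rule sprod_subset[OF fN]) blast+
      have cS: "card ?S = card (N \<inter> D) * card (N \<inter> M)" using card_sprod[OF fI] by (simp add: I1)
      have "multiplicity p (card N) \<le> multiplicity p (card ?S)" if p: "prime p" for p
      proof -
        have s: "syl p G (sprod (p_part p D) (p_part p M))" by (rule p_part_product_syl[OF G nD DG nM MG f p])
        let ?P = "N \<inter> sprod (p_part p D) (p_part p M)"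
        have sN: "syl p N ?P" by (rule syl_normal_Int[OF p G N s])
        have d: "p ^ multiplicity p (card N) dvd card ?S"
          using one_triv[OF p]
        proof
          assume t: "p_part p D = {1}"
          have "?P \<subseteq> N \<inter> M" using t p_part_subset[of p M] by (auto simp: sprod_def)
          then have "card ?P dvd card (N \<inter> M)" by (rule lagrange_dvd[OF fI(2) syl_fsub[OF sN]])
          then show ?thesis using sN unfolding cS by (simp add: syl_def dvd_mult)
        next
          assume t: "p_part p M = {1}"
          have "?P \<subseteq> N \<inter> D" using t p_part_subset[of p D] by (auto simp: sprod_def)
          then have "card ?P dvd card (N \<inter> D)" by (rule lagrange_dvd[OF fI(1) syl_fsub[OF sN]])
          then show ?thesis using sN unfolding cS by (simp add: syl_def)
        qed
        have "card ?S \<noteq> 0" unfolding cS using fsub_card_pos[OF fI(1)] fsub_card_pos[OF fI(2)] by simp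
        then show ?thesis using d p by (intro multiplicity_geI) (auto simp: not_prime_unit)
      qed
      then have "card N dvd card ?S" using fsub_card_pos[OF fN] by (intro multiplicity_le_imp_dvd) auto
      then have "card N \<le> card ?S" unfolding cS using fsub_card_pos[OF fI(1)] fsub_card_pos[OF fI(2)] by (intro dvd_imp_le) auto
      then have "?S = N" by (rule card_seteq[OF fsub_finite[OF fN] sub])
      then have "slv N" using factorised_slv[OF fN NG] ne by simp
      then show False using noslv[OF N subset_refl _ NG] ne by blast
    qed
    have f': "sprod M D = G" using sprod_commute[OF fD fM] f G by simp
    have D1: "D \<noteq> {1}"
    proof
      assume "D = {1}"
      then have "M = G" unfolding f[symmetric] by (simp add: sprod_def)
      then show False using nonil[OF normal_in_self[OF G]] nM less.prems(5) by simp
    qed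
    have M1: "M \<noteq> {1}"
    proof
      assume "M = {1}"
      then have "D = G" unfolding f[symmetric] by (simp add: sprod_def)
      then show False using nonil[OF normal_in_self[OF G]] nD less.prems(5) by simp
    qed
    have twoM: "\<exists>t. prime t \<and> t \<noteq> r \<and> t dvd card M" for r
      using prime_power_factor_not_simple[OF G simple nonil nD DG D1 fM f DM1, of r] by blast
    have twoD: "\<exists>t. prime t \<and> t \<noteq> r \<and> t dvd card D" for r
      using prime_power_factor_not_simple[OF G simple nonil nM MG M1 fD f' _, of r] DM1 by blast
    have "coprime_nilp_product G D M"
      by (rule coprime_nilp_product.intro[OF G nD DG nM MG f cop simple factorised_slv twoD twoM])
    then show False using coprime_nilp_product_absurd by blast
  qed
qed

theorem nilp_product_slv:
  assumes G: "fsub G" and D: "nilp D" and M: "nilp M" and f: "sprod D M = G" shows "slv G"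
proof (rule slv_if_quotients[OF G])
  fix \<phi> :: "'a \<Rightarrow> nat bperm" assume h: "hom_on G \<phi>" and ne: "\<phi> ` G \<noteq> {1}"
  have DX: "D \<subseteq> G" and MX: "M \<subseteq> G"
    using subset_sprod1[OF nilp_fsub[OF M], of D] subset_sprod2[OF nilp_fsub[OF D], of M] f by auto
  have "sprod (\<phi> ` D) (\<phi> ` M) = \<phi> ` G" using hom_on_sprod[OF h DX MX] f by simp
  from nilp_product_normal_pgroup[OF hom_on_image_fsub[OF h G G subset_refl] nilp_image[OF hom_on_subset[OF h DX] D]
      nilp_image[OF hom_on_subset[OF h MX] M] this ne]
  show "\<exists>p R. prime p \<and> normal_in R (\<phi> ` G) \<and> pgroup p R \<and> R \<noteq> {1}" .
qed

text \<open>The preimage of the core of the quotient is again a normal p-subgroup of G.\<close>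

lemma core_quotient_triv:
  assumes G: "fsub G" and p: "prime p" and h: "hom_on G \<phi>" and ker: "\<And>x. x \<in> G \<Longrightarrow> \<phi> x = 1 \<longleftrightarrow> x \<in> core p G"
  shows "core p (\<phi> ` G) = {1}"
proof -
  let ?N = "core p G" and ?R = "core p (\<phi> ` G)"
  have fQ: "fsub (\<phi> ` G)" by (rule hom_on_image_fsub[OF h G G subset_refl])
  have R: "normal_in ?R (\<phi> ` G)" "pgroup p ?R" by (rule core_normal_pgroup[OF p fQ])+
  have fR: "fsub ?R" by (rule pgroup_fsub[OF R(2)])
  have NG: "?N \<subseteq> G" by (rule normal_in_subset[OF core_normal_pgroup(1)[OF p G]])
  let ?L = "{x \<in> G. \<phi> x \<in> ?R}"
  have L: "normal_in ?L G" by (rule hom_on_vimage_normal[OF h G R(1)])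
  have im: "\<phi> ` ?L = ?R" using normal_in_subset[OF R(1)] by auto
  have hL: "hom_on ?L \<phi>" by (rule hom_on_subset[OF h]) blast
  have "{x \<in> ?L. \<phi> x = 1} = ?N"
  proof
    show "{x \<in> ?L. \<phi> x = 1} \<subseteq> ?N" using ker by blast
    show "?N \<subseteq> {x \<in> ?L. \<phi> x = 1}"
    proof
      fix x assume x: "x \<in> ?N"
      then have "x \<in> G" using NG by blast
      moreover have "\<phi> x = 1" using ker[OF \<open>x \<in> G\<close>] x by simp
      ultimately show "x \<in> {x \<in> ?L. \<phi> x = 1}" using fsub_one[OF fR] by simp
    qed
  qed
  then have c: "card ?R * card ?N = card ?L" using hom_on_card[OF hL normal_in_fsub[OF L]] im by simp
  obtain i where i: "card ?R = p ^ i" using R(2) by (auto simp: pgroup_def)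
  obtain j where j: "card ?N = p ^ j" using core_normal_pgroup(2)[OF p G] by (auto simp: pgroup_def)
  have "card ?L = p ^ (i + j)" using c i j by (simp add: power_add)
  then have "pgroup p ?L" using normal_in_fsub[OF L] unfolding pgroup_def by blast
  then have "?L \<subseteq> ?N" by (rule core_greatest[OF L])
  then have "\<phi> ` ?L \<subseteq> {1}" using ker by blast
  then show ?thesis using im fsub_one[OF fR] by blast
qed

text \<open>Write x = d m with p-elements d and m. Modulo O_p(G) their images are inverse to each
  other, so the image of d lies in both factors. It commutes with every q-core for q other than p,
  which lies in the product of the q-parts of the factors, and the p-core of the quotient is
  trivial. A p-element that centralises all cores of a solvable group lies in the p-core, so the
  image of d is 1.\<close>

lemma core_factorised:
  fixes G :: "'a::grp set"
  assumes G: "fsub G" and D: "nilp D" and M: "nilp M" and f: "sprod D M = G" and p: "prime p" and x: "x \<in> core p G"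
  shows "\<exists>d\<in>D. \<exists>m\<in>M. x = d * m \<and> d \<in> core p G \<and> m \<in> core p G"
proof -
  let ?N = "core p G"
  have N: "normal_in ?N G" "pgroup p ?N" by (rule core_normal_pgroup[OF p G])+
  have DG: "D \<subseteq> G" and MG: "M \<subseteq> G"
    using subset_sprod1[OF nilp_fsub[OF M], of D] subset_sprod2[OF nilp_fsub[OF D], of M] f by auto
  have "x \<in> sprod (p_part p D) (p_part p M)"
    using core_in_syl[OF p G p_part_product_syl[OF G D DG M MG f p]] x by blast
  then obtain d m where dm: "d \<in> p_part p D" "m \<in> p_part p M" "x = d * m" by (elim sprodE)
  have d: "d \<in> D" "p_elt p d" and m: "m \<in> M" "p_elt p m" using dm(1,2) by (auto simp: p_part_def)
  have dG: "d \<in> G" and mG: "m \<in> G" using d m DG MG by blast+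
  obtain \<phi> :: "'a \<Rightarrow> nat bperm" where h: "hom_on G \<phi>" and ker: "\<And>x. x \<in> G \<Longrightarrow> \<phi> x = 1 \<longleftrightarrow> x \<in> ?N"
    using quotient_hom[OF G N(1)] by (elim exE conjE) blast
  let ?Q = "\<phi> ` G" and ?D = "\<phi> ` D" and ?M = "\<phi> ` M"
  have fQ: "fsub ?Q" by (rule hom_on_image_fsub[OF h G G subset_refl])
  have nD: "nilp ?D" by (rule nilp_image[OF hom_on_subset[OF h DG] D])
  have nM: "nilp ?M" by (rule nilp_image[OF hom_on_subset[OF h MG] M])
  have f': "sprod ?D ?M = ?Q" using hom_on_sprod[OF h DG MG] f by simp
  have slvQ: "slv ?Q" by (rule nilp_product_slv[OF fQ nD nM f'])
  have DQ: "?D \<subseteq> ?Q" and MQ: "?M \<subseteq> ?Q" using DG MG by blast+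
  let ?r = "\<phi> d"
  have xG: "x \<in> G" using x normal_in_subset[OF N(1)] by blast
  have "\<phi> d * \<phi> m = 1" using ker[OF xG] x hom_on_mult[OF h dG mG] dm(3) by simp
  then have "gi ?r = \<phi> m" by (rule gi_unique)
  then have r': "?r = gi (\<phi> m)" by (metis gi_gi)
  have rD: "?r \<in> ?D" using d(1) by blast
  have "\<phi> m \<in> ?M" using m(1) by blast
  then have rM: "?r \<in> ?M" unfolding r' by (rule fsub_gi[OF nilp_fsub[OF nM]])
  have rQ: "?r \<in> ?Q" using dG by blast
  have "\<phi> (d ^ n) = ?r ^ n" for n by (rule hom_on_simps(3)[OF h G dG])
  then have rp: "p_elt p ?r" using d(2) hom_on_simps(1)[OF h G] unfolding p_elt_def by metis
  have "?r \<in> centraliser ?Q (fcore ?Q)"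
    unfolding centraliser_def
  proof (intro CollectI conjI ballI rQ)
    fix s assume "s \<in> fcore ?Q"
    then obtain q where q: "prime q" "s \<in> core q ?Q" by (auto simp: fcore_def)
    show "?r * s = s * ?r"
    proof (cases "q = p")
      case True
      then have "s = 1" using q core_quotient_triv[OF G p h ker] by auto
      then show ?thesis by simp
    next
      case False
      have "s \<in> sprod (p_part q ?D) (p_part q ?M)"
        using core_in_syl[OF q(1) fQ p_part_product_syl[OF fQ nD DQ nM MQ f' q(1)]] q(2) by blast
      then obtain a b where ab: "a \<in> p_part q ?D" "b \<in> p_part q ?M" "s = a * b" by (elim sprodE)
      have a: "a \<in> ?D" "p_elt q a" and b: "b \<in> ?M" "p_elt q b" using ab(1,2) unfolding p_part_def by blast+
      have ra: "?r * a = a * ?r" by (rule nilp_commute[OF nD p q(1) False[symmetric] rD a(1) rp a(2)])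
      have rb: "?r * b = b * ?r" by (rule nilp_commute[OF nM p q(1) False[symmetric] rM b(1) rp b(2)])
      have "?r * (a * b) = a * (?r * b)" by (simp only: mult.assoc[symmetric] ra)
      also have "\<dots> = a * b * ?r" by (simp only: rb mult.assoc)
      finally show ?thesis unfolding ab(3) .
    qed
  qed
  then have "?r \<in> p_part p (centraliser ?Q (fcore ?Q))" using rp by (simp add: p_part_def)
  then have "?r \<in> core p ?Q" using slv_centraliser_fcore(2)[OF slvQ p] by blast
  then have "?r = 1" using core_quotient_triv[OF G p h ker] by simp
  then have dN: "d \<in> ?N" using ker[OF dG] by simp
  have "m = gi d * x" by (simp add: dm(3))
  then have "m \<in> ?N" using fsub_mult[OF pgroup_fsub[OF N(2)] fsub_gi[OF pgroup_fsub[OF N(2)] dN] x] by simp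
  then show ?thesis using d(1) m(1) dm(3) dN by blast
qed

section \<open>Central series\<close>

text \<open>Moving y past x^n produces z^n, so z^a = 1; symmetrically z^b = 1.\<close>

lemma central_commutator_triv:
  fixes x y z :: "'a::grp"
  assumes e: "x * y = z * (y * x)" and zx: "z * x = x * z" and zy: "z * y = y * z"
    and ab: "coprime a b" "x ^ a = 1" "y ^ b = 1"
  shows "z = 1"
proof (rule coprime_powers_one[OF ab(1)])
  have c: "z ^ n * w = w * z ^ n" if "z * w = w * z" for n w
  proof (induction n)
    case (Suc n)
    have "z ^ Suc n * w = z * (w * z ^ n)" using Suc by (simp add: mult.assoc)
    also have "\<dots> = w * z ^ Suc n" using that by (simp add: mult.assoc[symmetric])
    finally show ?case .
  qed simp
  have "x ^ n * y = z ^ n * (y * x ^ n)" for n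
  proof (induction n)
    case (Suc n)
    have "x ^ Suc n * y = x * (x ^ n * y)" by (simp add: mult.assoc)
    also have "\<dots> = (x * z ^ n) * (y * x ^ n)" by (simp only: Suc mult.assoc)
    also have "\<dots> = z ^ n * ((x * y) * x ^ n)" by (simp only: c[OF zx, symmetric] mult.assoc)
    also have "\<dots> = (z ^ n * z) * (y * (x * x ^ n))" by (simp only: e mult.assoc)
    finally show ?case by (simp only: power_Suc2[symmetric] power_Suc[symmetric])
  qed simp
  from this[of a] show "z ^ a = 1" using ab(2) grp_right_eq_self[of "z ^ a" y] by (simp del: grp_right_eq_self)
  have "x * y ^ n = z ^ n * (y ^ n * x)" for n
  proof (induction n)
    case (Suc n)
    have "x * y ^ Suc n = (x * y) * y ^ n" by (simp add: mult.assoc)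
    also have "\<dots> = z * (y * (x * y ^ n))" by (simp only: e mult.assoc)
    also have "\<dots> = z * ((y * z ^ n) * (y ^ n * x))" by (simp only: Suc mult.assoc)
    also have "\<dots> = (z * z ^ n) * ((y * y ^ n) * x)" by (simp only: c[OF zy, symmetric] mult.assoc)
    finally show ?case by (simp only: power_Suc[symmetric])
  qed simp
  from this[of b] show "z ^ b = 1" using ab(3) grp_right_eq_self[of "z ^ b" x] by (simp del: grp_right_eq_self)
qed

text \<open>The commutator of two elements whose orders are powers of distinct primes is pushed down
  the series: modulo the next term it is central, hence trivial by
  \<open>central_commutator_triv\<close>.\<close>

lemma nilp_if_central_series:
  fixes D :: "'a::grp set"
  assumes D: "fsub D" and \<Gamma>: "\<Gamma> 0 = D" "\<Gamma> n = {1}" "\<And>i. normal_in (\<Gamma> i) D"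
    and com: "\<And>i c g. c \<in> \<Gamma> i \<Longrightarrow> g \<in> D \<Longrightarrow> c * g * gi c * gi g \<in> \<Gamma> (Suc i)"
  shows "nilp D"
  unfolding nilp_def
proof (intro conjI allI impI D)
  fix p q :: nat and x y assume pq: "prime p" "prime q" "p \<noteq> q" and x: "x \<in> D" and y: "y \<in> D" and xy: "p_elt p x" "p_elt q y"
  obtain k l where kl: "x ^ (p ^ k) = 1" "y ^ (q ^ l) = 1" using xy unfolding p_elt_def by blast
  have cop: "coprime (p ^ k) (q ^ l)" using pq by (simp add: primes_coprime)
  let ?c = "x * y * gi x * gi y"
  have "?c \<in> \<Gamma> i" for i
  proof (induction i)
    case 0
    then show ?case using x y D \<Gamma>(1) by (simp add: fsub_mult)
  next
    case (Suc i)
    obtain \<phi> :: "'a \<Rightarrow> nat bperm" where h: "hom_on D \<phi>" and ker: "\<And>x. x \<in> D \<Longrightarrow> \<phi> x = 1 \<longleftrightarrow> x \<in> \<Gamma> (Suc i)"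
      using quotient_hom[OF D \<Gamma>(3)[of "Suc i"]] by (elim exE conjE) blast
    have cD: "?c \<in> D" using x y D by (simp add: fsub_mult)
    have cen: "\<phi> ?c * \<phi> g = \<phi> g * \<phi> ?c" if g: "g \<in> D" for g
    proof -
      have k: "?c * g * gi ?c * gi g \<in> \<Gamma> (Suc i)" by (rule com[OF Suc g])
      have kD: "?c * g * gi ?c * gi g \<in> D" using cD g D by (simp add: fsub_mult del: gi_mult)
      have gc: "g * ?c \<in> D" by (rule fsub_mult[OF D g cD])
      have "(?c * g * gi ?c * gi g) * (g * ?c) = ?c * g" by (simp add: mult.assoc)
      then have "\<phi> (?c * g) = \<phi> (?c * g * gi ?c * gi g) * \<phi> (g * ?c)" using hom_on_mult[OF h kD gc] by simp
      also have "\<dots> = \<phi> (g * ?c)" using ker[OF kD] k by simp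
      finally show ?thesis by (simp only: hom_on_mult[OF h cD g] hom_on_mult[OF h g cD])
    qed
    have yx: "y * x \<in> D" by (rule fsub_mult[OF D y x])
    have "?c * (y * x) = x * y" by (simp add: mult.assoc)
    then have e: "\<phi> x * \<phi> y = \<phi> ?c * (\<phi> y * \<phi> x)"
      using hom_on_mult[OF h cD yx] hom_on_mult[OF h x y] hom_on_mult[OF h y x] by simp
    have "\<phi> ?c = 1"
    proof (rule central_commutator_triv[OF e cen[OF x] cen[OF y] cop])
      show "\<phi> x ^ p ^ k = 1" "\<phi> y ^ q ^ l = 1"
        by (simp_all only: hom_on_simps(3)[OF h D x, symmetric] hom_on_simps(3)[OF h D y, symmetric] kl hom_on_simps(1)[OF h D])
    qed
    then show ?case using ker[OF cD] by simp
  qed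
  then have "?c = 1" using \<Gamma>(2) by blast
  then have "(x * y) * (gi x * gi y) = 1" by (simp add: mult.assoc)
  then have "gi (x * y) = gi x * gi y" by (rule gi_unique)
  then have "gi (gi (x * y)) = gi (gi x * gi y)" by (rule arg_cong)
  then show "x * y = y * x" by simp
qed

text \<open>N' is the preimage of the centre of P/N, which is nontrivial.\<close>

lemma pgroup_central_step:
  fixes P :: "'a::grp set"
  assumes p: "prime p" and P: "pgroup p P" and N: "normal_in N P" "N \<noteq> P"
  shows "\<exists>N'. normal_in N' P \<and> N \<subset> N' \<and> (\<forall>c\<in>N'. \<forall>g\<in>P. c * g * gi c * gi g \<in> N)"
proof -
  have fP: "fsub P" by (rule pgroup_fsub[OF P])
  obtain \<phi> :: "'a \<Rightarrow> nat bperm" where h: "hom_on P \<phi>" and ker: "\<And>x. x \<in> P \<Longrightarrow> \<phi> x = 1 \<longleftrightarrow> x \<in> N"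
    using quotient_hom[OF fP N(1)] by (elim exE conjE) blast
  let ?Q = "\<phi> ` P"
  have fQ: "fsub ?Q" by (rule hom_on_image_fsub[OF h fP fP subset_refl])
  have nQ: "nilp ?Q" by (rule nilp_image[OF h pgroup_nilp[OF p P]])
  obtain x0 where x0: "x0 \<in> P" "x0 \<notin> N" using N normal_in_subset by blast
  then have ne: "?Q \<noteq> {1}" using ker by blast
  have "card ?Q dvd card P" using hom_on_card[OF h fP] by (metis dvd_triv_left)
  moreover obtain k where "card P = p ^ k" using P unfolding pgroup_def by blast
  ultimately obtain j where j: "card ?Q = p ^ j" using divides_primepow_nat[OF p, of "card ?Q" k] by auto
  have "j \<noteq> 0"
  proof
    assume "j = 0"
    then have "card ?Q = 1" using j by simp
    then show False using ne fsub_card1[OF fQ] by simp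
  qed
  then have pd: "p dvd card ?Q" using j by (simp add: dvd_power)
  obtain z where z: "z \<in> ?Q" "z \<noteq> 1" "\<forall>x\<in>?Q. z * x = x * z"
    using nilp_central[OF nQ p normal_in_self[OF fQ] pd] by blast
  let ?Z = "centraliser ?Q ?Q"
  have Z: "normal_in ?Z ?Q" by (rule normal_centraliser[OF fQ]) (rule cj_image_self[OF fQ])
  let ?N = "{x \<in> P. \<phi> x \<in> ?Z}"
  have N': "normal_in ?N P" by (rule hom_on_vimage_normal[OF h fP Z])
  have sub: "N \<subseteq> ?N"
  proof
    fix x assume x: "x \<in> N"
    then have xP: "x \<in> P" using normal_in_subset[OF N(1)] by blast
    then have "\<phi> x = 1" using ker x by blast
    then show "x \<in> ?N" using xP fsub_one[OF normal_in_fsub[OF Z]] by simp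
  qed
  obtain x where x: "x \<in> P" "z = \<phi> x" using z(1) by blast
  have "z \<in> ?Z" unfolding centraliser_def using z(1,3) by blast
  then have "x \<in> ?N" "x \<notin> N" using x z(2) ker by auto
  then have ss: "N \<subset> ?N" using sub by blast
  have "c * g * gi c * gi g \<in> N" if c: "c \<in> ?N" and g: "g \<in> P" for c g
  proof -
    have cP: "c \<in> P" and cZ: "\<phi> c \<in> ?Z" using c by blast+
    have gQ: "\<phi> g \<in> ?Q" using g by blast
    have cm: "\<phi> c * \<phi> g = \<phi> g * \<phi> c" using cZ gQ unfolding centraliser_def by blast
    have kP: "c * g * gi c * gi g \<in> P" using cP g fP by (simp add: fsub_mult)
    have "\<phi> (c * g * gi c * gi g) = \<phi> c * \<phi> g * gi (\<phi> c) * gi (\<phi> g)"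
      using cP g fP by (simp add: hom_on_mult[OF h] hom_on_simps(2)[OF h fP] fsub_mult)
    also have "\<dots> = 1" unfolding cm by (simp add: mult.assoc)
    finally show ?thesis using ker[OF kP] by simp
  qed
  then show ?thesis using N' ss by blast
qed

text \<open>\<open>\<gamma>\<close> stands for the lower central series, characterised by
  \<open>step\<close>. By induction some term lies in the next central step above N, and then the
  following term lies in N.\<close>

lemma pgroup_lower_central:
  fixes P :: "'a::grp set"
  assumes p: "prime p" and P: "pgroup p P" and \<gamma>: "\<gamma> 0 \<subseteq> P"
    and step: "\<And>n S. fsub S \<Longrightarrow> S \<subseteq> P \<Longrightarrow> (\<And>c g. c \<in> \<gamma> n \<Longrightarrow> g \<in> P \<Longrightarrow> c * g * gi c * gi g \<in> S) \<Longrightarrow> \<gamma> (Suc n) \<subseteq> S"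
  shows "normal_in N P \<Longrightarrow> \<exists>n::nat. \<gamma> n \<subseteq> N"
proof (induction "card P - card N" arbitrary: N rule: less_induct)
  case less
  show ?case
  proof (cases "N = P")
    case True
    then show ?thesis using \<gamma> by blast
  next
    case False
    obtain N' where N': "normal_in N' P" "N \<subset> N'" "\<forall>c\<in>N'. \<forall>g\<in>P. c * g * gi c * gi g \<in> N"
      using pgroup_central_step[OF p P less.prems False] by (elim exE conjE)
    have fP: "finite P" by (rule fsub_finite[OF pgroup_fsub[OF P]])
    have "card N < card N'" using N'(2) finite_subset[OF normal_in_subset[OF N'(1)] fP] by (intro psubset_card_mono)
    moreover have "card N' \<le> card P" by (rule card_mono[OF fP normal_in_subset[OF N'(1)]])
    ultimately have "card P - card N' < card P - card N" by linarith
    from less.hyps[OF this N'(1)] obtain n where n: "\<gamma> n \<subseteq> N'" by blast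
    have "\<gamma> (Suc n) \<subseteq> N"
      by (rule step[OF normal_in_fsub[OF less.prems] normal_in_subset[OF less.prems]]) (use n N'(3) in blast)
    then show ?thesis by blast
  qed
qed

section \<open>Embedding abstract groups\<close>

text \<open>Carries a group with an explicit carrier to a finite subset of a \<open>grp\<close>
  type, where the theory above applies.\<close>

locale embed = group H for H :: "('b, 'c) monoid_scheme" (structure) +
  fixes t :: "'b \<Rightarrow> 'g::grp"
  assumes inj: "inj_on t (carrier H)" and fin: "finite (carrier H)"
    and t_mult: "\<lbrakk>x \<in> carrier H; y \<in> carrier H\<rbrakk> \<Longrightarrow> t (x \<otimes> y) = t x * t y"
begin

lemma t_one: "t \<one> = 1"
proof -
  have "t \<one> * t \<one> = t \<one>" using t_mult[of \<one> \<one>] by simp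
  then show ?thesis by (simp only: grp_left_eq_self)
qed

lemma t_inv: "x \<in> carrier H \<Longrightarrow> t (inv x) = gi (t x)"
proof -
  assume x: "x \<in> carrier H"
  have "t x * t (inv x) = 1" using t_mult[OF x inv_closed[OF x]] x t_one by simp
  then show ?thesis by (rule gi_unique[symmetric])
qed

lemma t_mem: "I \<subseteq> carrier H \<Longrightarrow> x \<in> carrier H \<Longrightarrow> t x \<in> t ` I \<longleftrightarrow> x \<in> I"
  using inj_on_image_mem_iff[OF inj] by blast

lemma t_vimage: "S \<subseteq> t ` carrier H \<Longrightarrow> t ` {x \<in> carrier H. t x \<in> S} = S"
  by blast

lemma subgroup_iff:
  assumes I: "I \<subseteq> carrier H" shows "subgroup I H \<longleftrightarrow> fsub (t ` I)"
proof
  assume s: "subgroup I H"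
  show "fsub (t ` I)"
  proof (rule fsubI)
    show "finite (t ` I)" using finite_subset[OF I fin] by simp
    show "1 \<in> t ` I" using subgroup.one_closed[OF s] t_one by (metis image_eqI)
    fix x assume "x \<in> t ` I"
    then obtain a where a: "a \<in> I" "x = t a" by (elim imageE)
    then have aH: "a \<in> carrier H" using I by blast
    have "gi x = t (inv a)" using t_inv[OF aH] a(2) by simp
    then show "gi x \<in> t ` I" using subgroup.m_inv_closed[OF s a(1)] by blast
    fix y assume "y \<in> t ` I"
    then obtain b where b: "b \<in> I" "y = t b" by (elim imageE)
    then have bH: "b \<in> carrier H" using I by blast
    have "x * y = t (a \<otimes> b)" using t_mult[OF aH bH] a(2) b(2) by simp
    then show "x * y \<in> t ` I" using subgroup.m_closed[OF s a(1) b(1)] by blast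
  qed
next
  assume f: "fsub (t ` I)"
  show "subgroup I H"
  proof (rule subgroupI[OF I])
    have "t \<one> \<in> t ` I" using fsub_one[OF f] t_one by simp
    then show "I \<noteq> {}" by blast
    fix a assume a: "a \<in> I"
    then have aH: "a \<in> carrier H" using I by blast
    have "gi (t a) \<in> t ` I" by (rule fsub_gi[OF f imageI[OF a]])
    then have "t (inv a) \<in> t ` I" using t_inv[OF aH] by simp
    then show "inv a \<in> I" using t_mem[OF I inv_closed[OF aH]] by blast
    fix b assume b: "b \<in> I"
    then have bH: "b \<in> carrier H" using I by blast
    have "t a * t b \<in> t ` I" by (rule fsub_mult[OF f imageI[OF a] imageI[OF b]])
    then have "t (a \<otimes> b) \<in> t ` I" using t_mult[OF aH bH] by simp
    then show "a \<otimes> b \<in> I" using t_mem[OF I m_closed[OF aH bH]] by blast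
  qed
qed

lemma fsub_carrier: "fsub (t ` carrier H)"
  using subgroup_iff[of "carrier H"] subgroup_self by simp

lemma t_cj: "x \<in> carrier H \<Longrightarrow> h \<in> carrier H \<Longrightarrow> t (x \<otimes> h \<otimes> inv x) = cj (t x) (t h)"
  by (simp add: cj_def t_mult t_inv)

lemma normal_iff:
  assumes I: "I \<subseteq> carrier H" shows "I \<lhd> H \<longleftrightarrow> normal_in (t ` I) (t ` carrier H)"
proof -
  have "x \<otimes> h \<otimes> inv x \<in> I \<longleftrightarrow> cj (t x) (t h) \<in> t ` I" if x: "x \<in> carrier H" and h: "h \<in> I" for x h
  proof -
    have hH: "h \<in> carrier H" using h I by blast
    have "x \<otimes> h \<otimes> inv x \<in> carrier H" using x hH by simp
    from t_mem[OF I this] show ?thesis using t_cj[OF x hH] by simp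
  qed
  then show ?thesis unfolding normal_inv_iff normal_in_def using subgroup_iff[OF I] I by blast
qed

lemma lower_central_normal: "lower_central H n \<lhd> H"
proof (induction n)
  case 0
  then show ?case by (simp add: normal_iff normal_in_self fsub_carrier)
next
  case (Suc n)
  have sub: "lower_central H n \<subseteq> carrier H" using Suc normal_imp_subgroup subgroup.subset by blast
  show ?case unfolding lower_central.simps commutator_subgroup_def
  proof (rule normal_generateI)
    show "(\<Union>h\<in>lower_central H n. \<Union>k\<in>carrier H. {h \<otimes> k \<otimes> inv h \<otimes> inv k}) \<subseteq> carrier H"
      using sub by auto
    fix h g assume "h \<in> (\<Union>h\<in>lower_central H n. \<Union>k\<in>carrier H. {h \<otimes> k \<otimes> inv h \<otimes> inv k})" and g: "g \<in> carrier H"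
    then obtain a k where a: "a \<in> lower_central H n" and k: "k \<in> carrier H" and h: "h = a \<otimes> k \<otimes> inv a \<otimes> inv k" by blast
    have aH: "a \<in> carrier H" using a sub by blast
    let ?a = "g \<otimes> a \<otimes> inv g" and ?k = "g \<otimes> k \<otimes> inv g"
    \<comment> \<open>Conjugation distributes over the commutator; the identity is checked after
      applying t, where \<open>simp\<close> cancels inverses.\<close>
    have "t (g \<otimes> h \<otimes> inv g) = t (?a \<otimes> ?k \<otimes> inv ?a \<otimes> inv ?k)"
      unfolding h using aH k g by (simp add: t_mult t_inv mult.assoc)
    then have "g \<otimes> h \<otimes> inv g = ?a \<otimes> ?k \<otimes> inv ?a \<otimes> inv ?k"
      using inj_onD[OF inj] aH k g unfolding h by simp
    moreover have "?a \<in> lower_central H n" using Suc a g unfolding normal_inv_iff by blast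
    ultimately show "g \<otimes> h \<otimes> inv g \<in> (\<Union>h\<in>lower_central H n. \<Union>k\<in>carrier H. {h \<otimes> k \<otimes> inv h \<otimes> inv k})"
      using k g by auto
  qed
qed

lemma lower_central_subset: "lower_central H n \<subseteq> carrier H"
  using lower_central_normal normal_imp_subgroup subgroup.subset by blast

lemma t_commutator:
  "h \<in> carrier H \<Longrightarrow> k \<in> carrier H \<Longrightarrow> t (h \<otimes> k \<otimes> inv h \<otimes> inv k) = t h * t k * gi (t h) * gi (t k)"
  by (simp add: t_mult t_inv)

lemma nilp_if_nilpotent:
  assumes "nilpotent_group H" shows "nilp (t ` carrier H)"
proof -
  obtain n where n: "lower_central H n = {\<one>}" using assms by (auto simp: nilpotent_group_def)
  show ?thesis
  proof (rule nilp_if_central_series[OF fsub_carrier, of "\<lambda>i. t ` lower_central H i" n])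
    show "t ` lower_central H n = {1}" using n t_one by simp
    show "normal_in (t ` lower_central H i) (t ` carrier H)" for i
      using lower_central_normal normal_iff[OF lower_central_subset] by blast
    fix i c g assume "c \<in> t ` lower_central H i" "g \<in> t ` carrier H"
    then obtain a k where a: "a \<in> lower_central H i" "c = t a" and k: "k \<in> carrier H" "g = t k" by (elim imageE)
    have "a \<otimes> k \<otimes> inv a \<otimes> inv k \<in> lower_central H (Suc i)"
      unfolding lower_central.simps commutator_subgroup_def by (rule generate.incl) (use a k in blast)
    moreover have "c * g * gi c * gi g = t (a \<otimes> k \<otimes> inv a \<otimes> inv k)"
      using t_commutator[OF subsetD[OF lower_central_subset a(1)] k(1)] a(2) k(2) by simp
    ultimately show "c * g * gi c * gi g \<in> t ` lower_central H (Suc i)" by blast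
  qed simp
qed

text \<open>This serves to place normal p-subgroups of the additive group inside the Fitting
  subgroup.\<close>

lemma nilpotent_if_pgroup:
  assumes p: "prime p" and P: "pgroup p (t ` carrier H)" shows "nilpotent_group H"
proof -
  have "\<exists>n. t ` lower_central H n \<subseteq> {1}"
  proof (rule pgroup_lower_central[OF p P, where \<gamma> = "\<lambda>n. t ` lower_central H n"])
    fix n S assume S: "fsub S" "S \<subseteq> t ` carrier H"
      and c: "\<And>c g. c \<in> t ` lower_central H n \<Longrightarrow> g \<in> t ` carrier H \<Longrightarrow> c * g * gi c * gi g \<in> S"
    let ?S = "{x \<in> carrier H. t x \<in> S}"
    have s: "subgroup ?S H" using subgroup_iff[of ?S] S(1) t_vimage[OF S(2)] by simp
    have "lower_central H (Suc n) \<subseteq> ?S" unfolding lower_central.simps commutator_subgroup_def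
    proof (rule generate_subgroup_incl[OF _ s], safe)
      fix h k assume h: "h \<in> lower_central H n" and k: "k \<in> carrier H"
      have hH: "h \<in> carrier H" using h lower_central_subset by blast
      show "h \<otimes> k \<otimes> inv h \<otimes> inv k \<in> carrier H" using hH k by simp
      show "t (h \<otimes> k \<otimes> inv h \<otimes> inv k) \<in> S" unfolding t_commutator[OF hH k] by (rule c) (use h k in blast)+
    qed
    then show "t ` lower_central H (Suc n) \<subseteq> S" by blast
  qed (use normal_in_triv[OF fsub_carrier] in auto)
  then obtain n where n: "t ` lower_central H n \<subseteq> {1}" by blast
  have "lower_central H n = {\<one>}"
  proof
    show "lower_central H n \<subseteq> {\<one>}"
    proof
      fix x assume x: "x \<in> lower_central H n"
      then have "t x = t \<one>" using n t_one by auto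
      then show "x \<in> {\<one>}" using inj_onD[OF inj] x lower_central_subset by blast
    qed
    show "{\<one>} \<subseteq> lower_central H n"
      using subgroup.one_closed[OF normal_imp_subgroup[OF lower_central_normal]] by blast
  qed
  then show ?thesis unfolding nilpotent_group_def using group_axioms by blast
qed

lemma embed_subgroup:
  assumes "subgroup N H" shows "embed (H\<lparr>carrier := N\<rparr>) t"
proof -
  have N: "N \<subseteq> carrier H" using assms subgroup.subset by blast
  have g: "group (H\<lparr>carrier := N\<rparr>)" by (rule subgroup_imp_group[OF assms])
  show ?thesis
    by (rule embed.intro[OF g], rule embed_axioms.intro)
      (use N inj_on_subset[OF inj N] finite_subset[OF N fin] t_mult in auto)
qed

end

text \<open>Cayley's representation. Points outside the carrier are fixed, so that an element of the
  carrier gives a permutation of the whole type.\<close>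

definition ltr :: "('a, 'b) monoid_scheme \<Rightarrow> 'a \<Rightarrow> 'a bperm" where
  "ltr H a = Abs_bperm (\<lambda>x. if x \<in> carrier H then a \<otimes>\<^bsub>H\<^esub> x else x)"

lemma (in group) Rep_ltr:
  assumes a: "a \<in> carrier G"
  shows "Rep_bperm (ltr G a) = (\<lambda>x. if x \<in> carrier G then a \<otimes> x else x)"
proof -
  have c: "a \<otimes> (inv a \<otimes> x) = x" "inv a \<otimes> (a \<otimes> x) = x" if "x \<in> carrier G" for x
    using a that by (simp_all flip: m_assoc)
  have "bij (\<lambda>x. if x \<in> carrier G then a \<otimes> x else x)"
    by (rule o_bij[of "\<lambda>x. if x \<in> carrier G then inv a \<otimes> x else x"]) (use a c in \<open>auto simp: fun_eq_iff\<close>)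
  then show ?thesis unfolding ltr_def by (intro Abs_bperm_inverse) simp
qed

lemma (in group) embed_ltr:
  assumes "finite (carrier G)" shows "embed G (ltr G)"
proof (rule embed.intro[OF group_axioms], rule embed_axioms.intro)
  show "inj_on (ltr G) (carrier G)"
  proof (rule inj_onI)
    fix x y assume x: "x \<in> carrier G" and y: "y \<in> carrier G" and e: "ltr G x = ltr G y"
    have "Rep_bperm (ltr G x) \<one> = Rep_bperm (ltr G y) \<one>" by (simp only: e)
    then show "x = y" using x y by (simp add: Rep_ltr)
  qed
  show "finite (carrier G)" by (rule assms)
  show "ltr G (x \<otimes> y) = ltr G x * ltr G y" if "x \<in> carrier G" "y \<in> carrier G" for x y
    using that by (auto simp: Rep_bperm_inject[symmetric] Rep_bperm_times Rep_ltr fun_eq_iff m_assoc)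
qed

section \<open>The permutation group of a finite brace\<close>

locale finite_nilpotent_brace = skew_brace B for B :: "('a, 'b) ring_scheme" (structure) +
  assumes fin: "finite (carrier B)" and nil: "nilpotent_group B"
begin

abbreviation "C \<equiv> carrier B"
abbreviation "tau \<equiv> ltr (add_monoid B)"
abbreviation "ell \<equiv> ltr B"
text \<open>For a in the carrier this is lambda_a there and the identity elsewhere. As a quotient of
  two translations it is a permutation by construction.\<close>

definition "lam a = gi (tau a) * ell a"
abbreviation "TT \<equiv> tau ` C"
abbreviation "DD \<equiv> ell ` C"
abbreviation "LL \<equiv> lam ` C"
definition "GG = sprod TT LL"

sublocale T: embed "add_monoid B" tau
  by (rule add.embed_ltr) (simp add: fin)

sublocale D: embed B ell
  by (rule embed_ltr) (rule fin)

lemma Rep_tau: "a \<in> C \<Longrightarrow> Rep_bperm (tau a) = (\<lambda>x. if x \<in> C then a \<oplus> x else x)"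
  using add.Rep_ltr[of a] by (simp cong: if_cong)

lemma Rep_ell: "a \<in> C \<Longrightarrow> Rep_bperm (ell a) = (\<lambda>x. if x \<in> C then a \<otimes> x else x)"
  by (rule Rep_ltr)

lemma zero_C: "\<zero> \<in> C" using add.one_closed by simp

lemma add_C: "a \<in> C \<Longrightarrow> b \<in> C \<Longrightarrow> a \<oplus> b \<in> C" using add.m_closed[of a b] by simp

lemma neg_C: "a \<in> C \<Longrightarrow> \<ominus> a \<in> C" using add.inv_closed[of a] by (simp add: a_inv_def)

lemma tau_add: "a \<in> C \<Longrightarrow> b \<in> C \<Longrightarrow> tau (a \<oplus> b) = tau a * tau b" using T.t_mult[of a b] by simp

lemma tau_neg: "a \<in> C \<Longrightarrow> tau (\<ominus> a) = gi (tau a)" using T.t_inv[of a] by (simp add: a_inv_def)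

lemma tau_one: "tau \<one> = 1" using T.t_one zero_eq_one by simp

lemma lambda_C: "a \<in> C \<Longrightarrow> b \<in> C \<Longrightarrow> brace_lambda B a b \<in> C"
  unfolding brace_lambda_def by (intro add_C neg_C m_closed)

lemma tau_lambda: "a \<in> C \<Longrightarrow> b \<in> C \<Longrightarrow> tau (brace_lambda B a b) = gi (tau a) * tau (a \<otimes> b)"
  unfolding brace_lambda_def by (simp add: tau_add neg_C tau_neg)

lemma ell_eq: "ell a = tau a * lam a" by (simp add: lam_def)

lemma tau_eq: "tau a = ell a * gi (lam a)" by (simp add: lam_def mult.assoc)

text \<open>The brace law b (a + x) = (b a - b) + b x, read as an identity of permutations in x.
  Adding -b on the left turns b a - b into lambda_b(a) - b, and the last -b is absorbed in
  \<open>lam b\<close>.\<close>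

lemma lam_tau:
  assumes a: "a \<in> C" and b: "b \<in> C" shows "lam b * tau a = tau (brace_lambda B b a) * lam b"
proof -
  have n: "\<ominus> b \<in> C" and ba: "b \<otimes> a \<in> C" using a b neg_C by auto
  have "ell b * tau a = tau ((b \<otimes> a) \<ominus> b) * ell b"
  proof -
    have c: "(b \<otimes> a) \<ominus> b \<in> C" unfolding a_minus_def by (rule add_C[OF ba n])
    have "Rep_bperm (ell b * tau a) x = Rep_bperm (tau ((b \<otimes> a) \<ominus> b) * ell b) x" for x
      using brace_distrib[OF b a, of x] a b c add_C[OF a] by (simp add: Rep_bperm_times Rep_tau Rep_ell)
    then show ?thesis by (simp only: Rep_bperm_inject[symmetric] fun_eq_iff) simp
  qed
  also have "tau ((b \<otimes> a) \<ominus> b) = tau (b \<otimes> a) * gi (tau b)"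
    unfolding a_minus_def using tau_add[OF ba n] tau_neg[OF b] by simp
  finally have e: "ell b * tau a = tau (b \<otimes> a) * gi (tau b) * ell b" .
  have "lam b * tau a = gi (tau b) * (ell b * tau a)" by (simp add: lam_def mult.assoc)
  also have "\<dots> = gi (tau b) * tau (b \<otimes> a) * (gi (tau b) * ell b)" by (simp only: e mult.assoc)
  finally show ?thesis by (simp only: tau_lambda[OF b a] lam_def)
qed

lemma cj_lam_tau: "a \<in> C \<Longrightarrow> b \<in> C \<Longrightarrow> cj (lam b) (tau a) = tau (brace_lambda B b a)"
  by (simp add: cj_def lam_tau mult.assoc)

text \<open>Both sides of \<open>ell (a \<otimes> b) = ell a * ell b\<close> are written as a
  translation times a lambda; the translations agree and cancel.\<close>

lemma lam_mult:
  assumes a: "a \<in> C" and b: "b \<in> C" shows "lam (a \<otimes> b) = lam a * lam b"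
proof -
  have "tau (a \<otimes> b) * lam (a \<otimes> b) = ell a * ell b" using D.t_mult[OF a b] by (simp only: ell_eq)
  also have "\<dots> = tau a * (lam a * tau b) * lam b" by (simp add: ell_eq mult.assoc)
  also have "\<dots> = tau a * tau (brace_lambda B a b) * (lam a * lam b)" by (simp only: lam_tau[OF b a] mult.assoc)
  also have "tau a * tau (brace_lambda B a b) = tau (a \<otimes> b)" by (simp add: tau_lambda[OF a b])
  finally show ?thesis by simp
qed

lemma lam_one: "lam \<one> = 1" using tau_one D.t_one by (simp add: lam_def)

lemma lam_inv: "a \<in> C \<Longrightarrow> lam (inv a) = gi (lam a)"
proof -
  assume a: "a \<in> C"
  have "lam a * lam (inv a) = 1" using lam_mult[OF a inv_closed[OF a]] a lam_one by simp
  then show ?thesis by (rule gi_unique[symmetric])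
qed

lemma fsub_LL: "fsub LL"
proof (rule fsub_mult_closed)
  show "1 \<in> LL" using lam_one one_closed by (metis image_eqI)
  fix x y assume "x \<in> LL" "y \<in> LL"
  then obtain a b where ab: "a \<in> C" "b \<in> C" "x = lam a" "y = lam b" by (elim imageE)
  then have "x * y = lam (a \<otimes> b)" by (simp add: lam_mult)
  then show "x * y \<in> LL" using ab(1,2) by blast
qed (use fin in simp)

lemma fsub_TT: "fsub TT" using T.fsub_carrier by simp

lemma fsub_DD: "fsub DD" by (rule D.fsub_carrier)

lemma fsub_GG: "fsub GG"
  unfolding GG_def
proof (rule fsub_sprod[OF fsub_TT fsub_LL])
  show "sprod LL TT \<subseteq> sprod TT LL"
  proof
    fix x assume "x \<in> sprod LL TT"
    then obtain b a where ab: "b \<in> C" "a \<in> C" "x = lam b * tau a" by (elim sprodE imageE) blast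
    have "x = tau (brace_lambda B b a) * lam b" unfolding ab(3) by (rule lam_tau[OF ab(2,1)])
    then show "x \<in> sprod TT LL" using lambda_C[OF ab(1,2)] ab(1) by (simp only: sprodI imageI)
  qed
qed

lemma TT_GG: "TT \<subseteq> GG" and LL_GG: "LL \<subseteq> GG"
  unfolding GG_def by (rule subset_sprod1[OF fsub_LL], rule subset_sprod2[OF fsub_TT])

lemma DD_GG: "DD \<subseteq> GG"
proof
  fix x assume "x \<in> DD"
  then obtain a where a: "a \<in> C" "x = ell a" by (elim imageE)
  then show "x \<in> GG" unfolding GG_def a(2) ell_eq by (intro sprodI imageI)
qed

lemma DD_LL: "sprod DD LL = GG"
proof
  show "sprod DD LL \<subseteq> GG" by (rule sprod_subset[OF fsub_GG DD_GG LL_GG])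
  show "GG \<subseteq> sprod DD LL"
  proof
    fix x assume "x \<in> GG"
    then obtain a c where ac: "a \<in> C" "c \<in> C" "x = tau a * lam c" unfolding GG_def by (elim sprodE imageE) blast
    have "x = ell a * (gi (lam a) * lam c)" unfolding ac(3) tau_eq by (simp add: mult.assoc)
    moreover have "gi (lam a) * lam c \<in> LL"
      by (rule fsub_mult[OF fsub_LL fsub_gi[OF fsub_LL imageI[OF ac(1)]] imageI[OF ac(2)]])
    ultimately show "x \<in> sprod DD LL" using sprodI[OF imageI[OF ac(1)]] by simp
  qed
qed

text \<open>Every lambda_c fixes the common identity, whereas multiplication by b moves it to
  b.\<close>

lemma DD_Int_LL: "x \<in> DD \<Longrightarrow> x \<in> LL \<Longrightarrow> x = 1"
proof -
  assume "x \<in> DD" "x \<in> LL"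
  then obtain b c where bc: "b \<in> C" "c \<in> C" "x = ell b" "x = lam c" by (elim imageE)
  have "ell b = gi (tau c) * ell c" using bc(3,4) by (simp only: lam_def)
  then have "tau c * ell b = ell c" by (simp only: gi_right_cancel)
  then have "Rep_bperm (tau c * ell b) \<one> = Rep_bperm (ell c) \<one>" by (simp only:)
  then have "c \<oplus> b = c" using bc(1,2) by (simp add: Rep_bperm_times Rep_tau Rep_ell)
  then have "b = \<zero>" using add.l_cancel_one[of c b] bc(1,2) by simp
  then show ?thesis using bc(3) D.t_one zero_eq_one by simp
qed

lemma nilp_DD: "nilp DD" by (rule D.nilp_if_nilpotent[OF nil])

text \<open>\<open>lam\<close> is multiplicative, so \<open>LL\<close> is a homomorphic image of
  \<open>DD\<close>.\<close>

lemma nilp_LL: "nilp LL"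
proof -
  define \<psi> where "\<psi> x = lam (the_inv_into C ell x)" for x
  have \<psi>: "\<psi> (ell a) = lam a" if "a \<in> C" for a unfolding \<psi>_def using the_inv_into_f_f[OF D.inj that] by simp
  have "hom_on DD \<psi>" unfolding hom_on_def
  proof (intro ballI)
    fix x y assume "x \<in> DD" "y \<in> DD"
    then obtain a b where ab: "a \<in> C" "b \<in> C" "x = ell a" "y = ell b" by (elim imageE)
    have "\<psi> (x * y) = \<psi> (ell (a \<otimes> b))" using D.t_mult[OF ab(1,2)] ab(3,4) by simp
    then show "\<psi> (x * y) = \<psi> x * \<psi> y" using ab by (simp add: \<psi> lam_mult)
  qed
  from nilp_image[OF this nilp_DD] show ?thesis by (simp add: image_image \<psi>)
qed

lemma slv_GG: "slv GG" by (rule nilp_product_slv[OF fsub_GG nilp_DD nilp_LL DD_LL])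

lemma TT_normal: "normal_in TT GG"
proof (rule normal_inI[OF fsub_TT TT_GG])
  fix x y assume "x \<in> GG" "y \<in> TT"
  then obtain a c b where ac: "a \<in> C" "c \<in> C" "x = tau a * lam c" and b: "b \<in> C" "y = tau b"
    unfolding GG_def by (elim sprodE imageE) blast
  have "cj x y = cj (tau a) (tau (brace_lambda B c b))" unfolding ac(3) b(2) by (simp add: cj_cj[symmetric] cj_lam_tau[OF b(1) ac(2)])
  then show "cj x y \<in> TT" using fsub_cj[OF fsub_TT imageI[OF ac(1)] imageI[OF lambda_C[OF ac(2) b(1)]]] by simp
qed

text \<open>Ideals expressed in the permutation group. For lambda an inclusion suffices, because
  injectivity and finiteness turn it into the equality that a left ideal demands.\<close>

definition pideal :: "'a set \<Rightarrow> bool" where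
  "pideal I \<longleftrightarrow> I \<subseteq> C \<and> normal_in (tau ` I) TT \<and> normal_in (ell ` I) DD \<and> (\<forall>b\<in>C. \<forall>a\<in>I. brace_lambda B b a \<in> I)"

lemma pideal_brace_ideal:
  assumes I: "pideal I" shows "brace_ideal I B"
proof -
  have IC: "I \<subseteq> C" and lamI: "\<And>b a. b \<in> C \<Longrightarrow> a \<in> I \<Longrightarrow> brace_lambda B b a \<in> I" using I unfolding pideal_def by blast+
  have n1: "I \<lhd> add_monoid B" using T.normal_iff[of I] I unfolding pideal_def by simp
  have n2: "I \<lhd> B" using D.normal_iff[of I] I unfolding pideal_def by simp
  have "brace_lambda B b ` I = I" if b: "b \<in> C" for b
  proof (rule endo_inj_surj)
    show "finite I" using finite_subset[OF IC fin] .
    show "brace_lambda B b ` I \<subseteq> I" using lamI[OF b] by blast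
    show "inj_on (brace_lambda B b) I"
    proof (rule inj_onI)
      fix x y assume x: "x \<in> I" and y: "y \<in> I" and e: "brace_lambda B b x = brace_lambda B b y"
      have xC: "x \<in> C" and yC: "y \<in> C" using x y IC by blast+
      have "cj (lam b) (tau x) = cj (lam b) (tau y)" using e by (simp add: cj_lam_tau[OF xC b] cj_lam_tau[OF yC b])
      then have "tau x = tau y" by simp
      then show "x = y" using inj_onD[OF T.inj] xC yC by simp
    qed
  qed
  then show ?thesis unfolding brace_ideal_def brace_left_ideal_def using n1 n2 normal_imp_subgroup[OF n1] by blast
qed

lemma pideal_triv: "pideal {\<one>}"
proof -
  have "brace_lambda B b \<one> = \<one>" if "b \<in> C" for b
    unfolding brace_lambda_def using that add.l_inv[of b] zero_eq_one by (simp add: a_inv_def)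
  then show ?thesis unfolding pideal_def
    by (simp add: tau_one D.t_one normal_in_triv[OF fsub_TT] normal_in_triv[OF fsub_DD])
qed

text \<open>Since \<open>a \<otimes> b = a \<oplus> \<lambda>\<^sub>a b\<close>, the sets \<open>I + J\<close> and \<open>I \<cdot> J\<close> are equal.\<close>

lemma pideal_sum:
  assumes I: "pideal I" and J: "pideal J"
  shows "pideal {a \<oplus> b |a b. a \<in> I \<and> b \<in> J}"
proof -
  let ?K = "{a \<oplus> b |a b. a \<in> I \<and> b \<in> J}"
  have IC: "I \<subseteq> C" and JC: "J \<subseteq> C" using I J unfolding pideal_def by blast+
  have lI: "\<And>b a. b \<in> C \<Longrightarrow> a \<in> I \<Longrightarrow> brace_lambda B b a \<in> I" and lJ: "\<And>b a. b \<in> C \<Longrightarrow> a \<in> J \<Longrightarrow> brace_lambda B b a \<in> J"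
    using I J unfolding pideal_def by blast+
  have KC: "?K \<subseteq> C" using IC JC add_C by blast
  have tK: "tau ` ?K = sprod (tau ` I) (tau ` J)"
  proof
    show "tau ` ?K \<subseteq> sprod (tau ` I) (tau ` J)"
    proof
      fix x assume "x \<in> tau ` ?K"
      then obtain a b where ab: "a \<in> I" "b \<in> J" "x = tau (a \<oplus> b)" by blast
      have "x = tau a * tau b" unfolding ab(3) by (rule tau_add[OF subsetD[OF IC ab(1)] subsetD[OF JC ab(2)]])
      then show "x \<in> sprod (tau ` I) (tau ` J)" using ab(1,2) by (simp only: sprodI imageI)
    qed
    show "sprod (tau ` I) (tau ` J) \<subseteq> tau ` ?K"
    proof
      fix x assume "x \<in> sprod (tau ` I) (tau ` J)"
      then obtain a b where ab: "a \<in> I" "b \<in> J" "x = tau a * tau b" by (elim sprodE imageE) blast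
      have "x = tau (a \<oplus> b)" unfolding ab(3) by (rule tau_add[OF subsetD[OF IC ab(1)] subsetD[OF JC ab(2)], symmetric])
      then show "x \<in> tau ` ?K" using ab(1,2) by blast
    qed
  qed
  have eK: "ell ` ?K = sprod (ell ` I) (ell ` J)"
  proof
    show "ell ` ?K \<subseteq> sprod (ell ` I) (ell ` J)"
    proof
      fix x assume "x \<in> ell ` ?K"
      then obtain a b where ab: "a \<in> I" "b \<in> J" "x = ell (a \<oplus> b)" by blast
      have aC: "a \<in> C" and bC: "b \<in> C" using ab IC JC by blast+
      \<comment> \<open>Chosen so that the product of a and \<open>?b\<close> is a + b: lambda of a
        undoes lambda of the inverse of a.\<close>
      let ?b = "brace_lambda B (inv a) b"
      have bJ: "?b \<in> J" by (rule lJ[OF inv_closed[OF aC] ab(2)])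
      then have bC': "?b \<in> C" using JC by blast
      have "tau (a \<otimes> ?b) = tau a * tau (brace_lambda B a ?b)" using tau_lambda[OF aC bC'] by simp
      also have "tau (brace_lambda B a ?b) = tau b"
        by (simp only: cj_lam_tau[OF bC' aC, symmetric] cj_lam_tau[OF bC inv_closed[OF aC], symmetric] lam_inv[OF aC] cj_inv)
      also have "tau a * tau b = tau (a \<oplus> b)" by (rule tau_add[OF aC bC, symmetric])
      finally have "a \<otimes> ?b = a \<oplus> b" using inj_onD[OF T.inj] aC bC' add_C[OF aC bC] by simp
      then have "x = ell a * ell ?b" using D.t_mult[OF aC bC'] ab(3) by simp
      then show "x \<in> sprod (ell ` I) (ell ` J)" using ab(1) bJ by (simp only: sprodI imageI)
    qed
    show "sprod (ell ` I) (ell ` J) \<subseteq> ell ` ?K"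
    proof
      fix x assume "x \<in> sprod (ell ` I) (ell ` J)"
      then obtain a b where ab: "a \<in> I" "b \<in> J" "x = ell a * ell b" by (elim sprodE imageE) blast
      have aC: "a \<in> C" and bC: "b \<in> C" using ab IC JC by blast+
      have "tau (a \<otimes> b) = tau (a \<oplus> brace_lambda B a b)"
        using tau_lambda[OF aC bC] tau_add[OF aC lambda_C[OF aC bC]] by simp
      then have "a \<otimes> b = a \<oplus> brace_lambda B a b"
        using inj_onD[OF T.inj, of "a \<otimes> b"] aC bC add_C[OF aC lambda_C[OF aC bC]] by simp
      then have "x = ell (a \<oplus> brace_lambda B a b)" using D.t_mult[OF aC bC] ab(3) by simp
      then show "x \<in> ell ` ?K" using ab(1) lJ[OF aC ab(2)] by blast
    qed
  qed
  have "brace_lambda B c (a \<oplus> b) = brace_lambda B c a \<oplus> brace_lambda B c b" if c: "c \<in> C" and a: "a \<in> I" and b: "b \<in> J" for a b c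
  proof -
    have aC: "a \<in> C" and bC: "b \<in> C" using a b IC JC by blast+
    have "tau (brace_lambda B c (a \<oplus> b)) = cj (lam c) (tau a) * cj (lam c) (tau b)"
      using cj_lam_tau[OF add_C[OF aC bC] c] by (simp add: tau_add[OF aC bC] cj_mult)
    also have "\<dots> = tau (brace_lambda B c a \<oplus> brace_lambda B c b)"
      by (simp add: cj_lam_tau[OF aC c] cj_lam_tau[OF bC c] tau_add lambda_C c aC bC)
    finally show ?thesis using inj_onD[OF T.inj] by (simp add: lambda_C c aC bC add_C)
  qed
  then have "brace_lambda B c x \<in> ?K" if "c \<in> C" "x \<in> ?K" for c x using that lI lJ by fastforce
  moreover have "normal_in (tau ` ?K) TT" unfolding tK
    by (rule sprod_normal_normal[OF fsub_TT]) (use I J in \<open>auto simp: pideal_def\<close>)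
  moreover have "normal_in (ell ` ?K) DD" unfolding eK
    by (rule sprod_normal_normal[OF fsub_DD]) (use I J in \<open>auto simp: pideal_def\<close>)
  ultimately show ?thesis unfolding pideal_def using KC by blast
qed

definition "pcore p = {a \<in> C. tau a \<in> core p GG}"

text \<open>Besides \<open>ell a * gi (lam a)\<close>, \<open>tau a\<close> has by
  \<open>core_factorised\<close> a factorisation with both factors in the core. The two coincide,
  because \<open>DD\<close> and \<open>LL\<close> meet trivially.\<close>

lemma pcore_iff:
  assumes p: "prime p" and a: "a \<in> C"
  shows "a \<in> pcore p \<longleftrightarrow> ell a \<in> core p GG \<and> lam a \<in> core p GG"
proof
  have fN: "fsub (core p GG)" by (rule normal_in_fsub[OF core_normal_pgroup(1)[OF p fsub_GG]])
  assume "a \<in> pcore p"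
  then have "tau a \<in> core p GG" by (simp add: pcore_def)
  then obtain d m where dm: "d \<in> DD" "m \<in> LL" "tau a = d * m" "d \<in> core p GG" "m \<in> core p GG"
    using core_factorised[OF fsub_GG nilp_DD nilp_LL DD_LL p] by blast
  have "gi d * ell a = gi d * (tau a * lam a)" by (simp only: ell_eq)
  also have "\<dots> = m * lam a" unfolding dm(3) by (simp add: mult.assoc)
  finally have e: "gi d * ell a = m * lam a" .
  have "gi d * ell a \<in> DD" by (rule fsub_mult[OF fsub_DD fsub_gi[OF fsub_DD dm(1)] imageI[OF a]])
  moreover have "gi d * ell a \<in> LL" unfolding e by (rule fsub_mult[OF fsub_LL dm(2) imageI[OF a]])
  ultimately have o: "gi d * ell a = 1" by (rule DD_Int_LL)
  then have "gi (gi d) = ell a" by (rule gi_unique)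
  moreover have "gi m = lam a" using o unfolding e by (rule gi_unique)
  ultimately show "ell a \<in> core p GG \<and> lam a \<in> core p GG" using dm(4) fsub_gi[OF fN dm(5)] by simp
next
  have fN: "fsub (core p GG)" by (rule normal_in_fsub[OF core_normal_pgroup(1)[OF p fsub_GG]])
  assume "ell a \<in> core p GG \<and> lam a \<in> core p GG"
  then have "ell a * gi (lam a) \<in> core p GG" using fsub_mult[OF fN] fsub_gi[OF fN] by blast
  then show "a \<in> pcore p" using a by (simp add: pcore_def tau_eq[symmetric])
qed

lemma tau_pcore: "tau ` pcore p = core p GG \<inter> TT"
  unfolding pcore_def by blast

text \<open>Through \<open>tau\<close> the set is seen to be normal in the additive group and
  invariant under every lambda_b; through \<open>ell\<close> and \<open>lam\<close> it is seen to be
  closed under multiplication and its conjugations.\<close>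

lemma pideal_pcore:
  assumes p: "prime p" shows "pideal (pcore p)"
proof -
  have N: "normal_in (core p GG) GG" by (rule core_normal_pgroup(1)[OF p fsub_GG])
  have fN: "fsub (core p GG)" by (rule normal_in_fsub[OF N])
  have sub: "pcore p \<subseteq> C" unfolding pcore_def by blast
  have "normal_in (tau ` pcore p) TT" unfolding tau_pcore by (rule normal_in_Int_sub[OF N fsub_TT TT_GG])
  moreover have "normal_in (ell ` pcore p) DD"
  proof (rule normal_inI)
    have mem: "ell a \<in> core p GG" "lam a \<in> core p GG" if "a \<in> pcore p" for a
      using pcore_iff[OF p] that sub by blast+
    show "fsub (ell ` pcore p)"
    proof (rule fsub_mult_closed)
      show "finite (ell ` pcore p)" using finite_subset[OF sub fin] by simp
      have "\<one> \<in> pcore p" using tau_one fsub_one[OF fN] by (simp add: pcore_def)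
      then show "1 \<in> ell ` pcore p" using D.t_one by (metis image_eqI)
      fix x y assume "x \<in> ell ` pcore p" "y \<in> ell ` pcore p"
      then obtain a b where ab: "a \<in> pcore p" "b \<in> pcore p" "x = ell a" "y = ell b" by (elim imageE)
      have aC: "a \<in> C" and bC: "b \<in> C" using ab sub by blast+
      have e: "ell (a \<otimes> b) = ell a * ell b" by (rule D.t_mult[OF aC bC])
      have "a \<otimes> b \<in> pcore p"
        unfolding pcore_iff[OF p m_closed[OF aC bC]] e lam_mult[OF aC bC]
        using fsub_mult[OF fN] mem ab(1,2) by blast
      then show "x * y \<in> ell ` pcore p" using e ab(3,4) by (metis image_eqI)
    qed
    show "ell ` pcore p \<subseteq> DD" using sub by blast
    fix x y assume "x \<in> DD" "y \<in> ell ` pcore p"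
    then obtain g a where g: "g \<in> C" "x = ell g" and a: "a \<in> pcore p" "y = ell a" by (elim imageE)
    have aC: "a \<in> C" using a sub by blast
    have c: "g \<otimes> a \<otimes> inv g \<in> C" using g aC by simp
    have e: "ell (g \<otimes> a \<otimes> inv g) = cj (ell g) (ell a)" by (rule D.t_cj[OF g(1) aC])
    have l: "lam (g \<otimes> a \<otimes> inv g) = cj (lam g) (lam a)" using g(1) aC by (simp add: lam_mult lam_inv cj_def)
    have "ell g \<in> GG" "lam g \<in> GG" using DD_GG LL_GG g(1) by blast+
    then have "g \<otimes> a \<otimes> inv g \<in> pcore p"
      unfolding pcore_iff[OF p c] e l using normal_in_cj[OF N] mem[OF a(1)] by blast
    then show "cj x y \<in> ell ` pcore p" using e g(2) a(2) by (metis image_eqI)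
  qed
  moreover have "brace_lambda B b a \<in> pcore p" if b: "b \<in> C" and a: "a \<in> pcore p" for a b
  proof -
    have aC: "a \<in> C" and aN: "tau a \<in> core p GG" using a by (auto simp: pcore_def)
    have "lam b \<in> GG" using LL_GG b by blast
    then have "cj (lam b) (tau a) \<in> core p GG" by (rule normal_in_cj[OF N _ aN])
    then show ?thesis using lambda_C[OF b aC] by (simp add: pcore_def cj_lam_tau[OF aC b])
  qed
  ultimately show ?thesis unfolding pideal_def using sub by blast
qed

section \<open>The Fitting subgroup of the additive group\<close>

abbreviation "F \<equiv> fitting_subgroup (add_monoid B)"

lemma fitting_gens: "\<Union>{N. N \<lhd> add_monoid B \<and> nilpotent_group (add_monoid B\<lparr>carrier := N\<rparr>)} \<subseteq> carrier (add_monoid B)"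
  using normal_imp_subgroup subgroup.subset by blast

lemma F_subgroup: "subgroup F (add_monoid B)"
  unfolding fitting_subgroup_def by (rule add.generate_is_subgroup[OF fitting_gens])

lemma F_subset: "F \<subseteq> C" using subgroup.subset[OF F_subgroup] by simp

lemma pcore_F:
  assumes p: "prime p" shows "pcore p \<subseteq> F"
proof -
  have sub: "pcore p \<subseteq> C" unfolding pcore_def by blast
  have n: "pcore p \<lhd> add_monoid B" using T.normal_iff[of "pcore p"] pideal_pcore[OF p] sub unfolding pideal_def by simp
  interpret E: embed "add_monoid B\<lparr>carrier := pcore p\<rparr>" tau by (rule T.embed_subgroup[OF normal_imp_subgroup[OF n]])
  have f: "fsub (tau ` pcore p)" using E.fsub_carrier by simp
  have "pgroup p (tau ` pcore p)"
    by (rule pgroup_subset[OF p core_normal_pgroup(2)[OF p fsub_GG] f]) (simp add: tau_pcore)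
  then have "nilpotent_group (add_monoid B\<lparr>carrier := pcore p\<rparr>)" by (intro E.nilpotent_if_pgroup[OF p]) simp
  then have m: "pcore p \<in> {N. N \<lhd> add_monoid B \<and> nilpotent_group (add_monoid B\<lparr>carrier := N\<rparr>)}" using n by simp
  show ?thesis unfolding fitting_subgroup_def
  proof
    fix x assume "x \<in> pcore p"
    then show "x \<in> generate (add_monoid B) (\<Union>{N. N \<lhd> add_monoid B \<and> nilpotent_group (add_monoid B\<lparr>carrier := N\<rparr>)})"
      by (intro generate.incl UnionI[OF m])
  qed
qed

text \<open>A largest ideal M inside F contains each \<open>pcore p\<close>, because their sum is
  again an ideal inside F. A nilpotent normal subgroup of the additive group has its Sylow subgroups
  in the cores of \<open>TT\<close>, which lie in the cores of \<open>GG\<close> as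
  \<open>TT\<close> is normal; so it is contained in M, and F = M.\<close>

lemma fitting_pideal: "pideal F"
proof -
  let ?S = "{I. pideal I \<and> I \<subseteq> F}"
  have "finite ?S" by (rule finite_subset[of _ "Pow C"]) (use F_subset fin in auto)
  moreover have "\<one> \<in> F" using subgroup.one_closed[OF F_subgroup] zero_eq_one by simp
  then have "{\<one>} \<in> ?S" using pideal_triv by simp
  ultimately obtain M where M: "M \<in> ?S" and mx: "\<forall>N\<in>?S. card N \<le> card M" using ex_max_card[of ?S "\<lambda>x. x"] by blast
  have pM: "pideal M" and MF: "M \<subseteq> F" and MC: "M \<subseteq> C" using M F_subset by auto
  have pc: "pcore p \<subseteq> M" if p: "prime p" for p
  proof -
    let ?K = "{a \<oplus> b |a b. a \<in> pcore p \<and> b \<in> M}"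
    have pK: "pideal ?K" by (rule pideal_sum[OF pideal_pcore[OF p] pM])
    have "?K \<subseteq> F" using subgroup.m_closed[OF F_subgroup] pcore_F[OF p] MF by fastforce
    then have le: "card ?K \<le> card M" using mx pK by blast
    have z1: "\<zero> \<in> pcore p" using T.t_one zero_C fsub_one[OF normal_in_fsub[OF core_normal_pgroup(1)[OF p fsub_GG]]] by (simp add: pcore_def)
    have "M \<lhd> add_monoid B" using T.normal_iff[of M] pM MC unfolding pideal_def by simp
    then have z2: "\<zero> \<in> M" using subgroup.one_closed[OF normal_imp_subgroup] by fastforce
    have "M \<subseteq> ?K"
    proof
      fix x assume x: "x \<in> M"
      then have "x = \<zero> \<oplus> x" using add.l_one[of x] MC by auto
      then show "x \<in> ?K" using z1 x by blast
    qed
    moreover have "finite ?K" using finite_subset[of ?K C] pK fin unfolding pideal_def by blast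
    ultimately have "M = ?K" using le by (intro card_seteq)
    moreover have "pcore p \<subseteq> ?K"
    proof
      fix x assume x: "x \<in> pcore p"
      then have "x = x \<oplus> \<zero>" using add.r_one[of x] by (simp add: pcore_def)
      then show "x \<in> ?K" using z2 x by blast
    qed
    ultimately show ?thesis by simp
  qed
  have "F \<subseteq> M" unfolding fitting_subgroup_def
  proof (rule add.generate_subgroup_incl)
    have "M \<lhd> add_monoid B" using T.normal_iff[of M] pM MC unfolding pideal_def by simp
    then show sM: "subgroup M (add_monoid B)" by (rule normal_imp_subgroup)
    have fM: "fsub (tau ` M)" using T.subgroup_iff[of M] sM MC by simp
    show "\<Union>{N. N \<lhd> add_monoid B \<and> nilpotent_group (add_monoid B\<lparr>carrier := N\<rparr>)} \<subseteq> M"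
    proof (rule Union_least)
      fix N assume "N \<in> {N. N \<lhd> add_monoid B \<and> nilpotent_group (add_monoid B\<lparr>carrier := N\<rparr>)}"
      then have n: "N \<lhd> add_monoid B" and nl: "nilpotent_group (add_monoid B\<lparr>carrier := N\<rparr>)" by blast+
      have NC: "N \<subseteq> C" using subgroup.subset[OF normal_imp_subgroup[OF n]] by simp
      interpret E: embed "add_monoid B\<lparr>carrier := N\<rparr>" tau by (rule T.embed_subgroup[OF normal_imp_subgroup[OF n]])
      have nN: "nilp (tau ` N)" using E.nilp_if_nilpotent[OF nl] by simp
      have fN: "fsub (tau ` N)" by (rule nilp_fsub[OF nN])
      have nT: "normal_in (tau ` N) TT" using T.normal_iff[of N] n NC by simp
      have "tau ` N \<inter> tau ` M = tau ` N"
      proof (rule eq_if_all_syl[OF fN fsub_Int[OF fN fM]])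
        fix q :: nat assume q: "prime q"
        have "normal_in (p_part q (tau ` N)) TT" by (rule normal_p_part[OF nN nT q])
        then have "p_part q (tau ` N) \<subseteq> core q TT" by (rule core_greatest[OF _ nilp_p_part_pgroup[OF nN q]])
        also have "\<dots> \<subseteq> core q GG" by (rule core_core[OF q fsub_GG TT_normal])
        finally have "p_part q (tau ` N) \<subseteq> tau ` pcore q" unfolding tau_pcore using p_part_subset[of q "tau ` N"] NC by blast
        also have "\<dots> \<subseteq> tau ` M" using pc[OF q] by blast
        finally show "\<exists>Q. syl q (tau ` N) Q \<and> Q \<subseteq> tau ` N \<inter> tau ` M"
          using nilp_syl(1)[OF nN q] p_part_subset[of q "tau ` N"] by blast
      qed blast
      then have NM: "tau ` N \<subseteq> tau ` M" by blast
      show "N \<subseteq> M"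
      proof
        fix x assume x: "x \<in> N"
        then have "tau x \<in> tau ` M" using NM by blast
        then show "x \<in> M" using T.t_mem[of M x] MC NC x by auto
      qed
    qed
  qed
  then show ?thesis using MF pM by simp
qed

text \<open>\<open>TT\<close> is a nontrivial normal subgroup of the solvable group
  \<open>GG\<close>, so it contains a nontrivial normal p-subgroup of \<open>GG\<close>, whose
  elements are translations by elements of F.\<close>

lemma fitting_nontrivial:
  assumes "card C > 1" shows "card F > 1"
proof -
  have fF: "finite F" by (rule finite_subset[OF F_subset fin])
  have "card TT = card C" using card_image[OF T.inj] by simp
  then have "TT \<noteq> {1}" using assms by auto
  obtain p R where R: "prime p" "normal_in R GG" "R \<subseteq> TT" "pgroup p R" "R \<noteq> {1}"
    using slv_normal_core[OF slv_GG TT_normal \<open>TT \<noteq> {1}\<close>] by (elim exE conjE)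
  obtain x where x: "x \<in> R" "x \<noteq> 1" using fsub_nontriv[OF pgroup_fsub[OF R(4)] R(5)] by blast
  obtain a where a: "a \<in> C" "x = tau a" using x(1) R(3) by blast
  have "x \<in> core p GG" using core_greatest[OF R(2,4)] x(1) by blast
  then have "a \<in> F" using pcore_F[OF R(1)] a by (auto simp: pcore_def)
  moreover have "a \<noteq> \<zero>" using x(2) a(2) T.t_one by auto
  moreover have "\<zero> \<in> F" using subgroup.one_closed[OF F_subgroup] by simp
  ultimately have "card {a, \<zero>} \<le> card F" "card {a, \<zero>} = 2" using card_mono[OF fF, of "{a, \<zero>}"] by auto
  then show ?thesis by simp
qed

end

theorem theorem1:
  fixes B :: "('a, 'b) ring_scheme"
  assumes "skew_brace B"
    and "finite (carrier B)"
    and "card (carrier B) > 1"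
    and "nilpotent_group B"
  shows "brace_ideal (fitting_subgroup (add_monoid B)) B
         \<and> card (fitting_subgroup (add_monoid B)) > 1"
proof -
  interpret finite_nilpotent_brace B
    by (rule finite_nilpotent_brace.intro[OF assms(1)], rule finite_nilpotent_brace_axioms.intro) (use assms in auto)
  show ?thesis using pideal_brace_ideal[OF fitting_pideal] fitting_nontrivial[OF assms(3)] by blast
qed

end
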